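(* Let $X=\bigcup_{j=0}^{\infty}X_j$ be a long $\mathbb{C}^2$, i.e. $X$ is a $2$-dimensional complex manifold and $\{X_j\}_{j\ge 0}$ is a sequence of open subsets of $X$ with $X_j\subseteq X_{j+1}$ for all $j$, each $X_j$ biholomorphic to $\mathbb{C}^2$, and $\bigcup_j X_j=X$. If $(X_j,X_{j+1})$ is a meromorphically Runge pair for each $j$, then $X$ is an $\mathcal{M}$-manifold.
   Context: All complex manifolds are second countable and connected. $\mathcal{M}(X)$ denotes the space of (global) meromorphic functions on a complex manifold $X$ (sections of the sheaf of quotients of the sheaf of holomorphic functions). For a set $E\subseteq X$, $\mathcal{O}(E)$ denotes functions holomorphic in some open neighborhood of $E$, and $\mathcal{M}(X)\cap\mathcal{O}(E)$ denotes the meromorphic functions on $X$ that are holomorphic in a neighborhood of $E$. $\|f\|_K=\sup_{z\in K}|f(z)|$. The meromorphically convex hull of a compact set $K\subseteq X$ is $$\widehat{K}_X=\{z\in X: |f(z)|\le\|f\|_K \text{ for every } f\in\mathcal{M}(X)\cap\mathcal{O}(K\cup\{z\})\}.$$ A complex manifold $X$ of dimension $n\ge1$ is an $\mathcal{M}$-manifold if: (a) $X$ is meromorphically convex, i.e. $\widehat{K}_X$ is a compact subset of $X$ for every compact $K\subseteq X$; (b) $\mathcal{M}(X)$ separates points, i.e. for any $p\ne q$ in $X$ there is a meromorphic function $f$ on $X$, holomorphic near $p$ and $q$, with $f(p)\neq f(q)$; (c) for every $p\in X$ there exist a neighborhood $U$ of $p$ and meromorphic functions $f_1,\dots,f_n$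 on $X$ such that $f_1|_U,\dots,f_n|_U$ form a local holomorphic coordinate system on $U$. Let $X_1\subset X_2$ be Stein manifolds of the same dimension ($X_1$ an open subset of $X_2$). $(X_1,X_2)$ is a meromorphically Runge pair if for any compact set $K\subset X_1$, any $f\in\mathcal{M}(X_1)$ that is holomorphic on (a neighborhood of) $K$, and any $\varepsilon>0$, there exists $g\in\mathcal{M}(X_2)$ with $\|g-f\|_K<\varepsilon$ (in particular $g$ is holomorphic on $K$). *)

theory Defs
  imports "HOL-Analysis.Analysis"
begin

section \<open>Holomorphic functions of several complex variables\<close>

definition holo_Cn :: "(complex^'n::finite) set \<Rightarrow> (complex^'n \<Rightarrow> complex) \<Rightarrow> bool" where
  "holo_Cn S f \<longleftrightarrow> open S \<and>
     (\<forall>z\<in>S. \<exists>D. (f has_derivative D) (at z) \<and> (\<forall>c v. D (c *s v) = c * D v))"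

definition holo_Cn_map :: "(complex^'n) set \<Rightarrow> (complex^'n \<Rightarrow> complex^'m) \<Rightarrow> bool" where
  "holo_Cn_map S F \<longleftrightarrow> (\<forall>i. holo_Cn S (\<lambda>z. F z $ i))"

section \<open>Complex manifolds\<close>

text \<open>A chart is a pair of a coordinate domain and a coordinate map; the map is a total function,
  of which only the values on the domain matter.  The dimension is the size of the index type.\<close>

record ('a, 'n) cmfd =
  mtop :: "'a topology"
  atlas :: "('a set \<times> ('a \<Rightarrow> complex^'n)) set"

definition is_chart :: "'a topology \<Rightarrow> 'a set \<Rightarrow> ('a \<Rightarrow> complex^'n) \<Rightarrow> bool" where
  "is_chart T U \<phi> \<longleftrightarrow> openin T U \<and> open (\<phi> ` U) \<and>
     homeomorphic_map (subtopology T U) (top_of_set (\<phi> ` U)) \<phi>"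

definition compatible ::
    "'a set \<Rightarrow> ('a \<Rightarrow> complex^'n) \<Rightarrow> 'a set \<Rightarrow> ('a \<Rightarrow> complex^'n) \<Rightarrow> bool" where
  "compatible U \<phi> V \<psi> \<longleftrightarrow>
     holo_Cn_map (\<phi> ` (U \<inter> V)) (\<psi> \<circ> inv_into U \<phi>) \<and>
     holo_Cn_map (\<psi> ` (U \<inter> V)) (\<phi> \<circ> inv_into V \<psi>)"

definition complex_manifold :: "('a, 'n::finite) cmfd \<Rightarrow> bool" where
  "complex_manifold X \<longleftrightarrow>
     Hausdorff_space (mtop X) \<and> second_countable (mtop X) \<and> connected_space (mtop X) \<and>
     (\<forall>(U, \<phi>)\<in>atlas X. is_chart (mtop X) U \<phi>) \<and>
     (\<forall>(U, \<phi>)\<in>atlas X. \<forall>(V, \<psi>)\<in>atlas X. compatible U \<phi> V \<psi>) \<and>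
     \<Union> (fst ` atlas X) = topspace (mtop X)"

definition complex_space :: "(complex^'n, 'n::finite) cmfd" where
  "complex_space = \<lparr>mtop = euclidean, atlas = {(UNIV, \<lambda>z. z)}\<rparr>"

definition open_submfd :: "('a, 'n::finite) cmfd \<Rightarrow> 'a set \<Rightarrow> ('a, 'n::finite) cmfd" where
  "open_submfd X S =
     \<lparr>mtop = subtopology (mtop X) S, atlas = (\<lambda>(U, \<phi>). (U \<inter> S, \<phi>)) ` atlas X\<rparr>"

definition holo_map :: "('a, 'n::finite) cmfd \<Rightarrow> ('b, 'm::finite) cmfd \<Rightarrow> ('a \<Rightarrow> 'b) \<Rightarrow> bool" where
  "holo_map X Y F \<longleftrightarrow> continuous_map (mtop X) (mtop Y) F \<and>
     (\<forall>(U, \<phi>)\<in>atlas X. \<forall>(V, \<psi>)\<in>atlas Y.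
        holo_Cn_map (\<phi> ` (U \<inter> F -` V)) (\<psi> \<circ> F \<circ> inv_into U \<phi>))"

definition biholomorphic :: "('a, 'n::finite) cmfd \<Rightarrow> ('b, 'm::finite) cmfd \<Rightarrow> bool" where
  "biholomorphic X Y \<longleftrightarrow>
     (\<exists>F G. holo_map X Y F \<and> holo_map Y X G \<and>
        (\<forall>x\<in>topspace (mtop X). G (F x) = x) \<and> (\<forall>y\<in>topspace (mtop Y). F (G y) = y))"

definition holo_fun :: "('a, 'n::finite) cmfd \<Rightarrow> 'a set \<Rightarrow> ('a \<Rightarrow> complex) \<Rightarrow> bool" where
  "holo_fun X W f \<longleftrightarrow> openin (mtop X) W \<and>
     (\<forall>(U, \<phi>)\<in>atlas X. holo_Cn (\<phi> ` (U \<inter> W)) (f \<circ> inv_into U \<phi>))"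

text \<open>\<open>F\<close> restricted to \<open>U\<close> is a holomorphic coordinate system, i.e. a chart belonging to the
  maximal atlas.\<close>

definition holo_coordinates ::
    "('a, 'n::finite) cmfd \<Rightarrow> 'a set \<Rightarrow> ('a \<Rightarrow> complex^'n) \<Rightarrow> bool" where
  "holo_coordinates X U F \<longleftrightarrow> is_chart (mtop X) U F \<and> (\<forall>(V, \<psi>)\<in>atlas X. compatible U F V \<psi>)"

section \<open>Meromorphic functions\<close>

definition germ_eq ::
    "('a, 'n::finite) cmfd \<Rightarrow> 'a \<Rightarrow> ('a \<Rightarrow> complex) \<Rightarrow> ('a \<Rightarrow> complex) \<Rightarrow> bool" where
  "germ_eq X p f g \<longleftrightarrow> (\<exists>W. openin (mtop X) W \<and> p \<in> W \<and> (\<forall>q\<in>W. f q = g q))"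

definition holo_near :: "('a, 'n::finite) cmfd \<Rightarrow> 'a \<Rightarrow> ('a \<Rightarrow> complex) \<Rightarrow> bool" where
  "holo_near X p f \<longleftrightarrow> (\<exists>W. p \<in> W \<and> holo_fun X W f)"

text \<open>The element \<open>g / h\<close> of the quotient field of the ring of germs of holomorphic functions
  at \<open>p\<close>, as the equivalence class of all its representing pairs.\<close>

definition germ_quotient ::
    "('a, 'n::finite) cmfd \<Rightarrow> 'a \<Rightarrow> ('a \<Rightarrow> complex) \<Rightarrow> ('a \<Rightarrow> complex)
      \<Rightarrow> (('a \<Rightarrow> complex) \<times> ('a \<Rightarrow> complex)) set" where
  "germ_quotient X p g h =
     {(g', h'). holo_near X p g' \<and> holo_near X p h' \<and> \<not> germ_eq X p h' (\<lambda>_. 0) \<and>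
        germ_eq X p (\<lambda>q. g q * h' q) (\<lambda>q. g' q * h q)}"

type_synonym 'a mero_section = "'a \<Rightarrow> (('a \<Rightarrow> complex) \<times> ('a \<Rightarrow> complex)) set"

text \<open>Global sections of the sheaf of quotients: families of elements of the stalks that are
  locally given by one quotient of holomorphic functions.\<close>

definition meromorphic_funs :: "('a, 'n::finite) cmfd \<Rightarrow> 'a mero_section set" where
  "meromorphic_funs X =
     {s \<in> extensional (topspace (mtop X)).
        \<forall>p\<in>topspace (mtop X). \<exists>W g h. p \<in> W \<and> holo_fun X W g \<and> holo_fun X W h \<and>
          (\<forall>q\<in>W. \<not> germ_eq X q h (\<lambda>_. 0) \<and> s q = germ_quotient X q g h)}"

definition mero_holo_on :: "('a, 'n::finite) cmfd \<Rightarrow> 'a set \<Rightarrow> 'a mero_section \<Rightarrow> bool" where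
  "mero_holo_on X E s \<longleftrightarrow>
     (\<exists>W f. E \<subseteq> W \<and> holo_fun X W f \<and> (\<forall>q\<in>W. s q = germ_quotient X q f (\<lambda>_. 1)))"

text \<open>The value at a point where the section is holomorphic; unspecified elsewhere.\<close>

definition mero_val :: "('a, 'n::finite) cmfd \<Rightarrow> 'a mero_section \<Rightarrow> 'a \<Rightarrow> complex" where
  "mero_val X s p =
     (THE c. \<exists>f. holo_near X p f \<and> s p = germ_quotient X p f (\<lambda>_. 1) \<and> c = f p)"

text \<open>Inserting \<open>0\<close> gives the supremum over the empty set the value \<open>0\<close> and changes nothing
  otherwise.\<close>

definition sup_norm :: "'a set \<Rightarrow> ('a \<Rightarrow> complex) \<Rightarrow> real" where
  "sup_norm K f = Sup (insert 0 ((\<lambda>z. cmod (f z)) ` K))"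

section \<open>Stein manifolds, meromorphic convexity and Runge pairs\<close>

definition holo_hull :: "('a, 'n::finite) cmfd \<Rightarrow> 'a set \<Rightarrow> 'a set" where
  "holo_hull X K = {z \<in> topspace (mtop X).
     \<forall>f. holo_fun X (topspace (mtop X)) f \<longrightarrow> cmod (f z) \<le> sup_norm K f}"

definition Stein :: "('a, 'n::finite) cmfd \<Rightarrow> bool" where
  "Stein X \<longleftrightarrow> complex_manifold X \<and>
     (\<forall>K. compactin (mtop X) K \<longrightarrow> compactin (mtop X) (holo_hull X K)) \<and>
     (\<forall>p\<in>topspace (mtop X). \<forall>q\<in>topspace (mtop X). p \<noteq> q \<longrightarrow>
        (\<exists>f. holo_fun X (topspace (mtop X)) f \<and> f p \<noteq> f q)) \<and>
     (\<forall>p\<in>topspace (mtop X). \<exists>U F. p \<in> U \<and>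
        (\<forall>i. holo_fun X (topspace (mtop X)) (\<lambda>z. F z $ i)) \<and> holo_coordinates X U F)"

definition mero_hull :: "('a, 'n::finite) cmfd \<Rightarrow> 'a set \<Rightarrow> 'a set" where
  "mero_hull X K = {z \<in> topspace (mtop X).
     \<forall>s\<in>meromorphic_funs X. mero_holo_on X (insert z K) s \<longrightarrow>
       cmod (mero_val X s z) \<le> sup_norm K (mero_val X s)}"

definition M_manifold :: "('a, 'n::finite) cmfd \<Rightarrow> bool" where
  "M_manifold X \<longleftrightarrow> complex_manifold X \<and>
     (\<forall>K. compactin (mtop X) K \<longrightarrow> compactin (mtop X) (mero_hull X K)) \<and>
     (\<forall>p\<in>topspace (mtop X). \<forall>q\<in>topspace (mtop X). p \<noteq> q \<longrightarrow>
        (\<exists>s\<in>meromorphic_funs X. mero_holo_on X {p, q} s \<and> mero_val X s p \<noteq> mero_val X s q)) \<and>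
     (\<forall>p\<in>topspace (mtop X). \<exists>U s. p \<in> U \<and>
        (\<forall>i. s i \<in> meromorphic_funs X \<and> mero_holo_on X U (s i)) \<and>
        holo_coordinates X U (\<lambda>z. \<chi> i. mero_val X (s i) z))"

text \<open>The smaller member of the pair is the open submanifold \<open>S\<close> of \<open>X\<close>.\<close>

definition mero_Runge_pair :: "'a set \<Rightarrow> ('a, 'n::finite) cmfd \<Rightarrow> bool" where
  "mero_Runge_pair S X \<longleftrightarrow> openin (mtop X) S \<and> Stein (open_submfd X S) \<and> Stein X \<and>
     (\<forall>K f \<epsilon>. compactin (mtop (open_submfd X S)) K \<and>
        f \<in> meromorphic_funs (open_submfd X S) \<and> mero_holo_on (open_submfd X S) K f \<and> \<epsilon> > 0 \<longrightarrow>
        (\<exists>g\<in>meromorphic_funs X. mero_holo_on X K g \<and>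
           sup_norm K (\<lambda>z. mero_val X g z - mero_val (open_submfd X S) f z) < \<epsilon>))"

section \<open>Basic consistency facts\<close>

lemma germ_quotient_one_value:
  assumes "holo_near X p f" "holo_near X p f'"
    and eq: "germ_quotient X p f (\<lambda>_. 1) = germ_quotient X p f' (\<lambda>_. 1)"
    and one: "holo_near X p (\<lambda>_. 1)"
  shows "f p = f' p"
proof -
  have "\<not> germ_eq X p (\<lambda>_. 1) (\<lambda>_. 0)" by (auto simp: germ_eq_def)
  moreover have "germ_eq X p (\<lambda>q. f q * 1) (\<lambda>q. f q * 1)"
    using assms(1) by (auto simp: germ_eq_def holo_near_def holo_fun_def)
  ultimately have "(f, \<lambda>_. 1) \<in> germ_quotient X p f (\<lambda>_. 1)"
    using assms(1) one by (simp add: germ_quotient_def)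
  then have "germ_eq X p (\<lambda>q. f' q * 1) (\<lambda>q. f q * 1)"
    unfolding eq by (simp add: germ_quotient_def)
  then show ?thesis by (auto simp: germ_eq_def)
qed

lemma is_chart_Int:
  assumes "is_chart T U \<phi>" "openin T W"
  shows "open (\<phi> ` (U \<inter> W))"
proof -
  have op: "open (\<phi> ` U)" and hom: "homeomorphic_map (subtopology T U) (top_of_set (\<phi> ` U)) \<phi>"
    using assms(1) by (auto simp: is_chart_def)
  have "openin (subtopology T U) (U \<inter> W)"
    using assms(2) by (auto simp: openin_subtopology)
  with hom have "openin (top_of_set (\<phi> ` U)) (\<phi> ` (U \<inter> W))"
    using homeomorphic_imp_open_map open_map_def by blast
  with op show ?thesis by (metis openin_open_eq)
qed

lemma holo_near_one:
  assumes "complex_manifold X" "p \<in> topspace (mtop X)"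
  shows "holo_near X p (\<lambda>_. 1)"
proof -
  have "holo_Cn (\<phi> ` (U \<inter> topspace (mtop X))) ((\<lambda>_. 1) \<circ> inv_into U \<phi>)"
    if "(U, \<phi>) \<in> atlas X" for U \<phi>
  proof -
    have "is_chart (mtop X) U \<phi>" using assms(1) that by (auto simp: complex_manifold_def)
    then have "open (\<phi> ` (U \<inter> topspace (mtop X)))" by (rule is_chart_Int) simp
    moreover have "\<exists>D. (((\<lambda>_. 1) \<circ> inv_into U \<phi>) has_derivative D) (at z) \<and>
        (\<forall>c v. D (c *s v) = c * D v)" for z
      by (rule exI[of _ "\<lambda>_. 0"]) (simp add: o_def)
    ultimately show ?thesis by (simp add: holo_Cn_def)
  qed
  with assms(2) show ?thesis unfolding holo_near_def holo_fun_def by blast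
qed

lemma mero_val_eq:
  assumes "complex_manifold X" "holo_near X p f" "s p = germ_quotient X p f (\<lambda>_. 1)"
  shows "mero_val X s p = f p"
proof -
  have "p \<in> topspace (mtop X)"
    using assms(2) openin_subset by (fastforce simp: holo_near_def holo_fun_def)
  note one = holo_near_one[OF assms(1) this]
  show ?thesis unfolding mero_val_def
    by (rule the_equality) (use assms germ_quotient_one_value[OF _ _ _ one] in metis)+
qed

lemma complex_manifold_complex_space: "complex_manifold complex_space"
proof -
  have 1: "holo_Cn_map UNIV (\<lambda>z::complex^'a. z)"
    unfolding holo_Cn_map_def holo_Cn_def
  proof (intro allI conjI ballI)
    fix i and z :: "complex^'a"
    show "\<exists>D. ((\<lambda>z. z $ i) has_derivative D) (at z) \<and> (\<forall>c v. D (c *s v) = c * D v)"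
      by (rule exI[of _ "\<lambda>v. v $ i"])
        (auto intro: bounded_linear_imp_has_derivative)
  qed simp
  have "second_countable (euclidean :: (complex^'a) topology)"
  proof -
    obtain B :: "(complex^'a) set set" where "countable B" "topological_basis B"
      using ex_countable_basis by blast
    then have "\<forall>V\<in>B. openin euclidean V"
      "\<forall>U x. openin euclidean U \<and> x \<in> U \<longrightarrow> (\<exists>V\<in>B. x \<in> V \<and> V \<subseteq> U)"
      by (auto simp: topological_basis_open elim!: topological_basisE)
    with \<open>countable B\<close> show ?thesis unfolding second_countable_def by blast
  qed
  moreover have "inv_into UNIV (\<lambda>z::complex^'a. z) = (\<lambda>z. z)"
    by (auto simp: fun_eq_iff intro!: inv_into_f_eq)
  moreover have "connected_space (euclidean :: (complex^'a) topology)"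
    using connectedin_topspace[of "euclidean :: (complex^'a) topology"]
    by (simp add: convex_connected)
  moreover have "homeomorphic_map euclidean euclidean (\<lambda>z::complex^'a. z)"
    using homeomorphic_map_id[of "euclidean :: (complex^'a) topology" euclidean]
    unfolding id_def by blast
  ultimately show ?thesis using 1
    by (simp add: complex_manifold_def complex_space_def compatible_def is_chart_def o_def)
qed

lemma open_submfd_open_submfd:
  assumes "S \<subseteq> S'"
  shows "open_submfd (open_submfd X S') S = open_submfd X S"
proof -
  have "(\<lambda>(U, \<phi>). (U \<inter> S, \<phi>)) \<circ> (\<lambda>(U, \<phi>). (U \<inter> S', \<phi>))
      = (\<lambda>(U, \<phi> :: 'a \<Rightarrow> complex^'b). (U \<inter> S, \<phi>))"
    using assms by (auto simp: fun_eq_iff)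
  moreover have "S' \<inter> S = S" using assms by blast
  ultimately show ?thesis
    by (simp add: open_submfd_def subtopology_subtopology image_comp)
qed

end

theory Submission
  imports Defs "HOL-Complex_Analysis.Complex_Analysis" "HOL-Computational_Algebra.Fundamental_Theorem_Algebra"
begin

text \<open>On boxes of \<open>\<complex>\<^sup>2\<close> a strong Poincare theorem holds: a meromorphic function is a quotient \<open>A / W\<close>
  with \<open>W\<close> free of zeros wherever the function is holomorphic.  The local denominators have minimal
  degree in one variable and come, by linear algebra, from the moments of circle integrals; they are
  glued by solving the second Cousin problem.  Combined with polynomial density this turns the Runge
  property into the following: polynomials \<open>P, Q\<close> in the coordinates of \<open>X\<^sub>j\<close> are approximated on a
  compact set by \<open>A / u, B / u\<close> with polynomials \<open>A, B, u\<close> in the coordinates of \<open>X\<^sub>j\<^sub>+\<^sub>1\<close> and \<open>u\<close>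
  free of zeros there.  Iterating with tolerances adapted to the common factors \<open>u\<close> and passing to
  the limit, every rational function \<open>P / Q\<close> on \<open>X\<^sub>j\<close> without poles on a compact set \<open>K\<close> is
  approximated on \<open>K\<close> by meromorphic functions on \<open>X\<close>.

  Point separation and local coordinates follow by approximating the coordinates of \<open>X\<^sub>j\<close>.  For the
  hull of \<open>K \<subseteq> X\<^sub>j\<close>, let \<open>z \<in> X\<^sub>m\<close> lie outside a large compact polydisc of \<open>X\<^sub>j\<close>, and let \<open>t\<close> be a
  rational map on \<open>X\<^sub>m\<close> approximating the coordinates of \<open>X\<^sub>j\<close> on that polydisc, so that \<open>t\<close> has a
  holomorphic right inverse \<open>\<Theta>\<close> with values there.  Either \<open>t(z)\<close> is large, and a component of \<open>t\<close>
  separates \<open>z\<close> from \<open>K\<close>; or \<open>\<Theta>(t(z)) \<noteq> z\<close>, and the determinant at \<open>(\<Theta>(t(w)), w)\<close> of the Hefer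
  matrix of \<open>t\<close> vanishes at \<open>w = z\<close> but nowhere on \<open>K\<close>.\<close>

text \<open>The Runge hypothesis yields approximants that may have poles off the compact set, so
  along an exhaustion a limit of the meromorphic functions themselves makes no sense. The limit is
  taken of numerators and denominators, which is why both must pick up the same factor at every
  step. Denominators free of zeros are essential because in dimension two a quotient of holomorphic
  functions can read 0/0 at a point where it is holomorphic. A generator of the ideal of
  denominators is non-zero at all such points, and only then does a small change of numerator and
  denominator change the quotient little. That this ideal is locally principal is obtained from
  one-variable Cauchy integrals depending on a parameter. For the hull, the obstacle is that a point
  outside the polydisc may share its value under \<open>t\<close> with a point inside, so no
  function of \<open>t\<close> alone tells them apart. The Hefer matrix depends on two points: it is
  singular at two distinct points of one fibre, and on the diagonal it is the Jacobian up to
  scaling. Its determinant thus detects exactly the second sheet.\<close>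

no_notation fps_nth (infixl \<open>$\<close> 75)

section \<open>Holomorphic functions of several variables\<close>

lemma holo_CnI:
  assumes "open S"
    and "\<And>z. z \<in> S \<Longrightarrow> \<exists>D. (f has_derivative D) (at z) \<and> (\<forall>c v. D (c *s v) = c * D v)"
  shows "holo_Cn S f"
  using assms by (auto simp: holo_Cn_def)

lemma holo_Cn_open: "holo_Cn S f \<Longrightarrow> open S"
  by (simp add: holo_Cn_def)

lemma holo_CnE:
  assumes "holo_Cn S f" "z \<in> S"
  obtains D where "(f has_derivative D) (at z)" "\<And>c v. D (c *s v) = c * D v"
  using assms unfolding holo_Cn_def by blast

lemma holo_Cn_subset: "holo_Cn S f \<Longrightarrow> open T \<Longrightarrow> T \<subseteq> S \<Longrightarrow> holo_Cn T f"
  by (auto simp: holo_Cn_def)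

lemma holo_Cn_Int: "holo_Cn S f \<Longrightarrow> open T \<Longrightarrow> holo_Cn (S \<inter> T) f"
  by (auto simp: holo_Cn_def)

lemma holo_Cn_continuous_at:
  assumes "holo_Cn S f" "z \<in> S" shows "isCont f z"
  using holo_CnE[OF assms] has_derivative_continuous by metis

lemma holo_Cn_continuous_on: "holo_Cn S f \<Longrightarrow> continuous_on S f"
  using holo_Cn_continuous_at continuous_at_imp_continuous_on by blast

lemma holo_Cn_const: "open S \<Longrightarrow> holo_Cn S (\<lambda>_. c)"
  by (rule holo_CnI) (auto intro!: exI[of _ "\<lambda>_. 0"])

lemma holo_Cn_nth: "open S \<Longrightarrow> holo_Cn S (\<lambda>z. z $ i)"
  by (rule holo_CnI)
     (auto intro!: exI[of _ "\<lambda>v. v $ i"] bounded_linear_imp_has_derivative)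

lemma holo_Cn_add:
  assumes "holo_Cn S f" "holo_Cn S g" shows "holo_Cn S (\<lambda>z. f z + g z)"
proof (rule holo_CnI)
  fix z assume "z \<in> S"
  then obtain D E where "(f has_derivative D) (at z)" "\<And>c v. D (c *s v) = c * D v"
    "(g has_derivative E) (at z)" "\<And>c v. E (c *s v) = c * E v" by (metis holo_CnE assms)
  then show "\<exists>D. ((\<lambda>z. f z + g z) has_derivative D) (at z) \<and> (\<forall>c v. D (c *s v) = c * D v)"
    by (intro exI[of _ "\<lambda>v. D v + E v"])
       (auto intro!: derivative_intros simp: distrib_left simp del: mult_cancel_left)
qed (use assms in \<open>simp add: holo_Cn_open\<close>)

lemma holo_Cn_mult:
  assumes "holo_Cn S f" "holo_Cn S g" shows "holo_Cn S (\<lambda>z. f z * g z)"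
proof (rule holo_CnI)
  fix z assume "z \<in> S"
  then obtain D E where "(f has_derivative D) (at z)" "\<And>c v. D (c *s v) = c * D v"
    "(g has_derivative E) (at z)" "\<And>c v. E (c *s v) = c * E v" by (metis holo_CnE assms)
  then show "\<exists>D. ((\<lambda>z. f z * g z) has_derivative D) (at z) \<and> (\<forall>c v. D (c *s v) = c * D v)"
    by (intro exI[of _ "\<lambda>v. f z * E v + D v * g z"])
       (auto intro!: derivative_eq_intros simp: algebra_simps)
qed (use assms in \<open>simp add: holo_Cn_open\<close>)

lemma holo_Cn_curve:
  fixes \<gamma> :: "complex \<Rightarrow> complex^'k::finite"
  assumes f: "holo_Cn S f" and \<gamma>: "\<And>i. (\<lambda>t. \<gamma> t $ i) holomorphic_on A"
    and A: "open A" "\<And>t. t \<in> A \<Longrightarrow> \<gamma> t \<in> S"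
  shows "(\<lambda>t. f (\<gamma> t)) holomorphic_on A"
proof -
  have "(\<lambda>t. f (\<gamma> t)) field_differentiable at t" if t: "t \<in> A" for t
  proof -
    obtain D where D: "(f has_derivative D) (at (\<gamma> t))" "\<And>c v. D (c *s v) = c * D v"
      by (metis holo_CnE f A(2) t)
    have "\<exists>g. ((\<lambda>t. \<gamma> t $ i) has_field_derivative g) (at t)" for i
      using \<gamma>[of i] A(1) t by (metis field_differentiable_def holomorphic_on_imp_differentiable_at)
    then obtain g where g: "\<And>i. ((\<lambda>t. \<gamma> t $ i) has_field_derivative g i) (at t)" by metis
    have "(\<gamma> has_derivative (\<lambda>h. h *s (\<chi> i. g i))) (at t)"
      unfolding has_derivative_componentwise_within[of \<gamma>]
    proof
      fix b :: "complex^'k" assume "b \<in> Basis"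
      then obtain i b' where b: "b = axis i b'" "b' \<in> Basis" by (auto simp: Basis_vec_def)
      have "((\<lambda>t. \<gamma> t $ i \<bullet> b') has_derivative (\<lambda>h. (h * g i) \<bullet> b')) (at t)"
        using g[of i, unfolded has_field_derivative_def]
        by (auto intro!: derivative_eq_intros simp: mult.commute)
      then show "((\<lambda>t. \<gamma> t \<bullet> b) has_derivative (\<lambda>h. (h *s (\<chi> i. g i)) \<bullet> b)) (at t)"
        by (simp add: b inner_axis)
    qed
    then have "((\<lambda>t. f (\<gamma> t)) has_derivative (\<lambda>h. D (h *s (\<chi> i. g i)))) (at t)"
      using D(1) by (rule has_derivative_compose)
    then have "((\<lambda>t. f (\<gamma> t)) has_field_derivative D (\<chi> i. g i)) (at t)"
      by (simp add: has_field_derivative_def D(2) mult.commute[of _ "D _"] cong: if_cong)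
    then show ?thesis by (auto simp: field_differentiable_def)
  qed
  then show ?thesis by (simp add: holomorphic_on_def field_differentiable_at_within)
qed

lemma holo_Cn_map_has_derivative:
  fixes H :: "complex^'m::finite \<Rightarrow> complex^'k::finite"
  assumes "\<And>i. holo_Cn S (\<lambda>x. H x $ i)" "x \<in> S"
  obtains E where "(H has_derivative E) (at x)" "\<And>c v. E (c *s v) = c *s E v"
proof -
  have "\<exists>E. ((\<lambda>x. H x $ i) has_derivative E) (at x) \<and> (\<forall>c v. E (c *s v) = c * E v)" for i
    by (metis holo_CnE assms)
  then obtain E where E: "\<And>i. ((\<lambda>x. H x $ i) has_derivative E i) (at x)"
    "\<And>i c v. E i (c *s v) = c * E i v" by metis
  have "(H has_derivative (\<lambda>v. \<chi> i. E i v)) (at x)"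
    unfolding has_derivative_componentwise_within[of H]
  proof
    fix b :: "complex^'k" assume "b \<in> Basis"
    then obtain i b' where b: "b = axis i b'" "b' \<in> Basis" by (auto simp: Basis_vec_def)
    have "((\<lambda>t. H t $ i \<bullet> b') has_derivative (\<lambda>h. E i h \<bullet> b')) (at x)"
      using E(1)[of i] by (auto intro!: derivative_eq_intros)
    then show "((\<lambda>t. H t \<bullet> b) has_derivative (\<lambda>v. (\<chi> i. E i v) \<bullet> b)) (at x)"
      by (simp add: b inner_axis)
  qed
  then show ?thesis by (rule that) (simp add: E(2) vec_eq_iff)
qed

lemma holo_Cn_compose:
  assumes f: "holo_Cn T f" and H: "\<And>i. holo_Cn S (\<lambda>x. H x $ i)" and "\<And>x. x \<in> S \<Longrightarrow> H x \<in> T"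
  shows "holo_Cn S (\<lambda>x. f (H x))"
proof (rule holo_CnI)
  fix x assume x: "x \<in> S"
  obtain E where E: "(H has_derivative E) (at x)" "\<And>c v. E (c *s v) = c *s E v"
    using holo_Cn_map_has_derivative[OF H x] by blast
  obtain D where D: "(f has_derivative D) (at (H x))" "\<And>c v. D (c *s v) = c * D v"
    by (metis holo_CnE f assms(3) x)
  show "\<exists>D. ((\<lambda>x. f (H x)) has_derivative D) (at x) \<and> (\<forall>c v. D (c *s v) = c * D v)"
    by (rule exI[of _ "\<lambda>v. D (E v)"]) (simp add: has_derivative_compose[OF E(1) D(1)] E(2) D(2))
qed (use H holo_Cn_open in blast)

lemma holo_Cn_outer:
  assumes f: "holo_Cn S f" and g: "g holomorphic_on U" "open U" and "\<And>x. x \<in> S \<Longrightarrow> f x \<in> U"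
  shows "holo_Cn S (\<lambda>x. g (f x))"
proof (rule holo_CnI)
  fix x assume x: "x \<in> S"
  obtain D where D: "(f has_derivative D) (at x)" "\<And>c v. D (c *s v) = c * D v"
    by (metis holo_CnE f x)
  obtain g' where "(g has_field_derivative g') (at (f x))"
    using g assms(4)[OF x] holomorphic_on_imp_differentiable_at field_differentiable_def by blast
  then have "((\<lambda>x. g (f x)) has_derivative (\<lambda>v. g' * D v)) (at x)"
    using has_derivative_compose[OF D(1)] unfolding has_field_derivative_def by blast
  then show "\<exists>D. ((\<lambda>x. g (f x)) has_derivative D) (at x) \<and> (\<forall>c v. D (c *s v) = c * D v)"
    by (intro exI[of _ "\<lambda>v. g' * D v"]) (simp add: D(2))
qed (use f holo_Cn_open in blast)

lemma holo_Cn_uminus: "holo_Cn S f \<Longrightarrow> holo_Cn S (\<lambda>z. - f z)"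
  by (rule holo_Cn_outer[of S f _ UNIV]) (auto intro!: holomorphic_intros)

lemma holo_Cn_diff: "holo_Cn S f \<Longrightarrow> holo_Cn S g \<Longrightarrow> holo_Cn S (\<lambda>z. f z - g z)"
  using holo_Cn_add[of S f "\<lambda>z. - g z"] holo_Cn_uminus by force

lemma holo_Cn_inverse:
  "holo_Cn S f \<Longrightarrow> (\<And>z. z \<in> S \<Longrightarrow> f z \<noteq> 0) \<Longrightarrow> holo_Cn S (\<lambda>z. inverse (f z))"
  by (rule holo_Cn_outer[of S f _ "- {0}"]) (auto intro!: holomorphic_intros)

lemma holo_Cn_divide:
  "holo_Cn S f \<Longrightarrow> holo_Cn S g \<Longrightarrow> (\<And>z. z \<in> S \<Longrightarrow> g z \<noteq> 0) \<Longrightarrow> holo_Cn S (\<lambda>z. f z / g z)"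
  unfolding divide_inverse by (intro holo_Cn_mult holo_Cn_inverse)

lemma holo_Cn_exp: "holo_Cn S f \<Longrightarrow> holo_Cn S (\<lambda>z. exp (f z))"
  by (rule holo_Cn_outer[of S f _ UNIV]) (auto intro!: holomorphic_intros)

lemma holo_Cn_prod:
  "open S \<Longrightarrow> (\<And>i. i \<in> I \<Longrightarrow> holo_Cn S (f i)) \<Longrightarrow> holo_Cn S (\<lambda>z. \<Prod>i\<in>I. f i z)"
  by (induction I rule: infinite_finite_induct) (auto intro: holo_Cn_const holo_Cn_mult)

lemma holo_Cn_sum:
  "open S \<Longrightarrow> (\<And>i. i \<in> I \<Longrightarrow> holo_Cn S (f i)) \<Longrightarrow> holo_Cn S (\<lambda>z. \<Sum>i\<in>I. f i z)"
  by (induction I rule: infinite_finite_induct) (auto intro: holo_Cn_const holo_Cn_add)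

lemma holo_Cn_power: "holo_Cn S f \<Longrightarrow> holo_Cn S (\<lambda>z. f z ^ n)"
  by (induction n) (auto intro: holo_Cn_const holo_Cn_open holo_Cn_mult)

lemmas holo_Cn_intros = holo_Cn_const holo_Cn_nth holo_Cn_add holo_Cn_mult holo_Cn_diff
  holo_Cn_uminus holo_Cn_divide holo_Cn_exp holo_Cn_power holo_Cn_sum holo_Cn_prod

lemma holo_Cn_cong:
  assumes "holo_Cn S f" "\<And>x. x \<in> S \<Longrightarrow> f x = g x" shows "holo_Cn S g"
proof (rule holo_CnI)
  fix x assume x: "x \<in> S"
  obtain D where D: "(f has_derivative D) (at x)" "\<And>c v. D (c *s v) = c * D v"
    by (metis holo_CnE assms(1) x)
  have "(g has_derivative D) (at x)"
    by (rule has_derivative_transform_within_open[OF D(1) holo_Cn_open[OF assms(1)] x assms(2)])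
  then show "\<exists>D. (g has_derivative D) (at x) \<and> (\<forall>c v. D (c *s v) = c * D v)"
    by (intro exI[of _ D] conjI allI D(2))
qed (rule holo_Cn_open[OF assms(1)])

lemma holo_Cn_local:
  assumes "\<And>x. x \<in> S \<Longrightarrow> \<exists>N. x \<in> N \<and> N \<subseteq> S \<and> holo_Cn N f" shows "holo_Cn S f"
proof -
  have op: "open S"
  proof (subst open_subopen, intro ballI)
    fix x assume "x \<in> S"
    then obtain N where "x \<in> N" "N \<subseteq> S" "holo_Cn N f" using assms by blast
    then show "\<exists>T. open T \<and> x \<in> T \<and> T \<subseteq> S" using holo_Cn_open[of N f] by blast
  qed
  show ?thesis
  proof (rule holo_CnI[OF op])
    fix z assume "z \<in> S"
    then obtain N where "z \<in> N" "holo_Cn N f" using assms by blast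
    then show "\<exists>D. (f has_derivative D) (at z) \<and> (\<forall>c v. D (c *s v) = c * D v)"
      by (auto simp: holo_Cn_def)
  qed
qed

text \<open>The pullback of \<open>f\<close> to the complex line through \<open>p\<close> and
  \<open>q\<close> lives on the preimage of \<open>S\<close>, which is convex and so connected;
  there the one-variable identity theorem applies. Vanishing is asked only along the line, because
  the contrapositive supplies a direction in which a function with non-zero germ does not vanish
  identically.\<close>

lemma identity_on_line:
  assumes f: "holo_Cn S f" and S: "convex S" and p: "p \<in> S" and q: "q \<in> S"
    and 0: "eventually (\<lambda>t. f (p + t *s (q - p)) = 0) (nhds 0)"
  shows "f q = 0"
proof -
  define \<gamma> where "\<gamma> t = p + t *s (q - p)" for t :: complex
  define A where "A = \<gamma> -` S"
  have cont: "continuous_on UNIV \<gamma>"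
  proof -
    have "\<gamma> = (\<lambda>t. \<chi> i. p $ i + t * (q $ i - p $ i))"
      by (auto simp: \<gamma>_def vec_eq_iff fun_eq_iff algebra_simps)
    then show ?thesis by (auto intro!: continuous_intros)
  qed
  have A: "open A"
    unfolding A_def using holo_Cn_open[OF f] cont by (simp add: open_vimage)
  have "convex A"
    unfolding A_def convex_def
  proof (intro ballI allI impI)
    fix x y and u v :: real assume "x \<in> \<gamma> -` S" "y \<in> \<gamma> -` S" and uv: "0 \<le> u" "0 \<le> v" "u + v = 1"
    then have *: "u *\<^sub>R \<gamma> x + v *\<^sub>R \<gamma> y \<in> S" using S by (simp add: convexD)
    have u: "u = 1 - v" using uv(3) by simp
    have "u *\<^sub>R \<gamma> x + v *\<^sub>R \<gamma> y = \<gamma> (u *\<^sub>R x + v *\<^sub>R y)"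
      unfolding vec_eq_iff \<gamma>_def vector_add_component vector_scaleR_component
        vector_smult_component vector_minus_component
      by (simp add: scaleR_conv_of_real u) (simp add: algebra_simps)
    with * show "u *\<^sub>R x + v *\<^sub>R y \<in> \<gamma> -` S" by simp
  qed
  then have conn: "connected A" by (rule convex_connected)
  have hol: "(\<lambda>t. f (\<gamma> t)) holomorphic_on A"
    by (rule holo_Cn_curve[OF f _ A]) (auto simp: A_def \<gamma>_def intro!: holomorphic_intros)
  have \<gamma>01: "\<gamma> 0 = p" "\<gamma> 1 = q" by (auto simp: \<gamma>_def)
  have "eventually (\<lambda>t. f (\<gamma> t) = 0) (nhds 0)" using 0 by (simp add: \<gamma>_def)
  then obtain B where B: "open B" "0 \<in> B" "\<And>t. t \<in> B \<Longrightarrow> f (\<gamma> t) = 0"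
    unfolding eventually_nhds by blast
  have "f (\<gamma> 1) = 0"
  proof (rule analytic_continuation_open[of "A \<inter> B" A "\<lambda>t. f (\<gamma> t)" "\<lambda>_. 0"])
    show "A \<inter> B \<noteq> {}" using B \<gamma>01 p by (auto simp: A_def)
    show "1 \<in> A" using \<gamma>01 q by (simp add: A_def)
  qed (use A B conn hol in auto)
  then show ?thesis by (simp add: \<gamma>01)
qed

lemma continuous_on_line: "continuous_on S (\<lambda>t. p + t *s v :: complex^'n::finite)"
proof -
  have "(\<lambda>t. p + t *s v) = (\<lambda>t. \<chi> i. p $ i + t * v $ i)" by (auto simp: vec_eq_iff fun_eq_iff)
  moreover have "continuous_on S (\<lambda>t. \<chi> i. p $ i + t * v $ i)" by (intro continuous_intros)
  ultimately show ?thesis by (simp only:)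
qed

lemma identity_convex:
  assumes f: "holo_Cn S f" and S: "convex S" and p: "p \<in> S" and q: "q \<in> S"
    and 0: "eventually (\<lambda>x. f x = 0) (nhds p)"
  shows "f q = 0"
proof (rule identity_on_line[OF f S p q])
  have "isCont (\<lambda>t. p + t *s (q - p)) 0"
    using continuous_on_line[of UNIV p "q - p"] by (simp only: continuous_on_eq_continuous_at open_UNIV) blast
  then have "filterlim (\<lambda>t. p + t *s (q - p)) (nhds p) (nhds 0)"
    using tendsto_at_iff_tendsto_nhds[of "\<lambda>t. p + t *s (q - p)" 0] by (simp add: isCont_def)
  then show "eventually (\<lambda>t. f (p + t *s (q - p)) = 0) (nhds 0)"
    using 0 by (rule eventually_compose_filterlim[rotated])
qed

section \<open>Germs of holomorphic functions\<close>

definition hol_at :: "(complex^'n::finite \<Rightarrow> complex) \<Rightarrow> complex^'n \<Rightarrow> bool" where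
  "hol_at f p \<longleftrightarrow> (\<exists>N. p \<in> N \<and> holo_Cn N f)"

lemma hol_atI: "holo_Cn N f \<Longrightarrow> p \<in> N \<Longrightarrow> hol_at f p"
  by (auto simp: hol_at_def)

lemma hol_at_ball:
  assumes "hol_at f p" obtains e where "e > 0" "holo_Cn (ball p e) f"
proof -
  obtain N where N: "p \<in> N" "holo_Cn N f" using assms by (auto simp: hol_at_def)
  then obtain e where "e > 0" "ball p e \<subseteq> N" using holo_Cn_open open_contains_ball by metis
  with N that show ?thesis using holo_Cn_subset by blast
qed

lemma eventually_hol_at: "hol_at f p \<Longrightarrow> eventually (\<lambda>q. hol_at f q) (nhds p)"
  unfolding hol_at_def eventually_nhds using holo_Cn_open by metis

lemma hol_at_mult: "hol_at f p \<Longrightarrow> hol_at g p \<Longrightarrow> hol_at (\<lambda>z. f z * g z) p"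
proof -
  assume "hol_at f p" "hol_at g p"
  then obtain N M where "p \<in> N" "holo_Cn N f" "p \<in> M" "holo_Cn M g" by (auto simp: hol_at_def)
  then have "holo_Cn (N \<inter> M) (\<lambda>z. f z * g z)"
    by (intro holo_Cn_mult) (auto intro: holo_Cn_subset dest: holo_Cn_open)
  with \<open>p \<in> N\<close> \<open>p \<in> M\<close> show ?thesis by (auto simp: hol_at_def)
qed

lemma hol_at_cont: "hol_at f p \<Longrightarrow> isCont f p"
  using holo_Cn_continuous_at by (auto simp: hol_at_def)

lemma hol_at_cong:
  assumes "hol_at f p" "eventually (\<lambda>x. f x = g x) (nhds p)" shows "hol_at g p"
proof -
  obtain N where N: "p \<in> N" "holo_Cn N f" using assms by (auto simp: hol_at_def)
  obtain M where M: "open M" "p \<in> M" "\<And>x. x \<in> M \<Longrightarrow> f x = g x"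
    using assms(2) by (auto simp: eventually_nhds)
  have "holo_Cn (N \<inter> M) g" using holo_Cn_cong[OF holo_Cn_Int[OF N(2) M(1)]] M(3) by auto
  then show ?thesis using N M by (auto simp: hol_at_def)
qed

lemma hol_at_inverse:
  assumes "hol_at f p" "f p \<noteq> 0" shows "hol_at (\<lambda>z. inverse (f z)) p"
proof -
  obtain N where N: "p \<in> N" "holo_Cn N f" using assms by (auto simp: hol_at_def)
  have "open (N \<inter> f -` (- {0}))"
    using N by (intro continuous_open_preimage) (auto dest: holo_Cn_open holo_Cn_continuous_on)
  then have "holo_Cn (N \<inter> f -` (- {0})) (\<lambda>z. inverse (f z))"
    by (intro holo_Cn_inverse holo_Cn_subset[OF N(2)]) auto
  moreover have "p \<in> N \<inter> f -` (- {0})" using N assms by auto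
  ultimately show ?thesis by (rule hol_atI)
qed

lemma hol_at_const: "hol_at (\<lambda>_. c) p"
  by (rule hol_atI[OF holo_Cn_const[OF open_UNIV]]) simp

definition zero_germ :: "(complex^'n::finite \<Rightarrow> complex) \<Rightarrow> complex^'n \<Rightarrow> bool" where
  "zero_germ f p \<longleftrightarrow> eventually (\<lambda>x. f x = 0) (nhds p)"

lemma zero_germ_cong:
  "eventually (\<lambda>x. f x = g x) (nhds p) \<Longrightarrow> zero_germ f p \<longleftrightarrow> zero_germ g p"
  unfolding zero_germ_def by (rule eventually_cong) (auto elim: eventually_mono)

lemma not_zero_germI: "f p \<noteq> 0 \<Longrightarrow> \<not> zero_germ f p"
  unfolding zero_germ_def using eventually_nhds_x_imp_x by blast

lemma not_zero_germ_convex: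
  assumes "holo_Cn S f" "convex S" "p \<in> S" "q \<in> S" "\<not> zero_germ f p"
  shows "\<not> zero_germ f q"
proof
  assume "zero_germ f q"
  then have "\<And>x. x \<in> S \<Longrightarrow> f x = 0"
    using identity_convex[OF assms(1,2) assms(4)] by (simp add: zero_germ_def)
  then have "zero_germ f p"
    unfolding zero_germ_def eventually_nhds using assms(3) holo_Cn_open[OF assms(1)] by blast
  with assms show False by simp
qed

lemma not_zero_germ_nearby:
  assumes "hol_at f p" "\<not> zero_germ f p"
  shows "eventually (\<lambda>q. \<not> zero_germ f q) (nhds p)"
proof -
  obtain e where e: "e > 0" "holo_Cn (ball p e) f" using hol_at_ball[OF assms(1)] by blast
  then have "\<And>q. q \<in> ball p e \<Longrightarrow> \<not> zero_germ f q"
    using not_zero_germ_convex[OF e(2), of p] assms by simp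
  then show ?thesis unfolding eventually_nhds using e by (metis centre_in_ball open_ball)
qed

text \<open>Germs form an integral domain: if \<open>a\<close> and \<open>b\<close> differed at a
  nearby \<open>q\<close>, they would differ near \<open>q\<close> by continuity, so
  \<open>h\<close> would vanish near \<open>q\<close>, while the germ of \<open>h\<close> is
  non-zero at all points close to \<open>p\<close>.\<close>

lemma germ_cancel:
  assumes h: "hol_at h p" "\<not> zero_germ h p" and a: "hol_at a p" and b: "hol_at b p"
    and eq: "eventually (\<lambda>x. h x * a x = h x * b x) (nhds p)"
  shows "eventually (\<lambda>x. a x = b x) (nhds p)"
proof -
  have ev: "eventually (\<lambda>q. \<not> zero_germ h q \<and> hol_at a q \<and> hol_at b q \<and>
      eventually (\<lambda>x. h x * a x = h x * b x) (nhds q)) (nhds p)"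
    using eq by (intro eventually_conj not_zero_germ_nearby[OF h] eventually_hol_at[OF a]
        eventually_hol_at[OF b]) (simp add: eventually_eventually)
  then show ?thesis
  proof eventually_elim
    case (elim q)
    show "a q = b q"
    proof (rule ccontr)
      assume "a q \<noteq> b q"
      have "isCont (\<lambda>x. a x - b x) q" using elim hol_at_cont by (intro continuous_intros) auto
      then have "eventually (\<lambda>x. a x - b x \<in> - {0}) (nhds q)"
        using \<open>a q \<noteq> b q\<close> tendsto_at_iff_tendsto_nhds[of "\<lambda>x. a x - b x" q]
          topological_tendstoD[of "\<lambda>x. a x - b x" "a q - b q" "nhds q" "- {0}"]
        by (auto simp: isCont_def)
      moreover have "eventually (\<lambda>x. h x * a x = h x * b x) (nhds q)" using elim by blast
      ultimately have "eventually (\<lambda>x. h x = 0) (nhds q)" by eventually_elim auto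
      then show False using elim by (simp add: zero_germ_def)
    qed
  qed
qed

lemma not_zero_germ_mult:
  assumes "hol_at f p" "hol_at g p" "\<not> zero_germ f p" "\<not> zero_germ g p"
  shows "\<not> zero_germ (\<lambda>x. f x * g x) p"
proof
  assume "zero_germ (\<lambda>x. f x * g x) p"
  then have "eventually (\<lambda>x. f x * g x = f x * 0) (nhds p)" by (simp add: zero_germ_def)
  then have "eventually (\<lambda>x. g x = 0) (nhds p)"
    by (rule germ_cancel[OF assms(1,3,2), rotated]) (auto intro: hol_at_const)
  with assms show False by (simp add: zero_germ_def)
qed

section \<open>Functions on the complex plane squared\<close>

definition pt :: "complex \<Rightarrow> complex \<Rightarrow> complex^2" where "pt z w = vector [z, w]"

lemma pt_nth [simp]: "pt z w $ 1 = z" "pt z w $ 2 = w"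
  by (simp_all add: pt_def)

lemma pt_eta [simp]: "pt (p $ 1) (p $ 2) = p"
  by (simp add: vec_eq_iff forall_2)

lemma pt_eq_iff: "pt a b = p \<longleftrightarrow> a = p $ 1 \<and> b = p $ 2"
  by (auto simp: vec_eq_iff forall_2)

lemma pt_alt: "pt z w = (\<chi> i. if i = 1 then z else w)"
  by (simp add: vec_eq_iff forall_2)

lemma continuous_on_pt [continuous_intros]:
  "continuous_on S f \<Longrightarrow> continuous_on S g \<Longrightarrow> continuous_on S (\<lambda>x. pt (f x) (g x))"
  unfolding pt_alt by (rule continuous_on_vec_lambda, rename_tac i, case_tac "i = (1::2)") auto

definition rect2 :: "complex set \<Rightarrow> complex set \<Rightarrow> (complex^2) set" where
  "rect2 A B = {p. p $ 1 \<in> A \<and> p $ 2 \<in> B}"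

lemma rect2_iff [simp]: "p \<in> rect2 A B \<longleftrightarrow> p $ 1 \<in> A \<and> p $ 2 \<in> B"
  by (simp add: rect2_def)

lemma rect2_mono: "A \<subseteq> A' \<Longrightarrow> B \<subseteq> B' \<Longrightarrow> rect2 A B \<subseteq> rect2 A' B'"
  by auto

lemma rect2_vimage: "rect2 A B = (\<lambda>p. p $ 1) -` A \<inter> (\<lambda>p. p $ 2) -` B"
  by auto

lemma open_rect2: "open A \<Longrightarrow> open B \<Longrightarrow> open (rect2 A B)"
  unfolding rect2_vimage by (intro open_Int open_vimage continuous_intros)

lemma convex_rect2: "convex A \<Longrightarrow> convex B \<Longrightarrow> convex (rect2 A B)"
  unfolding convex_def by simp

lemma compact_rect2: "compact A \<Longrightarrow> compact B \<Longrightarrow> compact (rect2 A B)"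
proof -
  assume "compact A" "compact B"
  then have "compact ((\<lambda>x. pt (fst x) (snd x)) ` (A \<times> B))"
    by (intro compact_continuous_image compact_Times continuous_intros)
  moreover have "(\<lambda>x. pt (fst x) (snd x)) ` (A \<times> B) = rect2 A B"
    by (force simp: image_iff pt_eq_iff intro: pt_eta[symmetric])
  ultimately show ?thesis by simp
qed

lemma norm_le_sum2: "norm (p :: complex^2) \<le> cmod (p $ 1) + cmod (p $ 2)"
  using L2_set_le_sum[of "UNIV :: 2 set" "\<lambda>i. cmod (p $ i)"] by (simp add: norm_vec_def sum_2)

lemma rect2_inside_open:
  assumes "open S" "p \<in> S"
  obtains r where "r > 0" "rect2 (cball (p $ 1) r) (cball (p $ 2) r) \<subseteq> S"
proof -
  obtain e where e: "e > 0" "ball p e \<subseteq> S" using assms open_contains_ball by blast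
  have "rect2 (cball (p $ 1) (e/3)) (cball (p $ 2) (e/3)) \<subseteq> ball p e"
  proof
    fix x assume "x \<in> rect2 (cball (p $ 1) (e/3)) (cball (p $ 2) (e/3))"
    then have "cmod ((p - x) $ 1) + cmod ((p - x) $ 2) \<le> e/3 + e/3"
      by (intro add_mono) (auto simp: dist_norm)
    with norm_le_sum2[of "p - x"] e show "x \<in> ball p e" by (auto simp: dist_norm)
  qed
  with e show ?thesis by (intro that[of "e/3"]) auto
qed

lemma nhds_rect2: "eventually P (nhds p) \<longleftrightarrow>
    (\<exists>r>0. \<forall>q \<in> rect2 (ball (p $ 1) r) (ball (p $ 2) r). P q)"
proof
  assume "eventually P (nhds p)"
  then obtain S where S: "open S" "p \<in> S" "\<And>q. q \<in> S \<Longrightarrow> P q" by (auto simp: eventually_nhds)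
  then obtain r where "r > 0" "rect2 (cball (p $ 1) r) (cball (p $ 2) r) \<subseteq> S"
    using rect2_inside_open by blast
  moreover from \<open>rect2 (cball _ _) _ \<subseteq> S\<close> have "rect2 (ball (p $ 1) r) (ball (p $ 2) r) \<subseteq> S"
    by (auto simp: subset_iff)
  ultimately show "\<exists>r>0. \<forall>q \<in> rect2 (ball (p $ 1) r) (ball (p $ 2) r). P q"
    using S(3) by (intro exI[of _ r]) blast
next
  assume "\<exists>r>0. \<forall>q \<in> rect2 (ball (p $ 1) r) (ball (p $ 2) r). P q"
  then obtain r where r: "r > 0" "\<forall>q \<in> rect2 (ball (p $ 1) r) (ball (p $ 2) r). P q" by blast
  then show "eventually P (nhds p)"
    unfolding eventually_nhds
    by (intro exI[of _ "rect2 (ball (p $ 1) r) (ball (p $ 2) r)"] conjI open_rect2 open_ball) simp_all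
qed

text \<open>A derivative that is continuous up to the end points gives continuity in a parameter and
  the exchange of two contour integrals. A rectangle path has corners and is therefore handled edge
  by edge.\<close>

definition smooth_path :: "(real \<Rightarrow> complex) \<Rightarrow> bool" where
  "smooth_path \<gamma> \<longleftrightarrow> valid_path \<gamma> \<and> continuous_on {0..1} (\<lambda>t. vector_derivative \<gamma> (at t))"

lemma smooth_linepath: "smooth_path (linepath a b)"
  by (auto simp: smooth_path_def)

lemma smooth_circlepath: "smooth_path (circlepath c r)"
  unfolding smooth_path_def vector_derivative_circlepath by (auto intro!: continuous_intros)

lemma contour_integral_continuous_param:
  fixes k :: "'b::topological_space \<Rightarrow> complex \<Rightarrow> complex"
  assumes k: "continuous_on (S \<times> path_image \<gamma>) (\<lambda>(p, \<zeta>). k p \<zeta>)" and \<gamma>: "smooth_path \<gamma>"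
  shows "continuous_on S (\<lambda>p. contour_integral \<gamma> (k p))"
proof -
  have c\<gamma>: "continuous_on {0..1} \<gamma>" and d\<gamma>: "continuous_on {0..1} (\<lambda>t. vector_derivative \<gamma> (at t))"
    using \<gamma> valid_path_imp_path by (auto simp: smooth_path_def path_def)
  have "continuous_on (S \<times> {0..1}) (\<lambda>x. (\<lambda>(p, \<zeta>). k p \<zeta>) (fst x, \<gamma> (snd x)))"
    by (rule continuous_on_compose2[OF k])
       (auto intro!: continuous_intros continuous_on_compose2[OF c\<gamma>] simp: path_image_def)
  then have "continuous_on (S \<times> {0..1})
      (\<lambda>(p, t). k p (\<gamma> t) * vector_derivative \<gamma> (at t))"
    by (auto simp: split_beta intro!: continuous_intros continuous_on_compose2[OF d\<gamma>])
  then show ?thesis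
    unfolding contour_integral_integral
    using integral_continuous_on_param[of S 0 1 "\<lambda>p t. k p (\<gamma> t) * vector_derivative \<gamma> (at t)"]
    by simp
qed

lemma contour_integrable_smooth:
  assumes f: "continuous_on (path_image \<gamma>) f" and \<gamma>: "smooth_path \<gamma>"
  shows "f contour_integrable_on \<gamma>"
proof -
  have c\<gamma>: "continuous_on {0..1} \<gamma>" and d\<gamma>: "continuous_on {0..1} (\<lambda>t. vector_derivative \<gamma> (at t))"
    using \<gamma> valid_path_imp_path by (auto simp: smooth_path_def path_def)
  show ?thesis
    unfolding contour_integrable_on
    by (intro integrable_continuous_interval continuous_intros d\<gamma> continuous_on_compose2[OF f c\<gamma>])
       (auto simp: path_image_def)
qed

text \<open>Morera's theorem: around a triangle the integral over the parameter is exchanged with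
  the one over \<open>\<gamma>\<close>, and the inner triangle integrals vanish by Cauchy's
  theorem.\<close>

lemma contour_integral_holomorphic_param:
  assumes S: "open S" and k: "continuous_on (S \<times> path_image \<gamma>) (\<lambda>(p, \<zeta>). k p \<zeta>)"
    and hol: "\<And>\<zeta>. \<zeta> \<in> path_image \<gamma> \<Longrightarrow> (\<lambda>z. k z \<zeta>) holomorphic_on S"
    and \<gamma>: "smooth_path \<gamma>"
  shows "(\<lambda>z. contour_integral \<gamma> (k z)) holomorphic_on S"
proof -
  have "(\<lambda>z. contour_integral \<gamma> (k z)) analytic_on S"
  proof (rule Morera_triangle[OF contour_integral_continuous_param[OF k \<gamma>] S], rule impI)
    fix a b c assume abc: "convex hull {a, b, c} \<subseteq> S"
    have seg: "closed_segment x y \<subseteq> S" if "x \<in> {a,b,c}" "y \<in> {a,b,c}" for x y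
      using that abc hull_mono[of "{x,y}" "{a,b,c}" convex] by (auto simp: segment_convex_hull)
    define J where "J x y \<zeta> = contour_integral (linepath x y) (\<lambda>w. k w \<zeta>)" for x y \<zeta>
    have swap: "contour_integral (linepath x y) (\<lambda>z. contour_integral \<gamma> (k z)) =
        contour_integral \<gamma> (J x y)" and J: "J x y contour_integrable_on \<gamma>"
      if "x \<in> {a,b,c}" "y \<in> {a,b,c}" for x y
    proof -
      have kxy: "continuous_on (closed_segment x y \<times> path_image \<gamma>) (\<lambda>(p, \<zeta>). k p \<zeta>)"
        by (rule continuous_on_subset[OF k]) (use seg[OF that] in auto)
      show "contour_integral (linepath x y) (\<lambda>z. contour_integral \<gamma> (k z)) =
        contour_integral \<gamma> (J x y)"
        unfolding J_def by (rule contour_integral_swap)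
          (use \<gamma> kxy smooth_linepath[of x y] in \<open>auto simp: smooth_path_def\<close>)
      have "continuous_on (path_image \<gamma> \<times> closed_segment x y) (\<lambda>z. (\<lambda>(p, \<zeta>). k p \<zeta>) (snd z, fst z))"
        by (rule continuous_on_compose2[OF kxy]) (auto intro!: continuous_intros)
      then have "continuous_on (path_image \<gamma>) (J x y)"
        unfolding J_def
        by (intro contour_integral_continuous_param[OF _ smooth_linepath]) (simp add: split_beta)
      then show "J x y contour_integrable_on \<gamma>" using \<gamma> by (rule contour_integrable_smooth)
    qed
    have zero: "J a b \<zeta> + (J b c \<zeta> + J c a \<zeta>) = 0" if \<zeta>: "\<zeta> \<in> path_image \<gamma>" for \<zeta>
    proof -
      have h: "(\<lambda>w. k w \<zeta>) holomorphic_on convex hull {a, b, c}"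
        using hol[OF \<zeta>] abc holomorphic_on_subset by blast
      have i: "(\<lambda>w. k w \<zeta>) contour_integrable_on linepath x y" if "x \<in> {a,b,c}" "y \<in> {a,b,c}" for x y
        by (rule contour_integrable_continuous_linepath)
           (use seg[OF that] hol[OF \<zeta>] in \<open>auto intro: holomorphic_on_imp_continuous_on continuous_on_subset\<close>)
      show ?thesis
        unfolding J_def using contour_integral_unique[OF Cauchy_theorem_triangle[OF h]] i
        by (simp add: contour_integral_join contour_integrable_joinI)
    qed
    have "contour_integral (linepath a b) (\<lambda>z. contour_integral \<gamma> (k z)) +
        contour_integral (linepath b c) (\<lambda>z. contour_integral \<gamma> (k z)) +
        contour_integral (linepath c a) (\<lambda>z. contour_integral \<gamma> (k z)) =
        contour_integral \<gamma> (\<lambda>\<zeta>. J a b \<zeta> + (J b c \<zeta> + J c a \<zeta>))"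
      by (simp add: swap J contour_integral_add contour_integrable_add)
    also have "\<dots> = contour_integral \<gamma> (\<lambda>_. 0)"
      by (rule contour_integral_cong) (use zero in auto)
    finally show "contour_integral (linepath a b) (\<lambda>z. contour_integral \<gamma> (k z)) +
        contour_integral (linepath b c) (\<lambda>z. contour_integral \<gamma> (k z)) +
        contour_integral (linepath c a) (\<lambda>z. contour_integral \<gamma> (k z)) = 0" by simp
  qed
  then show ?thesis by (rule analytic_imp_holomorphic)
qed

text \<open>A factor that vanishes linearly at \<open>p\<close> makes the product differentiable
  there although \<open>c\<close> is only continuous. This differentiates the remainder term in
  Osgood's lemma.\<close>

lemma has_derivative_nth_vanishing:
  fixes c :: "complex^'n::finite \<Rightarrow> complex"
  assumes "isCont c p"
  shows "((\<lambda>x. (x $ i - p $ i) * c x) has_derivative (\<lambda>h. h $ i * c p)) (at p)"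
  unfolding has_derivative_at_within
proof
  have "bounded_linear (\<lambda>h :: complex^'n. h $ i)" by (rule bounded_linear_vec_nth)
  then show "bounded_linear (\<lambda>h. h $ i * c p)" by (rule bounded_linear_mult_const)
  have 1: "((\<lambda>x. c x - c p) \<longlongrightarrow> 0) (at p)"
    using assms LIM_zero isCont_def by blast
  show "((\<lambda>y. ((y $ i - p $ i) * c y - (p $ i - p $ i) * c p - (y - p) $ i * c p) /\<^sub>R norm (y - p)) \<longlongrightarrow> 0) (at p)"
  proof (rule Lim_null_comparison[OF always_eventually 1[THEN tendsto_norm_zero]], intro allI)
    fix y
    have "norm ((y $ i - p $ i) * c y - (p $ i - p $ i) * c p - (y - p) $ i * c p) =
        norm ((y - p) $ i) * norm (c y - c p)"
      by (simp add: norm_mult[symmetric] algebra_simps)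
    also have "\<dots> \<le> norm (y - p) * norm (c y - c p)"
      by (intro mult_right_mono Finite_Cartesian_Product.norm_nth_le) auto
    finally have *: "norm ((y $ i - p $ i) * c y - (p $ i - p $ i) * c p - (y - p) $ i * c p) \<le>
       norm (c y - c p) * norm (y - p)" by (simp add: mult.commute)
    show "norm (((y $ i - p $ i) * c y - (p $ i - p $ i) * c p - (y - p) $ i * c p) /\<^sub>R norm (y - p))
       \<le> norm (c y - c p)"
    proof (cases "y = p")
      case False
      then show ?thesis using * unfolding norm_scaleR abs_inverse abs_norm_cancel
        by (simp add: field_simps)
    qed simp
  qed
qed

text \<open>Near \<open>p\<close> one writes \<open>f (z, w) = f (z, b) + (w - b) * q (z, w)\<close>
  with \<open>b = p $ 2\<close>, where \<open>q\<close> is a divided difference given by a Cauchy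
  integral in the second variable and hence jointly continuous. Differentiability at
  \<open>p\<close> then costs only the derivative of \<open>f (z, b)\<close> in \<open>z\<close> and
  the continuity of \<open>q\<close>.\<close>

lemma osgood:
  assumes S: "open S" and cont: "continuous_on S f"
    and d1: "\<And>p. p \<in> S \<Longrightarrow> (\<lambda>t. f (pt t (p $ 2))) field_differentiable at (p $ 1)"
    and d2: "\<And>p. p \<in> S \<Longrightarrow> (\<lambda>t. f (pt (p $ 1) t)) field_differentiable at (p $ 2)"
  shows "holo_Cn S f"
proof (rule holo_CnI[OF S])
  fix p assume p: "p \<in> S"
  define a b where "a = p $ 1" and "b = p $ 2"
  obtain r where r: "r > 0" and rS: "rect2 (cball a r) (cball b r) \<subseteq> S"
    using rect2_inside_open[OF S p] unfolding a_def b_def by blast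
  define R where "R = rect2 (ball a r) (ball b r)"
  define q where "q p' = contour_integral (circlepath b r)
      (\<lambda>s. f (pt (p' $ 1) s) / ((s - p' $ 2) * (s - b))) / (2 * pi * \<i>)" for p' :: "complex^2"
  have R: "open R" "p \<in> R" unfolding R_def using r by (auto simp: a_def b_def intro: open_rect2)
  have "continuous_on R (\<lambda>p'. contour_integral (circlepath b r)
      (\<lambda>s. f (pt (p' $ 1) s) / ((s - p' $ 2) * (s - b))))"
  proof (rule contour_integral_continuous_param[OF _ smooth_circlepath])
    show "continuous_on (R \<times> path_image (circlepath b r))
        (\<lambda>(p', s). f (pt (p' $ 1) s) / ((s - p' $ 2) * (s - b)))"
      unfolding split_beta
      by (intro continuous_intros continuous_on_compose2[OF cont])
         (use r rS in \<open>auto simp: R_def dist_norm norm_minus_commute subset_iff\<close>)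
  qed
  then have "continuous_on R q" unfolding q_def by (intro continuous_intros) auto
  then have qc: "isCont q p" using R continuous_on_eq_continuous_at by blast
  have eq: "f (pt (p' $ 1) b) + (p' $ 2 - p $ 2) * q p' = f p'" if "p' \<in> R" for p'
  proof -
    define x y where "x = p' $ 1" and "y = p' $ 2"
    have x: "x \<in> ball a r" and y: "y \<in> ball b r" using that by (auto simp: R_def x_def y_def)
    have "(\<lambda>s. f (pt x s)) holomorphic_on cball b r"
    proof (rule holomorphic_onI)
      fix s assume "s \<in> cball b r"
      then have "pt x s \<in> S" using x rS by auto
      from d2[OF this] show "(\<lambda>s. f (pt x s)) field_differentiable at s within cball b r"
        by (simp add: field_differentiable_at_within)
    qed
    then have C: "((\<lambda>s. f (pt x s) / (s - u)) has_contour_integral (2 * pi * \<i> * f (pt x u)))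
        (circlepath b r)" if "u \<in> ball b r" for u
      using Cauchy_integral_circlepath_simple that by (simp add: dist_norm norm_minus_commute)
    have "((\<lambda>s. f (pt x s) / (s - y) - f (pt x s) / (s - b)) has_contour_integral
        (2 * pi * \<i> * f (pt x y) - 2 * pi * \<i> * f (pt x b))) (circlepath b r)"
      by (intro has_contour_integral_diff C y) (use r in simp)
    moreover have "f (pt x s) / (s - y) - f (pt x s) / (s - b) =
        (y - b) * (f (pt x s) / ((s - y) * (s - b)))" if "s \<in> path_image (circlepath b r)" for s
    proof -
      have "s \<noteq> y" "s \<noteq> b" using that y r by (auto simp: dist_norm norm_minus_commute)
      then show ?thesis by (simp add: field_simps)
    qed
    ultimately have "((\<lambda>s. (y - b) * (f (pt x s) / ((s - y) * (s - b)))) has_contour_integral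
        (2 * pi * \<i> * f (pt x y) - 2 * pi * \<i> * f (pt x b))) (circlepath b r)"
      by (rule has_contour_integral_eq)
    then have 1: "contour_integral (circlepath b r) (\<lambda>s. (y - b) * (f (pt x s) / ((s - y) * (s - b))))
       = 2 * pi * \<i> * (f (pt x y) - f (pt x b))"
      by (simp add: contour_integral_unique right_diff_distrib)
    have "(y - b) * contour_integral (circlepath b r) (\<lambda>s. f (pt x s) / ((s - y) * (s - b)))
        = 2 * pi * \<i> * (f (pt x y) - f (pt x b))"
    proof (cases "y = b")
      case False
      have "(\<lambda>s. (y - b) * (f (pt x s) / ((s - y) * (s - b)))) contour_integrable_on circlepath b r"
        using \<open>((\<lambda>s. (y - b) * (f (pt x s) / ((s - y) * (s - b)))) has_contour_integral _) _\<close>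
          contour_integrable_on_def by blast
      then have "(\<lambda>s. f (pt x s) / ((s - y) * (s - b))) contour_integrable_on circlepath b r"
        using contour_integrable_lmul_iff[of "y - b"] False by (simp del: times_divide_eq_right)
      from contour_integral_lmul[OF this, of "y - b"] 1 show ?thesis by simp
    qed (use 1 in simp)
    then show ?thesis by (simp add: q_def x_def y_def b_def field_simps)
  qed
  obtain fa where fa: "((\<lambda>t. f (pt t b)) has_field_derivative fa) (at a)"
    using d1[OF p] by (auto simp: field_differentiable_def a_def b_def)
  have "((\<lambda>p'. p' $ 1) has_derivative (\<lambda>h. h $ 1)) (at p)"
    by (intro bounded_linear_imp_has_derivative bounded_linear_vec_nth)
  from has_derivative_compose[OF this fa[unfolded has_field_derivative_def a_def]]
  have "((\<lambda>p'. f (pt (p' $ 1) b)) has_derivative (\<lambda>h. fa * h $ 1)) (at p)" by simp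
  from has_derivative_add[OF this has_derivative_nth_vanishing[OF qc, of 2]]
  have "((\<lambda>p'. f (pt (p' $ 1) b) + (p' $ 2 - p $ 2) * q p') has_derivative
      (\<lambda>h. fa * h $ 1 + h $ 2 * q p)) (at p)" .
  then have "(f has_derivative (\<lambda>h. fa * h $ 1 + h $ 2 * q p)) (at p)"
    by (rule has_derivative_transform_within_open[OF _ R eq])
  then show "\<exists>D. (f has_derivative D) (at p) \<and> (\<forall>c v. D (c *s v) = c * D v)"
    by (intro exI[of _ "\<lambda>h. fa * h $ 1 + h $ 2 * q p"]) (simp add: algebra_simps)
qed

lemma holo_slice1:
  assumes "holo_Cn S f" "open A" "\<And>t. t \<in> A \<Longrightarrow> pt t w \<in> S"
  shows "(\<lambda>t. f (pt t w)) holomorphic_on A"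
proof (rule holo_Cn_curve[OF assms(1) _ assms(2,3)])
  fix i :: 2 show "(\<lambda>t. pt t w $ i) holomorphic_on A"
    using exhaust_2[of i] by (auto intro: holomorphic_intros)
qed

lemma holo_slice2:
  assumes "holo_Cn S f" "open A" "\<And>t. t \<in> A \<Longrightarrow> pt z t \<in> S"
  shows "(\<lambda>t. f (pt z t)) holomorphic_on A"
proof (rule holo_Cn_curve[OF assms(1) _ assms(2,3)])
  fix i :: 2 show "(\<lambda>t. pt z t $ i) holomorphic_on A"
    using exhaust_2[of i] by (auto intro: holomorphic_intros)
qed

lemma osgood_slices:
  assumes "open S" "continuous_on S f"
    and "\<And>A w. open A \<Longrightarrow> (\<And>t. t \<in> A \<Longrightarrow> pt t w \<in> S) \<Longrightarrow> (\<lambda>t. f (pt t w)) holomorphic_on A"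
    and "\<And>A z. open A \<Longrightarrow> (\<And>t. t \<in> A \<Longrightarrow> pt z t \<in> S) \<Longrightarrow> (\<lambda>t. f (pt z t)) holomorphic_on A"
  shows "holo_Cn S f"
proof (rule osgood[OF assms(1,2)])
  fix p assume p: "p \<in> S"
  obtain r where r: "r > 0" "rect2 (cball (p $ 1) r) (cball (p $ 2) r) \<subseteq> S"
    using rect2_inside_open[OF assms(1) p] by blast
  have "(\<lambda>t. f (pt t (p $ 2))) holomorphic_on ball (p $ 1) r"
    by (rule assms(3)) (use r in auto)
  then show "(\<lambda>t. f (pt t (p $ 2))) field_differentiable at (p $ 1)"
    using r(1) holomorphic_on_imp_differentiable_at by fastforce
  have "(\<lambda>t. f (pt (p $ 1) t)) holomorphic_on ball (p $ 2) r"
    by (rule assms(4)) (use r in auto)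
  then show "(\<lambda>t. f (pt (p $ 1) t)) field_differentiable at (p $ 2)"
    using r(1) holomorphic_on_imp_differentiable_at by fastforce
qed

lemma holo_contour_param:
  fixes S :: "(complex^2) set"
  assumes S: "open S" and k: "continuous_on (S \<times> path_image \<gamma>) (\<lambda>(p, \<zeta>). k p \<zeta>)"
    and hol: "\<And>\<zeta>. \<zeta> \<in> path_image \<gamma> \<Longrightarrow> holo_Cn S (\<lambda>p. k p \<zeta>)"
    and \<gamma>: "smooth_path \<gamma>"
  shows "holo_Cn S (\<lambda>p. contour_integral \<gamma> (k p))"
proof (rule osgood_slices[OF S contour_integral_continuous_param[OF k \<gamma>]])
  fix A w assume A: "open A" "\<And>t. t \<in> A \<Longrightarrow> pt t w \<in> S"
  have "continuous_on (A \<times> path_image \<gamma>) (\<lambda>x. (\<lambda>(p, \<zeta>). k p \<zeta>) (pt (fst x) w, snd x))"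
    by (rule continuous_on_compose2[OF k]) (auto intro!: continuous_intros A)
  then have "continuous_on (A \<times> path_image \<gamma>) (\<lambda>(t, \<zeta>). k (pt t w) \<zeta>)"
    by (simp add: split_beta)
  then show "(\<lambda>t. contour_integral \<gamma> (k (pt t w))) holomorphic_on A"
    by (rule contour_integral_holomorphic_param[OF A(1) _ _ \<gamma>]) (rule holo_slice1[OF hol A])
next
  fix A z assume A: "open A" "\<And>t. t \<in> A \<Longrightarrow> pt z t \<in> S"
  have "continuous_on (A \<times> path_image \<gamma>) (\<lambda>x. (\<lambda>(p, \<zeta>). k p \<zeta>) (pt z (fst x), snd x))"
    by (rule continuous_on_compose2[OF k]) (auto intro!: continuous_intros A)
  then have "continuous_on (A \<times> path_image \<gamma>) (\<lambda>(t, \<zeta>). k (pt z t) \<zeta>)"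
    by (simp add: split_beta)
  then show "(\<lambda>t. contour_integral \<gamma> (k (pt z t))) holomorphic_on A"
    by (rule contour_integral_holomorphic_param[OF A(1) _ _ \<gamma>]) (rule holo_slice2[OF hol A])
qed

lemma holo_uniform_limit:
  fixes S :: "(complex^2) set"
  assumes S: "open S" and f: "\<And>n. holo_Cn S (f n)" and lim: "uniform_limit S f g sequentially"
  shows "holo_Cn S g"
proof (rule osgood_slices[OF S])
  show "continuous_on S g"
    using uniform_limit_theorem[OF _ lim] f holo_Cn_continuous_on by (metis always_eventually sequentially_bot)
  have *: "g' holomorphic_on A" if A: "open A" and f': "\<And>n. f' n holomorphic_on A"
    and l: "uniform_limit A f' g' sequentially" for A f' and g' :: "complex \<Rightarrow> complex"
  proof (rule holomorphic_uniform_sequence[OF A f'])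
    fix x assume "x \<in> A"
    then obtain d where "d > 0" "cball x d \<subseteq> A" using A open_contains_cball by blast
    with uniform_limit_on_subset[OF l] 
    show "\<exists>d>0. cball x d \<subseteq> A \<and> uniform_limit (cball x d) f' g' sequentially" by blast
  qed
  show "(\<lambda>t. g (pt t w)) holomorphic_on A" if A: "open A" "\<And>t. t \<in> A \<Longrightarrow> pt t w \<in> S" for A w
  proof (rule *[OF A(1)])
    show "(\<lambda>t. f n (pt t w)) holomorphic_on A" for n by (rule holo_slice1[OF f A])
    show "uniform_limit A (\<lambda>n t. f n (pt t w)) (\<lambda>t. g (pt t w)) sequentially"
    proof (rule uniform_limitI)
      fix e :: real assume "e > 0"
      with lim have "eventually (\<lambda>n. \<forall>x\<in>S. dist (f n x) (g x) < e) sequentially"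
        by (simp add: uniform_limit_iff)
      then show "eventually (\<lambda>n. \<forall>t\<in>A. dist (f n (pt t w)) (g (pt t w)) < e) sequentially"
        by eventually_elim (use A(2) in blast)
    qed
  qed
  show "(\<lambda>t. g (pt z t)) holomorphic_on A" if A: "open A" "\<And>t. t \<in> A \<Longrightarrow> pt z t \<in> S" for A z
  proof (rule *[OF A(1)])
    show "(\<lambda>t. f n (pt z t)) holomorphic_on A" for n by (rule holo_slice2[OF f A])
    show "uniform_limit A (\<lambda>n t. f n (pt z t)) (\<lambda>t. g (pt z t)) sequentially"
    proof (rule uniform_limitI)
      fix e :: real assume "e > 0"
      with lim have "eventually (\<lambda>n. \<forall>x\<in>S. dist (f n x) (g x) < e) sequentially"
        by (simp add: uniform_limit_iff)
      then show "eventually (\<lambda>n. \<forall>t\<in>A. dist (f n (pt z t)) (g (pt z t)) < e) sequentially"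
        by eventually_elim (use A(2) in blast)
    qed
  qed
qed

section \<open>Division by polynomials in one variable\<close>

lemma continuous_eq_off_point:
  fixes f g :: "complex \<Rightarrow> complex"
  assumes "isCont f a" "isCont g a" "eventually (\<lambda>x. f x = g x) (at a)"
  shows "f a = g a"
proof (rule tendsto_unique)
  show "(f \<longlongrightarrow> f a) (at a)" using assms(1) by (simp add: isCont_def)
  show "(f \<longlongrightarrow> g a) (at a)"
    using assms(2) tendsto_cong[OF assms(3)] by (simp add: isCont_def)
qed simp

lemma holomorphic_cancel_factor:
  assumes "X holomorphic_on B" "open B" "\<And>w. w \<in> B \<Longrightarrow> (w - a) * X w = 0" "w \<in> B"
  shows "X w = 0"
proof (cases "w = a")
  case True
  have "isCont X a"
    using assms True holomorphic_on_imp_continuous_on continuous_on_eq_continuous_at by blast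
  moreover have "eventually (\<lambda>x. X x = 0) (at a)"
    unfolding eventually_at_topological using assms True by (intro exI[of _ B]) auto
  ultimately show ?thesis using continuous_eq_off_point[where f = X and g = "\<lambda>_. 0" and a = a] True by simp
qed (use assms(3,4) in force)

lemma holomorphic_divide_root:
  assumes "f holomorphic_on S" "open S" "a \<in> S" "f a = 0"
  obtains g where "g holomorphic_on S" "\<And>z. z \<in> S \<Longrightarrow> f z = (z - a) * g z"
proof
  show "(\<lambda>z. if z = a then deriv f a else (f z - f a) / (z - a)) holomorphic_on S"
    using pole_lemma assms by (simp add: interior_open)
qed (use assms in auto)

text \<open>The point \<open>b\<close> excludes infinite order. The local cofactor is extended to
  all of \<open>S\<close> by dividing by the power of \<open>z - a\<close> away from
  \<open>a\<close>.\<close>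

lemma holomorphic_order_at:
  assumes f: "f holomorphic_on S" and S: "open S" "connected S" and a: "a \<in> S"
    and b: "b \<in> S" "f b \<noteq> 0"
  obtains n g where "g holomorphic_on S" "g a \<noteq> 0" "\<And>z. z \<in> S \<Longrightarrow> f z = (z - a) ^ n * g z"
proof (cases "f a = 0")
  case False
  then show ?thesis using that[of f 0] f by simp
next
  case True
  then have "\<not> f constant_on S" using a b unfolding constant_on_def by metis
  then obtain g0 r n where g0: "0 < n" "0 < r" "ball a r \<subseteq> S" "g0 holomorphic_on ball a r"
     "\<And>w. w \<in> ball a r \<Longrightarrow> f w = (w - a) ^ n * g0 w" "\<And>w. w \<in> ball a r \<Longrightarrow> g0 w \<noteq> 0"
    using holomorphic_factor_zero_nonconstant[OF f S a True] by metis
  define g where "g w = (if w = a then g0 a else f w / (w - a) ^ n)" for w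
  have "g holomorphic_on ball a r"
    using g0(4) by (rule holomorphic_transform) (auto simp: g_def g0(5))
  moreover have "(\<lambda>w. f w / (w - a) ^ n) holomorphic_on S - {a}"
    by (intro holomorphic_intros holomorphic_on_subset[OF f]) auto
  then have "g holomorphic_on S - {a}"
    by (rule holomorphic_transform) (auto simp: g_def)
  ultimately have "g holomorphic_on (ball a r \<union> (S - {a}))"
    using S by (intro holomorphic_on_Un) (auto intro: open_delete)
  then have "g holomorphic_on S" by (rule holomorphic_on_subset) (use g0 in auto)
  moreover have "g a \<noteq> 0" using g0 by (simp add: g_def)
  moreover have "f z = (z - a) ^ n * g z" for z
    using True g0(1) by (auto simp: g_def power_0_left)
  ultimately show ?thesis using that by blast
qed

text \<open>A one-variable form of Weierstrass preparation: the zeros in the closed disc are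
  finitely many, and the induction removes one of them with its full multiplicity at a time. As
  \<open>e\<close> has no zeros on the closed disc, it is a unit on a slightly larger open
  set.\<close>

lemma holomorphic_poly_factor:
  assumes "h holomorphic_on ball c R" "0 < r" "r < R" "\<And>w. w \<in> sphere c r \<Longrightarrow> h w \<noteq> 0"
  obtains P e where "P \<noteq> 0" "\<And>w. poly P w = 0 \<Longrightarrow> w \<in> ball c r" "e holomorphic_on ball c R"
    "\<And>w. w \<in> cball c r \<Longrightarrow> e w \<noteq> 0" "\<And>w. w \<in> ball c R \<Longrightarrow> h w = poly P w * e w"
proof -
  have "\<exists>P e. P \<noteq> 0 \<and> (\<forall>w. poly P w = 0 \<longrightarrow> w \<in> ball c r) \<and> e holomorphic_on ball c R \<and>
      (\<forall>w\<in>cball c r. e w \<noteq> 0) \<and> (\<forall>w\<in>ball c R. h w = poly P w * e w)"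
    using assms(1,4)
  proof (induction "card {w \<in> cball c r. h w = 0}" arbitrary: h rule: less_induct)
    case less
    have sp: "c + complex_of_real r \<in> sphere c r" using assms(2) by (simp add: dist_norm)
    have sb: "c + complex_of_real r \<in> ball c R" using assms by (simp add: dist_norm)
    show ?case
    proof (cases "{w \<in> cball c r. h w = 0} = {}")
      case True
      then show ?thesis using less.prems by (intro exI[of _ 1] exI[of _ h]) auto
    next
      case False
      then obtain a where a: "a \<in> cball c r" "h a = 0" by auto
      have "dist c a \<noteq> r" using a less.prems(2)[of a] by auto
      with a assms(3) have aB: "a \<in> ball c r" "a \<in> ball c R" by auto
      have "\<not> h constant_on ball c R"
        using a aB(2) sb less.prems(2)[OF sp] unfolding constant_on_def by metis
      then have fin: "finite {w \<in> cball c r. h w = 0}"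
        using assms by (intro holomorphic_compact_finite_zeros[OF less.prems(1)]) auto
      obtain n g where g: "g holomorphic_on ball c R" "g a \<noteq> 0"
          "\<And>z. z \<in> ball c R \<Longrightarrow> h z = (z - a) ^ n * g z"
        using holomorphic_order_at[OF less.prems(1) _ _ aB(2) sb less.prems(2)[OF sp]]
        by (metis open_ball connected_ball)
      have "{w \<in> cball c r. g w = 0} \<subset> {w \<in> cball c r. h w = 0}"
        using a g assms(3) by (auto simp: subset_iff)
      then have "card {w \<in> cball c r. g w = 0} < card {w \<in> cball c r. h w = 0}"
        using fin psubset_card_mono by blast
      moreover have "g w \<noteq> 0" if "w \<in> sphere c r" for w
        using less.prems(2)[OF that] g(3)[of w] that assms(3) by auto
      ultimately obtain P e where P: "P \<noteq> 0" "\<forall>w. poly P w = 0 \<longrightarrow> w \<in> ball c r"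
          "e holomorphic_on ball c R" "\<forall>w\<in>cball c r. e w \<noteq> 0" "\<forall>w\<in>ball c R. g w = poly P w * e w"
        using less.hyps[OF _ g(1)] by metis
      show ?thesis
        using P g(3) aB by (intro exI[of _ "[:-a, 1:] ^ n * P"] exI[of _ e]) (auto simp: algebra_simps)
    qed
  qed
  with that show ?thesis by blast
qed

lemma poly_root_split:
  fixes W :: "complex poly"
  assumes "W \<noteq> 0" "degree W \<noteq> 0"
  obtains a W1 where "W = [:-a, 1:] * W1" "W1 \<noteq> 0" "degree W = Suc (degree W1)" "poly W a = 0"
proof -
  obtain a where a: "poly W a = 0"
    using fundamental_theorem_of_algebra[of W] assms constant_degree[of W] by auto
  then obtain W1 where W1: "W = [:-a, 1:] * W1" using poly_eq_0_iff_dvd by (metis dvdE)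
  with assms have "W1 \<noteq> 0" by auto
  with W1 have "degree W = Suc (degree W1)"
    using degree_mult_eq[of "[:-a, 1:]" W1] by (simp del: mult_pCons_left)
  with W1 \<open>W1 \<noteq> 0\<close> a that show ?thesis by blast
qed

text \<open>A meromorphic function whose moments on a circle vanish has no poles inside: testing against
  \<open>W / (w - a)\<close> shows that the numerator vanishes at the root \<open>a\<close> of the denominator \<open>W\<close>.\<close>

lemma zero_moments_divisible:
  fixes W :: "complex poly"
  assumes "open B" "cball c r \<subseteq> B" "r > 0"
    and "W \<noteq> 0" "\<And>w. poly W w = 0 \<Longrightarrow> w \<in> ball c r" "G holomorphic_on B"
    and "\<And>q. contour_integral (circlepath c r) (\<lambda>w. G w * poly q w / poly W w) = 0"
  obtains G1 where "G1 holomorphic_on B" "\<And>w. w \<in> B \<Longrightarrow> G w = poly W w * G1 w"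
proof -
  have "\<exists>G1. G1 holomorphic_on B \<and> (\<forall>w\<in>B. G w = poly W w * G1 w)"
    using assms(4-)
  proof (induction "degree W" arbitrary: W G)
    case 0
    then obtain k where k: "W = [:k:]" "k \<noteq> 0" by (metis degree_eq_zeroE pCons_0_0)
    then show ?case using 0 by (intro exI[of _ "\<lambda>w. G w / k"]) (auto intro!: holomorphic_intros)
  next
    case (Suc n)
    obtain a W1 where W1: "W = [:-a, 1:] * W1" "W1 \<noteq> 0" "degree W = Suc (degree W1)" "poly W a = 0"
      using poly_root_split[of W] Suc.hyps(2) Suc.prems(1) by (metis nat.simps(3))
    have a: "a \<in> ball c r" using Suc.prems(2) W1 by blast
    have nz: "poly W w \<noteq> 0" if "w \<in> sphere c r" for w using Suc.prems(2)[of w] that by auto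
    have "contour_integral (circlepath c r) (\<lambda>w. G w * poly W1 w / poly W w) =
        contour_integral (circlepath c r) (\<lambda>w. G w / (w - a))"
    proof (rule contour_integral_cong)
      fix w assume "w \<in> path_image (circlepath c r)"
      with nz[of w] assms(3) have "poly W w \<noteq> 0" by simp
      then show "G w * poly W1 w / poly W w = G w / (w - a)"
        by (simp add: W1(1) field_simps)
    qed simp
    also have "\<dots> = 2 * of_real pi * \<i> * G a"
    proof (rule contour_integral_unique, rule Cauchy_integral_circlepath_simple)
      show "G holomorphic_on cball c r" using Suc.prems(3) assms(2) holomorphic_on_subset by blast
      show "norm (a - c) < r" using a by (simp add: dist_norm norm_minus_commute)
    qed
    finally have "G a = 0" using Suc.prems(4) by simp
    then obtain G2 where G2: "G2 holomorphic_on B" "\<And>z. z \<in> B \<Longrightarrow> G z = (z - a) * G2 z"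
      using holomorphic_divide_root[OF Suc.prems(3) assms(1), of a] a assms(2) by (metis ball_subset_cball subsetD)
    have "contour_integral (circlepath c r) (\<lambda>w. G2 w * poly q w / poly W1 w) = 0" for q
    proof -
      have "contour_integral (circlepath c r) (\<lambda>w. G2 w * poly q w / poly W1 w) =
          contour_integral (circlepath c r) (\<lambda>w. G w * poly q w / poly W w)"
      proof (rule contour_integral_cong)
        fix w assume w: "w \<in> path_image (circlepath c r)"
        with nz[of w] assms(3) have "poly W w \<noteq> 0" by simp
        moreover have "w \<in> B" using w assms(2,3) by auto
        moreover have "poly W w = (w - a) * poly W1 w" by (simp add: W1(1) algebra_simps)
        ultimately show "G2 w * poly q w / poly W1 w = G w * poly q w / poly W w"
          using G2(2)[of w] by simp
      qed simp
      then show ?thesis using Suc.prems(4) by simp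
    qed
    moreover have "poly W1 w = 0 \<Longrightarrow> w \<in> ball c r" for w using Suc.prems(2) W1(1) by simp
    ultimately obtain G1 where "G1 holomorphic_on B" "\<forall>w\<in>B. G2 w = poly W1 w * G1 w"
      using Suc.hyps(1)[of W1 G2] Suc.hyps(2) W1 G2(1) by auto
    moreover have "poly W w = (w - a) * poly W1 w" for w by (simp add: W1(1) algebra_simps)
    ultimately show ?case using G2(2) by (intro exI[of _ G1]) auto
  qed
  with that show ?thesis by blast
qed

text \<open>Induction over the roots of \<open>W\<close> with multiplicity: at a root
  \<open>a\<close> the relation forces \<open>H a = 0\<close> because \<open>G a \<noteq> 0\<close>,
  and after division by \<open>w - a\<close> the relation persists, at \<open>a\<close> itself by
  continuity.\<close>

lemma coprime_divisible:
  fixes W :: "complex poly"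
  assumes "open B" "W \<noteq> 0" "\<And>w. poly W w = 0 \<Longrightarrow> w \<in> B \<and> G w \<noteq> 0"
    and "H holomorphic_on B" "G holomorphic_on B" "K holomorphic_on B"
    and "\<And>w. w \<in> B \<Longrightarrow> H w * G w = poly W w * K w"
  obtains U where "U holomorphic_on B" "\<And>w. w \<in> B \<Longrightarrow> H w = poly W w * U w"
proof -
  have "\<exists>U. U holomorphic_on B \<and> (\<forall>w\<in>B. H w = poly W w * U w)"
    using assms(2-4,7)
  proof (induction "degree W" arbitrary: W H)
    case 0
    then obtain k where k: "W = [:k:]" "k \<noteq> 0" by (metis degree_eq_zeroE pCons_0_0)
    then show ?case using 0 by (intro exI[of _ "\<lambda>w. H w / k"]) (auto intro!: holomorphic_intros)
  next
    case (Suc n)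
    obtain a W1 where W1: "W = [:-a, 1:] * W1" "W1 \<noteq> 0" "degree W = Suc (degree W1)" "poly W a = 0"
      using poly_root_split[of W] Suc.hyps(2) Suc.prems(1) by (metis nat.simps(3))
    have a: "a \<in> B" "G a \<noteq> 0" using Suc.prems(2) W1(4) by auto
    have "H a = 0" using Suc.prems(4)[OF a(1)] a(2) W1(4) by simp
    then obtain H2 where H2: "H2 holomorphic_on B" "\<And>z. z \<in> B \<Longrightarrow> H z = (z - a) * H2 z"
      using holomorphic_divide_root[OF Suc.prems(3) assms(1) a(1)] by metis
    have "H2 w * G w - poly W1 w * K w = 0" if "w \<in> B" for w
    proof (rule holomorphic_cancel_factor[OF _ assms(1) _ that])
      show "(\<lambda>w. H2 w * G w - poly W1 w * K w) holomorphic_on B"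
        by (intro holomorphic_intros H2 assms)
      show "(w - a) * (H2 w * G w - poly W1 w * K w) = 0" if "w \<in> B" for w
        using Suc.prems(4)[OF that] H2(2)[OF that] by (simp add: W1(1) algebra_simps)
    qed
    moreover have "poly W1 w = 0 \<Longrightarrow> w \<in> B \<and> G w \<noteq> 0" for w using Suc.prems(2) W1(1) by simp
    ultimately obtain U where "U holomorphic_on B" "\<forall>w\<in>B. H2 w = poly W1 w * U w"
      using Suc.hyps(1)[of W1 H2] Suc.hyps(2) W1 H2(1) by auto
    moreover have "poly W w = (w - a) * poly W1 w" for w by (simp add: W1(1) algebra_simps)
    ultimately show ?case using H2(2) by (intro exI[of _ U]) auto
  qed
  with that show ?thesis by blast
qed

section \<open>Linear algebra over rings of holomorphic functions\<close>

lemma holomorphic_integral_domain: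
  assumes "a holomorphic_on D" "b holomorphic_on D" "open D" "connected D" "z0 \<in> D" "a z0 \<noteq> 0"
    and "\<And>z. z \<in> D \<Longrightarrow> a z * b z = 0" "z \<in> D"
  shows "b z = 0"
proof (rule analytic_continuation_open[of "{z \<in> D. a z \<noteq> 0}" D b "\<lambda>_. 0"])
  have "open (D \<inter> a -` (- {0}))"
    using assms by (intro continuous_open_preimage) (auto intro: holomorphic_on_imp_continuous_on)
  then show "open {z \<in> D. a z \<noteq> 0}" by (simp add: vimage_def Int_def)
qed (use assms in auto)

text \<open>A substitute for generic points that elimination respects: over a connected open
  \<open>D\<close>, a uniqueness set stays one after the zeros of a function that is not identically
  zero have been removed.\<close>

definition uniqueness_set :: "complex set \<Rightarrow> complex set \<Rightarrow> bool" where
  "uniqueness_set D E \<longleftrightarrow> E \<subseteq> D \<and>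
     (\<forall>b. b holomorphic_on D \<longrightarrow> (\<forall>z\<in>E. b z = 0) \<longrightarrow> (\<forall>z\<in>D. b z = 0))"

text \<open>Otherwise every \<open>E k\<close> would lie in the zero set of a function that is not
  identically zero and so be countable, and the non-empty open set \<open>D\<close> would be
  countable.\<close>

lemma uniqueness_set_countable_cover:
  assumes D: "open D" "connected D" "D \<noteq> {}" and E: "D = (\<Union>k::nat. E k)"
  obtains k where "uniqueness_set D (E k)"
proof -
  have "\<exists>k. uniqueness_set D (E k)"
  proof (rule ccontr)
    assume "\<nexists>k. uniqueness_set D (E k)"
    then have nu: "\<not> uniqueness_set D (E k)" for k by blast
    have sub: "E k \<subseteq> D" for k unfolding E by blast
    have "\<exists>b. b holomorphic_on D \<and> (\<forall>z\<in>E k. b z = 0) \<and> (\<exists>z\<in>D. b z \<noteq> 0)" for k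
      using nu[of k] sub[of k] unfolding uniqueness_set_def by blast
    then obtain b where b: "\<And>k. b k holomorphic_on D" "\<And>k z. z \<in> E k \<Longrightarrow> b k z = 0"
      "\<And>k. \<exists>z\<in>D. b k z \<noteq> 0" by metis
    obtain C :: "nat \<Rightarrow> complex set" where "\<And>n. compact (C n)" "\<And>n. C n \<subseteq> D" "\<Union>(range C) = D"
      using open_Union_compact_subsets[OF D(1)] by metis
    then have fsig: "fsigma D" unfolding fsigma_Union_compact by (intro exI[of _ C]) auto
    have "countable (E k)" for k
    proof (cases "b k constant_on D")
      case True
      then obtain y where y: "\<And>z. z \<in> D \<Longrightarrow> b k z = y" unfolding constant_on_def by blast
      have "E k = {}"
      proof (rule equals0I)
        fix z assume z: "z \<in> E k"
        then have "y = 0" using y[of z] b(2)[OF z] sub[of k] by auto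
        then show False using b(3)[of k] y by auto
      qed
      then show ?thesis by simp
    next
      case False
      then have "countable {z\<in>D. b k z = 0}"
        using holomorphic_countable_zeros[OF b(1) D(1,2) fsig] by blast
      then show ?thesis by (rule countable_subset[rotated]) (use sub[of k] b(2) in auto)
    qed
    then have "countable D" by (subst E) auto
    moreover have "uncountable D"
    proof -
      obtain z r where "0 < r" "ball z r \<subseteq> D" using D open_contains_ball by blast
      then show ?thesis using uncountable_ball[of r z] countable_subset by blast
    qed
    ultimately show False by blast
  qed
  with that show ?thesis by blast
qed

text \<open>Gaussian elimination without division: multiplying by the pivot instead of dividing by
  it keeps all coefficients holomorphic, and the zeros of the pivot are dropped from
  \<open>E\<close>, which remains a uniqueness set.\<close>

lemma holomorphic_kernel_vector:
  fixes v :: "nat \<Rightarrow> nat \<Rightarrow> complex \<Rightarrow> complex"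
  assumes D: "open D" "connected D" "D \<noteq> {}"
    and "\<And>n i. i < m \<Longrightarrow> v n i holomorphic_on D" "uniqueness_set D E"
    and "\<And>z. z \<in> E \<Longrightarrow> \<exists>q. (\<exists>i<m. q i \<noteq> 0) \<and> (\<forall>n. (\<Sum>i<m. q i * v n i z) = 0)"
  shows "\<exists>Q. (\<forall>i<m. Q i holomorphic_on D) \<and> (\<exists>i<m. \<exists>z\<in>D. Q i z \<noteq> 0) \<and>
    (\<forall>n. \<forall>z\<in>D. (\<Sum>i<m. Q i z * v n i z) = 0)"
  using assms(4-)
proof (induction m arbitrary: v E)
  case 0
  then have "E = {}" by auto
  then have "\<forall>z\<in>D. (1::complex) = 0"
    using 0(2) unfolding uniqueness_set_def by (metis empty_iff holomorphic_on_const)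
  with D show ?case by simp
next
  case (Suc m)
  show ?case
  proof (cases "\<forall>n. \<forall>z\<in>D. v n m z = 0")
    case True
    then show ?thesis using D(3)
      by (intro exI[of _ "\<lambda>i z. if i = m then 1 else 0"]) (auto intro!: holomorphic_intros)
  next
    case False
    then obtain n0 z0 where z0: "z0 \<in> D" "v n0 m z0 \<noteq> 0" by auto
    \<comment> \<open>The pivot for the last unknown; \<open>v'\<close> is the system after that
      unknown has been eliminated with equation \<open>n0\<close>.\<close>
    define a where "a = v n0 m"
    have a: "a holomorphic_on D" "a z0 \<noteq> 0" using Suc.prems(1) z0 by (auto simp: a_def)
    define v' where "v' n i z = a z * v n i z - v n m z * v n0 i z" for n i z
    define E' where "E' = {z \<in> E. a z \<noteq> 0}"
    have hv': "v' n i holomorphic_on D" if "i < m" for n i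
      unfolding v'_def using that Suc.prems(1) a by (intro holomorphic_intros) auto
    have "uniqueness_set D E'"
      unfolding uniqueness_set_def
    proof (intro conjI allI impI)
      show "E' \<subseteq> D" using Suc.prems(2) by (auto simp: uniqueness_set_def E'_def)
      fix b assume b: "b holomorphic_on D" "\<forall>z\<in>E'. b z = 0"
      have "(\<lambda>z. a z * b z) holomorphic_on D" "\<forall>z\<in>E. a z * b z = 0"
        using a b by (auto simp: E'_def intro!: holomorphic_intros)
      then have "\<forall>z\<in>D. a z * b z = 0" using Suc.prems(2) unfolding uniqueness_set_def by blast
      then show "\<forall>z\<in>D. b z = 0"
        using holomorphic_integral_domain[OF a(1) b(1) D(1,2) z0(1) a(2)] by blast
    qed
    moreover have "\<exists>q. (\<exists>i<m. q i \<noteq> 0) \<and> (\<forall>n. (\<Sum>i<m. q i * v' n i z) = 0)" if z: "z \<in> E'" for z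
    proof -
      obtain q where q: "\<exists>i<Suc m. q i \<noteq> 0" "\<And>n. (\<Sum>i<Suc m. q i * v n i z) = 0"
        using Suc.prems(3)[of z] z by (auto simp: E'_def)
      have az: "a z \<noteq> 0" using z by (simp add: E'_def)
      have s: "(\<Sum>i<m. q i * v n i z) = - (q m * v n m z)" for n
        using q(2)[of n] by (simp add: add_eq_0_iff2)
      have "\<exists>i<m. q i \<noteq> 0"
      proof (rule ccontr)
        assume *: "\<not> ?thesis"
        then have "q m * a z = 0" using s[of n0] by (simp add: a_def)
        with * q(1) az show False by (auto simp: less_Suc_eq)
      qed
      moreover have "(\<Sum>i<m. q i * v' n i z) = 0" for n
      proof -
        have "(\<Sum>i<m. q i * v' n i z) = a z * (\<Sum>i<m. q i * v n i z) - v n m z * (\<Sum>i<m. q i * v n0 i z)"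
          unfolding v'_def by (simp add: sum_distrib_left sum_subtractf algebra_simps)
        then show ?thesis unfolding s by (simp add: a_def)
      qed
      ultimately show ?thesis by blast
    qed
    ultimately obtain Q where Q: "\<forall>i<m. Q i holomorphic_on D" "\<exists>i<m. \<exists>z\<in>D. Q i z \<noteq> 0"
        "\<forall>n. \<forall>z\<in>D. (\<Sum>i<m. Q i z * v' n i z) = 0"
      using Suc.IH[of v' E'] hv' by blast
    \<comment> \<open>Back substitution, scaled by the pivot: the last entry solves equation
      \<open>n0\<close> without a division.\<close>
    define R where "R i z = (if i = m then - (\<Sum>i<m. Q i z * v n0 i z) else a z * Q i z)" for i z
    show ?thesis
    proof (intro exI[of _ R] conjI allI impI ballI)
      fix i assume i: "i < Suc m"
      show "R i holomorphic_on D"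
        unfolding R_def using i Q(1) a Suc.prems(1) by (cases "i = m") (auto intro!: holomorphic_intros)
    next
      obtain i z where iz: "i < m" "z \<in> D" "Q i z \<noteq> 0" using Q(2) by blast
      then have "\<exists>z\<in>D. a z * Q i z \<noteq> 0"
        using holomorphic_integral_domain[OF a(1) _ D(1,2) z0(1) a(2), of "Q i" z] Q(1) by blast
      with iz show "\<exists>i<Suc m. \<exists>z\<in>D. R i z \<noteq> 0" by (intro exI[of _ i]) (auto simp: R_def)
    next
      fix n z assume z: "z \<in> D"
      have "(\<Sum>i<Suc m. R i z * v n i z) = (\<Sum>i<m. a z * Q i z * v n i z) - (\<Sum>i<m. Q i z * v n0 i z) * v n m z"
        by (simp add: R_def)
      also have "\<dots> = (\<Sum>i<m. Q i z * v' n i z)"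
        unfolding v'_def by (simp add: sum_distrib_left sum_subtractf algebra_simps)
      finally show "(\<Sum>i<Suc m. R i z * v n i z) = 0" using Q(3) z by simp
    qed
  qed
qed

text \<open>Common factors \<open>z - z0\<close> are divided out as long as all components vanish at
  \<open>z0\<close>; the order of vanishing of one fixed component \<open>Q j\<close> bounds the
  number of divisions.\<close>

lemma kernel_vector_normalize:
  fixes v :: "nat \<Rightarrow> nat \<Rightarrow> complex \<Rightarrow> complex"
  assumes D: "open D" "connected D" "z0 \<in> D" and v: "\<And>n i. i < m \<Longrightarrow> v n i holomorphic_on D"
    and "\<And>i. i < m \<Longrightarrow> Q i holomorphic_on D" "\<exists>i<m. \<exists>z\<in>D. Q i z \<noteq> 0"
    and "\<And>n z. z \<in> D \<Longrightarrow> (\<Sum>i<m. Q i z * v n i z) = 0"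
  obtains Q' where "\<And>i. i < m \<Longrightarrow> Q' i holomorphic_on D" "\<exists>i<m. Q' i z0 \<noteq> 0"
    "\<And>n z. z \<in> D \<Longrightarrow> (\<Sum>i<m. Q' i z * v n i z) = 0"
proof -
  obtain j z1 where j: "j < m" "z1 \<in> D" "Q j z1 \<noteq> 0" using assms(6) by blast
  obtain N g where g: "g holomorphic_on D" "g z0 \<noteq> 0" "\<And>z. z \<in> D \<Longrightarrow> Q j z = (z - z0) ^ N * g z"
    using holomorphic_order_at[OF assms(5)[OF j(1)] D(1,2,3) j(2,3)] by metis
  have "\<exists>Q'. (\<forall>i<m. Q' i holomorphic_on D) \<and> (\<exists>i<m. Q' i z0 \<noteq> 0) \<and>
     (\<forall>n. \<forall>z\<in>D. (\<Sum>i<m. Q' i z * v n i z) = 0)"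
    using assms(5,7) g(3)
  proof (induction N arbitrary: Q)
    case 0
    then have "Q j z0 \<noteq> 0" using g(2) D(3) by simp
    with 0 j(1) show ?case by blast
  next
    case (Suc N)
    show ?case
    proof (cases "\<exists>i<m. Q i z0 \<noteq> 0")
      case True
      with Suc.prems show ?thesis by blast
    next
      case False
      have "\<exists>g. g holomorphic_on D \<and> (\<forall>z\<in>D. Q i z = (z - z0) * g z)" if "i < m" for i
        using holomorphic_divide_root[OF Suc.prems(1)[OF that] D(1,3)] False that by metis
      then obtain Q1 where Q1: "\<And>i. i < m \<Longrightarrow> Q1 i holomorphic_on D"
          "\<And>i z. i < m \<Longrightarrow> z \<in> D \<Longrightarrow> Q i z = (z - z0) * Q1 i z" by metis
      have "(\<Sum>i<m. Q1 i z * v n i z) = 0" if "z \<in> D" for n z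
      proof (rule holomorphic_cancel_factor[OF _ D(1) _ that])
        show "(\<lambda>z. \<Sum>i<m. Q1 i z * v n i z) holomorphic_on D"
          by (intro holomorphic_intros Q1 v) auto
        show "(z - z0) * (\<Sum>i<m. Q1 i z * v n i z) = 0" if "z \<in> D" for z
          using Suc.prems(2)[OF that, of n] Q1(2)[OF _ that] by (simp add: sum_distrib_left mult.assoc)
      qed
      moreover have "Q1 j z = (z - z0) ^ N * g z" if "z \<in> D" for z
      proof -
        have "Q1 j z - (z - z0) ^ N * g z = 0"
        proof (rule holomorphic_cancel_factor[OF _ D(1) _ that])
          show "(\<lambda>z. Q1 j z - (z - z0) ^ N * g z) holomorphic_on D"
            by (intro holomorphic_intros Q1 g j)
          show "(z - z0) * (Q1 j z - (z - z0) ^ N * g z) = 0" if "z \<in> D" for z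
            using Suc.prems(3)[OF that] Q1(2)[OF j(1) that] by (simp add: algebra_simps)
        qed
        then show ?thesis by simp
      qed
      ultimately show ?thesis using Suc.IH[of Q1] Q1(1) by blast
    qed
  qed
  with that show ?thesis by blast
qed

section \<open>Minimal denominators of a quotient of holomorphic functions\<close>

lemma tube2:
  assumes "open S" "compact C" "\<And>w. w \<in> C \<Longrightarrow> pt z0 w \<in> S"
  obtains \<rho> where "\<rho> > 0" "\<And>z w. z \<in> ball z0 \<rho> \<Longrightarrow> w \<in> C \<Longrightarrow> pt z w \<in> S"
proof -
  have "compact (rect2 {z0} C)" by (intro compact_rect2 assms) simp
  moreover have "rect2 {z0} C \<subseteq> S" using assms(3) by (auto simp: subset_iff) (metis pt_eta)
  ultimately obtain e where e: "e > 0" "(\<Union>x\<in>rect2 {z0} C. ball x e) \<subseteq> S"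
    using compact_subset_open_imp_ball_epsilon_subset[OF _ assms(1)] by metis
  have "pt z w \<in> S" if "z \<in> ball z0 e" "w \<in> C" for z w
  proof -
    have "norm (pt z0 w - pt z w) \<le> cmod (z0 - z)"
      using norm_le_sum2[of "pt z0 w - pt z w"] by simp
    then have "pt z w \<in> ball (pt z0 w) e" using that by (simp add: dist_norm)
    moreover have "pt z0 w \<in> rect2 {z0} C" using that by simp
    ultimately show ?thesis using e(2) by blast
  qed
  with e that show ?thesis by blast
qed

lemma holo_sphere_avoid:
  assumes h: "h holomorphic_on ball c R" "R > 0" and nz: "\<not> eventually (\<lambda>w. h w = 0) (nhds c)"
  obtains r where "0 < r" "r < R" "\<And>w. w \<in> sphere c r \<Longrightarrow> h w \<noteq> 0"
proof -
  have "\<exists>b\<in>ball c R. h b \<noteq> 0"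
    using nz h(2) unfolding eventually_nhds by (metis centre_in_ball open_ball)
  then obtain b where b: "b \<in> ball c R" "h b \<noteq> 0" by blast
  have c: "c \<in> ball c R" using h(2) by simp
  obtain n g where g: "g holomorphic_on ball c R" "g c \<noteq> 0"
      "\<And>z. z \<in> ball c R \<Longrightarrow> h z = (z - c) ^ n * g z"
    using holomorphic_order_at[OF h(1) open_ball connected_ball c b] by metis
  have "isCont g c" using g(1) c holomorphic_on_imp_continuous_on continuous_on_eq_continuous_at[OF open_ball] by blast
  then obtain d where d: "d > 0" "\<And>w. dist w c < d \<Longrightarrow> g w \<noteq> 0"
    using continuous_at_avoid[of c g 0] g(2) by (metis dist_commute)
  define r where "r = min d R / 2"
  show ?thesis
  proof
    show r: "0 < r" "r < R" using d h(2) by (auto simp: r_def)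
    fix w assume "w \<in> sphere c r"
    then have "dist c w = r" by simp
    then have "w \<in> ball c R" "dist w c < d" "w \<noteq> c" using r d by (auto simp: dist_commute r_def)
    then show "h w \<noteq> 0" using g(3) d(2) by simp
  qed
qed

lemma sum_monom_poly:
  fixes q :: "nat \<Rightarrow> complex" shows "poly (\<Sum>i<m. monom (q i) i) w = (\<Sum>i<m. q i * w ^ i)"
  by (simp add: poly_sum poly_monom)

lemma coeff_sum_monom: "coeff (\<Sum>i<m. monom (q i) i) j = (if j < m then q j else 0)"
  by (simp add: coeff_sum coeff_monom if_distrib sum.delta cong: if_cong)

lemma poly_as_sum:
  fixes P :: "complex poly" shows "degree P < m \<Longrightarrow> poly P w = (\<Sum>i<m. coeff P i * w ^ i)"
  unfolding poly_altdef
  by (rule sum.mono_neutral_left) (auto simp: coeff_eq_0)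

text \<open>The germs \<open>H\<close> for which \<open>H * g / h\<close> is holomorphic form the
  ideal of denominators of \<open>g / h\<close> at \<open>q\<close>, and \<open>W\<close> is a
  non-zero generator of it. The relations are written without division, so the zeros of
  \<open>h\<close> need no case distinction.\<close>

definition denominator_generator ::
    "(complex^'n::finite \<Rightarrow> complex) \<Rightarrow> (complex^'n \<Rightarrow> complex) \<Rightarrow> complex^'n \<Rightarrow> (complex^'n \<Rightarrow> complex) \<Rightarrow> bool" where
  "denominator_generator g h q W \<longleftrightarrow> hol_at W q \<and> \<not> zero_germ W q \<and>
     (\<exists>G. hol_at G q \<and> eventually (\<lambda>x. W x * g x = h x * G x) (nhds q)) \<and>
     (\<forall>H K. hol_at H q \<longrightarrow> hol_at K q \<longrightarrow> eventually (\<lambda>x. H x * g x = h x * K x) (nhds q) \<longrightarrow>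
        (\<exists>U. hol_at U q \<and> eventually (\<lambda>x. H x = U x * W x) (nhds q)))"

text \<open>For fixed first coordinate \<open>z\<close>, a polynomial \<open>q\<close> in the second coordinate clears the poles
  of \<open>g / h\<close> inside the circle iff its coefficients annihilate the moments \<open>c\<^sub>n(z)\<close> of \<open>g / h\<close>.
  The generator is an annihilator of minimal length with coefficients holomorphic in \<open>z\<close>; outside the
  zeros of a holomorphic function \<open>b\<close> it is also minimal for the individual \<open>z\<close>.\<close>

lemma local_denominator_slice:
  assumes g: "holo_Cn N g" and h: "holo_Cn N h" and p: "pt z0 w0 \<in> N"
    and nz: "\<not> eventually (\<lambda>w. h (pt z0 w) = 0) (nhds w0)"
  obtains S W where "open S" "pt z0 w0 \<in> S" "holo_Cn S W"
    "\<And>q. q \<in> S \<Longrightarrow> denominator_generator g h q W"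
proof -

  \<comment> \<open>A bidisc on whose vertical boundary circles \<open>h\<close> has no
    zeros\<close>
  obtain r1 where r1: "r1 > 0" "rect2 (cball z0 r1) (cball w0 r1) \<subseteq> N"
    using rect2_inside_open[OF holo_Cn_open[OF g] p] by auto
  define B where "B = ball w0 r1"
  have inN: "pt z w \<in> N" if "z \<in> cball z0 r1" "w \<in> cball w0 r1" for z w
    using r1(2) that by (auto simp: subset_iff)
  have inNB: "pt z w \<in> N" if "z \<in> ball z0 r1" "w \<in> B" for z w
    using inN that by (auto simp: B_def)
  have sl: "(\<lambda>w. f (pt z w)) holomorphic_on B" if "holo_Cn N f" "z \<in> cball z0 r1" for f z
    by (rule holo_slice2[OF that(1)]) (use inN that(2) in \<open>auto simp: B_def\<close>)
  obtain r where r: "0 < r" "r < r1" "\<And>w. w \<in> sphere w0 r \<Longrightarrow> h (pt z0 w) \<noteq> 0"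
    using holo_sphere_avoid[OF sl[OF h, unfolded B_def] r1(1) nz] r1(1) by auto
  have rB: "cball w0 r \<subseteq> B" using r by (auto simp: B_def)
  have "open (N \<inter> h -` (- {0}))"
    using holo_Cn_open[OF h] holo_Cn_continuous_on[OF h] by (intro continuous_open_preimage) auto
  then obtain \<rho>0 where \<rho>0: "\<rho>0 > 0"
      "\<And>z w. z \<in> ball z0 \<rho>0 \<Longrightarrow> w \<in> sphere w0 r \<Longrightarrow> pt z w \<in> N \<inter> h -` (- {0})"
    using tube2[of "N \<inter> h -` (- {0})" "sphere w0 r" z0] r inN r1(1) by auto
  define \<rho> where "\<rho> = min \<rho>0 r1"
  define D where "D = ball z0 \<rho>"
  have \<rho>: "\<rho> > 0" using \<rho>0 r1 by (simp add: \<rho>_def)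
  have D: "open D" "connected D" "z0 \<in> D" "D \<noteq> {}" using \<rho> by (auto simp: D_def)
  have D1: "z \<in> ball z0 r1" "z \<in> cball z0 r1" if "z \<in> D" for z using that by (auto simp: D_def \<rho>_def)
  have hs: "h (pt z w) \<noteq> 0" if "z \<in> D" "w \<in> sphere w0 r" for z w
    using \<rho>0(2)[of z w] that by (auto simp: D_def \<rho>_def)
  have sB: "w \<in> B" if "w \<in> sphere w0 r" for w using that rB by auto
  let ?C = "circlepath w0 r"
  have pim: "path_image ?C = sphere w0 r" using r by simp

  \<comment> \<open>Moments of \<open>g / h\<close> on the circle\<close>
  define c where "c n z = contour_integral ?C (\<lambda>w. g (pt z w) / h (pt z w) * w ^ n)" for n z
  have contgh: "continuous_on (D \<times> sphere w0 r) (\<lambda>x. f (pt (fst x) (snd x)))" if "holo_Cn N f" for f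
    by (rule continuous_on_compose2[OF holo_Cn_continuous_on[OF that]])
       (use D1 sB inNB in \<open>auto intro!: continuous_intros\<close>)
  have slice1: "(\<lambda>z. f (pt z w)) holomorphic_on D" if "holo_Cn N f" "w \<in> sphere w0 r" for f w
    by (rule holo_slice1[OF that(1) D(1)]) (use that(2) D1 sB inNB in auto)
  have chol: "c n holomorphic_on D" for n
    unfolding c_def
  proof (rule contour_integral_holomorphic_param[OF D(1) _ _ smooth_circlepath])
    show "continuous_on (D \<times> path_image ?C) (\<lambda>(z, w). g (pt z w) / h (pt z w) * w ^ n)"
      unfolding pim split_beta
      by (intro continuous_intros contgh g h) (use hs in auto)
    show "(\<lambda>z. g (pt z w) / h (pt z w) * w ^ n) holomorphic_on D" if "w \<in> path_image ?C" for w
      using that hs unfolding pim by (intro holomorphic_intros slice1 g h) auto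
  qed
  have contq: "continuous_on (sphere w0 r) (\<lambda>w. g (pt z w) / h (pt z w) * k w)"
    if "z \<in> D" "continuous_on (sphere w0 r) k" for z k
  proof (intro continuous_intros that)
    show "continuous_on (sphere w0 r) (\<lambda>w. g (pt z w))" "continuous_on (sphere w0 r) (\<lambda>w. h (pt z w))"
      using sl[OF g D1(2)[OF that(1)]] sl[OF h D1(2)[OF that(1)]] sB
      by (auto intro!: holomorphic_on_imp_continuous_on elim!: holomorphic_on_subset)
  qed (use hs that in auto)
  have mom: "contour_integral ?C (\<lambda>w. g (pt z w) / h (pt z w) * ((\<Sum>i<m. q i * w ^ i) * w ^ n)) =
      (\<Sum>i<m. q i * c (n + i) z)" if "z \<in> D" for z q m n
  proof -
    have "contour_integral ?C (\<lambda>w. g (pt z w) / h (pt z w) * ((\<Sum>i<m. q i * w ^ i) * w ^ n)) =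
       contour_integral ?C (\<lambda>w. \<Sum>i<m. q i * (g (pt z w) / h (pt z w) * w ^ (n + i)))"
      by (simp add: sum_distrib_left sum_distrib_right power_add mult_ac)
    also have "\<dots> = (\<Sum>i<m. contour_integral ?C (\<lambda>w. q i * (g (pt z w) / h (pt z w) * w ^ (n + i))))"
      using that by (intro contour_integral_sum contour_integrable_smooth smooth_circlepath)
        (auto simp only: pim intro!: continuous_intros contq finite_lessThan)
    also have "\<dots> = (\<Sum>i<m. q i * c (n + i) z)"
      unfolding c_def using that
      by (intro sum.cong refl contour_integral_lmul contour_integrable_smooth smooth_circlepath)
         (auto simp only: pim intro!: continuous_intros contq)
    finally show ?thesis .
  qed
  have momp: "contour_integral ?C (\<lambda>w. g (pt z w) / h (pt z w) * (\<Sum>i<m. q i * w ^ i) * poly P w) = 0"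
    if z: "z \<in> D" and q: "\<And>n. (\<Sum>i<m. q i * c (n + i) z) = 0" for z q m P
  proof -
    have exp: "X * S * poly P w = (\<Sum>n\<le>degree P. coeff P n * (X * (S * w ^ n)))" for X S w :: complex
      by (simp add: poly_altdef sum_distrib_left mult_ac)
    have "contour_integral ?C (\<lambda>w. g (pt z w) / h (pt z w) * (\<Sum>i<m. q i * w ^ i) * poly P w) =
        contour_integral ?C (\<lambda>w. \<Sum>n\<le>degree P. coeff P n *
          (g (pt z w) / h (pt z w) * ((\<Sum>i<m. q i * w ^ i) * w ^ n)))"
      by (simp only: exp)
    also have "\<dots> = (\<Sum>n\<le>degree P. contour_integral ?C (\<lambda>w. coeff P n *
          (g (pt z w) / h (pt z w) * ((\<Sum>i<m. q i * w ^ i) * w ^ n))))"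
      using z by (intro contour_integral_sum contour_integrable_smooth smooth_circlepath)
        (auto simp only: pim intro!: continuous_intros contq finite_atMost)
    also have "\<dots> = (\<Sum>n\<le>degree P. coeff P n * contour_integral ?C (\<lambda>w. 
          g (pt z w) / h (pt z w) * ((\<Sum>i<m. q i * w ^ i) * w ^ n)))"
      using z by (intro sum.cong refl contour_integral_lmul contour_integrable_smooth smooth_circlepath)
         (auto simp only: pim intro!: continuous_intros contq)
    also have "\<dots> = 0" using mom[OF z] q by simp
    finally show ?thesis .
  qed
  \<comment> \<open>\<open>E k\<close> collects the \<open>z\<close> for which a non-zero polynomial
    of degree below \<open>k\<close> clears the poles of the slice inside the circle. The polynomial
    factor of \<open>h\<close> on the slice does so, hence the sets \<open>E k\<close> exhaust
    \<open>D\<close>.\<close>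
  define E where "E k = {z \<in> D. \<exists>q. (\<exists>i<k. q i \<noteq> 0) \<and> (\<forall>n. (\<Sum>i<k. q i * c (n + i) z) = 0)}" for k
  have factor: "\<exists>P e. P \<noteq> 0 \<and> (\<forall>w. poly P w = 0 \<longrightarrow> w \<in> ball w0 r) \<and> e holomorphic_on B \<and>
      (\<forall>w\<in>cball w0 r. e w \<noteq> 0) \<and> (\<forall>w\<in>B. h (pt z w) = poly P w * e w)" if "z \<in> D" for z
    using holomorphic_poly_factor[OF sl[OF h D1(2)[OF that], unfolded B_def] r(1,2) hs[OF that]]
    unfolding B_def by metis
  have cauchy0: "contour_integral ?C f = 0" if "f holomorphic_on cball w0 r" for f
    using Cauchy_theorem_convex_simple[OF that convex_cball, of ?C] r(1)
    by (intro contour_integral_unique) auto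
  have "D = (\<Union>k. E k)"
  proof (intro equalityI subsetI)
    fix z assume z: "z \<in> D"
    obtain P e where P: "P \<noteq> 0" "e holomorphic_on B" "\<forall>w\<in>cball w0 r. e w \<noteq> 0"
      "\<forall>w\<in>B. h (pt z w) = poly P w * e w" using factor[OF z] by blast
    have "(\<Sum>i<Suc (degree P). coeff P i * c (n + i) z) = 0" for n
    proof -
      have "(\<Sum>i<Suc (degree P). coeff P i * c (n + i) z) =
        contour_integral ?C (\<lambda>w. g (pt z w) / h (pt z w) * (poly P w * w ^ n))"
        using mom[OF z, of "coeff P" "Suc (degree P)" n] by (simp add: poly_as_sum[of P "Suc (degree P)"])
      also have "\<dots> = contour_integral ?C (\<lambda>w. g (pt z w) / e w * w ^ n)"
      proof (rule contour_integral_cong)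
        fix w assume "w \<in> path_image ?C"
        then have s: "w \<in> sphere w0 r" by (simp only: pim)
        have "poly P w * e w \<noteq> 0" using P(4) sB[OF s] hs[OF z s] by auto
        then show "g (pt z w) / h (pt z w) * (poly P w * w ^ n) = g (pt z w) / e w * w ^ n"
          using P(4) sB[OF s] by (simp add: field_simps)
      qed simp
      also have "\<dots> = 0"
        using P(2,3) rB sl[OF g D1(2)[OF z]]
        by (intro cauchy0 holomorphic_intros) (auto elim: holomorphic_on_subset)
      finally show ?thesis .
    qed
    moreover have "\<exists>i<Suc (degree P). coeff P i \<noteq> 0" using P(1) by (intro exI[of _ "degree P"]) auto
    ultimately have "z \<in> E (Suc (degree P))" unfolding E_def using z by blast
    then show "z \<in> (\<Union>k. E k)" by blast
  qed (auto simp: E_def)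
  then obtain k0 where k0: "uniqueness_set D (E k0)"
    using uniqueness_set_countable_cover[OF D(1,2,4)] by metis

  \<comment> \<open>The shortest holomorphic annihilator of the moments\<close>
  define ann where "ann m Q \<longleftrightarrow> (\<forall>i<m. Q i holomorphic_on D) \<and> (\<exists>i<m. \<exists>z\<in>D. Q i z \<noteq> 0) \<and>
    (\<forall>n. \<forall>z\<in>D. (\<Sum>i<m. Q i z * c (n + i) z) = 0)" for m and Q :: "nat \<Rightarrow> complex \<Rightarrow> complex"
  have annE: "\<exists>Q. ann m Q" if "uniqueness_set D (E m)" for m
    unfolding ann_def
    by (rule holomorphic_kernel_vector[OF D(1,2,4) chol that]) (auto simp: E_def)
  define m where "m = (LEAST m. \<exists>Q. ann m Q)"
  obtain Q0 where Q0: "ann m Q0" unfolding m_def using LeastI_ex[of "\<lambda>m. \<exists>Q. ann m Q"] annE[OF k0] by blast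
  have m0: "m > 0" using Q0 by (auto simp: ann_def)
  have "\<not> (\<exists>Q. ann (m - 1) Q)" using not_less_Least[of "m - 1" "\<lambda>m. \<exists>Q. ann m Q"] m0 m_def by auto
  \<comment> \<open>If \<open>E (m - 1)\<close> were a uniqueness set, elimination would produce an
    annihilator shorter than \<open>m\<close>. So some \<open>b\<close>, not identically zero,
    vanishes on \<open>E (m - 1)\<close>.\<close>
  then have "\<not> uniqueness_set D (E (m - 1))" using annE by blast
  then obtain b z1 where b: "b holomorphic_on D" "\<And>z. z \<in> E (m - 1) \<Longrightarrow> b z = 0" "z1 \<in> D" "b z1 \<noteq> 0"
    unfolding uniqueness_set_def E_def by blast
  \<comment> \<open>Normalizing at \<open>z0\<close> keeps the polynomial \<open>P z0\<close> from
    being zero, so that \<open>W\<close> vanishes identically on no vertical slice over the smaller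
    disc \<open>D'\<close>.\<close>
  obtain Q where Q: "\<And>i. i < m \<Longrightarrow> Q i holomorphic_on D" "\<exists>i<m. Q i z0 \<noteq> 0"
      "\<And>n z. z \<in> D \<Longrightarrow> (\<Sum>i<m. Q i z * c (n + i) z) = 0"
    using kernel_vector_normalize[OF D(1,2,3), of m "\<lambda>n i. c (n + i)" Q0] Q0 chol unfolding ann_def by blast
  obtain i0 where i0: "i0 < m" "Q i0 z0 \<noteq> 0" using Q(2) by blast
  have "isCont (Q i0) z0" using Q(1)[OF i0(1)] D holomorphic_on_imp_continuous_on continuous_on_eq_continuous_at by blast
  then obtain d where d: "d > 0" "\<And>z. dist z0 z < d \<Longrightarrow> Q i0 z \<noteq> 0"
    using continuous_at_avoid[of z0 "Q i0" 0] i0(2) by blast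
  define D' where "D' = ball z0 (min d \<rho>)"
  have D': "open D'" "convex D'" "z0 \<in> D'" "D' \<subseteq> D" using d \<rho> by (auto simp: D'_def D_def)
  define W where "W p = (\<Sum>i<m. Q i (p $ 1) * (p $ 2) ^ i)" for p :: "complex^2"
  define P where "P z = (\<Sum>i<m. monom (Q i z) i)" for z
  have PW: "poly (P z) w = W (pt z w)" for z w by (simp add: P_def W_def sum_monom_poly)
  have P0: "P z \<noteq> 0" if "z \<in> D'" for z
  proof -
    have "coeff (P z) i0 \<noteq> 0" using d(2)[of z] that i0(1) by (auto simp: P_def coeff_sum_monom D'_def)
    then show ?thesis by auto
  qed
  have Pdeg: "degree (P z) < m" for z
    using m0 by (intro degree_lessI) (auto simp: P_def coeff_sum_monom)
  have holW: "holo_Cn (rect2 D UNIV) W"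
    unfolding W_def
  proof (intro holo_Cn_sum holo_Cn_mult holo_Cn_power holo_Cn_nth open_rect2 D(1) open_UNIV)
    fix i assume "i \<in> {..<m}"
    then show "holo_Cn (rect2 D UNIV) (\<lambda>p. Q i (p $ 1))"
      using Q(1) D(1) by (intro holo_Cn_outer[of _ "\<lambda>p. p $ 1" "Q i" D] holo_Cn_nth open_rect2) auto
  qed

  \<comment> \<open>The cofactor \<open>G\<close> with \<open>W * g = h * G\<close>\<close>
  define S where "S = rect2 D' (ball w0 r)"
  have S: "open S" "convex S" "pt z0 w0 \<in> S"
    unfolding S_def using D' r(1) by (auto intro!: open_rect2 convex_rect2)
  have SN: "S \<subseteq> N"
  proof
    fix x assume "x \<in> S"
    then have "pt (x $ 1) (x $ 2) \<in> N" using D1 D' rB by (intro inNB) (auto simp: S_def)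
    then show "x \<in> N" by simp
  qed
  \<comment> \<open>Cauchy integral of \<open>W * g / h\<close> over the circle, where
    \<open>h\<close> has no zeros. This is holomorphic in both variables from the outset, and it
    agrees with \<open>W * g / h\<close> inside because the poles there have been cleared.\<close>
  define G where "G p = contour_integral ?C
      (\<lambda>s. W (pt (p $ 1) s) * g (pt (p $ 1) s) / h (pt (p $ 1) s) / (s - p $ 2)) / (2 * pi * \<i>)" for p :: "complex^2"
  have sub1: "holo_Cn S (\<lambda>p. f (pt (p $ 1) s))" if f: "holo_Cn N' f" and s: "\<And>z. z \<in> D' \<Longrightarrow> pt z s \<in> N'" for f s N'
  proof (rule holo_Cn_compose[OF f])
    show "holo_Cn S (\<lambda>p. pt (p $ 1) s $ i)" for i :: 2
      using exhaust_2[of i] holo_Cn_nth[OF S(1)] holo_Cn_const[OF S(1)] by auto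
  qed (use s in \<open>auto simp: S_def\<close>)
  have contS: "continuous_on (S \<times> sphere w0 r) (\<lambda>x. f (pt (fst x $ 1) (snd x)))"
    if f: "holo_Cn N' f" and s: "\<And>z w. z \<in> D' \<Longrightarrow> w \<in> sphere w0 r \<Longrightarrow> pt z w \<in> N'" for f N'
    by (rule continuous_on_compose2[OF holo_Cn_continuous_on[OF f]])
       (use s in \<open>auto simp: S_def intro!: continuous_intros\<close>)
  have D'N: "pt z w \<in> N" if "z \<in> D'" "w \<in> sphere w0 r" for z w
    using that inNB D1 sB D'(4) by blast
  have "holo_Cn S (\<lambda>p. contour_integral ?C
      (\<lambda>s. W (pt (p $ 1) s) * g (pt (p $ 1) s) / h (pt (p $ 1) s) / (s - p $ 2)))"
  proof (rule holo_contour_param[OF S(1) _ _ smooth_circlepath])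
    show "continuous_on (S \<times> path_image ?C)
       (\<lambda>(p, s). W (pt (p $ 1) s) * g (pt (p $ 1) s) / h (pt (p $ 1) s) / (s - p $ 2))"
      unfolding pim split_beta
      by (intro continuous_intros contS[OF holW] contS[OF g] contS[OF h])
         (use D'N hs D'(4) in \<open>auto simp: S_def\<close>)
    show "holo_Cn S (\<lambda>p. W (pt (p $ 1) s) * g (pt (p $ 1) s) / h (pt (p $ 1) s) / (s - p $ 2))"
      if "s \<in> path_image ?C" for s
      using that unfolding pim
      by (intro holo_Cn_divide holo_Cn_mult holo_Cn_diff holo_Cn_const holo_Cn_nth S(1)
            sub1[OF holW] sub1[OF g] sub1[OF h])
         (use D'N hs D'(4) in \<open>auto simp: S_def\<close>)
  qed
  then have holG: "holo_Cn S G"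
    unfolding G_def by (intro holo_Cn_divide holo_Cn_const S(1)) simp_all
  \<comment> \<open>On one slice \<open>h = P0 * e\<close> with \<open>e\<close> a unit near the
    closed disc. The integrals of \<open>W * g / h\<close> against all polynomials vanish, so
    \<open>P0\<close> divides \<open>W * g / e\<close>; the quotient is \<open>G1\<close>, and
    Cauchy's formula identifies it with \<open>G\<close>.\<close>
  have slice: "\<exists>A G1. open A \<and> cball w0 r \<subseteq> A \<and> A \<subseteq> B \<and> G1 holomorphic_on A \<and>
      (\<forall>w\<in>A. W (pt z w) * g (pt z w) = h (pt z w) * G1 w) \<and> (\<forall>w\<in>ball w0 r. G (pt z w) = G1 w)"
    if z': "z \<in> D'" for z
  proof -
    have z: "z \<in> D" using z' D' by blast
    obtain P0 e where P0: "P0 \<noteq> 0" "\<And>w. poly P0 w = 0 \<Longrightarrow> w \<in> ball w0 r" "e holomorphic_on B"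
      "\<forall>w\<in>cball w0 r. e w \<noteq> 0" "\<forall>w\<in>B. h (pt z w) = poly P0 w * e w" using factor[OF z] by metis
    define A where "A = B \<inter> e -` (- {0})"
    have A: "open A" "cball w0 r \<subseteq> A" "A \<subseteq> B"
      unfolding A_def using P0(3,4) rB
      by (auto intro!: continuous_open_preimage holomorphic_on_imp_continuous_on simp: B_def)
    have hol: "(\<lambda>w. W (pt z w) * g (pt z w) / e w) holomorphic_on A"
    proof (intro holomorphic_intros)
      show "(\<lambda>w. g (pt z w)) holomorphic_on A" by (rule holomorphic_on_subset[OF sl[OF g D1(2)[OF z]] A(3)])
      show "e holomorphic_on A" by (rule holomorphic_on_subset[OF P0(3) A(3)])
      show "(\<lambda>w. W (pt z w)) holomorphic_on A"
        by (rule holo_slice2[OF holW A(1)]) (use z in auto)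
    qed (auto simp: A_def)
    have "contour_integral ?C (\<lambda>w. W (pt z w) * g (pt z w) / e w * poly q w / poly P0 w) = 0" for q
    proof -
      have "contour_integral ?C (\<lambda>w. W (pt z w) * g (pt z w) / e w * poly q w / poly P0 w) =
        contour_integral ?C (\<lambda>w. g (pt z w) / h (pt z w) * (\<Sum>i<m. Q i z * w ^ i) * poly q w)"
      proof (rule contour_integral_cong)
        fix w assume "w \<in> path_image ?C"
        then have s: "w \<in> sphere w0 r" by (simp only: pim)
        have "h (pt z w) = poly P0 w * e w" using P0(5) sB[OF s] by blast
        then show "W (pt z w) * g (pt z w) / e w * poly q w / poly P0 w =
            g (pt z w) / h (pt z w) * (\<Sum>i<m. Q i z * w ^ i) * poly q w"
          by (simp add: W_def mult_ac)
      qed simp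
      also have "\<dots> = 0" by (rule momp[OF z Q(3)[OF z]])
      finally show ?thesis .
    qed
    then obtain G1 where G1: "G1 holomorphic_on A" "\<And>w. w \<in> A \<Longrightarrow> W (pt z w) * g (pt z w) / e w = poly P0 w * G1 w"
      using zero_moments_divisible[OF A(1,2) r(1) P0(1,2) hol] by blast
    have eq: "W (pt z w) * g (pt z w) = h (pt z w) * G1 w" if "w \<in> A" for w
      using G1(2)[OF that] P0(5) that A by (auto simp: A_def field_simps)
    have "G (pt z w) = G1 w" if w: "w \<in> ball w0 r" for w
    proof -
      have "contour_integral ?C (\<lambda>s. W (pt z s) * g (pt z s) / h (pt z s) / (s - w)) =
          contour_integral ?C (\<lambda>s. G1 s / (s - w))"
      proof (rule contour_integral_cong)
        fix s assume "s \<in> path_image ?C"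
        then have s: "s \<in> sphere w0 r" by (simp only: pim)
        with eq[of s] hs[OF z s] A show "W (pt z s) * g (pt z s) / h (pt z s) / (s - w) = G1 s / (s - w)"
          by (simp add: subset_iff)
      qed simp
      also have "\<dots> = 2 * of_real pi * \<i> * G1 w"
        using w A(2) G1(1)
        by (intro contour_integral_unique Cauchy_integral_circlepath_simple)
           (auto simp: dist_norm norm_minus_commute elim: holomorphic_on_subset)
      finally show ?thesis by (simp add: G_def)
    qed
    with A G1(1) eq show ?thesis by blast
  qed
  have WG: "W q * g q = h q * G q" if "q \<in> S" for q
  proof -
    have "q $ 1 \<in> D'" using that by (simp add: S_def)
    from slice[OF this] obtain A G1 where "cball w0 r \<subseteq> A" "\<forall>w\<in>A. W (pt (q $ 1) w) * g (pt (q $ 1) w) = h (pt (q $ 1) w) * G1 w"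
       "\<forall>w\<in>ball w0 r. G (pt (q $ 1) w) = G1 w" by blast
    moreover have "q $ 2 \<in> ball w0 r" using that by (simp add: S_def)
    ultimately have "W (pt (q $ 1) (q $ 2)) * g (pt (q $ 1) (q $ 2)) = h (pt (q $ 1) (q $ 2)) * G (pt (q $ 1) (q $ 2))"
      using ball_subset_cball by (metis subsetD)
    then show ?thesis by simp
  qed
  \<comment> \<open>A common zero \<open>w1\<close> of \<open>W\<close> and \<open>G\<close> on a
    slice could be divided out of both. The shortened polynomial would have degree below
    \<open>m - 1\<close> and still annihilate the moments, so \<open>z \<in> E (m - 1)\<close> and
    \<open>b z = 0\<close>.\<close>
  have nocommon: "b z = 0" if z': "z \<in> D'" and w1: "w1 \<in> ball w0 r" and W0: "W (pt z w1) = 0"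
    and G0: "G (pt z w1) = 0" for z w1
  proof -
    have z: "z \<in> D" using z' D' by blast
    obtain A G1 where A: "open A" "cball w0 r \<subseteq> A" "A \<subseteq> B" "G1 holomorphic_on A"
      "\<forall>w\<in>A. W (pt z w) * g (pt z w) = h (pt z w) * G1 w" "\<forall>w\<in>ball w0 r. G (pt z w) = G1 w"
      using slice[OF z'] by blast
    have w1A: "w1 \<in> A" using w1 A(2) by (auto simp: subset_iff)
    have "G1 w1 = 0" using A(6) w1 G0 by auto
    then obtain G2 where G2: "G2 holomorphic_on A" "\<And>w. w \<in> A \<Longrightarrow> G1 w = (w - w1) * G2 w"
      using holomorphic_divide_root[OF A(4,1) w1A] by metis
    have "poly (P z) w1 = 0" using W0 PW by simp
    then obtain P1 where P1: "P z = [:-w1, 1:] * P1" using poly_eq_0_iff_dvd by (metis dvdE)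
    have P1n: "P1 \<noteq> 0" using P1 P0[OF z'] by auto
    have "degree (P z) = Suc (degree P1)"
      using P1 P1n degree_mult_eq[of "[:-w1, 1:]" P1] by (simp del: mult_pCons_left)
    then have dP1: "degree P1 < m - 1" using Pdeg[of z] by simp
    have PWz: "W (pt z w) = (w - w1) * poly P1 w" for w
      unfolding PW[symmetric] P1 by (simp add: algebra_simps)
    have "(\<Sum>i<m - 1. coeff P1 i * c (n + i) z) = 0" for n
    proof -
      have "(\<Sum>i<m - 1. coeff P1 i * c (n + i) z) =
        contour_integral ?C (\<lambda>w. g (pt z w) / h (pt z w) * (poly P1 w * w ^ n))"
        using mom[OF z, of "coeff P1" "m - 1" n] by (simp add: poly_as_sum[OF dP1])
      also have "\<dots> = contour_integral ?C (\<lambda>w. G2 w * w ^ n)"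
      proof (rule contour_integral_cong)
        fix w assume "w \<in> path_image ?C"
        then have s: "w \<in> sphere w0 r" by (simp only: pim)
        then have wA: "w \<in> A" using A(2) by auto
        have ww: "w - w1 \<noteq> 0" using s w1 by auto
        have "(w - w1) * (poly P1 w * g (pt z w)) = h (pt z w) * G1 w"
          using A(5) wA by (simp only: PWz mult.assoc)
        also have "\<dots> = (w - w1) * (h (pt z w) * G2 w)" by (simp only: G2(2)[OF wA] mult_ac)
        finally have "(w - w1) * (poly P1 w * g (pt z w)) = (w - w1) * (h (pt z w) * G2 w)" .
        then have "poly P1 w * g (pt z w) = h (pt z w) * G2 w" using ww by simp
        then show "g (pt z w) / h (pt z w) * (poly P1 w * w ^ n) = G2 w * w ^ n"
          using hs[OF z s] by (simp add: field_simps)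
      qed simp
      also have "\<dots> = 0"
        using A(2) by (intro cauchy0 holomorphic_intros holomorphic_on_subset[OF G2(1)])
      finally show ?thesis .
    qed
    moreover have "\<exists>i<m - 1. coeff P1 i \<noteq> 0" using P1n dP1 by (intro exI[of _ "degree P1"]) auto
    ultimately have "z \<in> E (m - 1)" unfolding E_def using z by blast
    then show ?thesis by (rule b(2))
  qed
  have holWS: "holo_Cn S W" by (rule holo_Cn_subset[OF holW S(1)]) (use D' in \<open>auto simp: S_def\<close>)
  have nzW: "\<not> zero_germ W q" if q: "q \<in> S" for q
  proof
    assume "zero_germ W q"
    then obtain s where s: "s > 0" "\<And>x. x \<in> rect2 (ball (q $ 1) s) (ball (q $ 2) s) \<Longrightarrow> W x = 0"
      unfolding zero_germ_def nhds_rect2 by blast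
    have "ball (q $ 2) s \<subseteq> {w. poly (P (q $ 1)) w = 0}" using s by (auto simp: PW)
    moreover have "finite {w. poly (P (q $ 1)) w = 0}" using P0 q by (intro poly_roots_finite) (auto simp: S_def)
    ultimately have "finite (ball (q $ 2) s)" by (rule finite_subset)
    then show False using uncountable_ball[OF s(1), of "q $ 2"] countable_finite by blast
  qed
  have nzh: "\<not> zero_germ h q" if q: "q \<in> S" for q
  proof -
    define S' where "S' = rect2 D' B"
    have S': "open S'" "convex S'" unfolding S'_def using D' by (auto simp: B_def intro!: open_rect2 convex_rect2)
    have S'N: "S' \<subseteq> N"
    proof
      fix x assume "x \<in> S'"
      then have "pt (x $ 1) (x $ 2) \<in> N" using D1 D'(4) by (intro inNB) (auto simp: S'_def)
      then show "x \<in> N" by simp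
    qed
    have sp: "w0 + of_real r \<in> sphere w0 r" using r(1) by (simp add: dist_norm)
    have "\<not> zero_germ h (pt z0 (w0 + of_real r))"
      by (rule not_zero_germI) (use hs[OF D(3) sp] in simp)
    then show ?thesis
      by (rule not_zero_germ_convex[OF holo_Cn_subset[OF h S'(1) S'N] S'(2), rotated 2])
         (use q sB[OF sp] D' rB in \<open>auto simp: S'_def S_def subset_iff\<close>)
  qed

  \<comment> \<open>Every denominator is a multiple of \<open>W\<close>\<close>
  have gen: "\<exists>U. hol_at U q \<and> eventually (\<lambda>x. H x = U x * W x) (nhds q)"
    if q: "q \<in> S" and H: "hol_at H q" and K: "hol_at K q"
      and HK: "eventually (\<lambda>x. H x * g x = h x * K x) (nhds q)" for q H K
  proof -
    obtain eH eK where eH: "eH > 0" "holo_Cn (ball q eH) H" "eK > 0" "holo_Cn (ball q eK) K"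
      using hol_at_ball H K by metis
    obtain A1 where A1: "open A1" "q \<in> A1" "\<And>x. x \<in> A1 \<Longrightarrow> H x * g x = h x * K x"
      using HK unfolding eventually_nhds by blast
    define A where "A = S \<inter> ball q eH \<inter> ball q eK \<inter> A1"
    have A: "open A" "q \<in> A" "A \<subseteq> S" unfolding A_def using S(1) A1 q eH by auto
    have AH: "holo_Cn A H" "holo_Cn A K" "holo_Cn A W" "holo_Cn A G" "holo_Cn A h"
      using A(1,3) SN by (auto intro: holo_Cn_subset[OF eH(2)] holo_Cn_subset[OF eH(4)] holo_Cn_subset[OF holWS]
         holo_Cn_subset[OF holG] holo_Cn_subset[OF h] simp: A_def)
    \<comment> \<open>Cancelling \<open>h\<close> from \<open>H * g = h * K\<close> and
      \<open>W * g = h * G\<close> leaves a relation in which \<open>G\<close> can be tested for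
      common zeros with \<open>W\<close>.\<close>
    have HG: "H x * G x = W x * K x" if x: "x \<in> A" for x
    proof -
      have "eventually (\<lambda>y. H y * G y = W y * K y) (nhds x)"
      proof (rule germ_cancel[of h x])
        show "hol_at h x" using AH(5) x by (rule hol_atI)
        show "\<not> zero_germ h x" using nzh x A by blast
        show "hol_at (\<lambda>y. H y * G y) x" "hol_at (\<lambda>y. W y * K y) x"
          using AH x by (auto intro: hol_at_mult hol_atI)
        show "eventually (\<lambda>y. h y * (H y * G y) = h y * (W y * K y)) (nhds x)"
          unfolding eventually_nhds
        proof (intro exI[of _ A] conjI ballI A x)
          fix y assume y: "y \<in> A"
          have "h y * (H y * G y) = H y * (W y * g y)" using WG[of y] y A(3) by (auto simp: mult_ac)
          also have "\<dots> = W y * (h y * K y)" using A1(3)[of y] y by (simp add: A_def mult_ac)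
          finally show "h y * (H y * G y) = h y * (W y * K y)" by (simp add: mult_ac)
        qed
      qed
      then show ?thesis by (rule eventually_nhds_x_imp_x)
    qed
    define z1 w1 where "z1 = q $ 1" and "w1 = q $ 2"
    have zw: "pt z1 w1 = q" by (simp add: z1_def w1_def)
    have z1: "z1 \<in> D'" "z1 \<in> D" using q D'(4) by (auto simp: S_def z1_def)
    obtain s0 where s0: "s0 > 0" "rect2 (cball z1 s0) (cball w1 s0) \<subseteq> A"
      using rect2_inside_open[OF A(1,2)] by (auto simp: z1_def w1_def)
    have inA: "pt z w \<in> A" if "z \<in> cball z1 s0" "w \<in> cball w1 s0" for z w
      using s0(2) that by (auto simp: subset_iff)
    have inS: "z \<in> D'" "w \<in> ball w0 r" if "z \<in> cball z1 s0" "w \<in> cball w1 s0" for z w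
      using inA[OF that] A(3) by (auto simp: S_def)
    \<comment> \<open>The zeros of \<open>b\<close> are isolated, so near \<open>z1\<close> only the
      slice \<open>z1\<close> itself can contain common zeros of \<open>W\<close> and
      \<open>G\<close>.\<close>
    obtain s1 where s1: "s1 > 0" "\<And>z. z \<in> ball z1 s1 - {z1} \<Longrightarrow> z \<in> D \<and> b z \<noteq> 0"
    proof -
      obtain n g0 where g0: "g0 holomorphic_on D" "g0 z1 \<noteq> 0" "\<And>z. z \<in> D \<Longrightarrow> b z = (z - z1) ^ n * g0 z"
        using holomorphic_order_at[OF b(1) D(1,2) z1(2) b(3,4)] by metis
      have "isCont g0 z1" using g0(1) D(1) z1(2) holomorphic_on_imp_continuous_on continuous_on_eq_continuous_at by blast
      then obtain d where d: "d > 0" "\<And>z. dist z1 z < d \<Longrightarrow> g0 z \<noteq> 0"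
        using continuous_at_avoid[of z1 g0 0] g0(2) by blast
      obtain d' where d': "d' > 0" "ball z1 d' \<subseteq> D" using D(1) z1(2) open_contains_ball by blast
      show ?thesis
        by (rule that[of "min d d'"]) (use d d' g0(3) in \<open>auto simp: subset_iff\<close>)
    qed
    have "(\<lambda>w. W (pt z1 w)) holomorphic_on ball w1 s0"
      by (rule holo_slice2[OF AH(3)]) (use inA s0(1) in auto)
    moreover have "\<not> eventually (\<lambda>w. W (pt z1 w) = 0) (nhds w1)"
    proof
      assume "eventually (\<lambda>w. W (pt z1 w) = 0) (nhds w1)"
      then obtain T where T: "open T" "w1 \<in> T" "\<And>w. w \<in> T \<Longrightarrow> W (pt z1 w) = 0"
        unfolding eventually_nhds by blast
      then obtain s where s: "s > 0" "ball w1 s \<subseteq> T" using open_contains_ball by blast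
      have "ball w1 s \<subseteq> {w. poly (P z1) w = 0}" using s T(3) by (auto simp: PW)
      moreover have "finite {w. poly (P z1) w = 0}" using P0[OF z1(1)] by (rule poly_roots_finite)
      ultimately have "finite (ball w1 s)" by (rule finite_subset)
      then show False using uncountable_ball[OF s(1), of w1] countable_finite by blast
    qed
    ultimately obtain t where t: "0 < t" "t < s0" "\<And>w. w \<in> sphere w1 t \<Longrightarrow> W (pt z1 w) \<noteq> 0"
      using holo_sphere_avoid[of "\<lambda>w. W (pt z1 w)" w1 s0] s0(1) by metis
    have "open (A \<inter> W -` (- {0}))"
      using A(1) holo_Cn_continuous_on[OF AH(3)] by (intro continuous_open_preimage) auto
    then obtain s2 where s2: "s2 > 0"
        "\<And>z w. z \<in> ball z1 s2 \<Longrightarrow> w \<in> sphere w1 t \<Longrightarrow> pt z w \<in> A \<inter> W -` (- {0})"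
      using tube2[of "A \<inter> W -` (- {0})" "sphere w1 t" z1] t inA s0(1) by auto
    define \<sigma> where "\<sigma> = Min {s0, s1, s2}"
    have \<sigma>: "\<sigma> > 0" "\<sigma> \<le> s0" "\<sigma> \<le> s1" "\<sigma> \<le> s2" using s0 s1 s2 by (auto simp: \<sigma>_def)
    define Z where "Z = ball z1 \<sigma>"
    define M where "M = rect2 Z (ball w1 t)"
    have M: "open M" "q \<in> M" unfolding M_def Z_def using \<sigma> t zw by (auto intro!: open_rect2 simp: z1_def w1_def)
    have ZA: "pt z w \<in> A" if "z \<in> Z" "w \<in> cball w1 t" for z w
      using that \<sigma> t by (intro inA) (auto simp: Z_def)
    have Wn: "W (pt z w) \<noteq> 0" if "z \<in> Z" "w \<in> sphere w1 t" for z w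
      using s2(2)[of z w] that \<sigma> by (auto simp: Z_def)
    let ?T = "circlepath w1 t"
    have pimT: "path_image ?T = sphere w1 t" using t by simp
    \<comment> \<open>The candidate for \<open>H / W\<close>, again a Cauchy integral over circles
      free of zeros of \<open>W\<close>. It is holomorphic also across the slice \<open>z1\<close>,
      where \<open>W\<close> and \<open>G\<close> may have common zeros.\<close>
    define U where "U p = contour_integral ?T (\<lambda>s. H (pt (p $ 1) s) / W (pt (p $ 1) s) / (s - p $ 2)) / (2 * pi * \<i>)"
      for p :: "complex^2"
    have contM: "continuous_on (M \<times> sphere w1 t) (\<lambda>x. f (pt (fst x $ 1) (snd x)))" if f: "holo_Cn A f" for f
      by (rule continuous_on_compose2[OF holo_Cn_continuous_on[OF f]])
         (use ZA in \<open>auto simp: M_def intro!: continuous_intros\<close>)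
    have subM: "holo_Cn M (\<lambda>p. f (pt (p $ 1) s))" if f: "holo_Cn A f" and s: "s \<in> sphere w1 t" for f s
    proof (rule holo_Cn_compose[OF f])
      show "holo_Cn M (\<lambda>p. pt (p $ 1) s $ i)" for i :: 2
        using exhaust_2[of i] holo_Cn_nth[OF M(1)] holo_Cn_const[OF M(1)] by auto
    qed (use s ZA in \<open>auto simp: M_def\<close>)
    have "holo_Cn M (\<lambda>p. contour_integral ?T (\<lambda>s. H (pt (p $ 1) s) / W (pt (p $ 1) s) / (s - p $ 2)))"
    proof (rule holo_contour_param[OF M(1) _ _ smooth_circlepath])
      show "continuous_on (M \<times> path_image ?T) (\<lambda>(p, s). H (pt (p $ 1) s) / W (pt (p $ 1) s) / (s - p $ 2))"
        unfolding pimT split_beta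
        by (intro continuous_intros contM AH) (use Wn in \<open>auto simp: M_def\<close>)
      show "holo_Cn M (\<lambda>p. H (pt (p $ 1) s) / W (pt (p $ 1) s) / (s - p $ 2))" if "s \<in> path_image ?T" for s
        using that unfolding pimT
        by (intro holo_Cn_divide holo_Cn_diff holo_Cn_const holo_Cn_nth M(1) subM AH)
           (use Wn in \<open>auto simp: M_def\<close>)
    qed
    then have holU: "holo_Cn M U"
      unfolding U_def by (intro holo_Cn_divide holo_Cn_const M(1)) simp_all
    \<comment> \<open>On these slices \<open>W\<close> and \<open>G\<close> have no common zero, so
      \<open>H * G = W * K\<close> makes \<open>W\<close> divide \<open>H\<close>. The slice
      \<open>z1\<close> is reached afterwards by continuity in \<open>z\<close>.\<close>
    have off: "H (pt z w) = U (pt z w) * W (pt z w)" if z: "z \<in> Z" "z \<noteq> z1" and w: "w \<in> ball w1 t" for z w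
    proof -
      have zc: "z \<in> cball z1 s0" and zD: "z \<in> D'" using z(1) \<sigma> inS(1)[of z w1] s0(1) by (auto simp: Z_def)
      have bz: "b z \<noteq> 0" using s1(2)[of z] z \<sigma> by (auto simp: Z_def)
      have slA: "(\<lambda>w. f (pt z w)) holomorphic_on ball w1 s0" if "holo_Cn A f" for f
        by (rule holo_slice2[OF that]) (use inA[OF zc] in auto)
      obtain P0 e where P0: "P0 \<noteq> 0" "\<And>w. poly P0 w = 0 \<Longrightarrow> w \<in> ball w1 t" "e holomorphic_on ball w1 s0"
        "\<And>w. w \<in> cball w1 t \<Longrightarrow> e w \<noteq> 0" "\<And>w. w \<in> ball w1 s0 \<Longrightarrow> W (pt z w) = poly P0 w * e w"
        using holomorphic_poly_factor[OF slA[OF AH(3)] t(1,2)] Wn[OF z(1)] by metis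
      define Y where "Y = ball w1 s0 \<inter> e -` (- {0})"
      have Y: "open Y" "cball w1 t \<subseteq> Y" "Y \<subseteq> ball w1 s0"
        unfolding Y_def using P0(3,4) t
        by (auto intro!: continuous_open_preimage holomorphic_on_imp_continuous_on)
      have roots: "w \<in> Y \<and> G (pt z w) \<noteq> 0" if "poly P0 w = 0" for w
      proof -
        have wt: "w \<in> ball w1 t" by (rule P0(2)[OF that])
        then have wY: "w \<in> Y" "w \<in> ball w1 s0" using Y by (auto simp: subset_iff)
        have "w \<in> ball w0 r" using inS(2)[of z1 w] s0(1) wY by auto
        then have "G (pt z w) \<noteq> 0" using nocommon[OF zD] bz P0(5)[OF wY(2)] that by auto
        with wY show ?thesis by blast
      qed
      have slY: "(\<lambda>w. f (pt z w)) holomorphic_on Y" if "holo_Cn A f" for f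
        by (rule holomorphic_on_subset[OF slA[OF that] Y(3)])
      have eq1: "H (pt z w) * G (pt z w) = poly P0 w * (e w * K (pt z w))" if "w \<in> Y" for w
        using HG[OF inA[OF zc, of w]] P0(5)[of w] that Y(3) by (auto simp: subset_iff)
      have eq2: "(\<lambda>w. e w * K (pt z w)) holomorphic_on Y"
        by (intro holomorphic_intros slY AH holomorphic_on_subset[OF P0(3) Y(3)])
      obtain U1 where U1: "U1 holomorphic_on Y" "\<And>w. w \<in> Y \<Longrightarrow> H (pt z w) = poly P0 w * U1 w"
        using coprime_divisible[OF Y(1) P0(1) roots slY[OF AH(1)] slY[OF AH(4)] eq2 eq1] by blast
      define U2 where "U2 w = U1 w / e w" for w
      have U2: "U2 holomorphic_on Y"
        unfolding U2_def by (intro holomorphic_intros U1 holomorphic_on_subset[OF P0(3) Y(3)]) (auto simp: Y_def)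
      have HU2: "H (pt z w) = U2 w * W (pt z w)" if "w \<in> Y" for w
        using U1(2)[OF that] P0(5)[of w] that by (auto simp: U2_def Y_def)
      have "contour_integral ?T (\<lambda>s. H (pt z s) / W (pt z s) / (s - w)) = contour_integral ?T (\<lambda>s. U2 s / (s - w))"
      proof (rule contour_integral_cong)
        fix s assume "s \<in> path_image ?T"
        then have s: "s \<in> sphere w1 t" by (simp only: pimT)
        with HU2[of s] Wn[OF z(1) s] Y show "H (pt z s) / W (pt z s) / (s - w) = U2 s / (s - w)"
          by (simp add: subset_iff)
      qed simp
      also have "\<dots> = 2 * of_real pi * \<i> * U2 w"
        using w Y(2) U2
        by (intro contour_integral_unique Cauchy_integral_circlepath_simple)
           (auto simp: dist_norm norm_minus_commute elim: holomorphic_on_subset)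
      finally have "U (pt z w) = U2 w" by (simp add: U_def)
      then show ?thesis using HU2[of w] w Y(2) by (auto simp: subset_iff)
    qed
    have "H x = U x * W x" if x: "x \<in> M" for x
    proof -
      define z w where "z = x $ 1" and "w = x $ 2"
      have z: "z \<in> Z" and w: "w \<in> ball w1 t" using x by (auto simp: M_def z_def w_def)
      have "H (pt z w) = U (pt z w) * W (pt z w)"
      proof (cases "z = z1")
        case False then show ?thesis using off z w by blast
      next
        case True
        have MA: "M \<subseteq> A"
        proof
          fix y assume "y \<in> M"
          then have "pt (y $ 1) (y $ 2) \<in> A" by (intro ZA) (auto simp: M_def)
          then show "y \<in> A" by simp
        qed
        have hZ: "(\<lambda>z. f (pt z w)) holomorphic_on Z" if "holo_Cn M f" for f
          by (rule holo_slice1[OF that]) (use w in \<open>auto simp: M_def Z_def\<close>)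
        have "(\<lambda>z. H (pt z w)) holomorphic_on Z" "(\<lambda>z. U (pt z w) * W (pt z w)) holomorphic_on Z"
          by (intro holomorphic_intros hZ holU holo_Cn_subset[OF AH(1) M(1) MA] holo_Cn_subset[OF AH(3) M(1) MA])+
        moreover have "isCont f z" if "f holomorphic_on Z" for f
          using holomorphic_on_imp_continuous_on[OF that] continuous_on_eq_continuous_at[of Z f] z
          by (simp add: Z_def)
        ultimately have "isCont (\<lambda>z. H (pt z w)) z" "isCont (\<lambda>z. U (pt z w) * W (pt z w)) z" by auto
        moreover have "eventually (\<lambda>z. H (pt z w) = U (pt z w) * W (pt z w)) (at z)"
          unfolding eventually_at_topological using off w z True
          by (intro exI[of _ Z]) (auto simp: Z_def)
        ultimately show ?thesis by (rule continuous_eq_off_point)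
      qed
      then show ?thesis by (simp add: z_def w_def)
    qed
    then have "eventually (\<lambda>x. H x = U x * W x) (nhds q)"
      unfolding eventually_nhds using M by blast
    moreover have "hol_at U q" using holU M(2) by (rule hol_atI)
    ultimately show ?thesis by blast
  qed
  have "denominator_generator g h q W" if q: "q \<in> S" for q
    unfolding denominator_generator_def
  proof (intro conjI allI impI)
    show "hol_at W q" using holWS q by (rule hol_atI)
    show "\<not> zero_germ W q" using nzW[OF q] .
    show "\<exists>G. hol_at G q \<and> eventually (\<lambda>x. W x * g x = h x * G x) (nhds q)"
      using holG q WG S(1) unfolding eventually_nhds by (blast intro: hol_atI)
  qed (use gen[OF q] in blast)
  with S(1,3) holWS that show ?thesis by blast
qed

section \<open>The second Cousin problem on boxes\<close>

text \<open>\<open>u q\<close> represents the germ attached to \<open>q\<close>; the glued function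
  evaluates at \<open>x\<close> the germ attached to \<open>x\<close>, and near \<open>q\<close> it
  coincides with \<open>u q\<close>.\<close>

lemma glue_holo:
  assumes "open N" "\<And>q. q \<in> N \<Longrightarrow> hol_at (u q) q"
    and "\<And>q. q \<in> N \<Longrightarrow> eventually (\<lambda>x. x \<in> N \<longrightarrow> u x x = u q x) (nhds q)"
  shows "holo_Cn N (\<lambda>x. u x x)"
proof (rule holo_Cn_local)
  fix q assume q: "q \<in> N"
  obtain A where A: "q \<in> A" "holo_Cn A (u q)" using assms(2)[OF q] by (auto simp: hol_at_def)
  obtain B where B: "open B" "q \<in> B" "\<And>x. x \<in> B \<Longrightarrow> x \<in> N \<Longrightarrow> u x x = u q x"
    using assms(3)[OF q] unfolding eventually_nhds by blast
  have "holo_Cn (N \<inter> A \<inter> B) (u q)"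
    using assms(1) B(1) holo_Cn_open[OF A(2)] by (intro holo_Cn_subset[OF A(2)]) auto
  then have "holo_Cn (N \<inter> A \<inter> B) (\<lambda>x. u x x)"
    by (rule holo_Cn_cong) (use B(3) in simp)
  then show "\<exists>M. q \<in> M \<and> M \<subseteq> N \<and> holo_Cn M (\<lambda>x. u x x)"
    using q A(1) B(2) by (intro exI[of _ "N \<inter> A \<inter> B"]) auto
qed

text \<open>Contractibility supplies a continuous logarithm. Near each point \<open>p\<close> it
  equals \<open>\<phi> p\<close> plus the principal logarithm of \<open>U / U p\<close> and is thus
  holomorphic.\<close>

lemma holo_log:
  assumes M: "convex M" and U: "holo_Cn M U" "\<And>q. q \<in> M \<Longrightarrow> U q \<noteq> 0"
  obtains \<phi> where "holo_Cn M \<phi>" "\<And>q. q \<in> M \<Longrightarrow> U q = exp (\<phi> q)"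
proof -
  obtain \<phi> where \<phi>: "continuous_on M \<phi>" "\<And>q. q \<in> M \<Longrightarrow> U q = exp (\<phi> q)"
    using continuous_logarithm_on_contractible[OF holo_Cn_continuous_on[OF U(1)] convex_imp_contractible[OF M] U(2)]
    by metis
  have "holo_Cn M \<phi>"
  proof (rule holo_Cn_local)
    fix p assume p: "p \<in> M"
    \<comment> \<open>The first condition bounds the imaginary part of
      \<open>\<phi> q - \<phi> p\<close> by 1, below \<open>pi\<close>, so that \<open>Ln\<close>
      recovers it; the second keeps \<open>U q / U p\<close> off the branch cut.\<close>
    define A where "A = M \<inter> (\<lambda>q. \<phi> q - \<phi> p) -` ball 0 1 \<inter> (\<lambda>q. U q / U p) -` ball 1 1"
    have M': "open M" by (rule holo_Cn_open[OF U(1)])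
    have "open (M \<inter> (\<lambda>q. \<phi> q - \<phi> p) -` ball 0 1)" "open (M \<inter> (\<lambda>q. U q / U p) -` ball 1 1)"
      using M' p U(2) by (auto intro!: continuous_open_preimage continuous_intros \<phi>(1) holo_Cn_continuous_on[OF U(1)])
    then have "open ((M \<inter> (\<lambda>q. \<phi> q - \<phi> p) -` ball 0 1) \<inter> (M \<inter> (\<lambda>q. U q / U p) -` ball 1 1))"
      by (rule open_Int)
    then have A: "open A" unfolding A_def by (simp add: Int_ac)
    have pA: "p \<in> A" using p U(2) by (simp add: A_def)
    have "holo_Cn A (\<lambda>q. \<phi> p + Ln (U q / U p))"
    proof (intro holo_Cn_add holo_Cn_const A holo_Cn_outer[of A "\<lambda>q. U q / U p" Ln "ball 1 1"] holo_Cn_divide)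
      show "holo_Cn A U" by (rule holo_Cn_subset[OF U(1) A]) (auto simp: A_def)
      show "Ln holomorphic_on ball 1 1"
      proof -
        have "z \<notin> \<real>\<^sub>\<le>\<^sub>0" if "z \<in> ball 1 1" for z :: complex
        proof -
          have "cmod (1 - z) < 1" using that by (simp add: dist_norm)
          then have "Re z > 0" using abs_Re_le_cmod[of "1 - z"] by simp
          then show ?thesis by (auto simp: complex_nonpos_Reals_iff)
        qed
        then show ?thesis by (intro holomorphic_intros) auto
      qed
    qed (use p U(2) in \<open>auto simp: A_def\<close>)
    then have "holo_Cn A \<phi>"
    proof (rule holo_Cn_cong)
      fix q assume q: "q \<in> A"
      have "cmod (\<phi> q - \<phi> p) < 1" using q by (simp add: A_def)
      then have "\<bar>Im (\<phi> q - \<phi> p)\<bar> < pi" using abs_Im_le_cmod[of "\<phi> q - \<phi> p"] pi_gt3 by linarith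
      then have "Ln (exp (\<phi> q - \<phi> p)) = \<phi> q - \<phi> p" by (intro Ln_exp) auto
      moreover have "U q / U p = exp (\<phi> q - \<phi> p)" using q p \<phi>(2) by (simp add: A_def exp_diff)
      ultimately show "\<phi> p + Ln (U q / U p) = \<phi> q" by simp
    qed
    then show "\<exists>N. p \<in> N \<and> N \<subseteq> M \<and> holo_Cn N \<phi>" using pA by (intro exI[of _ A]) (auto simp: A_def)
  qed
  with \<phi>(2) that show ?thesis by blast
qed

text \<open>Cauchy's integral over the boundary of the rectangle, taken edge by edge: each summand
  is holomorphic off its own edge. Sorting the edges by the side on which they lie solves the
  additive Cousin problem for neighbouring rectangles.\<close>

lemma cauchy_split:
  assumes V: "open V" "cbox a c \<subseteq> V" and B: "open B" and ac: "Re a < Re c" "Im a < Im c"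
    and \<phi>: "holo_Cn (rect2 V B) \<phi>"
  obtains E1 E2 E3 E4 where
    "holo_Cn (rect2 (- closed_segment a (Complex (Re c) (Im a))) B) E1"
    "holo_Cn (rect2 (- closed_segment (Complex (Re c) (Im a)) c) B) E2"
    "holo_Cn (rect2 (- closed_segment c (Complex (Re a) (Im c))) B) E3"
    "holo_Cn (rect2 (- closed_segment (Complex (Re a) (Im c)) a) B) E4"
    "\<And>p. p \<in> rect2 (box a c) B \<Longrightarrow> \<phi> p = E1 p + E2 p + E3 p + E4 p"
proof -
  define e f where "e = Complex (Re c) (Im a)" and "f = Complex (Re a) (Im c)"
  define E where "E x y p = contour_integral (linepath x y) (\<lambda>s. \<phi> (pt s (p $ 2)) / (s - p $ 1)) / (2 * pi * \<i>)"
    for x y and p :: "complex^2"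
  have mem: "a \<in> cbox a c" "c \<in> cbox a c" "e \<in> cbox a c" "f \<in> cbox a c"
    using ac by (auto simp: in_cbox_complex_iff e_def f_def)
  have seg: "closed_segment x y \<subseteq> cbox a c" if "x \<in> cbox a c" "y \<in> cbox a c" for x y
    using that convex_box(1) by (rule closed_segment_subset)
  have holE: "holo_Cn (rect2 (- closed_segment x y) B) (E x y)" if xy: "x \<in> cbox a c" "y \<in> cbox a c" for x y
  proof -
    have op: "open (rect2 (- closed_segment x y) B)" using B by (intro open_rect2) auto
    have "holo_Cn (rect2 (- closed_segment x y) B) (\<lambda>p. contour_integral (linepath x y) (\<lambda>s. \<phi> (pt s (p $ 2)) / (s - p $ 1)))"
    proof (rule holo_contour_param[OF op _ _ smooth_linepath])
      have "continuous_on (rect2 (- closed_segment x y) B \<times> closed_segment x y) (\<lambda>x. \<phi> (pt (snd x) (fst x $ 2)))"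
        by (rule continuous_on_compose2[OF holo_Cn_continuous_on[OF \<phi>]])
           (use seg[OF xy] V(2) in \<open>auto intro!: continuous_intros\<close>)
      then show "continuous_on (rect2 (- closed_segment x y) B \<times> path_image (linepath x y))
          (\<lambda>(p, s). \<phi> (pt s (p $ 2)) / (s - p $ 1))"
        unfolding split_beta path_image_linepath by (intro continuous_intros) auto
      fix s assume "s \<in> path_image (linepath x y)"
      then have s: "s \<in> closed_segment x y" "s \<in> V" using seg[OF xy] V(2) by auto
      have "holo_Cn (rect2 (- closed_segment x y) B) (\<lambda>p. \<phi> (pt s (p $ 2)))"
      proof (rule holo_Cn_compose[OF \<phi>])
        show "holo_Cn (rect2 (- closed_segment x y) B) (\<lambda>p. pt s (p $ 2) $ i)" for i :: 2
          using exhaust_2[of i] holo_Cn_nth[OF op] holo_Cn_const[OF op] by auto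
      qed (use s in auto)
      then show "holo_Cn (rect2 (- closed_segment x y) B) (\<lambda>p. \<phi> (pt s (p $ 2)) / (s - p $ 1))"
        by (intro holo_Cn_divide holo_Cn_diff holo_Cn_const holo_Cn_nth op) (use s in auto)
    qed
    then show ?thesis unfolding E_def by (intro holo_Cn_divide holo_Cn_const op) simp_all
  qed
  have sum: "\<phi> p = E a e p + E e c p + E c f p + E f a p" if p: "p \<in> rect2 (box a c) B" for p
  proof -
    define F where "F s = \<phi> (pt s (p $ 2)) / (s - p $ 1)" for s
    have hO: "(\<lambda>s. \<phi> (pt s (p $ 2))) holomorphic_on V"
      by (rule holo_slice1[OF \<phi> V(1)]) (use p in auto)
    have pim: "path_image (rectpath a c) = cbox a c - box a c"
      using ac by (intro path_image_rectpath_cbox_minus_box) auto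
    have "((\<lambda>s. \<phi> (pt s (p $ 2)) / (s - p $ 1)) has_contour_integral
        2 * pi * \<i> * winding_number (rectpath a c) (p $ 1) * \<phi> (pt (p $ 1) (p $ 2))) (rectpath a c)"
    proof (rule Cauchy_integral_formula_convex_simple[OF convex_box(1)])
      show "(\<lambda>s. \<phi> (pt s (p $ 2))) holomorphic_on cbox a c" using hO V(2) by (rule holomorphic_on_subset)
      show "p $ 1 \<in> interior (cbox a c)" using p by (simp add: interior_cbox)
      show "path_image (rectpath a c) \<subseteq> cbox a c - {p $ 1}" using p by (auto simp: pim)
    qed auto
    moreover have "winding_number (rectpath a c) (p $ 1) = 1"
      using p by (intro winding_number_rectpath) auto
    ultimately have C: "contour_integral (rectpath a c) F = 2 * pi * \<i> * \<phi> p"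
      unfolding F_def by (simp add: contour_integral_unique)
    have int: "F contour_integrable_on linepath x y" if "(x, y) \<in> {(a, e), (e, c), (c, f), (f, a)}" for x y
    proof (rule contour_integrable_smooth[OF _ smooth_linepath])
      have *: "path_image (linepath x y) \<subseteq> path_image (rectpath a c)"
        using that by (auto simp: rectpath_def Let_def e_def f_def path_image_join)
      show "continuous_on (path_image (linepath x y)) F"
        unfolding F_def
        using * p V(2) by (intro continuous_intros continuous_on_subset[OF holomorphic_on_imp_continuous_on[OF hO]])
          (auto simp: pim)
    qed
    have "contour_integral (rectpath a c) F = contour_integral (linepath a e) F + contour_integral (linepath e c) F
       + contour_integral (linepath c f) F + contour_integral (linepath f a) F"
      unfolding rectpath_def Let_def e_def[symmetric] f_def[symmetric]
      using int by (simp add: contour_integral_join contour_integrable_joinI add.assoc)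
    with C have "2 * pi * \<i> * \<phi> p = contour_integral (linepath a e) F + contour_integral (linepath e c) F
       + contour_integral (linepath c f) F + contour_integral (linepath f a) F" by simp
    then show ?thesis
      unfolding E_def F_def[symmetric] by (simp add: add_divide_distrib[symmetric] field_simps)
  qed
  show ?thesis
    by (rule that[of "E a e" "E e c" "E c f" "E f a"])
       (use holE mem sum in \<open>simp_all add: e_def[symmetric] f_def[symmetric]\<close>)
qed

section \<open>Additive splitting for rectangles with a common edge\<close>

definition bx :: "real \<Rightarrow> real \<Rightarrow> real \<Rightarrow> real \<Rightarrow> complex set" where
  "bx x0 x1 y0 y1 = {z. x0 \<le> Re z \<and> Re z \<le> x1 \<and> y0 \<le> Im z \<and> Im z \<le> y1}"

definition obx :: "real \<Rightarrow> real \<Rightarrow> real \<Rightarrow> real \<Rightarrow> real \<Rightarrow> complex set" where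
  "obx e x0 x1 y0 y1 = {z. x0 - e < Re z \<and> Re z < x1 + e \<and> y0 - e < Im z \<and> Im z < y1 + e}"

lemma bx_cbox: "bx x0 x1 y0 y1 = cbox (Complex x0 y0) (Complex x1 y1)"
  by (auto simp: bx_def in_cbox_complex_iff)

lemma obx_box: "obx e x0 x1 y0 y1 = box (Complex (x0 - e) (y0 - e)) (Complex (x1 + e) (y1 + e))"
  by (auto simp: obx_def in_box_complex_iff)

lemma compact_bx: "compact (bx x0 x1 y0 y1)" and convex_bx: "convex (bx x0 x1 y0 y1)"
  by (auto simp: bx_cbox)

lemma open_obx: "open (obx e x0 x1 y0 y1)" and convex_obx: "convex (obx e x0 x1 y0 y1)"
  by (auto simp: obx_box)

lemma obx_inside:
  assumes "open S" "bx x0 x1 y0 y1 \<subseteq> S" "x0 \<le> x1" "y0 \<le> y1"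
  obtains e where "e > 0" "obx e x0 x1 y0 y1 \<subseteq> S"
proof -
  obtain e where e: "e > 0" "(\<Union>x\<in>bx x0 x1 y0 y1. ball x e) \<subseteq> S"
    using compact_subset_open_imp_ball_epsilon_subset[OF compact_bx assms(1,2)] by metis
  have "obx (e/2) x0 x1 y0 y1 \<subseteq> S"
  proof
    fix z assume z: "z \<in> obx (e/2) x0 x1 y0 y1"
    \<comment> \<open>The nearest point of the closed rectangle, obtained by clamping both
      coordinates.\<close>
    define w where "w = Complex (max x0 (min (Re z) x1)) (max y0 (min (Im z) y1))"
    have "w \<in> bx x0 x1 y0 y1" using assms(3,4) by (auto simp: w_def bx_def)
    moreover have "cmod (w - z) \<le> \<bar>Re (w - z)\<bar> + \<bar>Im (w - z)\<bar>" by (rule cmod_le)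
    moreover have "\<bar>Re (w - z)\<bar> < e/2" "\<bar>Im (w - z)\<bar> < e/2"
      using z assms(3,4) e(1) by (auto simp: w_def obx_def max_def min_def)
    ultimately have "z \<in> (\<Union>x\<in>bx x0 x1 y0 y1. ball x e)" by (intro UN_I[of w]) (auto simp: dist_norm)
    with e show "z \<in> S" by blast
  qed
  with e that[of "e/2"] show ?thesis by simp
qed

text \<open>The additive Cousin problem for two plane sets, with the second variable as a parameter
  in an arbitrary open \<open>B\<close>. \<open>V\<close> may exceed \<open>O1 \<inter> O2\<close>
  because the contours run in it, and it is convex so that a unit on the product of \<open>V\<close>
  with a convex set has a logarithm.\<close>

definition splittable :: "complex set \<Rightarrow> complex set \<Rightarrow> bool" where
  "splittable A1 A2 \<longleftrightarrow> (\<forall>S1 S2. open S1 \<longrightarrow> open S2 \<longrightarrow> A1 \<subseteq> S1 \<longrightarrow> A2 \<subseteq> S2 \<longrightarrow>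
     (\<exists>O1 O2 V. open O1 \<and> open O2 \<and> open V \<and> convex V \<and> A1 \<subseteq> O1 \<and> A2 \<subseteq> O2 \<and>
        O1 \<subseteq> S1 \<and> O2 \<subseteq> S2 \<and> V \<subseteq> S1 \<inter> S2 \<and> O1 \<inter> O2 \<subseteq> V \<and>
        (\<forall>B \<phi>. open B \<longrightarrow> holo_Cn (rect2 V B) \<phi> \<longrightarrow>
           (\<exists>\<phi>1 \<phi>2. holo_Cn (rect2 O1 B) \<phi>1 \<and> holo_Cn (rect2 O2 B) \<phi>2 \<and>
              (\<forall>p\<in>rect2 (O1 \<inter> O2) B. \<phi> p = \<phi>1 p + \<phi>2 p)))))"

lemma splittableE:
  assumes "splittable A1 A2" "open S1" "open S2" "A1 \<subseteq> S1" "A2 \<subseteq> S2"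
  obtains O1 O2 V where "open O1" "open O2" "open V" "convex V" "A1 \<subseteq> O1" "A2 \<subseteq> O2"
    "O1 \<subseteq> S1" "O2 \<subseteq> S2" "V \<subseteq> S1 \<inter> S2" "O1 \<inter> O2 \<subseteq> V"
    "\<forall>B \<phi>. open B \<longrightarrow> holo_Cn (rect2 V B) \<phi> \<longrightarrow>
       (\<exists>\<phi>1 \<phi>2. holo_Cn (rect2 O1 B) \<phi>1 \<and> holo_Cn (rect2 O2 B) \<phi>2 \<and>
          (\<forall>p\<in>rect2 (O1 \<inter> O2) B. \<phi> p = \<phi>1 p + \<phi>2 p))"
  using assms(1)[unfolded splittable_def, THEN spec, THEN spec, THEN mp, THEN mp, THEN mp, THEN mp,
      OF assms(2-5)]
  by (elim exE conjE) (rule that)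

text \<open>A rectangle of margin \<open>\<delta>\<close> around the common edge is split by its
  sides: the right side lies outside the left neighbourhood, the other three lie outside the right
  one. Taking \<open>\<delta>\<close> as half of \<open>\<epsilon>\<close> fits the closed rectangle
  into \<open>V\<close>.\<close>

lemma splittable_vertical:
  assumes xm: "x0 \<le> m" "m \<le> x1" and y: "y0 \<le> y1"
  shows "splittable (bx x0 m y0 y1) (bx m x1 y0 y1)"
  unfolding splittable_def
proof (intro allI impI)
  fix S1 S2 assume S: "open S1" "open S2" "bx x0 m y0 y1 \<subseteq> S1" "bx m x1 y0 y1 \<subseteq> S2"
  obtain e1 where e1: "e1 > 0" "obx e1 x0 m y0 y1 \<subseteq> S1" using obx_inside[OF S(1,3) xm(1) y] by blast
  obtain e2 where e2: "e2 > 0" "obx e2 m x1 y0 y1 \<subseteq> S2" using obx_inside[OF S(2,4) xm(2) y] by blast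
  define \<epsilon> \<delta> where "\<epsilon> = min e1 e2" and "\<delta> = \<epsilon> / 2"
  have \<epsilon>: "\<epsilon> > 0" "\<epsilon> \<le> e1" "\<epsilon> \<le> e2" "\<delta> > 0" "\<delta> < \<epsilon>" using e1 e2 by (auto simp: \<epsilon>_def \<delta>_def)
  define a c where "a = Complex (m - \<delta>) (y0 - \<delta>)" and "c = Complex (m + \<delta>) (y1 + \<delta>)"
  show "\<exists>O1 O2 V. open O1 \<and> open O2 \<and> open V \<and> convex V \<and> bx x0 m y0 y1 \<subseteq> O1 \<and> bx m x1 y0 y1 \<subseteq> O2 \<and>
        O1 \<subseteq> S1 \<and> O2 \<subseteq> S2 \<and> V \<subseteq> S1 \<inter> S2 \<and> O1 \<inter> O2 \<subseteq> V \<and>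
        (\<forall>B \<phi>. open B \<longrightarrow> holo_Cn (rect2 V B) \<phi> \<longrightarrow>
           (\<exists>\<phi>1 \<phi>2. holo_Cn (rect2 O1 B) \<phi>1 \<and> holo_Cn (rect2 O2 B) \<phi>2 \<and>
              (\<forall>p\<in>rect2 (O1 \<inter> O2) B. \<phi> p = \<phi>1 p + \<phi>2 p)))"
  proof (rule exI[of _ "obx \<delta> x0 m y0 y1"], rule exI[of _ "obx \<delta> m x1 y0 y1"], rule exI[of _ "obx \<epsilon> m m y0 y1"],
      intro conjI open_obx convex_obx)
    show "bx x0 m y0 y1 \<subseteq> obx \<delta> x0 m y0 y1" "bx m x1 y0 y1 \<subseteq> obx \<delta> m x1 y0 y1"
      using \<epsilon> by (auto simp: bx_def obx_def)
    show "obx \<delta> x0 m y0 y1 \<subseteq> S1" by (rule order_trans[OF _ e1(2)]) (use \<epsilon> in \<open>auto simp: obx_def\<close>)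
    show "obx \<delta> m x1 y0 y1 \<subseteq> S2" by (rule order_trans[OF _ e2(2)]) (use \<epsilon> in \<open>auto simp: obx_def\<close>)
    have "obx \<epsilon> m m y0 y1 \<subseteq> obx e1 x0 m y0 y1" "obx \<epsilon> m m y0 y1 \<subseteq> obx e2 m x1 y0 y1"
      using \<epsilon> xm by (auto simp: obx_def)
    with e1(2) e2(2) show "obx \<epsilon> m m y0 y1 \<subseteq> S1 \<inter> S2" by blast
    show "obx \<delta> x0 m y0 y1 \<inter> obx \<delta> m x1 y0 y1 \<subseteq> obx \<epsilon> m m y0 y1" using \<epsilon> by (auto simp: obx_def)
    show "\<forall>B \<phi>. open B \<longrightarrow> holo_Cn (rect2 (obx \<epsilon> m m y0 y1) B) \<phi> \<longrightarrow>
      (\<exists>\<phi>1 \<phi>2. holo_Cn (rect2 (obx \<delta> x0 m y0 y1) B) \<phi>1 \<and> holo_Cn (rect2 (obx \<delta> m x1 y0 y1) B) \<phi>2 \<and>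
         (\<forall>p\<in>rect2 (obx \<delta> x0 m y0 y1 \<inter> obx \<delta> m x1 y0 y1) B. \<phi> p = \<phi>1 p + \<phi>2 p))"
    proof (intro allI impI)
    fix B \<phi> assume B: "open B" and \<phi>: "holo_Cn (rect2 (obx \<epsilon> m m y0 y1) B) \<phi>"
    have "cbox a c \<subseteq> obx \<epsilon> m m y0 y1" using \<epsilon> by (auto simp: in_cbox_complex_iff obx_def a_def c_def)
    moreover have "Re a < Re c" "Im a < Im c" using \<epsilon> y by (auto simp: a_def c_def)
    ultimately obtain E1 E2 E3 E4 where E:
      "holo_Cn (rect2 (- closed_segment a (Complex (Re c) (Im a))) B) E1"
      "holo_Cn (rect2 (- closed_segment (Complex (Re c) (Im a)) c) B) E2"
      "holo_Cn (rect2 (- closed_segment c (Complex (Re a) (Im c))) B) E3"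
      "holo_Cn (rect2 (- closed_segment (Complex (Re a) (Im c)) a) B) E4"
      "\<And>p. p \<in> rect2 (box a c) B \<Longrightarrow> \<phi> p = E1 p + E2 p + E3 p + E4 p"
      using cauchy_split[OF open_obx _ B _ _ \<phi>] by metis
    show "\<exists>\<phi>1 \<phi>2. holo_Cn (rect2 (obx \<delta> x0 m y0 y1) B) \<phi>1 \<and> holo_Cn (rect2 (obx \<delta> m x1 y0 y1) B) \<phi>2 \<and>
         (\<forall>p\<in>rect2 (obx \<delta> x0 m y0 y1 \<inter> obx \<delta> m x1 y0 y1) B. \<phi> p = \<phi>1 p + \<phi>2 p)"
    proof (intro exI conjI ballI)
      show "holo_Cn (rect2 (obx \<delta> x0 m y0 y1) B) E2"
        by (rule holo_Cn_subset[OF E(2) open_rect2[OF open_obx B] rect2_mono])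
           (use \<epsilon> y in \<open>auto simp: obx_def a_def c_def closed_segment_same_Re\<close>)
      show "holo_Cn (rect2 (obx \<delta> m x1 y0 y1) B) (\<lambda>p. E1 p + E3 p + E4 p)"
        by (intro holo_Cn_add holo_Cn_subset[OF E(1) open_rect2[OF open_obx B] rect2_mono]
            holo_Cn_subset[OF E(3) open_rect2[OF open_obx B] rect2_mono]
            holo_Cn_subset[OF E(4) open_rect2[OF open_obx B] rect2_mono])
           (use \<epsilon> y in \<open>auto simp: obx_def a_def c_def closed_segment_same_Re closed_segment_same_Im\<close>)
      fix p assume "p \<in> rect2 (obx \<delta> x0 m y0 y1 \<inter> obx \<delta> m x1 y0 y1) B"
      then have "p \<in> rect2 (box a c) B" by (auto simp: obx_def in_box_complex_iff a_def c_def)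
      from E(5)[OF this] show "\<phi> p = E2 p + (E1 p + E3 p + E4 p)" by simp
    qed
    qed
  qed
qed

text \<open>As for a vertical edge; here the upper side of the small rectangle serves the lower
  neighbourhood, and the other three serve the upper one.\<close>

lemma splittable_horizontal:
  assumes ym: "y0 \<le> m" "m \<le> y1" and x: "x0 \<le> x1"
  shows "splittable (bx x0 x1 y0 m) (bx x0 x1 m y1)"
  unfolding splittable_def
proof (intro allI impI)
  fix S1 S2 assume S: "open S1" "open S2" "bx x0 x1 y0 m \<subseteq> S1" "bx x0 x1 m y1 \<subseteq> S2"
  obtain e1 where e1: "e1 > 0" "obx e1 x0 x1 y0 m \<subseteq> S1" using obx_inside[OF S(1,3) x ym(1)] by blast
  obtain e2 where e2: "e2 > 0" "obx e2 x0 x1 m y1 \<subseteq> S2" using obx_inside[OF S(2,4) x ym(2)] by blast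
  define \<epsilon> \<delta> where "\<epsilon> = min e1 e2" and "\<delta> = \<epsilon> / 2"
  have \<epsilon>: "\<epsilon> > 0" "\<epsilon> \<le> e1" "\<epsilon> \<le> e2" "\<delta> > 0" "\<delta> < \<epsilon>" using e1 e2 by (auto simp: \<epsilon>_def \<delta>_def)
  define a c where "a = Complex (x0 - \<delta>) (m - \<delta>)" and "c = Complex (x1 + \<delta>) (m + \<delta>)"
  show "\<exists>O1 O2 V. open O1 \<and> open O2 \<and> open V \<and> convex V \<and> bx x0 x1 y0 m \<subseteq> O1 \<and> bx x0 x1 m y1 \<subseteq> O2 \<and>
        O1 \<subseteq> S1 \<and> O2 \<subseteq> S2 \<and> V \<subseteq> S1 \<inter> S2 \<and> O1 \<inter> O2 \<subseteq> V \<and>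
        (\<forall>B \<phi>. open B \<longrightarrow> holo_Cn (rect2 V B) \<phi> \<longrightarrow>
           (\<exists>\<phi>1 \<phi>2. holo_Cn (rect2 O1 B) \<phi>1 \<and> holo_Cn (rect2 O2 B) \<phi>2 \<and>
              (\<forall>p\<in>rect2 (O1 \<inter> O2) B. \<phi> p = \<phi>1 p + \<phi>2 p)))"
  proof (rule exI[of _ "obx \<delta> x0 x1 y0 m"], rule exI[of _ "obx \<delta> x0 x1 m y1"], rule exI[of _ "obx \<epsilon> x0 x1 m m"],
      intro conjI open_obx convex_obx)
    show "bx x0 x1 y0 m \<subseteq> obx \<delta> x0 x1 y0 m" "bx x0 x1 m y1 \<subseteq> obx \<delta> x0 x1 m y1"
      using \<epsilon> by (auto simp: bx_def obx_def)
    show "obx \<delta> x0 x1 y0 m \<subseteq> S1" by (rule order_trans[OF _ e1(2)]) (use \<epsilon> in \<open>auto simp: obx_def\<close>)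
    show "obx \<delta> x0 x1 m y1 \<subseteq> S2" by (rule order_trans[OF _ e2(2)]) (use \<epsilon> in \<open>auto simp: obx_def\<close>)
    have "obx \<epsilon> x0 x1 m m \<subseteq> obx e1 x0 x1 y0 m" "obx \<epsilon> x0 x1 m m \<subseteq> obx e2 x0 x1 m y1"
      using \<epsilon> ym by (auto simp: obx_def)
    with e1(2) e2(2) show "obx \<epsilon> x0 x1 m m \<subseteq> S1 \<inter> S2" by blast
    show "obx \<delta> x0 x1 y0 m \<inter> obx \<delta> x0 x1 m y1 \<subseteq> obx \<epsilon> x0 x1 m m" using \<epsilon> by (auto simp: obx_def)
    show "\<forall>B \<phi>. open B \<longrightarrow> holo_Cn (rect2 (obx \<epsilon> x0 x1 m m) B) \<phi> \<longrightarrow>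
      (\<exists>\<phi>1 \<phi>2. holo_Cn (rect2 (obx \<delta> x0 x1 y0 m) B) \<phi>1 \<and> holo_Cn (rect2 (obx \<delta> x0 x1 m y1) B) \<phi>2 \<and>
         (\<forall>p\<in>rect2 (obx \<delta> x0 x1 y0 m \<inter> obx \<delta> x0 x1 m y1) B. \<phi> p = \<phi>1 p + \<phi>2 p))"
    proof (intro allI impI)
    fix B \<phi> assume B: "open B" and \<phi>: "holo_Cn (rect2 (obx \<epsilon> x0 x1 m m) B) \<phi>"
    have "cbox a c \<subseteq> obx \<epsilon> x0 x1 m m" using \<epsilon> by (auto simp: in_cbox_complex_iff obx_def a_def c_def)
    moreover have "Re a < Re c" "Im a < Im c" using \<epsilon> x by (auto simp: a_def c_def)
    ultimately obtain E1 E2 E3 E4 where E: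
      "holo_Cn (rect2 (- closed_segment a (Complex (Re c) (Im a))) B) E1"
      "holo_Cn (rect2 (- closed_segment (Complex (Re c) (Im a)) c) B) E2"
      "holo_Cn (rect2 (- closed_segment c (Complex (Re a) (Im c))) B) E3"
      "holo_Cn (rect2 (- closed_segment (Complex (Re a) (Im c)) a) B) E4"
      "\<And>p. p \<in> rect2 (box a c) B \<Longrightarrow> \<phi> p = E1 p + E2 p + E3 p + E4 p"
      using cauchy_split[OF open_obx _ B _ _ \<phi>] by metis
    show "\<exists>\<phi>1 \<phi>2. holo_Cn (rect2 (obx \<delta> x0 x1 y0 m) B) \<phi>1 \<and> holo_Cn (rect2 (obx \<delta> x0 x1 m y1) B) \<phi>2 \<and>
         (\<forall>p\<in>rect2 (obx \<delta> x0 x1 y0 m \<inter> obx \<delta> x0 x1 m y1) B. \<phi> p = \<phi>1 p + \<phi>2 p)"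
    proof (intro exI conjI ballI)
      show "holo_Cn (rect2 (obx \<delta> x0 x1 y0 m) B) E3"
        by (rule holo_Cn_subset[OF E(3) open_rect2[OF open_obx B] rect2_mono])
           (use \<epsilon> x in \<open>auto simp: obx_def a_def c_def closed_segment_same_Im\<close>)
      show "holo_Cn (rect2 (obx \<delta> x0 x1 m y1) B) (\<lambda>p. E1 p + E2 p + E4 p)"
        by (intro holo_Cn_add holo_Cn_subset[OF E(1) open_rect2[OF open_obx B] rect2_mono]
            holo_Cn_subset[OF E(2) open_rect2[OF open_obx B] rect2_mono]
            holo_Cn_subset[OF E(4) open_rect2[OF open_obx B] rect2_mono])
           (use \<epsilon> x in \<open>auto simp: obx_def a_def c_def closed_segment_same_Re closed_segment_same_Im\<close>)
      fix p assume "p \<in> rect2 (obx \<delta> x0 x1 y0 m \<inter> obx \<delta> x0 x1 m y1) B"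
      then have "p \<in> rect2 (box a c) B" by (auto simp: obx_def in_box_complex_iff a_def c_def)
      from E(5)[OF this] show "\<phi> p = E3 p + (E1 p + E2 p + E4 p)" by simp
    qed
    qed
  qed
qed

lemma tube_rect2:
  assumes "open N" "compact A" "compact C" "convex C" "rect2 A C \<subseteq> N"
  obtains e where "e > 0"
    "\<And>d. 0 < d \<Longrightarrow> d \<le> e \<Longrightarrow> rect2 (\<Union>a\<in>A. ball a d) (\<Union>c\<in>C. ball c d) \<subseteq> N"
proof -
  obtain e where e: "e > 0" "(\<Union>x\<in>rect2 A C. ball x e) \<subseteq> N"
    using compact_subset_open_imp_ball_epsilon_subset[OF compact_rect2[OF assms(2,3)] assms(1,5)] by metis
  have "rect2 (\<Union>a\<in>A. ball a d) (\<Union>c\<in>C. ball c d) \<subseteq> N" if d: "0 < d" "d \<le> e/2" for d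
  proof
    fix p assume "p \<in> rect2 (\<Union>a\<in>A. ball a d) (\<Union>c\<in>C. ball c d)"
    then obtain a c where ac: "a \<in> A" "c \<in> C" "dist a (p $ 1) < d" "dist c (p $ 2) < d" by auto
    have "norm (pt a c - p) \<le> cmod (a - p $ 1) + cmod (c - p $ 2)"
      using norm_le_sum2[of "pt a c - p"] by simp
    also have "\<dots> < e" using ac d by (simp add: dist_norm)
    finally have "p \<in> ball (pt a c) e" by (simp add: dist_norm)
    moreover have "pt a c \<in> rect2 A C" using ac by simp
    ultimately show "p \<in> N" using e(2) by blast
  qed
  with e(1) that[of "e/2"] show ?thesis by simp
qed

lemma convex_thicken:
  fixes C :: "complex set"
  assumes "convex C" shows "convex (\<Union>c\<in>C. ball c d)"
proof -
  have "(\<Union>c\<in>C. ball c d) = (\<Union>x\<in>C. \<Union>y\<in>ball 0 d. {x + y})"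
  proof (intro equalityI subsetI)
    fix z assume "z \<in> (\<Union>c\<in>C. ball c d)"
    then obtain c where "c \<in> C" "dist c z < d" by auto
    then show "z \<in> (\<Union>x\<in>C. \<Union>y\<in>ball 0 d. {x + y})"
      by (intro UN_I[of c] UN_I[of "z - c"]) (auto simp: dist_norm norm_minus_commute)
  next
    fix z assume "z \<in> (\<Union>x\<in>C. \<Union>y\<in>ball 0 d. {x + y})"
    then obtain x y where "x \<in> C" "y \<in> ball 0 d" "z = x + y" by blast
    then show "z \<in> (\<Union>c\<in>C. ball c d)" by (intro UN_I[of x]) (auto simp: dist_norm)
  qed
  then show ?thesis using convex_sums[OF assms convex_ball] by simp
qed

text \<open>Data of the second Cousin problem: the germs that \<open>D\<close> admits at a point
  form a single class modulo units. Besides generators of denominators, the abstract form covers the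
  same datum with the variables exchanged.\<close>

locale cousin_data =
  fixes D :: "complex^2 \<Rightarrow> (complex^2 \<Rightarrow> complex) \<Rightarrow> bool"
  assumes D_hol: "D q W \<Longrightarrow> hol_at W q"
    and D_nonzero: "D q W \<Longrightarrow> \<not> zero_germ W q"
    and D_unit: "D q W \<Longrightarrow> D q W' \<Longrightarrow>
        \<exists>U. hol_at U q \<and> U q \<noteq> 0 \<and> eventually (\<lambda>x. W x = U x * W' x) (nhds q)"
    and D_change: "D q W \<Longrightarrow> hol_at U q \<Longrightarrow> U q \<noteq> 0 \<Longrightarrow>
        eventually (\<lambda>x. W' x = U x * W x) (nhds q) \<Longrightarrow> D q W'"
    and D_local: "\<exists>S W. open S \<and> p \<in> S \<and> holo_Cn S W \<and> (\<forall>q\<in>S. D q W)"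
begin

definition solvable :: "(complex^2) set \<Rightarrow> bool" where
  "solvable K \<longleftrightarrow> (\<exists>N W. K \<subseteq> N \<and> holo_Cn N W \<and> (\<forall>q\<in>N. D q W))"

text \<open>The local units are determined by cancelling \<open>W2\<close>, so they agree on
  overlaps and glue.\<close>

lemma unit_function:
  assumes W: "holo_Cn M W1" "holo_Cn M W2" "\<And>q. q \<in> M \<Longrightarrow> D q W1" "\<And>q. q \<in> M \<Longrightarrow> D q W2"
  obtains U where "holo_Cn M U" "\<And>q. q \<in> M \<Longrightarrow> U q \<noteq> 0" "\<And>q. q \<in> M \<Longrightarrow> W1 q = U q * W2 q"
proof -
  have "\<forall>q\<in>M. \<exists>U. hol_at U q \<and> U q \<noteq> 0 \<and> eventually (\<lambda>x. W1 x = U x * W2 x) (nhds q)"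
    using D_unit W(3,4) by blast
  then obtain u where u: "\<And>q. q \<in> M \<Longrightarrow> hol_at (u q) q" "\<And>q. q \<in> M \<Longrightarrow> u q q \<noteq> 0"
    "\<And>q. q \<in> M \<Longrightarrow> eventually (\<lambda>x. W1 x = u q x * W2 x) (nhds q)" by metis
  have "holo_Cn M (\<lambda>x. u x x)"
  proof (rule glue_holo[OF holo_Cn_open[OF W(1)] u(1)])
    fix q assume q: "q \<in> M"
    have "eventually (\<lambda>x. hol_at (u q) x) (nhds q)" by (rule eventually_hol_at[OF u(1)[OF q]])
    moreover have "eventually (\<lambda>x. eventually (\<lambda>y. W1 y = u q y * W2 y) (nhds x)) (nhds q)"
      using u(3)[OF q] by (simp add: eventually_eventually)
    ultimately show "eventually (\<lambda>x. x \<in> M \<longrightarrow> u x x = u q x) (nhds q)"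
    proof eventually_elim
      case (elim x)
      show ?case
      proof
        assume x: "x \<in> M"
        have "eventually (\<lambda>y. W2 y * u x y = W2 y * u q y) (nhds x)"
          using elim(2) u(3)[OF x] by eventually_elim (simp add: mult.commute)
        then have "eventually (\<lambda>y. u x y = u q y) (nhds x)"
          by (rule germ_cancel[OF D_hol D_nonzero u(1)[OF x] elim(1), rotated 2]) (use W(4)[OF x] in auto)
        then show "u x x = u q x" by (rule eventually_nhds_x_imp_x)
      qed
    qed
  qed
  moreover have "W1 q = u q q * W2 q" if "q \<in> M" for q
    using u(3)[OF that] by (rule eventually_nhds_x_imp_x)
  ultimately show ?thesis using that u(2) by blast
qed

lemma solvable_subset: "solvable K \<Longrightarrow> K' \<subseteq> K \<Longrightarrow> solvable K'"
  unfolding solvable_def by blast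

text \<open>On the overlap the two solutions differ by a unit \<open>exp \<phi>\<close>. Splitting
  \<open>\<phi> = \<phi>1 + \<phi>2\<close> makes \<open>W1 * exp (- \<phi>1)\<close> and
  \<open>W2 * exp \<phi>2\<close> agree there.\<close>

lemma solvable_merge:
  assumes spl: "splittable A1 A2" and A: "compact A1" "compact A2" and C: "compact C" "convex C"
    and s1: "solvable (rect2 A1 C)" and s2: "solvable (rect2 A2 C)"
  shows "solvable (rect2 (A1 \<union> A2) C)"
proof -
  obtain N1 W1 where N1: "rect2 A1 C \<subseteq> N1" "holo_Cn N1 W1" "\<forall>q\<in>N1. D q W1"
    using s1 unfolding solvable_def by blast
  obtain N2 W2 where N2: "rect2 A2 C \<subseteq> N2" "holo_Cn N2 W2" "\<forall>q\<in>N2. D q W2"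
    using s2 unfolding solvable_def by blast
  obtain e1 where e1: "e1 > 0"
      "\<And>d. 0 < d \<Longrightarrow> d \<le> e1 \<Longrightarrow> rect2 (\<Union>a\<in>A1. ball a d) (\<Union>c\<in>C. ball c d) \<subseteq> N1"
    using tube_rect2[OF holo_Cn_open[OF N1(2)] A(1) C N1(1)] by metis
  obtain e2 where e2: "e2 > 0"
      "\<And>d. 0 < d \<Longrightarrow> d \<le> e2 \<Longrightarrow> rect2 (\<Union>a\<in>A2. ball a d) (\<Union>c\<in>C. ball c d) \<subseteq> N2"
    using tube_rect2[OF holo_Cn_open[OF N2(2)] A(2) C N2(1)] by metis
  define d where "d = min e1 e2"
  have d: "0 < d" "d \<le> e1" "d \<le> e2" using e1(1) e2(1) by (auto simp: d_def)
  define S1 S2 T where "S1 = (\<Union>a\<in>A1. ball a d)" and "S2 = (\<Union>a\<in>A2. ball a d)" and "T = (\<Union>c\<in>C. ball c d)"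
  have T: "open T" "convex T" "C \<subseteq> T" unfolding T_def using d(1) convex_thicken[OF C(2)] by auto
  have S12: "open S1" "open S2" "A1 \<subseteq> S1" "A2 \<subseteq> S2" unfolding S1_def S2_def using d(1) by auto
  have SN: "rect2 S1 T \<subseteq> N1" "rect2 S2 T \<subseteq> N2"
    unfolding S1_def S2_def T_def using e1(2)[OF d(1,2)] e2(2)[OF d(1,3)] by auto
  obtain O1 O2 V where V: "open O1" "open O2" "open V" "convex V" "A1 \<subseteq> O1" "A2 \<subseteq> O2"
      "O1 \<subseteq> S1" "O2 \<subseteq> S2" "V \<subseteq> S1 \<inter> S2" "O1 \<inter> O2 \<subseteq> V"
      and split: "\<forall>B \<phi>. open B \<longrightarrow> holo_Cn (rect2 V B) \<phi> \<longrightarrow>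
           (\<exists>\<phi>1 \<phi>2. holo_Cn (rect2 O1 B) \<phi>1 \<and> holo_Cn (rect2 O2 B) \<phi>2 \<and>
              (\<forall>p\<in>rect2 (O1 \<inter> O2) B. \<phi> p = \<phi>1 p + \<phi>2 p))"
    by (rule splittableE[OF spl S12])
  define M where "M = rect2 V T"
  have M: "open M" "convex M" unfolding M_def using V(3,4) T by (auto intro: open_rect2 convex_rect2)
  have MN: "M \<subseteq> N1" "M \<subseteq> N2" using V(9) SN by (auto simp: M_def subset_iff)
  obtain U where U: "holo_Cn M U" "\<And>q. q \<in> M \<Longrightarrow> U q \<noteq> 0" "\<And>q. q \<in> M \<Longrightarrow> W1 q = U q * W2 q"
    using unit_function[of M W1 W2] holo_Cn_subset[OF N1(2) M(1) MN(1)] holo_Cn_subset[OF N2(2) M(1) MN(2)]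
      N1(3) N2(3) MN by blast
  obtain \<phi> where \<phi>: "holo_Cn M \<phi>" "\<And>q. q \<in> M \<Longrightarrow> U q = exp (\<phi> q)" using holo_log[OF M(2) U(1,2)] by blast
  obtain \<phi>1 \<phi>2 where \<phi>12: "holo_Cn (rect2 O1 T) \<phi>1" "holo_Cn (rect2 O2 T) \<phi>2"
      "\<forall>p\<in>rect2 (O1 \<inter> O2) T. \<phi> p = \<phi>1 p + \<phi>2 p"
    using split[THEN spec, THEN spec, THEN mp, THEN mp, OF T(1) \<phi>(1)[unfolded M_def]] by blast
  define W where "W p = (if p $ 1 \<in> O1 then W1 p * exp (- \<phi>1 p) else W2 p * exp (\<phi>2 p))" for p :: "complex^2"
  have R1: "open (rect2 O1 T)" and R2: "open (rect2 O2 T)" using V T by (auto intro: open_rect2)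
  have RN: "rect2 O1 T \<subseteq> N1" "rect2 O2 T \<subseteq> N2" using SN V(7,8) by (auto simp: subset_iff)
  have Wa: "W p = exp (- \<phi>1 p) * W1 p" if "p \<in> rect2 O1 T" for p using that by (simp add: W_def)
  have Wb: "W p = exp (\<phi>2 p) * W2 p" if p: "p \<in> rect2 O2 T" for p
  proof (cases "p $ 1 \<in> O1")
    case True
    then have q: "p \<in> rect2 (O1 \<inter> O2) T" using p by simp
    then have pM: "p \<in> M" using V(10) by (auto simp: M_def)
    have "W p = W2 p * (exp (\<phi>1 p + \<phi>2 p) * exp (- \<phi>1 p))"
      using True U(3)[OF pM] \<phi>(2)[OF pM] \<phi>12(3) q by (simp add: W_def)
    then show ?thesis by (simp add: exp_add[symmetric] mult.commute)
  qed (simp add: W_def)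
  have h1: "holo_Cn (rect2 O1 T) W"
    by (rule holo_Cn_cong[where f = "\<lambda>p. exp (- \<phi>1 p) * W1 p"])
       (use Wa in \<open>auto intro!: holo_Cn_mult holo_Cn_exp holo_Cn_uminus \<phi>12(1) holo_Cn_subset[OF N1(2) R1 RN(1)]\<close>)
  have h2: "holo_Cn (rect2 O2 T) W"
    by (rule holo_Cn_cong[where f = "\<lambda>p. exp (\<phi>2 p) * W2 p"])
       (use Wb in \<open>auto intro!: holo_Cn_mult holo_Cn_exp \<phi>12(2) holo_Cn_subset[OF N2(2) R2 RN(2)]\<close>)
  have "D q W" if q: "q \<in> rect2 O1 T \<union> rect2 O2 T" for q
    using q
  proof
    assume q: "q \<in> rect2 O1 T"
    have "hol_at (\<lambda>p. exp (- \<phi>1 p)) q"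
      using holo_Cn_exp[OF holo_Cn_uminus[OF \<phi>12(1)]] q by (rule hol_atI)
    moreover have "eventually (\<lambda>x. W x = exp (- \<phi>1 x) * W1 x) (nhds q)"
      unfolding eventually_nhds using R1 q Wa by blast
    ultimately show ?thesis
      using D_change[of q W1 "\<lambda>p. exp (- \<phi>1 p)" W] N1(3) RN(1) q by auto
  next
    assume q: "q \<in> rect2 O2 T"
    have "hol_at (\<lambda>p. exp (\<phi>2 p)) q" using holo_Cn_exp[OF \<phi>12(2)] q by (rule hol_atI)
    moreover have "eventually (\<lambda>x. W x = exp (\<phi>2 x) * W2 x) (nhds q)"
      unfolding eventually_nhds using R2 q Wb by blast
    ultimately show ?thesis
      using D_change[of q W2 "\<lambda>p. exp (\<phi>2 p)" W] N2(3) RN(2) q by auto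
  qed
  moreover have "holo_Cn (rect2 O1 T \<union> rect2 O2 T) W"
  proof (rule holo_Cn_local)
    fix x assume "x \<in> rect2 O1 T \<union> rect2 O2 T"
    then show "\<exists>N. x \<in> N \<and> N \<subseteq> rect2 O1 T \<union> rect2 O2 T \<and> holo_Cn N W"
      using h1 h2 by blast
  qed
  moreover have "rect2 (A1 \<union> A2) C \<subseteq> rect2 O1 T \<union> rect2 O2 T" using V(5,6) T(3) by auto
  ultimately show ?thesis unfolding solvable_def by blast
qed

end

definition swap2 :: "complex^2 \<Rightarrow> complex^2" where "swap2 p = pt (p $ 2) (p $ 1)"

lemma swap2_simps [simp]: "swap2 p $ 1 = p $ 2" "swap2 p $ 2 = p $ 1" "swap2 (swap2 p) = p"
  by (simp_all add: swap2_def)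

lemma continuous_swap2: "continuous_on S swap2"
  unfolding swap2_def by (intro continuous_intros)

lemma eventually_nhds_compose:
  assumes "eventually P (nhds (f q))" "isCont f q"
  shows "eventually (\<lambda>x. P (f x)) (nhds q)"
proof -
  have "filterlim f (nhds (f q)) (nhds q)"
    using assms(2) tendsto_at_iff_tendsto_nhds[of f q] by (simp add: isCont_def)
  then show ?thesis using assms(1) by (rule eventually_compose_filterlim[rotated])
qed

lemma hol_at_compose:
  assumes "hol_at f (T q)" "\<And>i. holo_Cn UNIV (\<lambda>x. T x $ i)"
  shows "hol_at (\<lambda>x. f (T x)) q"
proof -
  obtain N where N: "T q \<in> N" "holo_Cn N f" using assms(1) by (auto simp: hol_at_def)
  have "continuous_on UNIV T"
  proof -
    have "continuous_on UNIV (\<lambda>x. \<chi> i. T x $ i)"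
      by (intro continuous_on_vec_lambda holo_Cn_continuous_on assms(2))
    then show ?thesis by simp
  qed
  then have op: "open (T -` N)" using holo_Cn_open[OF N(2)] by (simp add: open_vimage)
  have "holo_Cn (T -` N) (\<lambda>x. f (T x))"
    by (rule holo_Cn_compose[OF N(2)]) (auto intro: holo_Cn_subset[OF assms(2) op])
  then show ?thesis by (rule hol_atI) (use N in simp)
qed

lemma holo_swap2: "holo_Cn UNIV (\<lambda>x. swap2 x $ i)"
  using exhaust_2[of i] holo_Cn_nth[OF open_UNIV] by auto

lemma isCont_swap2: "isCont swap2 q"
  using continuous_swap2[of UNIV] by (simp add: continuous_on_eq_continuous_at)

context cousin_data
begin

text \<open>Merging has been carried out in the first variable; transporting the datum by the swap
  gives it in the second.\<close>

lemma cousin_data_swap: "cousin_data (\<lambda>q W. D (swap2 q) (\<lambda>x. W (swap2 x)))"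
proof
  have h: "hol_at W q" if "hol_at (\<lambda>x. W (swap2 x)) (swap2 q)" for W q
    using hol_at_compose[OF that holo_swap2] by simp
  have ev: "eventually P (nhds q)" if "eventually (\<lambda>x. P (swap2 x)) (nhds (swap2 q))" for P q
    using eventually_nhds_compose[OF that isCont_swap2] by simp
  fix q W assume W: "D (swap2 q) (\<lambda>x. W (swap2 x))"
  show "hol_at W q" using h[OF D_hol[OF W]] .
  show "\<not> zero_germ W q"
    using D_nonzero[OF W] eventually_nhds_compose[of "\<lambda>x. W x = 0" swap2 "swap2 q"] isCont_swap2
    unfolding zero_germ_def by auto
  {
    fix W' assume W': "D (swap2 q) (\<lambda>x. W' (swap2 x))"
    obtain U where U: "hol_at U (swap2 q)" "U (swap2 q) \<noteq> 0"
        "eventually (\<lambda>x. W (swap2 x) = U x * W' (swap2 x)) (nhds (swap2 q))"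
      using D_unit[OF W W'] by blast
    have "hol_at (\<lambda>x. U (swap2 x)) q" by (rule hol_at_compose[OF U(1) holo_swap2])
    moreover have "eventually (\<lambda>x. W x = U (swap2 x) * W' x) (nhds q)"
      by (rule ev) (use U(3) in simp)
    ultimately show "\<exists>U. hol_at U q \<and> U q \<noteq> 0 \<and> eventually (\<lambda>x. W x = U x * W' x) (nhds q)"
      using U(2) by blast
  next
    fix U W' assume U: "hol_at U q" "U q \<noteq> 0" "eventually (\<lambda>x. W' x = U x * W x) (nhds q)"
    show "D (swap2 q) (\<lambda>x. W' (swap2 x))"
    proof (rule D_change[OF W])
      show "hol_at (\<lambda>x. U (swap2 x)) (swap2 q)"
        by (rule hol_at_compose[OF _ holo_swap2]) (use U(1) in simp)
      show "eventually (\<lambda>x. W' (swap2 x) = U (swap2 x) * W (swap2 x)) (nhds (swap2 q))"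
        by (rule eventually_nhds_compose[OF _ isCont_swap2]) (use U(3) in simp)
    qed (use U(2) in simp)
  }
next
  fix p
  obtain S W where S: "open S" "swap2 p \<in> S" "holo_Cn S W" "\<forall>q\<in>S. D q W" using D_local by blast
  have op: "open (swap2 -` S)" using S(1) continuous_swap2 by (simp add: open_vimage)
  have "holo_Cn (swap2 -` S) (\<lambda>x. W (swap2 x))"
    by (rule holo_Cn_compose[OF S(3)]) (auto intro: holo_Cn_subset[OF holo_swap2 op])
  then show "\<exists>S W. open S \<and> p \<in> S \<and> holo_Cn S W \<and> (\<forall>q\<in>S. D (swap2 q) (\<lambda>x. W (swap2 x)))"
    using S op by (intro exI[of _ "swap2 -` S"] exI[of _ "\<lambda>x. W (swap2 x)"]) simp
qed

lemma solvable_swap: "cousin_data.solvable (\<lambda>q W. D (swap2 q) (\<lambda>x. W (swap2 x))) (rect2 A B) \<longleftrightarrow> solvable (rect2 B A)"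
proof -
  interpret sw: cousin_data "\<lambda>q W. D (swap2 q) (\<lambda>x. W (swap2 x))" by (rule cousin_data_swap)
  have h: "holo_Cn (swap2 -` N) (\<lambda>x. W (swap2 x))" if "holo_Cn N W" for N W
    by (rule holo_Cn_compose[OF that])
       (auto intro: holo_Cn_subset[OF holo_swap2] open_vimage continuous_swap2 holo_Cn_open[OF that])
  show ?thesis
  proof
    assume "sw.solvable (rect2 A B)"
    then obtain N W where N: "rect2 A B \<subseteq> N" "holo_Cn N W" "\<forall>q\<in>N. D (swap2 q) (\<lambda>x. W (swap2 x))"
      unfolding sw.solvable_def by blast
    show "solvable (rect2 B A)"
      unfolding solvable_def
    proof (intro exI conjI ballI)
      show "rect2 B A \<subseteq> swap2 -` N" using N(1) by (auto simp: subset_iff)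
      show "holo_Cn (swap2 -` N) (\<lambda>x. W (swap2 x))" by (rule h[OF N(2)])
      fix q assume "q \<in> swap2 -` N"
      then show "D q (\<lambda>x. W (swap2 x))" using N(3) by force
    qed
  next
    assume "solvable (rect2 B A)"
    then obtain N W where N: "rect2 B A \<subseteq> N" "holo_Cn N W" "\<forall>q\<in>N. D q W"
      unfolding solvable_def by blast
    show "sw.solvable (rect2 A B)"
      unfolding sw.solvable_def
    proof (intro exI conjI ballI)
      show "rect2 A B \<subseteq> swap2 -` N" using N(1) by (auto simp: subset_iff)
      show "holo_Cn (swap2 -` N) (\<lambda>x. W (swap2 x))" by (rule h[OF N(2)])
      fix q assume "q \<in> swap2 -` N"
      then show "D (swap2 q) (\<lambda>x. W (swap2 (swap2 x)))" using N(3) by simp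
    qed
  qed
qed

lemma solvable_merge2:
  assumes "splittable A1 A2" "compact A1" "compact A2" "compact C" "convex C"
    and "solvable (rect2 C A1)" "solvable (rect2 C A2)"
  shows "solvable (rect2 C (A1 \<union> A2))"
proof -
  interpret sw: cousin_data "\<lambda>q W. D (swap2 q) (\<lambda>x. W (swap2 x))" by (rule cousin_data_swap)
  show ?thesis using sw.solvable_merge[OF assms(1-5)] assms(6,7) by (simp add: solvable_swap)
qed

end

text \<open>Bisection with a size \<open>d\<close> carried along: \<open>\<Phi> d a b\<close> is
  meant to say that boxes with side \<open>[a, b]\<close> in one real coordinate and sides shorter
  than \<open>d\<close> in the coordinates still open are good. The minimum of two sizes serves the
  union of two intervals.\<close>

lemma Bolzano_stage:
  fixes \<Phi> :: "real \<Rightarrow> real \<Rightarrow> real \<Rightarrow> bool"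
  assumes "a \<le> b"
    and mono: "\<And>d d' a b. \<Phi> d a b \<Longrightarrow> d' \<le> d \<Longrightarrow> \<Phi> d' a b"
    and trans: "\<And>d a b c. \<Phi> d a b \<Longrightarrow> \<Phi> d b c \<Longrightarrow> a \<le> b \<Longrightarrow> b \<le> c \<Longrightarrow> \<Phi> d a c"
    and local: "\<And>v. \<exists>d>0. \<forall>a b. a \<le> v \<longrightarrow> v \<le> b \<longrightarrow> b - a < d \<longrightarrow> \<Phi> d a b"
  shows "\<exists>d>0. \<Phi> d a b"
  using assms(1)
proof (induction rule: Bolzano)
  case (trans a b c)
  then obtain d1 d2 where "d1 > 0" "\<Phi> d1 a b" "d2 > 0" "\<Phi> d2 b c" by blast
  then have "\<Phi> (min d1 d2) a b" "\<Phi> (min d1 d2) b c" "min d1 d2 > 0" by (auto intro: mono)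
  with assms(3) trans(3,4) show ?case by blast
next
  case (local v)
  obtain d where "d > 0" "\<forall>a b. a \<le> v \<longrightarrow> v \<le> b \<longrightarrow> b - a < d \<longrightarrow> \<Phi> d a b" using assms(4) by blast
  then show ?case by blast
qed

context cousin_data
begin

text \<open>The four real coordinates are treated one after another. After each stage one more side
  of the box is the prescribed one, while the sides still open have to be short; bisecting the new
  side yields one bound for their length.\<close>

theorem solvable_box:
  assumes "x0 \<le> x1" "y0 \<le> y1" "u0 \<le> u1" "v0 \<le> v1"
  shows "solvable (rect2 (bx x0 x1 y0 y1) (bx u0 u1 v0 v1))"
proof -
  let ?P = "\<lambda>x0 x1 y0 y1 u0 u1 v0 v1. solvable (rect2 (bx x0 x1 y0 y1) (bx u0 u1 v0 v1))"
  have bxv: "bx x0 x1 y0 y1 \<union> bx x1 x2 y0 y1 = bx x0 x2 y0 y1" if "x0 \<le> x1" "x1 \<le> x2" for x0 x1 x2 y0 y1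
    using that by (auto simp: bx_def)
  have bxh: "bx x0 x1 y0 y1 \<union> bx x0 x1 y1 y2 = bx x0 x1 y0 y2" if "y0 \<le> y1" "y1 \<le> y2" for x0 x1 y0 y1 y2
    using that by (auto simp: bx_def)
  note cc = compact_bx convex_bx
  have tx: "?P a c y0 y1 u0 u1 v0 v1"
    if "?P a b y0 y1 u0 u1 v0 v1" "?P b c y0 y1 u0 u1 v0 v1" "a \<le> b" "b \<le> c" "y0 \<le> y1" for a b c y0 y1 u0 u1 v0 v1
    using solvable_merge[OF splittable_vertical[OF that(3-5)] cc(1,1,1,2) that(1,2)] bxv[OF that(3,4)] by simp
  have ty: "?P x0 x1 a c u0 u1 v0 v1"
    if "?P x0 x1 a b u0 u1 v0 v1" "?P x0 x1 b c u0 u1 v0 v1" "a \<le> b" "b \<le> c" "x0 \<le> x1" for a b c x0 x1 u0 u1 v0 v1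
    using solvable_merge[OF splittable_horizontal[OF that(3-5)] cc(1,1,1,2) that(1,2)] bxh[OF that(3,4)] by simp
  have tu: "?P x0 x1 y0 y1 a c v0 v1"
    if "?P x0 x1 y0 y1 a b v0 v1" "?P x0 x1 y0 y1 b c v0 v1" "a \<le> b" "b \<le> c" "v0 \<le> v1" for a b c x0 x1 y0 y1 v0 v1
    using solvable_merge2[OF splittable_vertical[OF that(3-5)] cc(1,1,1,2) that(1,2)] bxv[OF that(3,4)] by simp
  have tv: "?P x0 x1 y0 y1 u0 u1 a c"
    if "?P x0 x1 y0 y1 u0 u1 a b" "?P x0 x1 y0 y1 u0 u1 b c" "a \<le> b" "b \<le> c" "u0 \<le> u1" for a b c x0 x1 y0 y1 u0 u1
    using solvable_merge2[OF splittable_horizontal[OF that(3-5)] cc(1,1,1,2) that(1,2)] bxh[OF that(3,4)] by simp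
  define near :: "real \<Rightarrow> real \<Rightarrow> real \<Rightarrow> real \<Rightarrow> bool" where
    "near d x a b \<longleftrightarrow> a \<le> x \<and> x \<le> b \<and> b - a < d" for d x a b
  have near_mono: "near d x a b" if "near d' x a b" "d' \<le> d" for d d' x a b using that by (auto simp: near_def)
  have l0: "\<exists>d>0. \<forall>x0 x1 y0 y1 u0 u1 v0 v1. near d x x0 x1 \<longrightarrow> near d y y0 y1 \<longrightarrow> near d u u0 u1 \<longrightarrow> near d v v0 v1 \<longrightarrow>
      ?P x0 x1 y0 y1 u0 u1 v0 v1" for x y u v
  proof -
    obtain S W where S: "open S" "pt (Complex x y) (Complex u v) \<in> S" "holo_Cn S W" "\<forall>q\<in>S. D q W"
      using D_local by blast
    then have sS: "solvable S" unfolding solvable_def by blast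
    obtain r where r: "r > 0" "rect2 (cball (Complex x y) r) (cball (Complex u v) r) \<subseteq> S"
      using rect2_inside_open[OF S(1,2)] by auto
    have sub: "bx x0 x1 y0 y1 \<subseteq> cball (Complex x y) r" if "near (r/2) x x0 x1" "near (r/2) y y0 y1" for x y x0 x1 y0 y1
    proof
      fix z assume "z \<in> bx x0 x1 y0 y1"
      then have "\<bar>Re (Complex x y - z)\<bar> \<le> r/2" "\<bar>Im (Complex x y - z)\<bar> \<le> r/2"
        using that unfolding bx_def near_def mem_Collect_eq minus_complex.sel complex.sel
        by (smt (verit) field_sum_of_halves)+
      then show "z \<in> cball (Complex x y) r" using cmod_le[of "Complex x y - z"] by (auto simp: dist_norm)
    qed
    show ?thesis
    proof (intro exI[of _ "r/2"] conjI allI impI)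
      fix x0 x1 y0 y1 u0 u1 v0 v1
      assume n: "near (r/2) x x0 x1" "near (r/2) y y0 y1" "near (r/2) u u0 u1" "near (r/2) v v0 v1"
      have "rect2 (bx x0 x1 y0 y1) (bx u0 u1 v0 v1) \<subseteq> S"
        by (rule order_trans[OF rect2_mono[OF sub[OF n(1,2)] sub[OF n(3,4)]] r(2)])
      then show "?P x0 x1 y0 y1 u0 u1 v0 v1" by (rule solvable_subset[OF sS])
    qed (use r in simp)
  qed
  have l1: "\<exists>d>0. \<forall>x0 x1 y0 y1 u0 u1. near d x x0 x1 \<longrightarrow> near d y y0 y1 \<longrightarrow> near d u u0 u1 \<longrightarrow>
      ?P x0 x1 y0 y1 u0 u1 v0 v1" for x y u
  proof (rule Bolzano_stage[OF assms(4)])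
    fix d d' a b assume "\<forall>x0 x1 y0 y1 u0 u1. near d x x0 x1 \<longrightarrow> near d y y0 y1 \<longrightarrow> near d u u0 u1 \<longrightarrow> ?P x0 x1 y0 y1 u0 u1 a b" "d' \<le> d"
    then show "\<forall>x0 x1 y0 y1 u0 u1. near d' x x0 x1 \<longrightarrow> near d' y y0 y1 \<longrightarrow> near d' u u0 u1 \<longrightarrow> ?P x0 x1 y0 y1 u0 u1 a b"
      using near_mono by blast
  next
    fix d a b c assume 1: "\<forall>x0 x1 y0 y1 u0 u1. near d x x0 x1 \<longrightarrow> near d y y0 y1 \<longrightarrow> near d u u0 u1 \<longrightarrow> ?P x0 x1 y0 y1 u0 u1 a b"
      "\<forall>x0 x1 y0 y1 u0 u1. near d x x0 x1 \<longrightarrow> near d y y0 y1 \<longrightarrow> near d u u0 u1 \<longrightarrow> ?P x0 x1 y0 y1 u0 u1 b c" "a \<le> b" "b \<le> c"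
    show "\<forall>x0 x1 y0 y1 u0 u1. near d x x0 x1 \<longrightarrow> near d y y0 y1 \<longrightarrow> near d u u0 u1 \<longrightarrow> ?P x0 x1 y0 y1 u0 u1 a c"
    proof (intro allI impI)
      fix x0 x1 y0 y1 u0 u1 assume n: "near d x x0 x1" "near d y y0 y1" "near d u u0 u1"
      show "?P x0 x1 y0 y1 u0 u1 a c"
        by (rule tv[OF _ _ 1(3,4)]) (use 1(1,2) n in \<open>auto simp: near_def\<close>)
    qed
  next
    fix v
    obtain d where d: "d > 0" "\<forall>x0 x1 y0 y1 u0 u1 v0 v1. near d x x0 x1 \<longrightarrow> near d y y0 y1 \<longrightarrow> near d u u0 u1 \<longrightarrow> near d v v0 v1 \<longrightarrow>
      ?P x0 x1 y0 y1 u0 u1 v0 v1" using l0 by blast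
    show "\<exists>d>0. \<forall>a b. a \<le> v \<longrightarrow> v \<le> b \<longrightarrow> b - a < d \<longrightarrow>
      (\<forall>x0 x1 y0 y1 u0 u1. near d x x0 x1 \<longrightarrow> near d y y0 y1 \<longrightarrow> near d u u0 u1 \<longrightarrow> ?P x0 x1 y0 y1 u0 u1 a b)"
      by (rule exI[of _ d]) (use d in \<open>simp add: near_def\<close>)
  qed
  have l2: "\<exists>d>0. \<forall>x0 x1 y0 y1. near d x x0 x1 \<longrightarrow> near d y y0 y1 \<longrightarrow> ?P x0 x1 y0 y1 u0 u1 v0 v1" for x y
  proof (rule Bolzano_stage[OF assms(3)])
    fix d d' a b assume "\<forall>x0 x1 y0 y1. near d x x0 x1 \<longrightarrow> near d y y0 y1 \<longrightarrow> ?P x0 x1 y0 y1 a b v0 v1" "d' \<le> d"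
    then show "\<forall>x0 x1 y0 y1. near d' x x0 x1 \<longrightarrow> near d' y y0 y1 \<longrightarrow> ?P x0 x1 y0 y1 a b v0 v1"
      using near_mono by blast
  next
    fix d a b c assume 1: "\<forall>x0 x1 y0 y1. near d x x0 x1 \<longrightarrow> near d y y0 y1 \<longrightarrow> ?P x0 x1 y0 y1 a b v0 v1"
      "\<forall>x0 x1 y0 y1. near d x x0 x1 \<longrightarrow> near d y y0 y1 \<longrightarrow> ?P x0 x1 y0 y1 b c v0 v1" "a \<le> b" "b \<le> c"
    show "\<forall>x0 x1 y0 y1. near d x x0 x1 \<longrightarrow> near d y y0 y1 \<longrightarrow> ?P x0 x1 y0 y1 a c v0 v1"
    proof (intro allI impI)
      fix x0 x1 y0 y1 assume n: "near d x x0 x1" "near d y y0 y1"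
      show "?P x0 x1 y0 y1 a c v0 v1"
        by (rule tu[OF _ _ 1(3,4) assms(4)]) (use 1(1,2) n in \<open>auto simp: near_def\<close>)
    qed
  next
    fix u
    obtain d where d: "d > 0" "\<forall>x0 x1 y0 y1 u0 u1. near d x x0 x1 \<longrightarrow> near d y y0 y1 \<longrightarrow> near d u u0 u1 \<longrightarrow>
      ?P x0 x1 y0 y1 u0 u1 v0 v1" using l1 by blast
    show "\<exists>d>0. \<forall>a b. a \<le> u \<longrightarrow> u \<le> b \<longrightarrow> b - a < d \<longrightarrow>
      (\<forall>x0 x1 y0 y1. near d x x0 x1 \<longrightarrow> near d y y0 y1 \<longrightarrow> ?P x0 x1 y0 y1 a b v0 v1)"
      by (rule exI[of _ d]) (use d in \<open>simp add: near_def\<close>)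
  qed
  have l3: "\<exists>d>0. \<forall>x0 x1. near d x x0 x1 \<longrightarrow> ?P x0 x1 y0 y1 u0 u1 v0 v1" for x
  proof (rule Bolzano_stage[OF assms(2)])
    fix d d' a b assume "\<forall>x0 x1. near d x x0 x1 \<longrightarrow> ?P x0 x1 a b u0 u1 v0 v1" "d' \<le> d"
    then show "\<forall>x0 x1. near d' x x0 x1 \<longrightarrow> ?P x0 x1 a b u0 u1 v0 v1" using near_mono by blast
  next
    fix d a b c assume 1: "\<forall>x0 x1. near d x x0 x1 \<longrightarrow> ?P x0 x1 a b u0 u1 v0 v1"
      "\<forall>x0 x1. near d x x0 x1 \<longrightarrow> ?P x0 x1 b c u0 u1 v0 v1" "a \<le> b" "b \<le> c"
    show "\<forall>x0 x1. near d x x0 x1 \<longrightarrow> ?P x0 x1 a c u0 u1 v0 v1"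
    proof (intro allI impI)
      fix x0 x1 assume n: "near d x x0 x1"
      show "?P x0 x1 a c u0 u1 v0 v1"
        by (rule ty[OF _ _ 1(3,4)]) (use 1(1,2) n in \<open>auto simp: near_def\<close>)
    qed
  next
    fix y
    obtain d where d: "d > 0" "\<forall>x0 x1 y0 y1. near d x x0 x1 \<longrightarrow> near d y y0 y1 \<longrightarrow> ?P x0 x1 y0 y1 u0 u1 v0 v1"
      using l2 by blast
    show "\<exists>d>0. \<forall>a b. a \<le> y \<longrightarrow> y \<le> b \<longrightarrow> b - a < d \<longrightarrow>
      (\<forall>x0 x1. near d x x0 x1 \<longrightarrow> ?P x0 x1 a b u0 u1 v0 v1)"
      by (rule exI[of _ d]) (use d in \<open>simp add: near_def\<close>)
  qed
  show ?thesis
    using assms(1)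
  proof (induction rule: Bolzano)
    case (trans a b c)
    show ?case by (rule tx[OF trans assms(2)])
  next
    case (local x)
    obtain d where d: "d > 0" "\<forall>x0 x1. near d x x0 x1 \<longrightarrow> ?P x0 x1 y0 y1 u0 u1 v0 v1" using l3 by blast
    show ?case by (rule exI[of _ d]) (use d in \<open>simp add: near_def\<close>)
  qed
qed

end

section \<open>Quotient representation of meromorphic functions on boxes\<close>

lemma holo_map_isCont:
  fixes T :: "complex^'n::finite \<Rightarrow> complex^'m::finite"
  assumes "\<And>i. holo_Cn S (\<lambda>x. T x $ i)" "q \<in> S"
  shows "isCont T q"
  using holo_Cn_map_has_derivative[OF assms] has_derivative_continuous by metis

lemma denominator_generator_compose:
  fixes T T' :: "complex^2 \<Rightarrow> complex^2"
  assumes T: "\<And>i. holo_Cn UNIV (\<lambda>x. T x $ i)" and T': "\<And>i. holo_Cn UNIV (\<lambda>x. T' x $ i)"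
    and inv: "\<And>x. T (T' x) = x" "\<And>x. T' (T x) = x"
    and W: "denominator_generator (\<lambda>x. g (T x)) (\<lambda>x. h (T x)) (T' q) W"
  shows "denominator_generator g h q (\<lambda>x. W (T' x))"
proof -
  have cT: "isCont T x" and cT': "isCont T' x" for x
    by (rule holo_map_isCont[OF T UNIV_I], rule holo_map_isCont[OF T' UNIV_I])
  have ev: "eventually P (nhds q) \<longleftrightarrow> eventually (\<lambda>x. P (T x)) (nhds (T' q))" for P
    using eventually_nhds_compose[of P T "T' q"] eventually_nhds_compose[of "\<lambda>x. P (T x)" T' q] cT cT' inv
    by auto
  have hol: "hol_at f (T' q) \<Longrightarrow> hol_at (\<lambda>x. f (T' x)) q" for f by (rule hol_at_compose[OF _ T'])
  have hol': "hol_at f q \<Longrightarrow> hol_at (\<lambda>x. f (T x)) (T' q)" for f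
    by (rule hol_at_compose[OF _ T]) (simp add: inv)
  show ?thesis
    unfolding denominator_generator_def
  proof (intro conjI allI impI)
    show "hol_at (\<lambda>x. W (T' x)) q" using W hol by (simp add: denominator_generator_def)
    show "\<not> zero_germ (\<lambda>x. W (T' x)) q"
      using W by (simp add: denominator_generator_def zero_germ_def ev inv)
    obtain G where G: "hol_at G (T' q)" "eventually (\<lambda>x. W x * g (T x) = h (T x) * G x) (nhds (T' q))"
      using W by (auto simp: denominator_generator_def)
    then show "\<exists>G. hol_at G q \<and> eventually (\<lambda>x. W (T' x) * g x = h x * G x) (nhds q)"
      by (intro exI[of _ "\<lambda>x. G (T' x)"]) (simp add: hol ev inv)
    fix H K assume "hol_at H q" "hol_at K q" "eventually (\<lambda>x. H x * g x = h x * K x) (nhds q)"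
    then have "hol_at (\<lambda>x. H (T x)) (T' q)" "hol_at (\<lambda>x. K (T x)) (T' q)"
      "eventually (\<lambda>x. H (T x) * g (T x) = h (T x) * K (T x)) (nhds (T' q))"
      by (auto simp: hol' ev)
    then obtain U where "hol_at U (T' q)" "eventually (\<lambda>x. H (T x) = U x * W x) (nhds (T' q))"
      using W unfolding denominator_generator_def by blast
    then show "\<exists>U. hol_at U q \<and> eventually (\<lambda>x. H x = U x * W (T' x)) (nhds q)"
      by (intro exI[of _ "\<lambda>x. U (T' x)"]) (simp add: hol ev inv)
  qed
qed

lemma local_denominator_via:
  fixes T T' :: "complex^2 \<Rightarrow> complex^2"
  assumes T: "\<And>i. holo_Cn UNIV (\<lambda>x. T x $ i)" and T': "\<And>i. holo_Cn UNIV (\<lambda>x. T' x $ i)"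
    and inv: "\<And>x. T (T' x) = x" "\<And>x. T' (T x) = x"
    and g: "holo_Cn N g" and h: "holo_Cn N h" and p: "p \<in> N" "T (pt 0 0) = p"
    and nz: "\<not> eventually (\<lambda>t. h (T (pt 0 t)) = 0) (nhds 0)"
  shows "\<exists>S W. open S \<and> p \<in> S \<and> holo_Cn S W \<and> (\<forall>q\<in>S. denominator_generator g h q W)"
proof -
  have cont: "continuous_on UNIV T" "continuous_on UNIV T'"
    using holo_map_isCont[OF T UNIV_I] holo_map_isCont[OF T' UNIV_I]
    by (auto simp: continuous_on_eq_continuous_at)
  have op: "open (T -` N)" using holo_Cn_open[OF g] cont by (simp add: open_vimage)
  have comp: "holo_Cn (T -` N) (\<lambda>x. f (T x))" if "holo_Cn N f" for f
    by (rule holo_Cn_compose[OF that]) (auto intro: holo_Cn_subset[OF T op])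
  have "pt 0 0 \<in> T -` N" using p by simp
  from local_denominator_slice[OF comp[OF g] comp[OF h] this nz]
  obtain S W where S: "open S" "pt 0 0 \<in> S" "holo_Cn S W"
    "\<And>q. q \<in> S \<Longrightarrow> denominator_generator (\<lambda>x. g (T x)) (\<lambda>x. h (T x)) q W" by blast
  have op': "open (T' -` S)" using S(1) cont by (simp add: open_vimage)
  show ?thesis
  proof (intro exI conjI ballI)
    show "open (T' -` S)" by fact
    show "p \<in> T' -` S" using S(2) inv(2)[of "pt 0 0"] p(2) by simp
    show "holo_Cn (T' -` S) (\<lambda>x. W (T' x))"
      by (rule holo_Cn_compose[OF S(3)]) (auto intro: holo_Cn_subset[OF T' op'])
    fix q assume "q \<in> T' -` S"
    then show "denominator_generator g h q (\<lambda>x. W (T' x))"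
      by (intro denominator_generator_compose[OF T T' inv] S(4)) simp
  qed
qed

lemma holo_pt:
  assumes "holo_Cn S f" "holo_Cn S g" shows "holo_Cn S (\<lambda>x. pt (f x) (g x) $ i)"
  using exhaust_2[of i] assms by auto

text \<open>After a linear change of coordinates \<open>h\<close> does not vanish identically on the vertical line.\<close>

lemma local_denominator:
  fixes g h :: "complex^2 \<Rightarrow> complex"
  assumes g: "holo_Cn N g" and h: "holo_Cn N h" and p: "p \<in> N" and nz: "\<not> zero_germ h p"
  shows "\<exists>S W. open S \<and> p \<in> S \<and> holo_Cn S W \<and> (\<forall>q\<in>S. denominator_generator g h q W)"
proof -
  obtain e where e: "e > 0" "ball p e \<subseteq> N" using holo_Cn_open[OF g] p open_contains_ball by blast
  have hb: "holo_Cn (ball p e) h" using h e by (auto intro: holo_Cn_subset)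
  obtain q where q: "q \<in> ball p e" "h q \<noteq> 0"
    using nz e(1) unfolding zero_germ_def eventually_nhds by (metis centre_in_ball open_ball)
  \<comment> \<open>If \<open>h p = 0\<close>, the direction points to a nearby zero-free point of
    \<open>h\<close>, and by the identity theorem on lines \<open>h\<close> does not vanish
    identically along it. Otherwise any direction will do.\<close>
  obtain v where v: "v $ 1 \<noteq> 0 \<or> v $ 2 \<noteq> 0" "\<not> eventually (\<lambda>t. h (p + t *s v) = 0) (nhds 0)"
  proof (cases "h p = 0")
    case True
    then have "q - p \<noteq> 0" using q by auto
    then have "(q - p) $ 1 \<noteq> 0 \<or> (q - p) $ 2 \<noteq> 0" unfolding vec_eq_iff forall_2 by auto
    moreover have "\<not> eventually (\<lambda>t. h (p + t *s (q - p)) = 0) (nhds 0)"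
    proof
      assume "eventually (\<lambda>t. h (p + t *s (q - p)) = 0) (nhds 0)"
      from identity_on_line[OF hb convex_ball _ q(1) this] q(2) e(1) show False by simp
    qed
    ultimately show ?thesis by (rule that)
  next
    case False
    have "\<not> eventually (\<lambda>t. h (p + t *s pt 1 1) = 0) (nhds 0)"
      using False eventually_nhds_x_imp_x[of "\<lambda>t. h (p + t *s pt 1 1) = 0" 0] by auto
    then show ?thesis using that[of "pt 1 1"] by simp
  qed
  note hi = holo_pt holo_Cn_add holo_Cn_diff holo_Cn_mult holo_Cn_divide holo_Cn_const holo_Cn_nth open_UNIV
  show ?thesis
  \<comment> \<open>The direction \<open>v\<close> becomes the vertical axis; the other axis is
    \<open>(1, 0)\<close> if \<open>v $ 2 \<noteq> 0\<close> and \<open>(0, 1)\<close> otherwise,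
    which keeps the map invertible.\<close>
  proof (cases "v $ 2 = 0")
    case False
    have line: "pt (p $ 1 + 0 + t * v $ 1) (p $ 2 + t * v $ 2) = p + t *s v" for t
      by (simp add: vec_eq_iff forall_2)
    show ?thesis
    proof (rule local_denominator_via[of "\<lambda>x. pt (p $ 1 + x $ 1 + x $ 2 * v $ 1) (p $ 2 + x $ 2 * v $ 2)"
          "\<lambda>y. pt (y $ 1 - p $ 1 - (y $ 2 - p $ 2) / v $ 2 * v $ 1) ((y $ 2 - p $ 2) / v $ 2)", OF _ _ _ _ g h p])
      show "\<not> (\<forall>\<^sub>F t in nhds 0. h (pt (p $ 1 + pt 0 t $ 1 + pt 0 t $ 2 * v $ 1) (p $ 2 + pt 0 t $ 2 * v $ 2)) = 0)"
        using v(2) by (simp only: pt_nth line not_False_eq_True)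
    qed (use False in \<open>auto intro!: hi simp: pt_eq_iff\<close>)
  next
    case True
    then have v1: "v $ 1 \<noteq> 0" using v by simp
    have line: "pt (p $ 1 + t * v $ 1) (p $ 2 + 0 + t * v $ 2) = p + t *s v" for t
      by (simp add: vec_eq_iff forall_2)
    show ?thesis
    proof (rule local_denominator_via[of "\<lambda>x. pt (p $ 1 + x $ 2 * v $ 1) (p $ 2 + x $ 1 + x $ 2 * v $ 2)"
          "\<lambda>y. pt (y $ 2 - p $ 2 - (y $ 1 - p $ 1) / v $ 1 * v $ 2) ((y $ 1 - p $ 1) / v $ 1)", OF _ _ _ _ g h p])
      show "\<not> (\<forall>\<^sub>F t in nhds 0. h (pt (p $ 1 + pt 0 t $ 2 * v $ 1) (p $ 2 + pt 0 t $ 1 + pt 0 t $ 2 * v $ 2)) = 0)"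
        using v(2) by (simp only: pt_nth line not_False_eq_True)
    qed (use v1 in \<open>auto intro!: hi simp: pt_eq_iff\<close>)
  qed
qed

text \<open>A meromorphic function on \<open>\<complex>\<^sup>2\<close>, given near each point \<open>p\<close> as the quotient \<open>g p / h p\<close>.\<close>

locale mero_data =
  fixes g h :: "complex^2 \<Rightarrow> complex^2 \<Rightarrow> complex"
  assumes data: "\<exists>N. p \<in> N \<and> holo_Cn N (g p) \<and> holo_Cn N (h p) \<and>
    (\<forall>q\<in>N. \<not> zero_germ (h p) q \<and> eventually (\<lambda>x. g p x * h q x = g q x * h p x) (nhds q))"
begin

lemma hol_at_data: "hol_at (g p) p" "hol_at (h p) p" "\<not> zero_germ (h p) p"
  using data[of p] by (auto simp: hol_at_def)

lemma relation_transfer: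
  assumes eq: "eventually (\<lambda>x. g1 x * h2 x = g2 x * h1 x) (nhds q)"
    and h1: "hol_at h1 q" "\<not> zero_germ h1 q" and hol: "hol_at g2 q" "hol_at h2 q" "hol_at H q" "hol_at K q"
    and rel: "eventually (\<lambda>x. H x * g1 x = h1 x * K x) (nhds q)"
  shows "eventually (\<lambda>x. H x * g2 x = h2 x * K x) (nhds q)"
proof (rule germ_cancel[OF h1])
  show "eventually (\<lambda>x. h1 x * (H x * g2 x) = h1 x * (h2 x * K x)) (nhds q)"
    using eq rel
  proof eventually_elim
    case (elim x)
    have "h1 x * (H x * g2 x) = H x * (g1 x * h2 x)" by (simp add: elim(1) mult_ac)
    also have "\<dots> = (H x * g1 x) * h2 x" by (simp only: mult.assoc)
    also have "\<dots> = h1 x * (h2 x * K x)" by (simp only: elim(2) mult_ac)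
    finally show ?case .
  qed
qed (intro hol_at_mult hol)+

lemma denominator_generator_cong:
  assumes eq: "eventually (\<lambda>x. g1 x * h2 x = g2 x * h1 x) (nhds q)"
    and h: "hol_at h1 q" "\<not> zero_germ h1 q" "hol_at h2 q" "\<not> zero_germ h2 q" "hol_at g1 q" "hol_at g2 q"
    and gen: "denominator_generator g1 h1 q W"
  shows "denominator_generator g2 h2 q W"
proof -
  have eq': "eventually (\<lambda>x. g2 x * h1 x = g1 x * h2 x) (nhds q)"
    using eq by eventually_elim simp
  show ?thesis
    unfolding denominator_generator_def
  proof (intro conjI allI impI)
    show W: "hol_at W q" "\<not> zero_germ W q" using gen by (auto simp: denominator_generator_def)
    show "\<exists>G. hol_at G q \<and> eventually (\<lambda>x. W x * g2 x = h2 x * G x) (nhds q)"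
      using gen relation_transfer[OF eq h(1,2) h(6) h(3) W(1)] unfolding denominator_generator_def by blast
    fix H K assume H: "hol_at H q" "hol_at K q" "eventually (\<lambda>x. H x * g2 x = h2 x * K x) (nhds q)"
    have "eventually (\<lambda>x. H x * g1 x = h1 x * K x) (nhds q)"
      by (rule relation_transfer[OF eq' h(3,4) h(5) h(1) H])
    then show "\<exists>U. hol_at U q \<and> eventually (\<lambda>x. H x = U x * W x) (nhds q)"
      using gen H(1,2) unfolding denominator_generator_def by blast
  qed
qed

text \<open>Two generators of the same ideal divide each other, so after cancelling \<open>W\<close>
  the product of the two factors is 1 and both are units.\<close>

sublocale cousin_data "\<lambda>q W. denominator_generator (g q) (h q) q W"
proof
  fix q W assume W: "denominator_generator (g q) (h q) q W"
  then show hW: "hol_at W q" and nW: "\<not> zero_germ W q" by (auto simp: denominator_generator_def)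
  {
    fix W' assume W': "denominator_generator (g q) (h q) q W'"
    then have hW': "hol_at W' q" "\<not> zero_germ W' q" by (auto simp: denominator_generator_def)
    obtain U where U: "hol_at U q" "eventually (\<lambda>x. W x = U x * W' x) (nhds q)"
      using W W' unfolding denominator_generator_def by blast
    obtain V where V: "hol_at V q" "eventually (\<lambda>x. W' x = V x * W x) (nhds q)"
      using W W' unfolding denominator_generator_def by blast
    have "eventually (\<lambda>x. W x * (U x * V x) = W x * 1) (nhds q)"
      using U(2) V(2) by eventually_elim (simp add: mult_ac)
    then have "eventually (\<lambda>x. U x * V x = 1) (nhds q)"
      by (rule germ_cancel[OF hW nW hol_at_mult[OF U(1) V(1)] hol_at_const])
    then have "U q * V q = 1" by (rule eventually_nhds_x_imp_x)
    with U show "\<exists>U. hol_at U q \<and> U q \<noteq> 0 \<and> eventually (\<lambda>x. W x = U x * W' x) (nhds q)" by auto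
  next
    fix U W' assume U: "hol_at U q" "U q \<noteq> 0" and ev: "eventually (\<lambda>x. W' x = U x * W x) (nhds q)"
    have ev': "eventually (\<lambda>x. U x * W x = W' x) (nhds q)" using ev by eventually_elim simp
    have iU: "hol_at (\<lambda>x. inverse (U x)) q" by (rule hol_at_inverse[OF U])
    have Un: "eventually (\<lambda>x. U x \<noteq> 0) (nhds q)"
    proof -
      have "(U \<longlongrightarrow> U q) (nhds q)"
        using hol_at_cont[OF U(1)] tendsto_at_iff_tendsto_nhds[of U q] by (simp add: isCont_def)
      then show ?thesis using U(2) by (rule tendsto_imp_eventually_ne)
    qed
    show "denominator_generator (g q) (h q) q W'"
      unfolding denominator_generator_def
    proof (intro conjI allI impI)
      show "hol_at W' q" by (rule hol_at_cong[OF hol_at_mult[OF U(1) hW] ev'])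
      show "\<not> zero_germ W' q"
        using not_zero_germ_mult[OF U(1) hW not_zero_germI[of U q, OF U(2)] nW] zero_germ_cong[OF ev'] by simp
      obtain G where G: "hol_at G q" "eventually (\<lambda>x. W x * g q x = h q x * G x) (nhds q)"
        using W unfolding denominator_generator_def by blast
      have "eventually (\<lambda>x. W' x * g q x = h q x * (U x * G x)) (nhds q)"
        using G(2) ev
      proof eventually_elim
        case (elim x)
        have "W' x * g q x = U x * (W x * g q x)" by (simp add: elim(2) mult_ac)
        then show ?case by (simp add: elim(1) mult_ac)
      qed
      then show "\<exists>G. hol_at G q \<and> eventually (\<lambda>x. W' x * g q x = h q x * G x) (nhds q)"
        using hol_at_mult[OF U(1) G(1)] by blast
      fix H K assume "hol_at H q" "hol_at K q" "eventually (\<lambda>x. H x * g q x = h q x * K x) (nhds q)"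
      then obtain V where V: "hol_at V q" "eventually (\<lambda>x. H x = V x * W x) (nhds q)"
        using W unfolding denominator_generator_def by blast
      have "eventually (\<lambda>x. H x = (V x * inverse (U x)) * W' x) (nhds q)"
        using V(2) ev Un by eventually_elim simp
      then show "\<exists>U. hol_at U q \<and> eventually (\<lambda>x. H x = U x * W' x) (nhds q)"
        using hol_at_mult[OF V(1) iU] by blast
    qed
  }
next
  fix p
  obtain N where N: "p \<in> N" "holo_Cn N (g p)" "holo_Cn N (h p)"
    "\<And>q. q \<in> N \<Longrightarrow> \<not> zero_germ (h p) q"
    "\<And>q. q \<in> N \<Longrightarrow> eventually (\<lambda>x. g p x * h q x = g q x * h p x) (nhds q)" using data[of p] by blast
  obtain S W where S: "open S" "p \<in> S" "holo_Cn S W" "\<forall>q\<in>S. denominator_generator (g p) (h p) q W"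
    using local_denominator[OF N(2,3,1) N(4)[OF N(1)]] by blast
  show "\<exists>S W. open S \<and> p \<in> S \<and> holo_Cn S W \<and> (\<forall>q\<in>S. denominator_generator (g q) (h q) q W)"
  proof (intro exI conjI ballI)
    show "open (S \<inter> N)" using S(1) holo_Cn_open[OF N(2)] by auto
    show "p \<in> S \<inter> N" using S(2) N(1) by simp
    show "holo_Cn (S \<inter> N) W" by (rule holo_Cn_Int[OF S(3) holo_Cn_open[OF N(2)]])
    fix q assume q: "q \<in> S \<inter> N"
    then have qN: "q \<in> N" by simp
    show "denominator_generator (g q) (h q) q W"
      by (rule denominator_generator_cong[OF N(5)[OF qN] hol_atI[OF N(3) qN] N(4)[OF qN] hol_at_data(2,3)
            hol_atI[OF N(2) qN] hol_at_data(1)]) (use S(4) q in blast)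
  qed
qed

text \<open>A solution \<open>W\<close> of the Cousin problem generates the ideal of denominators at
  every point of a neighbourhood. Being itself a denominator, it has local numerators
  \<open>W * g q / h q\<close>, and these are unique and glue to \<open>G\<close>.\<close>

theorem quotient_on_box:
  assumes "x0 \<le> x1" "y0 \<le> y1" "u0 \<le> u1" "v0 \<le> v1"
  obtains N W G where "rect2 (bx x0 x1 y0 y1) (bx u0 u1 v0 v1) \<subseteq> N" "holo_Cn N W" "holo_Cn N G"
    "\<And>q. q \<in> N \<Longrightarrow> \<not> zero_germ W q"
    "\<And>q. q \<in> N \<Longrightarrow> eventually (\<lambda>x. g q x * W x = G x * h q x) (nhds q)"
    "\<And>q. q \<in> N \<Longrightarrow> h q q \<noteq> 0 \<Longrightarrow> W q \<noteq> 0"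
proof -
  obtain N W where N: "rect2 (bx x0 x1 y0 y1) (bx u0 u1 v0 v1) \<subseteq> N" "holo_Cn N W"
      "\<And>q. q \<in> N \<Longrightarrow> denominator_generator (g q) (h q) q W"
    using solvable_box[OF assms] unfolding solvable_def by blast
  have opN: "open N" by (rule holo_Cn_open[OF N(2)])
  have "\<forall>q\<in>N. \<exists>G. hol_at G q \<and> eventually (\<lambda>x. W x * g q x = h q x * G x) (nhds q)"
    using N(3) unfolding denominator_generator_def by blast
  then obtain u where u: "\<And>q. q \<in> N \<Longrightarrow> hol_at (u q) q"
      "\<And>q. q \<in> N \<Longrightarrow> eventually (\<lambda>x. W x * g q x = h q x * u q x) (nhds q)" by metis
  have near: "eventually (\<lambda>x. x \<in> N \<longrightarrow> u x x = u q x) (nhds q)" if q: "q \<in> N" for q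
  proof -
    obtain M where M: "q \<in> M" "holo_Cn M (g q)" "holo_Cn M (h q)"
      "\<And>x. x \<in> M \<Longrightarrow> \<not> zero_germ (h q) x"
      "\<And>x. x \<in> M \<Longrightarrow> eventually (\<lambda>y. g q y * h x y = g x y * h q y) (nhds x)" using data[of q] by blast
    have "eventually (\<lambda>x. x \<in> M) (nhds q)"
      using M(1) holo_Cn_open[OF M(2)] by (rule eventually_nhds_in_open[rotated])
    moreover have "eventually (\<lambda>x. hol_at (u q) x) (nhds q)" by (rule eventually_hol_at[OF u(1)[OF q]])
    moreover have "eventually (\<lambda>x. eventually (\<lambda>y. W y * g q y = h q y * u q y) (nhds x)) (nhds q)"
      using u(2)[OF q] by (simp add: eventually_eventually)
    ultimately show ?thesis
    proof eventually_elim
      case (elim x)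
      show ?case
      proof
        assume x: "x \<in> N"
        have hx: "hol_at (h x) x" "\<not> zero_germ (h x) x" by (rule hol_at_data)+
        have "eventually (\<lambda>y. W y * g x y = h x y * u q y) (nhds x)"
          by (rule relation_transfer[OF M(5)[OF elim(1)] hol_atI[OF M(3) elim(1)] M(4)[OF elim(1)]
                hol_at_data(1,2) hol_atI[OF N(2) x] elim(2,3)])
        then have "eventually (\<lambda>y. h x y * u x y = h x y * u q y) (nhds x)"
          using u(2)[OF x] by eventually_elim simp
        then have "eventually (\<lambda>y. u x y = u q y) (nhds x)"
          by (rule germ_cancel[OF hx u(1)[OF x] elim(2)])
        then show "u x x = u q x" by (rule eventually_nhds_x_imp_x)
      qed
    qed
  qed
  have holG: "holo_Cn N (\<lambda>x. u x x)" by (rule glue_holo[OF opN u(1) near])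
  show ?thesis
  proof (rule that[OF N(1,2) holG])
    fix q assume q: "q \<in> N"
    show "\<not> zero_germ W q" using N(3)[OF q] by (simp add: denominator_generator_def)
    have "eventually (\<lambda>x. x \<in> N) (nhds q)" using q opN by (rule eventually_nhds_in_open[rotated])
    then show "eventually (\<lambda>x. g q x * W x = u x x * h q x) (nhds q)"
      using near[OF q] u(2)[OF q] by eventually_elim (simp add: mult.commute)
    assume hq: "h q q \<noteq> 0"
    \<comment> \<open>\<open>h q\<close> is itself a denominator, hence a multiple of
      \<open>W\<close>; so \<open>W\<close> cannot vanish where \<open>h q\<close> does not.\<close>
    have "eventually (\<lambda>x. h q x * g q x = h q x * g q x) (nhds q)" by simp
    then obtain U where "eventually (\<lambda>x. h q x = U x * W x) (nhds q)"
      using N(3)[OF q] hol_at_data[of q] unfolding denominator_generator_def by blast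
    then have "h q q = U q * W q" by (rule eventually_nhds_x_imp_x)
    then show "W q \<noteq> 0" using hq by auto
  qed
qed

end

section \<open>Algebras of functions and polynomial approximation\<close>

text \<open>Polynomials are kept as functions over arbitrary generators, so that the same inductions
  serve polynomials on C^2, polynomials in a pair of points, and rational expressions.\<close>

inductive_set fun_alg :: "('b \<Rightarrow> complex) set \<Rightarrow> ('b \<Rightarrow> complex) set" for A where
  const: "(\<lambda>_. c) \<in> fun_alg A"
| gen: "f \<in> A \<Longrightarrow> f \<in> fun_alg A"
| add: "f \<in> fun_alg A \<Longrightarrow> f' \<in> fun_alg A \<Longrightarrow> (\<lambda>x. f x + f' x) \<in> fun_alg A"
| mult: "f \<in> fun_alg A \<Longrightarrow> f' \<in> fun_alg A \<Longrightarrow> (\<lambda>x. f x * f' x) \<in> fun_alg A"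

lemma fun_alg_uminus: "f \<in> fun_alg A \<Longrightarrow> (\<lambda>x. - f x) \<in> fun_alg A"
  using fun_alg.mult[OF fun_alg.const[of "-1"]] by fastforce

lemma fun_alg_diff: "f \<in> fun_alg A \<Longrightarrow> f' \<in> fun_alg A \<Longrightarrow> (\<lambda>x. f x - f' x) \<in> fun_alg A"
  using fun_alg.add[OF _ fun_alg_uminus[of f']] by force

lemma fun_alg_power: "f \<in> fun_alg A \<Longrightarrow> (\<lambda>x. f x ^ n) \<in> fun_alg A"
  by (induction n) (auto intro: fun_alg.intros)

lemma fun_alg_sum: "(\<And>i. i \<in> I \<Longrightarrow> f i \<in> fun_alg A) \<Longrightarrow> (\<lambda>x. \<Sum>i\<in>I. f i x) \<in> fun_alg A"
  by (induction I rule: infinite_finite_induct) (auto intro: fun_alg.intros)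

lemma fun_alg_substitute:
  assumes "f \<in> fun_alg A" "\<And>a. a \<in> A \<Longrightarrow> (\<lambda>x. a (\<phi> x)) \<in> fun_alg B"
  shows "(\<lambda>x. f (\<phi> x)) \<in> fun_alg B"
  using assms(1) by induction (auto intro: fun_alg.intros assms(2))

definition approximable :: "'b set \<Rightarrow> ('b \<Rightarrow> complex) set \<Rightarrow> ('b \<Rightarrow> complex) \<Rightarrow> bool" where
  "approximable S B f \<longleftrightarrow> (\<forall>\<epsilon>>0. \<exists>f'\<in>B. \<forall>x\<in>S. cmod (f x - f' x) < \<epsilon>)"

text \<open>Boundedness is carried through the induction because the error of a product is
  controlled by the size of its factors.\<close>

lemma fun_alg_approx:
  assumes "f \<in> fun_alg A"
    and A: "\<And>a. a \<in> A \<Longrightarrow> \<exists>M. \<forall>x\<in>S. cmod (a x) \<le> M" "\<And>a. a \<in> A \<Longrightarrow> approximable S (fun_alg B) a"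
  shows "(\<exists>M. \<forall>x\<in>S. cmod (f x) \<le> M) \<and> approximable S (fun_alg B) f"
  using assms(1)
proof induction
  case (const c)
  have "approximable S (fun_alg B) (\<lambda>_. c)"
    unfolding approximable_def by (auto intro!: bexI[of _ "\<lambda>_. c"] fun_alg.const)
  then show ?case by auto
next
  case (gen f)
  then show ?case using A by auto
next
  case (add f f')
  then obtain M M' where M: "\<forall>x\<in>S. cmod (f x) \<le> M" "\<forall>x\<in>S. cmod (f' x) \<le> M'" by blast
  have "approximable S (fun_alg B) (\<lambda>x. f x + f' x)"
    unfolding approximable_def
  proof (intro allI impI)
    fix \<epsilon> :: real assume "\<epsilon> > 0"
    then have "\<epsilon> / 2 > 0" by simp
    then obtain g g' where g: "g \<in> fun_alg B" "\<forall>x\<in>S. cmod (f x - g x) < \<epsilon> / 2"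
      "g' \<in> fun_alg B" "\<forall>x\<in>S. cmod (f' x - g' x) < \<epsilon> / 2" using add.IH unfolding approximable_def by meson
    show "\<exists>k\<in>fun_alg B. \<forall>x\<in>S. cmod (f x + f' x - k x) < \<epsilon>"
    proof (rule bexI[OF _ fun_alg.add[OF g(1,3)]], rule ballI)
      fix x assume "x \<in> S"
      then have "cmod ((f x - g x) + (f' x - g' x)) < \<epsilon> / 2 + \<epsilon> / 2"
        using g by (intro norm_triangle_lt add_strict_mono) auto
      then show "cmod (f x + f' x - (g x + g' x)) < \<epsilon>" by (simp add: algebra_simps)
    qed
  qed
  moreover have "\<forall>x\<in>S. cmod (f x + f' x) \<le> M + M'"
    using M by (intro ballI order_trans[OF norm_triangle_ineq] add_mono) auto
  ultimately show ?case by blast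
next
  case (mult f f')
  then obtain M0 M0' where M0: "\<forall>x\<in>S. cmod (f x) \<le> M0" "\<forall>x\<in>S. cmod (f' x) \<le> M0'" by blast
  define M where "M = max 1 (max M0 M0')"
  have M: "\<And>x. x \<in> S \<Longrightarrow> cmod (f x) \<le> M" "\<And>x. x \<in> S \<Longrightarrow> cmod (f' x) \<le> M" "M \<ge> 1"
    using M0 by (force simp: M_def)+
  have "approximable S (fun_alg B) (\<lambda>x. f x * f' x)"
    unfolding approximable_def
  proof (intro allI impI)
    fix \<epsilon> :: real assume \<epsilon>: "\<epsilon> > 0"
    \<comment> \<open>With \<open>M \<ge> 1\<close> and \<open>\<delta> \<le> 1\<close> the
      approximant \<open>g'\<close> is bounded by \<open>2 * M\<close>, so the error of the product
      is at most \<open>3 * M * \<delta>\<close>, which is below \<open>\<epsilon>\<close>.\<close>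
    define \<delta> where "\<delta> = min 1 (\<epsilon> / (4 * M))"
    have \<delta>: "\<delta> > 0" "\<delta> \<le> 1" "4 * M * \<delta> \<le> \<epsilon>" using \<epsilon> M(3) by (auto simp: \<delta>_def min_def field_simps)
    obtain g g' where g: "g \<in> fun_alg B" "\<forall>x\<in>S. cmod (f x - g x) < \<delta>"
      "g' \<in> fun_alg B" "\<forall>x\<in>S. cmod (f' x - g' x) < \<delta>" using mult.IH \<delta>(1) unfolding approximable_def by meson
    show "\<exists>k\<in>fun_alg B. \<forall>x\<in>S. cmod (f x * f' x - k x) < \<epsilon>"
    proof (rule bexI[OF _ fun_alg.mult[OF g(1,3)]], rule ballI)
      fix x assume x: "x \<in> S"
      have "cmod (g' x) \<le> cmod (f' x) + cmod (f' x - g' x)"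
        using norm_triangle_sub[of "g' x" "f' x"] by (simp add: norm_minus_commute)
      also have "\<dots> \<le> M + 1" using M(2)[OF x] g(4) x \<delta>(2) by (intro add_mono) force+
      finally have g'M: "cmod (g' x) \<le> 2 * M" using M(3) by simp
      have "f x * f' x - g x * g' x = f x * (f' x - g' x) + (f x - g x) * g' x" by (simp add: algebra_simps)
      also have "cmod \<dots> \<le> cmod (f x) * cmod (f' x - g' x) + cmod (f x - g x) * cmod (g' x)"
        using norm_triangle_ineq by (simp flip: norm_mult)
      also have "\<dots> \<le> M * \<delta> + \<delta> * (2 * M)"
        using M(1)[OF x] M(3) g(2,4) x g'M \<delta>(1) by (intro add_mono mult_mono) (auto intro: less_imp_le)
      also have "\<dots> < \<epsilon>"
      proof -
        have "0 < M * \<delta>" using M(3) \<delta>(1) by simp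
        then show ?thesis using \<delta>(3) by (simp add: algebra_simps)
      qed
      finally show "cmod (f x * f' x - g x * g' x) < \<epsilon>" .
    qed
  qed
  moreover have "\<forall>x\<in>S. cmod (f x * f' x) \<le> M * M"
    using M by (auto simp: norm_mult intro!: mult_mono order_trans[OF norm_ge_zero])
  ultimately show ?case by blast
qed

definition poly2 :: "(complex^2 \<Rightarrow> complex) set" where
  "poly2 = fun_alg (range (\<lambda>i p. p $ i))"

lemma poly2_nth: "(\<lambda>p. p $ i) \<in> poly2"
  unfolding poly2_def by (rule fun_alg.gen) simp

lemma poly2_holo: "P \<in> poly2 \<Longrightarrow> holo_Cn UNIV P"
  unfolding poly2_def by (induction rule: fun_alg.induct) (auto intro!: holo_Cn_intros)

text \<open>Summing the geometric series inside Cauchy's formula leaves the remainder integrand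
  \<open>g s * (w / s) ^ N / (s - w)\<close>, which is estimated on the circle of radius
  \<open>\<rho>\<close>.\<close>

lemma cauchy_taylor_tail:
  assumes g: "g holomorphic_on ball 0 R" and r: "0 \<le> r" "r < \<rho>" "\<rho> < R"
    and M: "\<And>s. s \<in> sphere 0 \<rho> \<Longrightarrow> cmod (g s) \<le> M" and w: "w \<in> cball 0 r"
  shows "cmod (g w - (\<Sum>n<N. contour_integral (circlepath 0 \<rho>) (\<lambda>s. g s / s ^ Suc n) / (2 * pi * \<i>) * w ^ n))
    \<le> M * \<rho> / (\<rho> - r) * (r / \<rho>) ^ N"
proof -
  let ?C = "circlepath 0 \<rho>"
  have \<rho>: "\<rho> > 0" using r by simp
  have pim: "path_image ?C = sphere 0 \<rho>" using \<rho> by simp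
  have gc: "g holomorphic_on cball 0 \<rho>" by (rule holomorphic_on_subset[OF g]) (use r in auto)
  have gs: "continuous_on (sphere 0 \<rho>) g"
    by (rule continuous_on_subset[OF holomorphic_on_imp_continuous_on[OF gc]]) auto
  have nz: "s \<noteq> 0" "s \<noteq> w" if "s \<in> sphere 0 \<rho>" for s using that w r by auto
  have 1: "((\<lambda>s. g s / (s - w)) has_contour_integral (2 * of_real pi * \<i> * g w)) ?C"
    using w r by (intro Cauchy_integral_circlepath_simple[OF gc]) (auto simp: norm_minus_commute)
  have ci: "((\<lambda>s. g s / s ^ Suc n) has_contour_integral contour_integral ?C (\<lambda>s. g s / s ^ Suc n)) ?C" for n
    by (intro has_contour_integral_integral contour_integrable_smooth smooth_circlepath)
       (unfold pim, intro continuous_intros gs, use nz in auto)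
  have 2: "((\<lambda>s. \<Sum>n<N. g s / s ^ Suc n * w ^ n) has_contour_integral
      (\<Sum>n<N. contour_integral ?C (\<lambda>s. g s / s ^ Suc n) * w ^ n)) ?C"
    by (intro has_contour_integral_sum has_contour_integral_rmul ci) auto
  have geo: "g s / (s - w) - (\<Sum>n<N. g s / s ^ Suc n * w ^ n) = g s * (w / s) ^ N / (s - w)"
    if s: "s \<in> sphere 0 \<rho>" for s
  proof -
    have sw: "s - w \<noteq> 0" "s \<noteq> 0" using nz[OF s] by auto
    have "(\<Sum>n<N. g s / s ^ Suc n * w ^ n) = g s / s * (\<Sum>n<N. (w / s) ^ n)"
      by (simp add: sum_distrib_left power_divide mult_ac)
    also have "(\<Sum>n<N. (w / s) ^ n) = (1 - (w / s) ^ N) / (1 - w / s)"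
      using sw by (subst geometric_sum) (auto simp: field_simps)
    also have "g s / s * \<dots> = g s * (1 - (w / s) ^ N) / (s - w)"
      using sw by (simp add: divide_simps)
    finally show ?thesis by (simp add: diff_divide_distrib[symmetric] algebra_simps)
  qed
  have "((\<lambda>s. g s / (s - w) - (\<Sum>n<N. g s / s ^ Suc n * w ^ n)) has_contour_integral
     (2 * of_real pi * \<i> * g w - (\<Sum>n<N. contour_integral ?C (\<lambda>s. g s / s ^ Suc n) * w ^ n))) ?C"
    by (rule has_contour_integral_diff[OF 1 2])
  then have 3: "((\<lambda>s. g s * (w / s) ^ N / (s - w)) has_contour_integral
     (2 * of_real pi * \<i> * g w - (\<Sum>n<N. contour_integral ?C (\<lambda>s. g s / s ^ Suc n) * w ^ n))) ?C"
    by (rule has_contour_integral_eq) (simp only: pim geo)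
  define Z where "Z = g w - (\<Sum>n<N. contour_integral ?C (\<lambda>s. g s / s ^ Suc n) / (2 * pi * \<i>) * w ^ n)"
  have M0: "M \<ge> 0" using order_trans[OF norm_ge_zero M[of "of_real \<rho>"]] \<rho> by simp
  have "cmod (2 * of_real pi * \<i> * g w - (\<Sum>n<N. contour_integral ?C (\<lambda>s. g s / s ^ Suc n) * w ^ n))
      \<le> (M * (r / \<rho>) ^ N / (\<rho> - r)) * (2 * pi * \<rho>)"
  proof (rule has_contour_integral_bound_circlepath[OF 3])
    show "0 \<le> M * (r / \<rho>) ^ N / (\<rho> - r)" using M0 r \<rho> by simp
    fix s :: complex assume "cmod (s - 0) = \<rho>"
    then have s: "s \<in> sphere 0 \<rho>" "cmod s = \<rho>" by auto
    have "cmod (s - w) \<ge> \<rho> - r" using norm_triangle_ineq2[of s w] w s(2) by simp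
    moreover have "cmod ((w / s) ^ N) \<le> (r / \<rho>) ^ N"
      using w s(2) \<rho> by (auto simp: norm_power norm_divide intro!: power_mono divide_right_mono)
    ultimately show "cmod (g s * (w / s) ^ N / (s - w)) \<le> M * (r / \<rho>) ^ N / (\<rho> - r)"
      unfolding norm_divide norm_mult
      using M[OF s(1)] M0 r by (intro frac_le mult_mono) auto
  qed (use \<rho> in simp)
  also have "2 * of_real pi * \<i> * g w - (\<Sum>n<N. contour_integral ?C (\<lambda>s. g s / s ^ Suc n) * w ^ n)
     = 2 * of_real pi * \<i> * Z"
    by (simp add: Z_def right_diff_distrib sum_distrib_left)
  finally have "2 * pi * cmod Z \<le> 2 * pi * (M * \<rho> / (\<rho> - r) * (r / \<rho>) ^ N)"
    by (simp add: norm_mult mult_ac)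
  then show ?thesis unfolding Z_def[symmetric] by (rule mult_left_le_imp_le) simp
qed

lemma taylor_tail_small:
  assumes "0 \<le> r" "r < \<rho>" "(\<epsilon>::real) > 0" obtains N :: nat where "M * \<rho> / (\<rho> - r) * (r / \<rho>) ^ N < \<epsilon>"
proof -
  have "(\<lambda>N. M * \<rho> / (\<rho> - r) * (r / \<rho>) ^ N) \<longlonglongrightarrow> M * \<rho> / (\<rho> - r) * 0"
    using assms by (intro tendsto_intros LIMSEQ_power_zero) auto
  then have "eventually (\<lambda>N. M * \<rho> / (\<rho> - r) * (r / \<rho>) ^ N < \<epsilon>) sequentially"
    using assms(3) by (intro order_tendstoD) auto
  then show ?thesis using that by (auto simp: eventually_sequentially)
qed

text \<open>Two one-variable Taylor expansions: first in the second variable, with coefficients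
  \<open>C n\<close> holomorphic in the first, then of each \<open>C n\<close>. Inserting the second
  expansion into the first is a change of generators of the algebra.\<close>

theorem poly2_dense:
  assumes f: "holo_Cn (rect2 (ball 0 R) (ball 0 R)) f" and r: "0 < r" "r < R"
  shows "approximable (rect2 (cball 0 r) (cball 0 r)) poly2 f"
  unfolding approximable_def
proof (intro allI impI)
  fix \<epsilon> :: real assume \<epsilon>: "\<epsilon> > 0"
  define \<rho> where "\<rho> = (r + R) / 2"
  have \<rho>: "r < \<rho>" "\<rho> < R" "\<rho> > 0" using r by (auto simp: \<rho>_def)
  let ?C = "circlepath 0 \<rho>" and ?K = "rect2 (cball 0 r) (cball 0 r)"
  have pim: "path_image ?C = sphere 0 \<rho>" using \<rho> by simp
  define C where "C n z = contour_integral ?C (\<lambda>s. f (pt z s) / s ^ Suc n) / (2 * pi * \<i>)" for n z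
  have holC: "C n holomorphic_on ball 0 R" for n
  proof -
    have "(\<lambda>z. contour_integral ?C (\<lambda>s. f (pt z s) / s ^ Suc n)) holomorphic_on ball 0 R"
    proof (rule contour_integral_holomorphic_param[OF open_ball _ _ smooth_circlepath])
      have "continuous_on (ball 0 R \<times> sphere 0 \<rho>) (\<lambda>x. f (pt (fst x) (snd x)))"
        by (rule continuous_on_compose2[OF holo_Cn_continuous_on[OF f]])
           (use \<rho> in \<open>auto intro!: continuous_intros\<close>)
      then show "continuous_on (ball 0 R \<times> path_image ?C) (\<lambda>(z, s). f (pt z s) / s ^ Suc n)"
        unfolding pim split_beta by (intro continuous_intros) (use \<rho> in auto)
      fix s assume "s \<in> path_image ?C"
      then have s: "s \<in> sphere 0 \<rho>" by (simp only: pim)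
      have "(\<lambda>z. f (pt z s)) holomorphic_on ball 0 R" by (rule holo_slice1[OF f]) (use s \<rho> in auto)
      then show "(\<lambda>z. f (pt z s) / s ^ Suc n) holomorphic_on ball 0 R"
        by (intro holomorphic_intros) (use s \<rho> in auto)
    qed
    then show ?thesis unfolding C_def by (intro holomorphic_intros) auto
  qed
  have bnd: "\<exists>M. \<forall>x\<in>K. cmod (k x) \<le> M" if "compact K" "continuous_on K k" for K and k :: "'b::topological_space \<Rightarrow> complex"
    using compact_imp_bounded[OF compact_continuous_image[OF that(2,1)]] unfolding bounded_iff by blast
  have "compact (rect2 (cball 0 r) (sphere 0 \<rho>))" by (intro compact_rect2) auto
  moreover have "continuous_on (rect2 (cball 0 r) (sphere 0 \<rho>)) f"
    by (rule continuous_on_subset[OF holo_Cn_continuous_on[OF f]]) (use r \<rho> in auto)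
  ultimately obtain M where M: "\<forall>x\<in>rect2 (cball 0 r) (sphere 0 \<rho>). cmod (f x) \<le> M" using bnd by blast
  have r0: "0 \<le> r" using r by simp
  have \<epsilon>2: "\<epsilon> / 2 > 0" using \<epsilon> by simp
  obtain N where N: "M * \<rho> / (\<rho> - r) * (r / \<rho>) ^ N < \<epsilon> / 2"
    using taylor_tail_small[OF r0 \<rho>(1) \<epsilon>2] by blast
  define f1 where "f1 p = (\<Sum>n<N. C n (p $ 1) * (p $ 2) ^ n)" for p :: "complex^2"
  have f1: "cmod (f p - f1 p) < \<epsilon> / 2" if p: "p \<in> ?K" for p
  proof -
    have "(\<lambda>w. f (pt (p $ 1) w)) holomorphic_on ball 0 R" by (rule holo_slice2[OF f]) (use p r in auto)
    then have "cmod (f (pt (p $ 1) (p $ 2)) - f1 p) \<le> M * \<rho> / (\<rho> - r) * (r / \<rho>) ^ N"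
      unfolding f1_def C_def
      by (rule cauchy_taylor_tail[OF _ r0 \<rho>(1,2)]) (use M p in auto)
    from le_less_trans[OF this N] show ?thesis by (simp only: pt_eta)
  qed
  define A where "A = range (\<lambda>n p. C n (p $ 1)) \<union> range (\<lambda>i (p::complex^2). p $ i)"
  have "f1 \<in> fun_alg A"
    unfolding f1_def A_def
    by (intro fun_alg_sum fun_alg.mult fun_alg_power) (auto intro!: fun_alg.gen)
  moreover have "\<exists>M. \<forall>x\<in>?K. cmod (a x) \<le> M" if "a \<in> A" for a
  proof (rule bnd)
    show "compact ?K" by (intro compact_rect2) auto
    have "continuous_on ?K (\<lambda>p. C n (p $ 1))" for n
      by (rule continuous_on_compose2[OF holomorphic_on_imp_continuous_on[OF holC]])
         (use r in \<open>auto intro!: continuous_intros\<close>)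
    with that show "continuous_on ?K a" by (auto simp: A_def intro!: continuous_intros)
  qed
  moreover have "approximable ?K (fun_alg (range (\<lambda>i p. p $ i))) a" if aA: "a \<in> A" for a
  proof -
    consider n where "a = (\<lambda>p. C n (p $ 1))" | i where "a = (\<lambda>p. p $ i)" using aA unfolding A_def by blast
    then show ?thesis
    proof cases
      case 2
      then show ?thesis unfolding approximable_def by (auto intro!: bexI[of _ a] fun_alg.gen)
    next
      case 1
      show ?thesis
        unfolding approximable_def
      proof (intro allI impI)
        fix \<epsilon> :: real assume \<epsilon>: "\<epsilon> > 0"
        have "continuous_on (sphere 0 \<rho>) (C n)"
          by (rule continuous_on_subset[OF holomorphic_on_imp_continuous_on[OF holC]]) (use \<rho> in auto)
        then obtain L where L: "\<forall>x\<in>sphere 0 \<rho>. cmod (C n x) \<le> L" using bnd[OF compact_sphere] by blast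
        obtain k where k: "L * \<rho> / (\<rho> - r) * (r / \<rho>) ^ k < \<epsilon>" using taylor_tail_small[OF r0 \<rho>(1) \<epsilon>] by blast
        define P where "P p = (\<Sum>n'<k. contour_integral ?C (\<lambda>s. C n s / s ^ Suc n') / (2 * pi * \<i>) * (p $ 1) ^ n')"
          for p :: "complex^2"
        have "P \<in> fun_alg (range (\<lambda>i p. p $ i))"
          unfolding P_def by (intro fun_alg_sum fun_alg.mult fun_alg_power fun_alg.const) (auto intro!: fun_alg.gen)
        moreover have "cmod (a p - P p) < \<epsilon>" if p: "p \<in> ?K" for p
        proof -
          have "cmod (C n (p $ 1) - P p) \<le> L * \<rho> / (\<rho> - r) * (r / \<rho>) ^ k"
            unfolding P_def by (rule cauchy_taylor_tail[OF holC r0 \<rho>(1,2)]) (use L p in auto)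
          from le_less_trans[OF this k] 1 show ?thesis by simp
        qed
        ultimately show "\<exists>f'\<in>fun_alg (range (\<lambda>i p. p $ i)). \<forall>x\<in>?K. cmod (a x - f' x) < \<epsilon>" by blast
      qed
    qed
  qed
  ultimately have "approximable ?K poly2 f1" unfolding poly2_def using fun_alg_approx[of f1 A ?K] by blast
  then obtain P where P: "P \<in> poly2" "\<forall>x\<in>?K. cmod (f1 x - P x) < \<epsilon> / 2"
    using \<epsilon>2 unfolding approximable_def by blast
  have "cmod (f x - P x) < \<epsilon>" if "x \<in> ?K" for x
    using norm_triangle_lt[of "f x - f1 x" "f1 x - P x" \<epsilon>] f1[OF that] P(2) that by force
  with P(1) show "\<exists>P\<in>poly2. \<forall>x\<in>?K. cmod (f x - P x) < \<epsilon>" by blast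
qed

section \<open>Open subsets biholomorphic to the complex plane squared\<close>

lemma chart_inj:
  assumes "complex_manifold X" "(U, \<phi>) \<in> atlas X"
  shows "is_chart (mtop X) U \<phi>" "openin (mtop X) U" "inj_on \<phi> U"
proof -
  show 1: "is_chart (mtop X) U \<phi>" using assms by (auto simp: complex_manifold_def)
  then show 2: "openin (mtop X) U" by (simp add: is_chart_def)
  have "inj_on \<phi> (topspace (subtopology (mtop X) U))"
    using 1 homeomorphic_imp_injective_map unfolding is_chart_def by blast
  moreover have "topspace (subtopology (mtop X) U) = U" using openin_subset[OF 2] by auto
  ultimately show "inj_on \<phi> U" by simp
qed

lemma chart_at:
  assumes "complex_manifold X" "p \<in> topspace (mtop X)"
  shows "\<exists>U \<phi>. (U, \<phi>) \<in> atlas X \<and> p \<in> U"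
proof -
  have "p \<in> \<Union> (fst ` atlas X)" using assms by (simp add: complex_manifold_def)
  then obtain c where "c \<in> atlas X" "p \<in> fst c" by blast
  then show ?thesis by (intro exI[of _ "fst c"] exI[of _ "snd c"]) simp
qed

lemma holo_fun_subset:
  assumes X: "complex_manifold X" and f: "holo_fun X W f" and W': "openin (mtop X) W'" "W' \<subseteq> W"
  shows "holo_fun X W' f"
  unfolding holo_fun_def
proof (intro conjI W' ballI, clarify)
  fix U \<phi> assume U: "(U, \<phi>) \<in> atlas X"
  show "holo_Cn (\<phi> ` (U \<inter> W')) (f \<circ> inv_into U \<phi>)"
  proof (rule holo_Cn_subset)
    show "holo_Cn (\<phi> ` (U \<inter> W)) (f \<circ> inv_into U \<phi>)" using f U by (auto simp: holo_fun_def)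
    show "open (\<phi> ` (U \<inter> W'))" by (rule is_chart_Int[OF chart_inj(1)[OF X U] W'(1)])
  qed (use W'(2) in blast)
qed

lemma holo_fun_open_submfd:
  assumes X: "complex_manifold X" and S: "openin (mtop X) S"
  shows "holo_fun (open_submfd X S) W f \<longleftrightarrow> W \<subseteq> S \<and> holo_fun X W f"
proof -
  have top: "openin (mtop (open_submfd X S)) W \<longleftrightarrow> openin (mtop X) W \<and> W \<subseteq> S"
    using S by (simp add: open_submfd_def openin_open_subtopology)
  have eq: "holo_Cn (\<phi> ` (U \<inter> S \<inter> W)) (f \<circ> inv_into (U \<inter> S) \<phi>) \<longleftrightarrow> holo_Cn (\<phi> ` (U \<inter> W)) (f \<circ> inv_into U \<phi>)"
    if U: "(U, \<phi>) \<in> atlas X" and W: "W \<subseteq> S" for U \<phi>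
  proof -
    have *: "(f \<circ> inv_into (U \<inter> S) \<phi>) z = (f \<circ> inv_into U \<phi>) z" if "z \<in> \<phi> ` (U \<inter> W)" for z
    proof -
      obtain x where x: "x \<in> U" "x \<in> W" "z = \<phi> x" using \<open>z \<in> _\<close> by blast
      then show ?thesis using chart_inj(3)[OF X U] W inj_on_subset[of \<phi> U "U \<inter> S"]
        by (auto simp: inv_into_f_f)
    qed
    have "U \<inter> S \<inter> W = U \<inter> W" using W by blast
    then show ?thesis using holo_Cn_cong[of "\<phi> ` (U \<inter> W)"] * by metis
  qed
  show ?thesis
  proof
    assume h: "holo_fun (open_submfd X S) W f"
    then have W: "openin (mtop X) W" "W \<subseteq> S" using top by (auto simp: holo_fun_def)
    have "holo_Cn (\<phi> ` (U \<inter> W)) (f \<circ> inv_into U \<phi>)" if U: "(U, \<phi>) \<in> atlas X" for U \<phi>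
    proof -
      have "(U \<inter> S, \<phi>) \<in> atlas (open_submfd X S)" using U by (force simp: open_submfd_def)
      then show ?thesis using h eq[OF U W(2)] by (auto simp: holo_fun_def)
    qed
    with W show "W \<subseteq> S \<and> holo_fun X W f" by (auto simp: holo_fun_def)
  next
    assume h: "W \<subseteq> S \<and> holo_fun X W f"
    then show "holo_fun (open_submfd X S) W f"
      using top eq unfolding holo_fun_def by (auto simp: open_submfd_def)
  qed
qed

text \<open>A biholomorphic copy of C^2 in \<open>X\<close>, recorded through the transport of open
  sets and holomorphic functions, so that germs, quotients and compact sets in \<open>S\<close> can
  be treated on C^2.\<close>

locale plane_chart =
  fixes X :: "('a, 2) cmfd" and S :: "'a set" and F :: "'a \<Rightarrow> complex^2" and G :: "complex^2 \<Rightarrow> 'a"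
  assumes X: "complex_manifold X" and S: "openin (mtop X) S"
    and GS: "G y \<in> S" and GF: "x \<in> S \<Longrightarrow> G (F x) = x" and FG: "F (G y) = y"
    and open_image: "openin (mtop X) W \<Longrightarrow> W \<subseteq> S \<Longrightarrow> open (F ` W)"
    and open_preimage: "open V \<Longrightarrow> openin (mtop X) (S \<inter> F -` V)"
    and holo_iff: "openin (mtop X) W \<Longrightarrow> W \<subseteq> S \<Longrightarrow> holo_fun X W f \<longleftrightarrow> holo_Cn (F ` W) (\<lambda>y. f (G y))"

lemma plane_chart_exists:
  fixes X :: "('a, 2) cmfd"
  assumes X: "complex_manifold X" and S: "openin (mtop X) S"
    and bih: "biholomorphic (open_submfd X S) (complex_space :: (complex^2, 2) cmfd)"
  obtains F G where "plane_chart X S F G"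
proof -
  obtain F G where F: "holo_map (open_submfd X S) complex_space F" and G: "holo_map complex_space (open_submfd X S) G"
    and inv: "\<forall>x\<in>topspace (mtop (open_submfd X S)). G (F x) = x"
      "\<forall>y\<in>topspace (mtop (complex_space :: (complex^2, 2) cmfd)). F (G y) = y"
    using bih unfolding biholomorphic_def by blast
  have ts: "topspace (mtop (open_submfd X S)) = S"
    using openin_subset[OF S] by (auto simp: open_submfd_def)
  have GF: "G (F x) = x" if "x \<in> S" for x using inv(1) ts that by auto
  have FG: "F (G y) = y" for y using inv(2) by (simp add: complex_space_def)
  have cF: "continuous_map (subtopology (mtop X) S) euclidean F"
    using F by (simp add: holo_map_def open_submfd_def complex_space_def)
  have cG: "continuous_map euclidean (subtopology (mtop X) S) G"
    using G by (simp add: holo_map_def open_submfd_def complex_space_def)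
  have GS: "G y \<in> S" for y using cG by (auto simp: continuous_map_def Pi_iff)
  have im: "F ` W = G -` W" if "W \<subseteq> S" for W
  proof (intro equalityI subsetI)
    fix y assume "y \<in> F ` W" then show "y \<in> G -` W" using GF that by auto
  next
    fix y assume "y \<in> G -` W" then show "y \<in> F ` W" using FG[of y] by (metis imageI vimage_eq)
  qed
  have opG: "open (G -` W)" if "openin (mtop X) W" for W
  proof -
    have "openin euclidean {y \<in> topspace euclidean. G y \<in> W \<inter> S}"
      by (rule openin_continuous_map_preimage[OF cG]) (use that S in \<open>auto simp: openin_open_subtopology\<close>)
    then show ?thesis using GS by (simp add: vimage_def)
  qed
  have opF: "openin (mtop X) (S \<inter> F -` V)" if "open V" for V
  proof -
    have "openin (subtopology (mtop X) S) {x \<in> topspace (subtopology (mtop X) S). F x \<in> V}"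
      by (rule openin_continuous_map_preimage[OF cF]) (use that in simp)
    moreover have "{x \<in> topspace (subtopology (mtop X) S). F x \<in> V} = S \<inter> F -` V"
      using ts by (auto simp: open_submfd_def)
    ultimately show ?thesis using S by (simp add: openin_open_subtopology)
  qed
  have id: "inv_into UNIV (\<lambda>z::complex^2. z) = (\<lambda>z. z)"
    by (auto simp: fun_eq_iff intro!: inv_into_f_eq)
  have holG: "holo_Cn (G -` U) (\<lambda>y. \<phi> (G y) $ i)" if U: "(U, \<phi>) \<in> atlas X" for U \<phi> i
  proof -
    have "(U \<inter> S, \<phi>) \<in> atlas (open_submfd X S)" using U by (force simp: open_submfd_def)
    then have "holo_Cn_map ((\<lambda>z. z) ` (UNIV \<inter> G -` (U \<inter> S))) (\<phi> \<circ> G \<circ> inv_into UNIV (\<lambda>z. z))"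
      using G unfolding holo_map_def complex_space_def by fastforce
    moreover have "G -` (U \<inter> S) = G -` U" using GS by auto
    ultimately show ?thesis by (simp add: holo_Cn_map_def id o_def)
  qed
  have holF: "holo_Cn (\<phi> ` (U \<inter> S)) (\<lambda>z. F (inv_into (U \<inter> S) \<phi> z) $ i)" if U: "(U, \<phi>) \<in> atlas X" for U \<phi> i
  proof -
    have "(U \<inter> S, \<phi>) \<in> atlas (open_submfd X S)" using U by (force simp: open_submfd_def)
    then have "holo_Cn_map (\<phi> ` (U \<inter> S \<inter> F -` UNIV)) ((\<lambda>z. z) \<circ> F \<circ> inv_into (U \<inter> S) \<phi>)"
      using F unfolding holo_map_def complex_space_def by fastforce
    then show ?thesis by (simp add: holo_Cn_map_def o_def)
  qed
  have "holo_fun X W f \<longleftrightarrow> holo_Cn (F ` W) (\<lambda>y. f (G y))" if W: "openin (mtop X) W" "W \<subseteq> S" for W f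
  proof
    assume f: "holo_fun X W f"
    show "holo_Cn (F ` W) (\<lambda>y. f (G y))"
    proof (rule holo_Cn_local)
      fix y assume y: "y \<in> F ` W"
      then have Gy: "G y \<in> W" using im[OF W(2)] by auto
      then have "G y \<in> topspace (mtop X)" using openin_subset[OF W(1)] by blast
      then obtain U \<phi> where U: "(U, \<phi>) \<in> atlas X" "G y \<in> U" using chart_at[OF X] by blast
      have inj: "inj_on \<phi> U" by (rule chart_inj(3)[OF X U(1)])
      have op: "open (G -` (U \<inter> W))" using opG[of "U \<inter> W"] chart_inj(2)[OF X U(1)] W(1) by (simp add: openin_Int)
      have "holo_Cn (G -` (U \<inter> W)) (\<lambda>y. (f \<circ> inv_into U \<phi>) (\<phi> (G y)))"
      proof (rule holo_Cn_compose)
        show "holo_Cn (\<phi> ` (U \<inter> W)) (f \<circ> inv_into U \<phi>)" using f U by (auto simp: holo_fun_def)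
        show "holo_Cn (G -` (U \<inter> W)) (\<lambda>y. \<phi> (G y) $ i)" for i
          by (rule holo_Cn_subset[OF holG[OF U(1)] op]) auto
      qed auto
      then have "holo_Cn (G -` (U \<inter> W)) (\<lambda>y. f (G y))"
        by (rule holo_Cn_cong) (use inj in \<open>auto simp: inv_into_f_f\<close>)
      moreover have "G -` (U \<inter> W) \<subseteq> F ` W" using im[OF W(2)] by auto
      ultimately show "\<exists>N. y \<in> N \<and> N \<subseteq> F ` W \<and> holo_Cn N (\<lambda>y. f (G y))"
        by (intro exI[of _ "G -` (U \<inter> W)"] conjI) (use Gy U(2) in auto)
    qed
  next
    assume h: "holo_Cn (F ` W) (\<lambda>y. f (G y))"
    show "holo_fun X W f"
      unfolding holo_fun_def
    proof (intro conjI W ballI, clarify)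
      fix U \<phi> assume U: "(U, \<phi>) \<in> atlas X"
      have inj: "inj_on \<phi> U" by (rule chart_inj(3)[OF X U])
      then have inj': "inj_on \<phi> (U \<inter> S)" by (rule inj_on_subset) auto
      have op: "open (\<phi> ` (U \<inter> W))" by (rule is_chart_Int[OF chart_inj(1)[OF X U] W(1)])
      have "holo_Cn (\<phi> ` (U \<inter> W)) (\<lambda>z. f (G (F (inv_into (U \<inter> S) \<phi> z))))"
      proof (rule holo_Cn_compose[OF h])
        show "holo_Cn (\<phi> ` (U \<inter> W)) (\<lambda>z. F (inv_into (U \<inter> S) \<phi> z) $ i)" for i
          by (rule holo_Cn_subset[OF holF[OF U] op]) (use W(2) in auto)
        fix z assume "z \<in> \<phi> ` (U \<inter> W)"
        then obtain x where "x \<in> U" "x \<in> W" "z = \<phi> x" by blast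
        then show "F (inv_into (U \<inter> S) \<phi> z) \<in> F ` W" using inj' W(2) by (auto simp: inv_into_f_f)
      qed
      then show "holo_Cn (\<phi> ` (U \<inter> W)) (f \<circ> inv_into U \<phi>)"
      proof (rule holo_Cn_cong)
        fix z assume "z \<in> \<phi> ` (U \<inter> W)"
        then obtain x where "x \<in> U" "x \<in> W" "z = \<phi> x" by blast
        then show "f (G (F (inv_into (U \<inter> S) \<phi> z))) = (f \<circ> inv_into U \<phi>) z"
          using inj inj' W(2) GF by (auto simp: inv_into_f_f subset_iff)
      qed
    qed
  qed
  then have "plane_chart X S F G"
    using X S GS GF FG opF opG im by unfold_locales auto
  then show ?thesis by (rule that)
qed

context plane_chart
begin

lemma image_vimage: "W \<subseteq> S \<Longrightarrow> F ` W = G -` W"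
proof (intro equalityI subsetI)
  fix y assume "W \<subseteq> S" "y \<in> F ` W" then show "y \<in> G -` W" using GF by auto
next
  fix y assume "y \<in> G -` W" then show "y \<in> F ` W" using FG[of y] by (metis imageI vimage_eq)
qed

lemma S_top: "S \<subseteq> topspace (mtop X)"
  using S by (rule openin_subset)

lemma preimage_eq: "S \<inter> F -` V = G ` V"
  using GS GF FG by (auto simp: image_iff) metis

lemma open_G_image: "open V \<Longrightarrow> openin (mtop X) (G ` V)"
  using open_preimage[of V] preimage_eq by simp

lemma F_G_image: "F ` G ` V = V"
  using FG by (auto simp: image_iff)

lemma holo_G_image: "open V \<Longrightarrow> holo_fun X (G ` V) f \<longleftrightarrow> holo_Cn V (\<lambda>y. f (G y))"
  using holo_iff[OF open_G_image, of V f] GS F_G_image by auto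

lemma germ_eq_iff: "germ_eq X (G y) f g \<longleftrightarrow> eventually (\<lambda>x. f (G x) = g (G x)) (nhds y)"
proof
  assume "germ_eq X (G y) f g"
  then obtain W where W: "openin (mtop X) W" "G y \<in> W" "\<forall>q\<in>W. f q = g q" by (auto simp: germ_eq_def)
  have "open (F ` (W \<inter> S))" by (rule open_image) (use W S in auto)
  moreover have "y \<in> F ` (W \<inter> S)" using W(2) GS by (simp add: image_vimage)
  moreover have "f (G x) = g (G x)" if "x \<in> F ` (W \<inter> S)" for x using that W(3) by (simp add: image_vimage)
  ultimately show "eventually (\<lambda>x. f (G x) = g (G x)) (nhds y)" unfolding eventually_nhds by blast
next
  assume "eventually (\<lambda>x. f (G x) = g (G x)) (nhds y)"
  then obtain V where V: "open V" "y \<in> V" "\<forall>x\<in>V. f (G x) = g (G x)" unfolding eventually_nhds by blast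
  then show "germ_eq X (G y) f g"
    unfolding germ_eq_def by (intro exI[of _ "G ` V"]) (auto intro: open_G_image)
qed

lemma holo_near_iff: "holo_near X (G y) f \<longleftrightarrow> hol_at (\<lambda>x. f (G x)) y"
proof
  assume "holo_near X (G y) f"
  then obtain W where W: "G y \<in> W" "holo_fun X W f" by (auto simp: holo_near_def)
  have WS: "openin (mtop X) (W \<inter> S)" using W(2) S by (auto simp: holo_fun_def)
  have "holo_fun X (W \<inter> S) f" by (rule holo_fun_subset[OF X W(2) WS]) auto
  then have "holo_Cn (F ` (W \<inter> S)) (\<lambda>x. f (G x))" using holo_iff[OF WS] by auto
  then show "hol_at (\<lambda>x. f (G x)) y" by (rule hol_atI) (use W(1) GS in \<open>simp add: image_vimage\<close>)
next
  assume "hol_at (\<lambda>x. f (G x)) y"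
  then obtain N where N: "y \<in> N" "holo_Cn N (\<lambda>x. f (G x))" by (auto simp: hol_at_def)
  then have "holo_fun X (G ` N) f" using holo_G_image holo_Cn_open by blast
  with N show "holo_near X (G y) f" by (auto simp: holo_near_def)
qed

lemma germ_quotient_iff:
  "(f, k) \<in> germ_quotient X (G y) g h \<longleftrightarrow>
     hol_at (\<lambda>x. f (G x)) y \<and> hol_at (\<lambda>x. k (G x)) y \<and> \<not> zero_germ (\<lambda>x. k (G x)) y \<and>
     eventually (\<lambda>x. g (G x) * k (G x) = f (G x) * h (G x)) (nhds y)"
  by (simp add: germ_quotient_def holo_near_iff germ_eq_iff zero_germ_def)

text \<open>This is the transitivity of cross-multiplication, which rests on cancelling a non-zero
  germ.\<close>

lemma germ_quotient_cong:
  assumes hol: "hol_at (\<lambda>x. g (G x)) y" "hol_at (\<lambda>x. h (G x)) y" "hol_at (\<lambda>x. g' (G x)) y" "hol_at (\<lambda>x. h' (G x)) y"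
    and nz: "\<not> zero_germ (\<lambda>x. h (G x)) y" "\<not> zero_germ (\<lambda>x. h' (G x)) y"
    and eq: "eventually (\<lambda>x. g (G x) * h' (G x) = g' (G x) * h (G x)) (nhds y)"
  shows "germ_quotient X (G y) g h = germ_quotient X (G y) g' h'"
proof -
  have *: "(f, k) \<in> germ_quotient X (G y) g' h'"
    if fk: "(f, k) \<in> germ_quotient X (G y) g h" and hol: "hol_at (\<lambda>x. h (G x)) y" "hol_at (\<lambda>x. g' (G x)) y" "hol_at (\<lambda>x. h' (G x)) y"
      and nz: "\<not> zero_germ (\<lambda>x. h (G x)) y"
      and eq: "eventually (\<lambda>x. g (G x) * h' (G x) = g' (G x) * h (G x)) (nhds y)" for f k g h g' h'
  proof -
    have fk': "hol_at (\<lambda>x. f (G x)) y" "hol_at (\<lambda>x. k (G x)) y" "\<not> zero_germ (\<lambda>x. k (G x)) y"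
      "eventually (\<lambda>x. g (G x) * k (G x) = f (G x) * h (G x)) (nhds y)"
      using fk by (auto simp: germ_quotient_iff)
    have "eventually (\<lambda>x. h (G x) * (g' (G x) * k (G x)) = h (G x) * (f (G x) * h' (G x))) (nhds y)"
      using fk'(4) eq
    proof eventually_elim
      case (elim x)
      have "h (G x) * (g' (G x) * k (G x)) = (g' (G x) * h (G x)) * k (G x)" by (simp add: mult_ac)
      also have "\<dots> = h' (G x) * (g (G x) * k (G x))" by (simp add: elim(2)[symmetric] mult_ac)
      also have "\<dots> = h (G x) * (f (G x) * h' (G x))" by (simp add: elim(1) mult_ac)
      finally show ?case .
    qed
    then have "eventually (\<lambda>x. g' (G x) * k (G x) = f (G x) * h' (G x)) (nhds y)"
      by (rule germ_cancel[OF hol(1) nz, rotated 2]) (intro hol_at_mult fk' hol)+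
    with fk' show ?thesis by (simp add: germ_quotient_iff)
  qed
  have eq': "eventually (\<lambda>x. g' (G x) * h (G x) = g (G x) * h' (G x)) (nhds y)"
    using eq by eventually_elim simp
  show ?thesis
    using *[OF _ hol(2,3,4) nz(1) eq] *[OF _ hol(4,1,2) nz(2) eq'] by auto
qed

lemma germ_quotient_self:
  assumes "hol_at (\<lambda>x. g (G x)) y" "hol_at (\<lambda>x. h (G x)) y" "\<not> zero_germ (\<lambda>x. h (G x)) y"
  shows "(g, h) \<in> germ_quotient X (G y) g h"
  using assms by (simp add: germ_quotient_iff)

lemma submfd_holo_near: "p \<in> S \<Longrightarrow> holo_near (open_submfd X S) p f \<longleftrightarrow> holo_near X p f"
proof
  assume "p \<in> S" "holo_near (open_submfd X S) p f"
  then show "holo_near X p f" by (auto simp: holo_near_def holo_fun_open_submfd[OF X S])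
next
  assume p: "p \<in> S" "holo_near X p f"
  then obtain W where W: "p \<in> W" "holo_fun X W f" by (auto simp: holo_near_def)
  have WS: "openin (mtop X) (W \<inter> S)" using W(2) S by (auto simp: holo_fun_def)
  have "holo_fun X (W \<inter> S) f" by (rule holo_fun_subset[OF X W(2) WS]) auto
  with p W show "holo_near (open_submfd X S) p f"
    unfolding holo_near_def holo_fun_open_submfd[OF X S] by (intro exI[of _ "W \<inter> S"]) auto
qed

lemma submfd_germ_eq: "p \<in> S \<Longrightarrow> germ_eq (open_submfd X S) p f g \<longleftrightarrow> germ_eq X p f g"
proof
  assume "p \<in> S" "germ_eq (open_submfd X S) p f g"
  then show "germ_eq X p f g"
    using S by (auto simp: germ_eq_def open_submfd_def openin_open_subtopology)
next
  assume p: "p \<in> S" "germ_eq X p f g"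
  then obtain W where "openin (mtop X) W" "p \<in> W" "\<forall>q\<in>W. f q = g q" by (auto simp: germ_eq_def)
  with p S show "germ_eq (open_submfd X S) p f g"
    unfolding germ_eq_def by (intro exI[of _ "W \<inter> S"]) (auto simp: open_submfd_def openin_open_subtopology)
qed

lemma submfd_germ_quotient: "p \<in> S \<Longrightarrow> germ_quotient (open_submfd X S) p g h = germ_quotient X p g h"
  by (simp add: germ_quotient_def submfd_holo_near submfd_germ_eq)

lemma compact_F_image:
  assumes "compactin (mtop X) K" "K \<subseteq> S" shows "compact (F ` K)"
proof -
  have "continuous_map (subtopology (mtop X) S) euclidean F"
    unfolding continuous_map_def
  proof (intro conjI allI impI)
    fix V :: "(complex^2) set" assume "openin euclidean V"
    then have "openin (mtop X) (S \<inter> F -` V)" using open_preimage by simp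
    moreover have "{x \<in> topspace (subtopology (mtop X) S). F x \<in> V} = S \<inter> F -` V" using S_top by auto
    ultimately show "openin (subtopology (mtop X) S) {x \<in> topspace (subtopology (mtop X) S). F x \<in> V}"
      using S by (simp add: openin_open_subtopology)
  qed simp
  moreover have "compactin (subtopology (mtop X) S) K" using assms by (simp add: compactin_subtopology)
  ultimately have "compactin euclidean (F ` K)" by (rule image_compactin[rotated])
  then show ?thesis by simp
qed

lemma continuous_G: "continuous_map euclidean (mtop X) G"
  unfolding continuous_map_def
proof (intro conjI allI impI)
  show "G \<in> topspace euclidean \<rightarrow> topspace (mtop X)" using GS S_top by auto
  fix W assume "openin (mtop X) W"
  then have "open (F ` (W \<inter> S))" using S by (intro open_image) auto
  moreover have "{y \<in> topspace euclidean. G y \<in> W} = F ` (W \<inter> S)" using GS by (auto simp: image_vimage)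
  ultimately show "openin euclidean {y \<in> topspace euclidean. G y \<in> W}" by simp
qed

lemma compact_G_image: "compact L \<Longrightarrow> compactin (mtop X) (G ` L)"
  using image_compactin[OF _ continuous_G, of L] by simp

lemma G_F_image: "K \<subseteq> S \<Longrightarrow> G ` F ` K = K"
  using GF by (auto simp: image_iff subset_iff)

lemma holo_fun_poly: "P \<in> poly2 \<Longrightarrow> holo_fun X S (\<lambda>x. P (F x))"
proof -
  assume P: "P \<in> poly2"
  have "G ` UNIV = S" using GS GF by (metis UNIV_I image_subsetI rangeI subset_antisym subsetI)
  then show ?thesis using holo_G_image[of UNIV "\<lambda>x. P (F x)"] poly2_holo[OF P] by (simp add: FG)
qed

lemma transition_holo:
  assumes "plane_chart X S' F' G'" "S \<subseteq> S'" "P \<in> poly2"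
  shows "holo_Cn UNIV (\<lambda>y. P (F' (G y)))"
proof -
  interpret c': plane_chart X S' F' G' by fact
  have "holo_fun X S (\<lambda>x. P (F' x))" by (rule holo_fun_subset[OF X c'.holo_fun_poly[OF assms(3)] S assms(2)])
  moreover have "F ` S = UNIV" using GS by (simp add: image_vimage vimage_def)
  ultimately show ?thesis using holo_iff[OF S order_refl] by auto
qed

end

section \<open>Values of meromorphic sections and sup norms\<close>

lemma mero_val_at:
  assumes X: "complex_manifold X" and W: "holo_fun X W f" "q \<in> W" and s: "s q = germ_quotient X q f (\<lambda>_. 1)"
  shows "mero_val X s q = f q"
  by (rule mero_val_eq[OF X]) (use W s in \<open>auto simp: holo_near_def\<close>)

lemma sup_norm_upper:
  assumes "\<forall>x\<in>K. cmod (f x) \<le> M" "z \<in> K" shows "cmod (f z) \<le> sup_norm K f"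
proof -
  have "bdd_above (insert 0 ((\<lambda>z. cmod (f z)) ` K))"
    using assms(1) by (auto intro!: bdd_aboveI2)
  then show ?thesis unfolding sup_norm_def by (rule cSup_upper[rotated]) (use assms(2) in auto)
qed

lemma sup_norm_least:
  assumes "\<And>x. x \<in> K \<Longrightarrow> cmod (f x) \<le> M" "0 \<le> M" shows "sup_norm K f \<le> M"
  unfolding sup_norm_def by (rule cSup_least) (use assms in auto)

lemma quotient_approx:
  fixes A W :: "'b::topological_space \<Rightarrow> complex"
  assumes C: "compact C" and cont: "continuous_on C A" "continuous_on C W" and nz: "\<And>x. x \<in> C \<Longrightarrow> W x \<noteq> 0"
    and \<delta>: "\<delta> > 0"
  obtains \<eta> where "\<eta> > 0"
    "\<And>x a w. x \<in> C \<Longrightarrow> cmod (a - A x) < \<eta> \<Longrightarrow> cmod (w - W x) < \<eta> \<Longrightarrow> w \<noteq> 0 \<and> cmod (a / w - A x / W x) < \<delta>"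
proof (cases "C = {}")
  case True then show ?thesis using that[of 1] by simp
next
  case False
  have "continuous_on C (\<lambda>x. cmod (W x))" by (intro continuous_intros cont)
  from continuous_attains_inf[OF C False this]
  obtain x0 where x0: "x0 \<in> C" "\<And>x. x \<in> C \<Longrightarrow> cmod (W x0) \<le> cmod (W x)" by blast
  define m where "m = cmod (W x0)"
  have m: "m > 0" "\<And>x. x \<in> C \<Longrightarrow> m \<le> cmod (W x)" using x0 nz by (auto simp: m_def)
  have cq: "continuous_on C (\<lambda>x. A x / W x)" by (intro continuous_intros cont) (use nz in auto)
  obtain M where M: "\<And>x. x \<in> C \<Longrightarrow> cmod (A x / W x) \<le> M"
    using compact_imp_bounded[OF compact_continuous_image[OF cq C]] unfolding bounded_iff by blast
  have M0: "M \<ge> 0" using M[OF x0(1)] norm_ge_zero order_trans by blast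
  \<comment> \<open>The first bound keeps \<open>cmod w \<ge> m / 2\<close>; with the second the
    error is at most \<open>\<eta> * (1 + M) / (m / 2) \<le> \<delta> / 2\<close>.\<close>
  define \<eta> where "\<eta> = min (m / 2) (\<delta> * m / (4 * (1 + M)))"
  have "\<eta> * (1 + M) \<le> \<delta> * m / (4 * (1 + M)) * (1 + M)"
    using M0 by (intro mult_right_mono) (auto simp: \<eta>_def)
  also have "\<dots> = \<delta> * m / 4" using M0 by (simp add: field_simps)
  finally have "\<eta> * (1 + M) \<le> \<delta> * m / 4" .
  moreover have "\<eta> > 0" using m(1) M0 \<delta> by (simp add: \<eta>_def)
  moreover have "\<eta> \<le> m / 2" unfolding \<eta>_def by (rule min.cobounded1)
  ultimately have \<eta>: "\<eta> > 0" "\<eta> \<le> m / 2" "\<eta> * (1 + M) \<le> \<delta> * m / 4" by blast+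
  show ?thesis
  proof (rule that[OF \<eta>(1)])
    fix x a w assume x: "x \<in> C" and a: "cmod (a - A x) < \<eta>" and w: "cmod (w - W x) < \<eta>"
    have "cmod (W x) - cmod (w - W x) \<le> cmod w"
      using norm_triangle_ineq2[of "W x" "W x - w"] by (simp add: norm_minus_commute)
    then have wm: "cmod w \<ge> m / 2" using w \<eta>(2) m(2)[OF x] by linarith
    then have w0: "w \<noteq> 0" using m(1) by auto
    have "a / w - A x / W x = ((a - A x) + (A x / W x) * (W x - w)) / w"
      using w0 nz[OF x] by (simp add: field_simps)
    then have "cmod (a / w - A x / W x) = cmod ((a - A x) + (A x / W x) * (W x - w)) / cmod w"
      by (simp add: norm_divide)
    also have "\<dots> \<le> (\<eta> + M * \<eta>) / (m / 2)"
    proof (rule frac_le)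
      show "cmod ((a - A x) + (A x / W x) * (W x - w)) \<le> \<eta> + M * \<eta>"
        using a w M[OF x] M0
        by (intro order_trans[OF norm_triangle_ineq] add_mono)
           (auto simp del: times_divide_eq_left simp: norm_mult norm_minus_commute intro!: mult_mono)
    qed (use \<eta>(1) M0 m(1) wm in auto)
    also have "\<dots> = \<eta> * (1 + M) / (m / 2)" by (simp add: algebra_simps)
    also have "\<dots> \<le> (\<delta> * m / 4) / (m / 2)" using \<eta>(3) m(1) by (intro divide_right_mono) auto
    also have "\<dots> < \<delta>" using m(1) \<delta> by (simp add: field_simps)
    finally show "w \<noteq> 0 \<and> cmod (a / w - A x / W x) < \<delta>" using w0 by simp
  qed
qed

section \<open>One approximation step\<close>

text \<open>At the points of \<open>K\<close> the representing pair is chosen with value 1 of the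
  denominator. This is what makes the denominator \<open>W\<close> on the box non-zero at the images
  of points of \<open>K\<close>.\<close>

lemma (in plane_chart) mero_quotient:
  assumes s: "s \<in> meromorphic_funs (open_submfd X S)" and K: "K \<subseteq> S" "mero_holo_on (open_submfd X S) K s"
    and R: "R > 0"
  obtains N W A where "rect2 (ball 0 R) (ball 0 R) \<subseteq> N" "holo_Cn N W" "holo_Cn N A"
    "\<And>x. x \<in> K \<Longrightarrow> F x \<in> N \<Longrightarrow> W (F x) \<noteq> 0 \<and> mero_val (open_submfd X S) s x = A (F x) / W (F x)"
proof -
  let ?Y = "open_submfd X S"
  have ts: "topspace (mtop ?Y) = S" using S_top by (auto simp: open_submfd_def)
  obtain W0 f0 where W0: "K \<subseteq> W0" "holo_fun ?Y W0 f0" "\<forall>q\<in>W0. s q = germ_quotient ?Y q f0 (\<lambda>_. 1)"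
    using K(2) unfolding mero_holo_on_def by blast
  have W0S: "W0 \<subseteq> S" "holo_fun X W0 f0" "openin (mtop X) W0"
    using W0(2) unfolding holo_fun_open_submfd[OF X S] by (auto simp: holo_fun_def)
  have one: "holo_Cn V (\<lambda>_. 1)" if "open V" for V :: "(complex^2) set" using that by (rule holo_Cn_const)
  have "\<exists>W g h. G y \<in> W \<and> W \<subseteq> S \<and> holo_fun X W g \<and> holo_fun X W h \<and>
      (\<forall>q\<in>W. \<not> germ_eq X q h (\<lambda>_. 0) \<and> s q = germ_quotient X q g h) \<and>
      (G y \<in> K \<longrightarrow> g (G y) = f0 (G y) \<and> h (G y) = 1)" for y
  proof (cases "G y \<in> K")
    case True
    have "holo_fun X W0 (\<lambda>_. 1)" using holo_iff[OF W0S(3,1)] one[OF open_image[OF W0S(3,1)]] by auto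
    moreover have "\<not> germ_eq X q (\<lambda>_. 1) (\<lambda>_. 0)" for q by (auto simp: germ_eq_def)
    moreover have "s q = germ_quotient X q f0 (\<lambda>_. 1)" if "q \<in> W0" for q
      using W0(3) W0S(1) that submfd_germ_quotient by auto
    ultimately show ?thesis using True W0(1) W0S
      by (intro exI[of _ W0] exI[of _ f0] exI[of _ "\<lambda>_. 1"]) auto
  next
    case False
    obtain W g h where W: "G y \<in> W" "holo_fun ?Y W g" "holo_fun ?Y W h"
        "\<forall>q\<in>W. \<not> germ_eq ?Y q h (\<lambda>_. 0) \<and> s q = germ_quotient ?Y q g h"
      using s GS[of y] ts unfolding meromorphic_funs_def by blast
    then have "W \<subseteq> S" "holo_fun X W g" "holo_fun X W h" by (auto simp: holo_fun_open_submfd[OF X S])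
    moreover from this have "\<forall>q\<in>W. \<not> germ_eq X q h (\<lambda>_. 0) \<and> s q = germ_quotient X q g h"
      using W(4) submfd_germ_eq submfd_germ_quotient by (metis subsetD)
    ultimately show ?thesis using W(1) False by blast
  qed
  then obtain V g h where V: "\<And>y. G y \<in> V y" "\<And>y. V y \<subseteq> S" "\<And>y. holo_fun X (V y) (g y)" "\<And>y. holo_fun X (V y) (h y)"
      "\<And>y q. q \<in> V y \<Longrightarrow> \<not> germ_eq X q (h y) (\<lambda>_. 0)" "\<And>y q. q \<in> V y \<Longrightarrow> s q = germ_quotient X q (g y) (h y)"
      "\<And>y. G y \<in> K \<Longrightarrow> g y (G y) = f0 (G y) \<and> h y (G y) = 1"
    by metis
  have Vo: "openin (mtop X) (V y)" for y using V(3) by (auto simp: holo_fun_def)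
  have hg: "holo_Cn (F ` V y) (\<lambda>x. g y (G x))" "holo_Cn (F ` V y) (\<lambda>x. h y (G x))" for y
    using holo_iff[OF Vo V(2)] V(3,4) by auto
  have nz: "\<not> zero_germ (\<lambda>x. h y (G x)) q" if "q \<in> F ` V y" for y q
    using V(5)[of "G q" y] that image_vimage[OF V(2)] germ_eq_iff[of q "h y" "\<lambda>_. 0"] by (auto simp: zero_germ_def)
  interpret mero_data "\<lambda>y x. g y (G x)" "\<lambda>y x. h y (G x)"
  proof
    fix p
    show "\<exists>N. p \<in> N \<and> holo_Cn N (\<lambda>x. g p (G x)) \<and> holo_Cn N (\<lambda>x. h p (G x)) \<and>
       (\<forall>q\<in>N. \<not> zero_germ (\<lambda>x. h p (G x)) q \<and>
          eventually (\<lambda>x. g p (G x) * h q (G x) = g q (G x) * h p (G x)) (nhds q))"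
    proof (rule exI[of _ "F ` V p"], intro conjI ballI hg)
      show "p \<in> F ` V p" using V(1) image_vimage[OF V(2)] by auto
      fix q assume q: "q \<in> F ` V p"
      then show "\<not> zero_germ (\<lambda>x. h p (G x)) q" by (rule nz)
      have "G q \<in> V p" using q image_vimage[OF V(2)] by auto
      then have eq: "germ_quotient X (G q) (g p) (h p) = germ_quotient X (G q) (g q) (h q)"
        using V(6) V(1) by metis
      have qq: "q \<in> F ` V q" using V(1) image_vimage[OF V(2)] by auto
      have "(g q, h q) \<in> germ_quotient X (G q) (g q) (h q)"
        by (rule germ_quotient_self) (use hg qq nz in \<open>auto intro: hol_atI\<close>)
      then show "eventually (\<lambda>x. g p (G x) * h q (G x) = g q (G x) * h p (G x)) (nhds q)"
        unfolding eq[symmetric] germ_quotient_iff by blast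
    qed
  qed
  obtain N W A where N: "rect2 (bx (-R) R (-R) R) (bx (-R) R (-R) R) \<subseteq> N" "holo_Cn N W" "holo_Cn N A"
    "\<And>q. q \<in> N \<Longrightarrow> \<not> zero_germ W q"
    "\<And>q. q \<in> N \<Longrightarrow> eventually (\<lambda>x. g q (G x) * W x = A x * h q (G x)) (nhds q)"
    "\<And>q. q \<in> N \<Longrightarrow> h q (G q) \<noteq> 0 \<Longrightarrow> W q \<noteq> 0"
    using quotient_on_box[of "-R" R "-R" R "-R" R "-R" R] R by auto
  have "ball 0 R \<subseteq> bx (-R) R (-R) R"
  proof
    fix z :: complex assume "z \<in> ball 0 R"
    then have "\<bar>Re z\<bar> \<le> R" "\<bar>Im z\<bar> \<le> R" using abs_Re_le_cmod[of z] abs_Im_le_cmod[of z] by auto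
    then show "z \<in> bx (-R) R (-R) R" by (auto simp: bx_def)
  qed
  then have 1: "rect2 (ball 0 R) (ball 0 R) \<subseteq> N" using N(1) rect2_mono by (meson order_trans)
  show ?thesis
  proof (rule that[OF 1 N(2,3)])
    fix x assume x: "x \<in> K" "F x \<in> N"
    have GFx: "G (F x) = x" using GF x(1) K(1) by auto
    have "g (F x) x = f0 x" "h (F x) x = 1" using V(7)[of "F x"] GFx x(1) by auto
    moreover have "g (F x) (G (F x)) * W (F x) = A (F x) * h (F x) (G (F x))"
      using N(5)[OF x(2)] by (rule eventually_nhds_x_imp_x)
    ultimately have eq: "f0 x * W (F x) = A (F x)" by (simp add: GFx)
    have Wn: "W (F x) \<noteq> 0" using N(6)[OF x(2)] \<open>h (F x) x = 1\<close> GFx by simp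
    have "mero_val ?Y s x = f0 x"
      unfolding mero_val_def
    proof (rule the_equality)
      have xW: "x \<in> W0" using x(1) W0(1) by blast
      show "\<exists>f. holo_near ?Y x f \<and> s x = germ_quotient ?Y x f (\<lambda>_. 1) \<and> f0 x = f x"
        using W0(2,3) xW by (auto simp: holo_near_def)
      fix c assume "\<exists>f. holo_near ?Y x f \<and> s x = germ_quotient ?Y x f (\<lambda>_. 1) \<and> c = f x"
      then obtain f where f: "holo_near ?Y x f" "s x = germ_quotient ?Y x f (\<lambda>_. 1)" "c = f x" by blast
      have "holo_fun X W0 (\<lambda>_. 1)" using holo_iff[OF W0S(3,1)] one[OF open_image[OF W0S(3,1)]] by auto
      then have "holo_near ?Y x (\<lambda>_. 1)" using xW W0S(1) by (auto simp: holo_near_def holo_fun_open_submfd[OF X S])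
      moreover have "holo_near ?Y x f0" using W0(2) xW by (auto simp: holo_near_def)
      ultimately have "f x = f0 x"
        using germ_quotient_one_value[OF f(1)] f(2) W0(3) xW by auto
      with f(3) show "c = f0 x" by simp
    qed
    with eq Wn show "W (F x) \<noteq> 0 \<and> mero_val ?Y s x = A (F x) / W (F x)" by (simp add: field_simps)
  qed
qed

text \<open>\<open>P\<close> in the coordinates of \<open>S\<close> is a holomorphic section, which
  the Runge property approximates on \<open>K\<close> by a meromorphic \<open>g\<close> on
  \<open>S'\<close>. As \<open>g\<close> has a denominator without zeros on the image of
  \<open>K\<close>, both parts of its quotient may be replaced by polynomials.\<close>

lemma approx_step1:
  assumes c: "plane_chart X S F G" and c': "plane_chart X S' F' G'" and SS: "S \<subseteq> S'"
    and Runge: "mero_Runge_pair S (open_submfd X S')"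
    and P: "P \<in> poly2" and K: "compactin (mtop X) K" "K \<subseteq> S" and \<delta>: "\<delta> > 0"
  obtains A u where "A \<in> poly2" "u \<in> poly2"
    "\<And>x. x \<in> K \<Longrightarrow> u (F' x) \<noteq> 0 \<and> cmod (A (F' x) / u (F' x) - P (F x)) < \<delta>"
proof -
  interpret c: plane_chart X S F G by fact
  interpret c': plane_chart X S' F' G' by fact
  let ?Y = "open_submfd X S" and ?Z = "open_submfd X S'"
  have YZ: "open_submfd ?Z S = ?Y" by (rule open_submfd_open_submfd[OF SS])
  have tsY: "topspace (mtop ?Y) = S" using c.S_top by (auto simp: open_submfd_def)
  have cY: "complex_manifold ?Y" using Runge by (simp add: mero_Runge_pair_def YZ Stein_def)
  define s where "s = (\<lambda>q\<in>S. germ_quotient ?Y q (\<lambda>x. P (F x)) (\<lambda>_. 1))"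
  have hP: "holo_fun ?Y S (\<lambda>x. P (F x))"
    using c.holo_fun_poly[OF P] by (simp add: holo_fun_open_submfd[OF c.X c.S])
  have h1: "holo_fun ?Y S (\<lambda>_. 1)"
    using c.holo_fun_poly[of "\<lambda>_. 1"] by (simp add: holo_fun_open_submfd[OF c.X c.S] poly2_def fun_alg.const)
  have sM: "s \<in> meromorphic_funs ?Y"
    unfolding meromorphic_funs_def
  proof (intro CollectI conjI ballI)
    show "s \<in> extensional (topspace (mtop ?Y))" unfolding s_def tsY by simp
    fix p assume "p \<in> topspace (mtop ?Y)"
    then show "\<exists>W g h. p \<in> W \<and> holo_fun ?Y W g \<and> holo_fun ?Y W h \<and>
        (\<forall>q\<in>W. \<not> germ_eq ?Y q h (\<lambda>_. 0) \<and> s q = germ_quotient ?Y q g h)"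
      using hP h1 tsY by (intro exI[of _ S] exI[of _ "\<lambda>x. P (F x)"] exI[of _ "\<lambda>_. 1"]) (auto simp: s_def germ_eq_def)
  qed
  have sK: "mero_holo_on ?Y K s"
    unfolding mero_holo_on_def using K(2) hP by (intro exI[of _ S] exI[of _ "\<lambda>x. P (F x)"]) (auto simp: s_def)
  have sval: "mero_val ?Y s x = P (F x)" if "x \<in> S" for x
    using mero_val_at[OF cY hP that, of s] that by (simp add: s_def)
  have "compactin (mtop ?Y) K" using K by (simp add: open_submfd_def compactin_subtopology)
  with Runge sM sK \<delta> obtain g where g: "g \<in> meromorphic_funs ?Z" "mero_holo_on ?Z K g"
      "sup_norm K (\<lambda>z. mero_val ?Z g z - mero_val ?Y s z) < \<delta> / 2"
    unfolding mero_Runge_pair_def YZ by (meson half_gt_zero)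
  have KS': "K \<subseteq> S'" using K(2) SS by blast
  define C where "C = F' ` K"
  have C: "compact C" unfolding C_def by (rule c'.compact_F_image[OF K(1) KS'])
  obtain r where r: "r > 0" "C \<subseteq> rect2 (cball 0 r) (cball 0 r)"
  proof -
    obtain B where B: "\<And>x. x \<in> C \<Longrightarrow> norm x \<le> B" using compact_imp_bounded[OF C] by (auto simp: bounded_iff)
    have "C \<subseteq> rect2 (cball 0 (max 1 B)) (cball 0 (max 1 B))"
    proof
      fix x assume "x \<in> C"
      then have "cmod (x $ 1) \<le> B" "cmod (x $ 2) \<le> B"
        using B Finite_Cartesian_Product.norm_nth_le[of x] order_trans by blast+
      then show "x \<in> rect2 (cball 0 (max 1 B)) (cball 0 (max 1 B))" by auto
    qed
    then show ?thesis using that[of "max 1 B"] by simp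
  qed
  define R where "R = r + 1"
  have R: "R > 0" "r < R" using r by (auto simp: R_def)
  obtain N W A where N: "rect2 (ball 0 R) (ball 0 R) \<subseteq> N" "holo_Cn N W" "holo_Cn N A"
      "\<And>x. x \<in> K \<Longrightarrow> F' x \<in> N \<Longrightarrow> W (F' x) \<noteq> 0 \<and> mero_val ?Z g x = A (F' x) / W (F' x)"
    using c'.mero_quotient[OF g(1) KS' g(2) R(1)] by blast
  have CN: "C \<subseteq> N"
  proof
    fix x assume "x \<in> C"
    then have "x \<in> rect2 (ball 0 R) (ball 0 R)" using r(2) R(2) by (auto simp: subset_iff)
    then show "x \<in> N" using N(1) by blast
  qed
  have val: "W (F' x) \<noteq> 0" "mero_val ?Z g x = A (F' x) / W (F' x)" if "x \<in> K" for x
    using N(4)[OF that] CN that by (auto simp: C_def)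
  have Wnz: "W x \<noteq> 0" if "x \<in> C" for x using val(1) that by (auto simp: C_def)
  have cont: "continuous_on C A" "continuous_on C W"
    using holo_Cn_continuous_on[OF N(3)] holo_Cn_continuous_on[OF N(2)] CN continuous_on_subset by blast+
  have close: "cmod (A (F' x) / W (F' x) - P (F x)) < \<delta> / 2" if x: "x \<in> K" for x
  proof -
    have cq: "continuous_on C (\<lambda>y. A y / W y - P (F (G' y)))"
    proof (intro continuous_intros cont)
      have "continuous_on (F ` K) P" using holo_Cn_continuous_on[OF poly2_holo[OF P]] continuous_on_subset by blast
      moreover have "continuous_on C (\<lambda>y. F (G' y))"
      proof -
        have "continuous_on C (\<lambda>y. F (G' y) $ i)" for i :: 2
        proof -
          have "open (F' ` S)" by (rule c'.open_image[OF c.S SS])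
          moreover have "holo_fun X S (\<lambda>x. F x $ i)" using c.holo_fun_poly[OF poly2_nth] .
          ultimately have "holo_Cn (F' ` S) (\<lambda>y. F (G' y) $ i)" using c'.holo_iff[OF c.S SS] by auto
          then show ?thesis
            using holo_Cn_continuous_on continuous_on_subset K(2) unfolding C_def by blast
        qed
        then have "continuous_on C (\<lambda>y. \<chi> i. F (G' y) $ i)" by (intro continuous_on_vec_lambda)
        then show ?thesis by simp
      qed
      ultimately show "continuous_on C (\<lambda>y. P (F (G' y)))"
        by (rule continuous_on_compose2) (use c'.GF KS' in \<open>auto simp: C_def subset_iff\<close>)
    qed (use Wnz in auto)
    \<comment> \<open>\<open>sup_norm\<close> is a supremum of reals and dominates the single values
      only for a bounded function; compactness provides the bound.\<close>
    obtain M where M: "\<And>y. y \<in> C \<Longrightarrow> cmod (A y / W y - P (F (G' y))) \<le> M"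
      using compact_imp_bounded[OF compact_continuous_image[OF cq C]] unfolding bounded_iff by blast
    have eqv: "mero_val ?Z g z - mero_val ?Y s z = A (F' z) / W (F' z) - P (F (G' (F' z)))" if "z \<in> K" for z
      using val(2)[OF that] sval[OF subsetD[OF K(2) that]] c'.GF[OF subsetD[OF KS' that]] by simp
    have "cmod (mero_val ?Z g x - mero_val ?Y s x) \<le> sup_norm K (\<lambda>z. mero_val ?Z g z - mero_val ?Y s z)"
      by (rule sup_norm_upper[of K _ M, OF _ x]) (use eqv M in \<open>auto simp: C_def\<close>)
    with g(3) eqv[OF x] c'.GF[of x] KS' x show ?thesis by auto
  qed
  have \<delta>2: "\<delta> / 2 > 0" using \<delta> by simp
  obtain \<eta> where \<eta>: "\<eta> > 0" "\<And>x a w. x \<in> C \<Longrightarrow> cmod (a - A x) < \<eta> \<Longrightarrow> cmod (w - W x) < \<eta> \<Longrightarrow>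
      w \<noteq> 0 \<and> cmod (a / w - A x / W x) < \<delta> / 2"
    using quotient_approx[OF C cont Wnz \<delta>2] by blast
  have opR: "open (rect2 (ball 0 R) (ball 0 R))" by (intro open_rect2) auto
  have "approximable (rect2 (cball 0 r) (cball 0 r)) poly2 A" "approximable (rect2 (cball 0 r) (cball 0 r)) poly2 W"
    by (rule poly2_dense[OF holo_Cn_subset[OF N(3) opR N(1)] r(1) R(2)],
        rule poly2_dense[OF holo_Cn_subset[OF N(2) opR N(1)] r(1) R(2)])
  then obtain A' u where A': "A' \<in> poly2" "\<forall>x\<in>rect2 (cball 0 r) (cball 0 r). cmod (A x - A' x) < \<eta>"
      and u: "u \<in> poly2" "\<forall>x\<in>rect2 (cball 0 r) (cball 0 r). cmod (W x - u x) < \<eta>"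
    using \<eta>(1) unfolding approximable_def by meson
  show ?thesis
  proof (rule that[OF A'(1) u(1)])
    fix x assume x: "x \<in> K"
    then have xC: "F' x \<in> C" by (simp add: C_def)
    have *: "u (F' x) \<noteq> 0 \<and> cmod (A' (F' x) / u (F' x) - A (F' x) / W (F' x)) < \<delta> / 2"
      by (rule \<eta>(2)[OF xC]) (use A'(2) u(2) xC r(2) in \<open>auto simp: norm_minus_commute\<close>)
    have "cmod ((A' (F' x) / u (F' x) - A (F' x) / W (F' x)) + (A (F' x) / W (F' x) - P (F x))) < \<delta> / 2 + \<delta> / 2"
      using * close[OF x] by (intro norm_triangle_lt add_strict_mono) auto
    with * show "u (F' x) \<noteq> 0 \<and> cmod (A' (F' x) / u (F' x) - P (F x)) < \<delta>" by simp
  qed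
qed

text \<open>The two denominators are multiplied to a common one, so that it cancels from the
  quotient of the two approximants.\<close>

lemma approx_step:
  assumes c: "plane_chart X S F G" and c': "plane_chart X S' F' G'" and SS: "S \<subseteq> S'"
    and Runge: "mero_Runge_pair S (open_submfd X S')"
    and PQ: "P \<in> poly2" "Q \<in> poly2" and K: "compactin (mtop X) K" "K \<subseteq> S" and \<delta>: "\<delta> > 0"
  obtains A B u where "A \<in> poly2" "B \<in> poly2" "u \<in> poly2"
    "\<And>x. x \<in> K \<Longrightarrow> u (F' x) \<noteq> 0 \<and> cmod (A (F' x) / u (F' x) - P (F x)) < \<delta> \<and>
       cmod (B (F' x) / u (F' x) - Q (F x)) < \<delta>"
proof -
  obtain A1 u1 where 1: "A1 \<in> poly2" "u1 \<in> poly2"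
    "\<And>x. x \<in> K \<Longrightarrow> u1 (F' x) \<noteq> 0 \<and> cmod (A1 (F' x) / u1 (F' x) - P (F x)) < \<delta>"
    using approx_step1[OF c c' SS Runge PQ(1) K \<delta>] by blast
  obtain A2 u2 where 2: "A2 \<in> poly2" "u2 \<in> poly2"
    "\<And>x. x \<in> K \<Longrightarrow> u2 (F' x) \<noteq> 0 \<and> cmod (A2 (F' x) / u2 (F' x) - Q (F x)) < \<delta>"
    using approx_step1[OF c c' SS Runge PQ(2) K \<delta>] by blast
  show ?thesis
  proof (rule that)
    show "(\<lambda>x. A1 x * u2 x) \<in> poly2" "(\<lambda>x. A2 x * u1 x) \<in> poly2" "(\<lambda>x. u1 x * u2 x) \<in> poly2"
      using 1 2 by (auto simp: poly2_def intro: fun_alg.mult)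
  qed (use 1(3) 2(3) in auto)
qed

section \<open>Meromorphic functions on a union of planes\<close>

definition pd :: "real \<Rightarrow> (complex^2) set" where "pd r = rect2 (ball 0 r) (ball 0 r)"
definition cpd :: "real \<Rightarrow> (complex^2) set" where "cpd r = rect2 (cball 0 r) (cball 0 r)"

lemma pd_props: "open (pd r)" "convex (pd r)" "compact (cpd r)" "pd r \<subseteq> cpd r"
  unfolding pd_def cpd_def by (auto intro!: open_rect2 convex_rect2 compact_rect2)

lemma compact_in_pd:
  assumes "compact C" obtains r where "r > 0" "C \<subseteq> pd r"
proof -
  obtain B where B: "\<And>x. x \<in> C \<Longrightarrow> norm x \<le> B" using compact_imp_bounded[OF assms] by (auto simp: bounded_iff)
  have "C \<subseteq> pd (max 1 (B + 1))"
  proof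
    fix x assume "x \<in> C"
    then have "cmod (x $ 1) \<le> B" "cmod (x $ 2) \<le> B"
      using B Finite_Cartesian_Product.norm_nth_le[of x] order_trans by blast+
    then show "x \<in> pd (max 1 (B + 1))" by (auto simp: pd_def)
  qed
  then show ?thesis using that[of "max 1 (B + 1)"] by simp
qed

lemma geometric_uniform_limit:
  fixes s :: "nat \<Rightarrow> 'b \<Rightarrow> complex"
  assumes "\<And>k x. x \<in> L \<Longrightarrow> cmod (s (Suc k) x - s k x) \<le> \<epsilon> * (1/2) ^ k" "\<epsilon> \<ge> 0"
  shows "\<exists>l. uniform_limit L s l sequentially \<and> (\<forall>x\<in>L. cmod (l x - s 0 x) \<le> 2 * \<epsilon>)"
proof -
  define d where "d k x = s (Suc k) x - s k x" for k x
  have sm: "summable (\<lambda>k. \<epsilon> * (1/2) ^ k)" by (intro summable_mult summable_geometric) simp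
  have "uniform_limit L (\<lambda>n x. \<Sum>i<n. d i x) (\<lambda>x. suminf (\<lambda>i. d i x)) sequentially"
    by (rule Weierstrass_m_test[OF _ sm]) (use assms(1) in \<open>auto simp: d_def\<close>)
  then have "uniform_limit L (\<lambda>n x. s 0 x + (\<Sum>i<n. d i x)) (\<lambda>x. s 0 x + suminf (\<lambda>i. d i x)) sequentially"
    by (intro uniform_limit_add uniform_limit_const)
  moreover have "s 0 x + (\<Sum>i<n. d i x) = s n x" for n x
    unfolding d_def by (simp add: sum_lessThan_telescope[of "\<lambda>i. s i x"])
  ultimately have 1: "uniform_limit L s (\<lambda>x. s 0 x + suminf (\<lambda>i. d i x)) sequentially" by simp
  have "cmod (suminf (\<lambda>i. d i x)) \<le> 2 * \<epsilon>" if "x \<in> L" for x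
  proof -
    have "cmod (suminf (\<lambda>i. d i x)) \<le> (\<Sum>k. \<epsilon> * (1/2) ^ k)"
      by (rule norm_suminf_le[OF _ sm]) (use assms(1) that in \<open>auto simp: d_def\<close>)
    also have "\<dots> = 2 * \<epsilon>" by (simp add: suminf_mult suminf_geometric summable_geometric)
    finally show ?thesis .
  qed
  then show ?thesis using 1 by (intro exI[of _ "\<lambda>x. s 0 x + suminf (\<lambda>i. d i x)"]) auto
qed

locale long_plane =
  fixes X :: "('a, 2) cmfd" and Xs :: "nat \<Rightarrow> 'a set"
    and F :: "nat \<Rightarrow> 'a \<Rightarrow> complex^2" and G :: "nat \<Rightarrow> complex^2 \<Rightarrow> 'a"
  assumes chart: "plane_chart X (Xs j) (F j) (G j)"
    and Xs_Suc: "Xs j \<subseteq> Xs (Suc j)"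
    and cover: "(\<Union>j. Xs j) = topspace (mtop X)"
    and Runge: "mero_Runge_pair (Xs j) (open_submfd X (Xs (Suc j)))"
begin

lemma X: "complex_manifold X"
  using chart[of 0] by (simp add: plane_chart_def)

lemma Xs_mono: "i \<le> j \<Longrightarrow> Xs i \<subseteq> Xs j"
  using lift_Suc_mono_le[of Xs] Xs_Suc by blast

text \<open>Forgetting the first \<open>k\<close> planes reduces statements about level
  \<open>k\<close> to level 0.\<close>

lemma shift: "long_plane X (\<lambda>j. Xs (j + k)) (\<lambda>j. F (j + k)) (\<lambda>j. G (j + k))"
proof (rule long_plane.intro)
  have "topspace (mtop X) \<subseteq> (\<Union>j. Xs (j + k))"
  proof
    fix x assume "x \<in> topspace (mtop X)"
    then obtain j where "x \<in> Xs j" using cover by blast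
    then have "x \<in> Xs (j + k)" using Xs_mono[of j "j + k"] by auto
    then show "x \<in> (\<Union>j. Xs (j + k))" by blast
  qed
  then show "(\<Union>j. Xs (j + k)) = topspace (mtop X)" using cover by blast
qed (use chart Xs_Suc Runge in auto)

lemma compact_in_level:
  assumes "compactin (mtop X) K" obtains j where "K \<subseteq> Xs j"
proof -
  have "\<And>U. U \<in> range Xs \<Longrightarrow> openin (mtop X) U" using chart by (auto simp: plane_chart_def)
  moreover have "K \<subseteq> \<Union> (range Xs)" using assms cover by (auto simp: compactin_def)
  ultimately obtain \<F> where \<F>: "finite \<F>" "\<F> \<subseteq> range Xs" "K \<subseteq> \<Union> \<F>"
    using assms unfolding compactin_def by blast
  then obtain I where I: "finite I" "\<F> = Xs ` I" using finite_subset_image by metis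
  have "K \<subseteq> Xs (Max (insert 0 I))"
  proof
    fix x assume "x \<in> K"
    then obtain i where i: "i \<in> I" "x \<in> Xs i" using \<F>(3) I(2) by blast
    then have "i \<le> Max (insert 0 I)" using I(1) by simp
    then show "x \<in> Xs (Max (insert 0 I))" using Xs_mono i(2) by blast
  qed
  then show ?thesis by (rule that)
qed

text \<open>The radii are chosen recursively: the next polydisc swallows the closed current one and
  also the closed polydiscs of radius \<open>n\<close> of all levels up to \<open>n\<close>. The
  latter makes the union all of \<open>X\<close>.\<close>

lemma exhaustion:
  assumes K: "compactin (mtop X) K" "K \<subseteq> Xs 0"
  obtains r where "\<And>j. r j > 0" "K \<subseteq> G 0 ` pd (r 0)" "\<And>j. G j ` cpd (r j) \<subseteq> G (Suc j) ` pd (r (Suc j))"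
    "(\<Union>j. G j ` pd (r j)) = topspace (mtop X)"
proof -
  interpret c: plane_chart X "Xs j" "F j" "G j" for j by (rule chart)
  have inpd: "\<exists>r>0. C \<subseteq> G j ` pd r" if C: "compactin (mtop X) C" "C \<subseteq> Xs j" for C j
  proof -
    obtain r where "r > 0" "F j ` C \<subseteq> pd r" using compact_in_pd[OF c.compact_F_image[OF C]] by blast
    then show ?thesis using c.G_F_image[OF C(2)] image_mono[of "F j ` C" "pd r" "G j"] by auto
  qed
  \<comment> \<open>The clause for \<open>n = 0\<close> builds the starting condition on
    \<open>K\<close> into the invariant of the recursive choice.\<close>
  have "\<exists>r. \<forall>n. (r n > 0 \<and> (n = 0 \<longrightarrow> K \<subseteq> G 0 ` pd (r n))) \<and>
      G n ` cpd (r n) \<union> (\<Union>i\<le>n. G i ` cpd (real n)) \<subseteq> G (Suc n) ` pd (r (Suc n))"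
  proof (rule dependent_nat_choice)
    show "\<exists>r>0. (0::nat) = 0 \<longrightarrow> K \<subseteq> G 0 ` pd r" using inpd[OF K] by blast
    fix r :: real and n :: nat
    define C where "C = G n ` cpd r \<union> (\<Union>i\<le>n. G i ` cpd (real n))"
    have "compactin (mtop X) C"
      unfolding C_def by (intro compactin_Un compactin_Union c.compact_G_image pd_props)
        (auto intro: c.compact_G_image pd_props)
    moreover have "C \<subseteq> Xs (Suc n)"
    proof -
      have "G i ` T \<subseteq> Xs (Suc n)" if "i \<le> n" for i T using c.GS Xs_mono[of i "Suc n"] that by auto
      then show ?thesis unfolding C_def by blast
    qed
    ultimately obtain r' where "r' > 0" "C \<subseteq> G (Suc n) ` pd r'" using inpd by blast
    then show "\<exists>y. (0 < y \<and> (Suc n = 0 \<longrightarrow> K \<subseteq> G 0 ` pd y)) \<and>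
        G n ` cpd r \<union> (\<Union>i\<le>n. G i ` cpd (real n)) \<subseteq> G (Suc n) ` pd y" unfolding C_def by blast
  qed
  then obtain r where rr: "\<forall>n. (r n > 0 \<and> (n = 0 \<longrightarrow> K \<subseteq> G 0 ` pd (r n))) \<and>
      G n ` cpd (r n) \<union> (\<Union>i\<le>n. G i ` cpd (real n)) \<subseteq> G (Suc n) ` pd (r (Suc n))" by (rule exE)
  have r: "r n > 0" "G n ` cpd (r n) \<union> (\<Union>i\<le>n. G i ` cpd (real n)) \<subseteq> G (Suc n) ` pd (r (Suc n))" for n
    by (rule conjunct1[OF conjunct1[OF spec[OF rr, of n]]], rule conjunct2[OF spec[OF rr, of n]])
  have K0: "K \<subseteq> G 0 ` pd (r 0)"
    by (rule mp[OF conjunct2[OF conjunct1[OF spec[OF rr, of 0]]] refl])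
  have "topspace (mtop X) \<subseteq> (\<Union>j. G j ` pd (r j))"
  proof
    fix x assume "x \<in> topspace (mtop X)"
    then obtain i where i: "x \<in> Xs i" using cover by blast
    obtain k :: nat where k: "norm (F i x) \<le> real k" using real_arch_simple by blast
    define n where "n = max i k"
    have "cmod (F i x $ 1) \<le> real n" "cmod (F i x $ 2) \<le> real n"
      using k Finite_Cartesian_Product.norm_nth_le[of "F i x"] by (smt (verit) n_def max.cobounded2 of_nat_le_iff)+
    then have "F i x \<in> cpd (real n)" by (simp add: cpd_def)
    then have "x \<in> G i ` cpd (real n)" using c.GF[OF i] by (metis imageI)
    moreover have "i \<le> n" by (simp add: n_def)
    ultimately have "x \<in> (\<Union>i\<le>n. G i ` cpd (real n))" by blast
    then have "x \<in> G (Suc n) ` pd (r (Suc n))" using r(2)[of n] by blast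
    then show "x \<in> (\<Union>j. G j ` pd (r j))" by blast
  qed
  moreover have "G j ` pd (r j) \<subseteq> topspace (mtop X)" for j using c.GS[of j] c.S_top[of j] by blast
  ultimately have "(\<Union>j. G j ` pd (r j)) = topspace (mtop X)" by blast
  moreover have "G j ` cpd (r j) \<subseteq> G (Suc j) ` pd (r (Suc j))" for j using r(2)[of j] by (rule le_supE)
  ultimately show ?thesis using that[of r, OF r(1) K0] by blast
qed

text \<open>Numerators and denominators are approximated separately; at each step they may acquire a
  common factor \<open>u\<close> without zeros on the current compact set, and these factors are divided out
  again in the limit.  The tolerance \<open>\<Lambda>\<close> is a lower bound for the product of all such factors.\<close>

theorem section_approx0:
  assumes PQ: "P \<in> poly2" "Q \<in> poly2" and K: "compactin (mtop X) K" "K \<subseteq> Xs 0" "K \<noteq> {}"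
    and Q0: "\<And>x. x \<in> K \<Longrightarrow> Q (F 0 x) \<noteq> 0" and \<delta>: "\<delta> > 0"
  obtains s W f where "s \<in> meromorphic_funs X" "K \<subseteq> W" "holo_fun X W f"
    "\<And>q. q \<in> W \<Longrightarrow> s q = germ_quotient X q f (\<lambda>_. 1)"
    "\<And>x. x \<in> K \<Longrightarrow> cmod (f x - P (F 0 x) / Q (F 0 x)) < \<delta>"
proof -
  interpret c: plane_chart X "Xs j" "F j" "G j" for j by (rule chart)
  obtain r where r: "\<And>j. r j > 0" "K \<subseteq> G 0 ` pd (r 0)" "\<And>j. G j ` cpd (r j) \<subseteq> G (Suc j) ` pd (r (Suc j))"
    "(\<Union>j. G j ` pd (r j)) = topspace (mtop X)" using exhaustion[OF K(1,2)] by blast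
  define V where "V j = G j ` pd (r j)" for j
  define L where "L j = G j ` cpd (r j)" for j
  have VL: "V j \<subseteq> L j" "L j \<subseteq> V (Suc j)" for j
    unfolding V_def L_def by (rule image_mono[OF pd_props(4)], rule r(3))
  have LX: "L j \<subseteq> Xs j" for j using c.GS by (auto simp: L_def)
  have Lc: "compactin (mtop X) (L j)" for j unfolding L_def by (intro c.compact_G_image pd_props)
  have LSuc: "L j \<subseteq> L (Suc j)" for j using VL(2)[of j] VL(1)[of "Suc j"] by blast
  have Lmono: "L i \<subseteq> L j" if "i \<le> j" for i j using lift_Suc_mono_le[of L, OF LSuc that] .
  have Vo: "openin (mtop X) (V j)" for j unfolding V_def by (intro c.open_G_image pd_props)
  have KV: "K \<subseteq> V 0" "K \<subseteq> L 0" using r(2) VL(1)[of 0] by (auto simp: V_def)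
  have contp: "continuous_on T p" if "p \<in> poly2" for p T
    using holo_Cn_continuous_on[OF poly2_holo[OF that]] continuous_on_subset by blast
  obtain \<eta> where \<eta>: "\<eta> > 0" "\<And>x a w. x \<in> F 0 ` K \<Longrightarrow> cmod (a - P x) < \<eta> \<Longrightarrow> cmod (w - Q x) < \<eta> \<Longrightarrow>
      w \<noteq> 0 \<and> cmod (a / w - P x / Q x) < \<delta>"
    using quotient_approx[OF c.compact_F_image[OF K(1,2)] contp[OF PQ(1)] contp[OF PQ(2)] _ \<delta>] Q0 by blast
  \<comment> \<open>The errors \<open>\<epsilon> * (1/2) ^ n\<close> of the steps add up to at most
    \<open>2 * \<epsilon>\<close>, which is half of \<open>\<eta>\<close>.\<close>
  define \<epsilon> where "\<epsilon> = \<eta> / 4"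
  have \<epsilon>: "\<epsilon> > 0" "2 * \<epsilon> < \<eta>" using \<eta>(1) by (auto simp: \<epsilon>_def)
  \<comment> \<open>A state holds numerator, denominator, the factor acquired in the step that led
    to it, and \<open>\<Lambda>\<close>. The tolerance of a step is scaled by
    \<open>\<Lambda>\<close> and by the new factor, so that it survives the division by all factors
    acquired since any earlier level.\<close>
  have "\<exists>st. \<forall>n. (case st n of (A, B, u, \<Lambda>) \<Rightarrow> A \<in> poly2 \<and> B \<in> poly2 \<and> u \<in> poly2 \<and> \<Lambda> > (0::real) \<and> \<Lambda> \<le> 1 \<and>
         (n = 0 \<longrightarrow> A = P \<and> B = Q)) \<and>
      (case st n of (A, B, u, \<Lambda>) \<Rightarrow> case st (Suc n) of (A', B', u', \<Lambda>') \<Rightarrow>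
        (\<forall>x\<in>L n. u' (F (Suc n) x) \<noteq> 0 \<and> \<Lambda>' \<le> \<Lambda> * cmod (u' (F (Suc n) x)) \<and>
          cmod (A' (F (Suc n) x) - u' (F (Suc n) x) * A (F n x)) \<le> \<epsilon> * (1/2) ^ n * \<Lambda> * cmod (u' (F (Suc n) x)) \<and>
          cmod (B' (F (Suc n) x) - u' (F (Suc n) x) * B (F n x)) \<le> \<epsilon> * (1/2) ^ n * \<Lambda> * cmod (u' (F (Suc n) x))))"
  proof (rule dependent_nat_choice)
    show "\<exists>st. case st of (A, B, u, \<Lambda>) \<Rightarrow> A \<in> poly2 \<and> B \<in> poly2 \<and> u \<in> poly2 \<and> \<Lambda> > (0::real) \<and> \<Lambda> \<le> 1 \<and>
         ((0::nat) = 0 \<longrightarrow> A = P \<and> B = Q)"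
      \<comment> \<open>No factor has been acquired at the start; \<open>P\<close> in the third slot
        is an arbitrary polynomial, and 1 is the empty product.\<close>
      by (rule exI[of _ "(P, Q, P, 1)"]) (use PQ in simp)
  next
    fix st :: "(complex^2 \<Rightarrow> complex) \<times> (complex^2 \<Rightarrow> complex) \<times> (complex^2 \<Rightarrow> complex) \<times> real" and n :: nat
    assume st: "case st of (A, B, u, \<Lambda>) \<Rightarrow> A \<in> poly2 \<and> B \<in> poly2 \<and> u \<in> poly2 \<and> \<Lambda> > 0 \<and> \<Lambda> \<le> 1 \<and>
         (n = 0 \<longrightarrow> A = P \<and> B = Q)"
    obtain A B u \<Lambda> where st_eq: "st = (A, B, u, \<Lambda>)" by (cases st) auto
    have AB: "A \<in> poly2" "B \<in> poly2" "\<Lambda> > 0" "\<Lambda> \<le> 1" using st by (auto simp: st_eq)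
    have \<delta>': "\<epsilon> * (1/2) ^ n * \<Lambda> > 0" using \<epsilon>(1) AB(3) by simp
    obtain A' B' u' where A': "A' \<in> poly2" "B' \<in> poly2" "u' \<in> poly2"
      "\<And>x. x \<in> L n \<Longrightarrow> u' (F (Suc n) x) \<noteq> 0 \<and> cmod (A' (F (Suc n) x) / u' (F (Suc n) x) - A (F n x)) < \<epsilon> * (1/2) ^ n * \<Lambda> \<and>
         cmod (B' (F (Suc n) x) / u' (F (Suc n) x) - B (F n x)) < \<epsilon> * (1/2) ^ n * \<Lambda>"
      using approx_step[OF chart[of n] chart[of "Suc n"] Xs_Suc Runge AB(1,2) Lc LX \<delta>'] by blast
    have LS: "L n \<subseteq> Xs (Suc n)" using LX[of n] Xs_Suc[of n] by blast
    have "\<exists>m>0. \<forall>x\<in>L n. m \<le> cmod (u' (F (Suc n) x))"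
    proof (cases "L n = {}")
      case True then show ?thesis by (intro exI[of _ 1]) simp
    next
      case False
      have "compact (F (Suc n) ` L n)" by (rule c.compact_F_image[OF Lc LS])
      moreover have "continuous_on (F (Suc n) ` L n) (\<lambda>y. cmod (u' y))" by (intro continuous_intros contp A')
      ultimately obtain y where y: "y \<in> F (Suc n) ` L n" "\<forall>z\<in>F (Suc n) ` L n. cmod (u' y) \<le> cmod (u' z)"
        using continuous_attains_inf[of "F (Suc n) ` L n" "\<lambda>y. cmod (u' y)"] False by auto
      then have "cmod (u' y) > 0" using A'(4) by auto
      with y show ?thesis by blast
    qed
    then obtain m where m: "m > 0" "\<And>x. x \<in> L n \<Longrightarrow> m \<le> cmod (u' (F (Suc n) x))" by blast
    \<comment> \<open>\<open>m\<close> bounds the new factor from below on \<open>L n\<close>; the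
      cap at 1 keeps all \<open>\<Lambda>\<close> at most 1.\<close>
    define \<Lambda>' where "\<Lambda>' = \<Lambda> * min 1 m"
    have \<Lambda>': "\<Lambda>' > 0" "\<Lambda>' \<le> 1" using AB(3,4) m(1) by (auto simp: \<Lambda>'_def mult_le_one)
    have q: "cmod (a' - w * a) \<le> d * cmod w" if "w \<noteq> 0" "cmod (a' / w - a) < d" for a' w a :: complex and d
    proof -
      have "a' - w * a = (a' / w - a) * w" using that(1) by (simp add: field_simps)
      then show ?thesis using that(2) by (simp add: norm_mult mult_right_mono)
    qed
    show "\<exists>st'. (case st' of (A, B, u, \<Lambda>) \<Rightarrow> A \<in> poly2 \<and> B \<in> poly2 \<and> u \<in> poly2 \<and> \<Lambda> > 0 \<and> \<Lambda> \<le> 1 \<and>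
         (Suc n = 0 \<longrightarrow> A = P \<and> B = Q)) \<and>
      (case st of (A, B, u, \<Lambda>) \<Rightarrow> case st' of (A', B', u', \<Lambda>') \<Rightarrow>
        (\<forall>x\<in>L n. u' (F (Suc n) x) \<noteq> 0 \<and> \<Lambda>' \<le> \<Lambda> * cmod (u' (F (Suc n) x)) \<and>
          cmod (A' (F (Suc n) x) - u' (F (Suc n) x) * A (F n x)) \<le> \<epsilon> * (1/2) ^ n * \<Lambda> * cmod (u' (F (Suc n) x)) \<and>
          cmod (B' (F (Suc n) x) - u' (F (Suc n) x) * B (F n x)) \<le> \<epsilon> * (1/2) ^ n * \<Lambda> * cmod (u' (F (Suc n) x))))"
    proof (rule exI[of _ "(A', B', u', \<Lambda>')"], unfold st_eq prod.case, intro conjI ballI)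
      fix x assume x: "x \<in> L n"
      show "u' (F (Suc n) x) \<noteq> 0" using A'(4)[OF x] by blast
      show "\<Lambda>' \<le> \<Lambda> * cmod (u' (F (Suc n) x))"
        unfolding \<Lambda>'_def using m(2)[OF x] AB(3) by (intro mult_left_mono) auto
      show "cmod (A' (F (Suc n) x) - u' (F (Suc n) x) * A (F n x)) \<le> \<epsilon> * (1/2) ^ n * \<Lambda> * cmod (u' (F (Suc n) x))"
        "cmod (B' (F (Suc n) x) - u' (F (Suc n) x) * B (F n x)) \<le> \<epsilon> * (1/2) ^ n * \<Lambda> * cmod (u' (F (Suc n) x))"
        using A'(4)[OF x] by (auto intro!: q)
    qed (use A' \<Lambda>' in auto)
  qed
  then obtain st where stt: "\<forall>n. (case st n of (A, B, u, \<Lambda>) \<Rightarrow> A \<in> poly2 \<and> B \<in> poly2 \<and> u \<in> poly2 \<and> \<Lambda> > (0::real) \<and> \<Lambda> \<le> 1 \<and>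
         (n = 0 \<longrightarrow> A = P \<and> B = Q)) \<and>
      (case st n of (A, B, u, \<Lambda>) \<Rightarrow> case st (Suc n) of (A', B', u', \<Lambda>') \<Rightarrow>
        (\<forall>x\<in>L n. u' (F (Suc n) x) \<noteq> 0 \<and> \<Lambda>' \<le> \<Lambda> * cmod (u' (F (Suc n) x)) \<and>
          cmod (A' (F (Suc n) x) - u' (F (Suc n) x) * A (F n x)) \<le> \<epsilon> * (1/2) ^ n * \<Lambda> * cmod (u' (F (Suc n) x)) \<and>
          cmod (B' (F (Suc n) x) - u' (F (Suc n) x) * B (F n x)) \<le> \<epsilon> * (1/2) ^ n * \<Lambda> * cmod (u' (F (Suc n) x))))"
    by (rule exE)
  have st: "case st n of (A, B, u, \<Lambda>) \<Rightarrow> A \<in> poly2 \<and> B \<in> poly2 \<and> u \<in> poly2 \<and> \<Lambda> > (0::real) \<and> \<Lambda> \<le> 1 \<and>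
         (n = 0 \<longrightarrow> A = P \<and> B = Q)"
      "case st n of (A, B, u, \<Lambda>) \<Rightarrow> case st (Suc n) of (A', B', u', \<Lambda>') \<Rightarrow>
        (\<forall>x\<in>L n. u' (F (Suc n) x) \<noteq> 0 \<and> \<Lambda>' \<le> \<Lambda> * cmod (u' (F (Suc n) x)) \<and>
          cmod (A' (F (Suc n) x) - u' (F (Suc n) x) * A (F n x)) \<le> \<epsilon> * (1/2) ^ n * \<Lambda> * cmod (u' (F (Suc n) x)) \<and>
          cmod (B' (F (Suc n) x) - u' (F (Suc n) x) * B (F n x)) \<le> \<epsilon> * (1/2) ^ n * \<Lambda> * cmod (u' (F (Suc n) x)))" for n
    by (rule conjunct1[OF spec[OF stt, of n]], rule conjunct2[OF spec[OF stt, of n]])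
  define pA pB pu \<Lambda> where "pA n = fst (st n)" and "pB n = fst (snd (st n))" and "pu n = fst (snd (snd (st n)))"
    and "\<Lambda> n = snd (snd (snd (st n)))" for n
  have pp: "pA n \<in> poly2" "pB n \<in> poly2" "pu n \<in> poly2" "\<Lambda> n > 0" "\<Lambda> n \<le> 1" for n
    using st(1)[of n] by (auto simp: pA_def pB_def pu_def \<Lambda>_def split: prod.splits)
  have pP: "pA 0 = P" "pB 0 = Q" using st(1)[of 0] by (auto simp: pA_def pB_def split: prod.splits)
  define w where "w n x = pu n (F n x)" for n x
  have rec: "w (Suc n) x \<noteq> 0" "\<Lambda> (Suc n) \<le> \<Lambda> n * cmod (w (Suc n) x)"
     "cmod (pA (Suc n) (F (Suc n) x) - w (Suc n) x * pA n (F n x)) \<le> \<epsilon> * (1/2) ^ n * \<Lambda> n * cmod (w (Suc n) x)"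
     "cmod (pB (Suc n) (F (Suc n) x) - w (Suc n) x * pB n (F n x)) \<le> \<epsilon> * (1/2) ^ n * \<Lambda> n * cmod (w (Suc n) x)"
    if "x \<in> L n" for n x
    using st(2)[of n] that by (auto simp: pA_def pB_def pu_def \<Lambda>_def w_def split: prod.splits)

  \<comment> \<open>Limits with the common factors divided out\<close>
  define v where "v j k x = (\<Prod>i<k. w (j + Suc i) x)" for j k x
  have inL: "x \<in> L (j + k)" if "x \<in> L j" for x j k using Lmono[of j "j + k"] that by auto
  have v: "v j k x \<noteq> 0 \<and> \<Lambda> (j + k) \<le> \<Lambda> j * cmod (v j k x)" if x: "x \<in> L j" for j k x
  proof (induction k)
    case 0 then show ?case by (simp add: v_def)
  next
    case (Suc k)
    have vS: "v j (Suc k) x = v j k x * w (Suc (j + k)) x" by (simp add: v_def)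
    have "\<Lambda> (j + Suc k) \<le> \<Lambda> (j + k) * cmod (w (Suc (j + k)) x)" using rec(2)[OF inL[OF x, of k]] by simp
    also have "\<dots> \<le> (\<Lambda> j * cmod (v j k x)) * cmod (w (Suc (j + k)) x)" using Suc by (intro mult_right_mono) auto
    finally show ?case using Suc rec(1)[OF inL[OF x, of k]] by (simp add: vS norm_mult mult_ac)
  qed
  have vL: "\<Lambda> (j + k) \<le> cmod (v j k x)" if "x \<in> L j" for j k x
  proof -
    have "\<Lambda> j * cmod (v j k x) \<le> 1 * cmod (v j k x)" using pp(5) by (intro mult_right_mono) auto
    then show ?thesis using v[OF that, of k] by linarith
  qed
  \<comment> \<open>For fixed \<open>j\<close> the approximants of level \<open>j + k\<close> are
    brought back to level \<open>j\<close> by dividing by the factors acquired in between. The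
    product \<open>v\<close> starts at index \<open>j + 1\<close> because a factor is stored with
    the later of its two levels.\<close>
  define as where "as p j k x = p (j + k) (F (j + k) x) / v j k x" for p :: "nat \<Rightarrow> complex^2 \<Rightarrow> complex" and j k x
  \<comment> \<open>Dividing the error of the step by the old and the new factors leaves
    \<open>\<epsilon> * (1/2) ^ (j + k) * \<Lambda> (j + k) / cmod (v j k x)\<close>, and
    \<open>\<Lambda> (j + k)\<close> does not exceed \<open>cmod (v j k x)\<close>.\<close>
  have small: "cmod (as p j (Suc k) x - as p j k x) \<le> \<epsilon> * (1/2) ^ k"
    if x: "x \<in> L j" and p: "\<And>n x. x \<in> L n \<Longrightarrow>
      cmod (p (Suc n) (F (Suc n) x) - w (Suc n) x * p n (F n x)) \<le> \<epsilon> * (1/2) ^ n * \<Lambda> n * cmod (w (Suc n) x)"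
    for p :: "nat \<Rightarrow> complex^2 \<Rightarrow> complex" and j k x
  proof -
    define a a' W where "a = p (j + k) (F (j + k) x)" and "a' = p (Suc (j + k)) (F (Suc (j + k)) x)"
      and "W = w (Suc (j + k)) x"
    have W: "W \<noteq> 0" "v j k x \<noteq> 0" using rec(1)[OF inL[OF x, of k]] v[OF x, of k] by (auto simp: W_def)
    have "as p j (Suc k) x - as p j k x = a' / (v j k x * W) - a / v j k x"
      by (simp add: as_def a_def a'_def W_def v_def)
    also have "\<dots> = (a' - W * a) / (v j k x * W)" using W by (simp add: field_simps)
    finally have "cmod (as p j (Suc k) x - as p j k x) = cmod (a' - W * a) / (cmod (v j k x) * cmod W)"
      by (simp add: norm_divide norm_mult)
    also have "\<dots> \<le> (\<epsilon> * (1/2) ^ (j + k) * \<Lambda> (j + k) * cmod W) / (cmod (v j k x) * cmod W)"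
      using p[OF inL[OF x, of k]] by (intro divide_right_mono) (auto simp: a_def a'_def W_def)
    also have "\<dots> = \<epsilon> * (1/2) ^ (j + k) * (\<Lambda> (j + k) / cmod (v j k x))" using W by simp
    also have "\<dots> \<le> \<epsilon> * (1/2) ^ k * 1"
    proof (rule mult_mono)
      show "\<epsilon> * (1/2) ^ (j + k) \<le> \<epsilon> * (1/2) ^ k" using \<epsilon>(1) by (intro mult_left_mono power_decreasing) auto
      show "\<Lambda> (j + k) / cmod (v j k x) \<le> 1" using vL[OF x, of k] W by simp
    qed (use \<epsilon>(1) pp(4)[of "j + k"] in auto)
    finally show ?thesis by simp
  qed
  have lim: "\<exists>l. uniform_limit (L j) (as p j) l sequentially \<and> (\<forall>x\<in>L j. cmod (l x - as p j 0 x) \<le> 2 * \<epsilon>)"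
    if "\<And>n x. x \<in> L n \<Longrightarrow>
      cmod (p (Suc n) (F (Suc n) x) - w (Suc n) x * p n (F n x)) \<le> \<epsilon> * (1/2) ^ n * \<Lambda> n * cmod (w (Suc n) x)"
    for p :: "nat \<Rightarrow> complex^2 \<Rightarrow> complex" and j
    by (rule geometric_uniform_limit) (use small that \<epsilon>(1) in auto)
  obtain \<alpha> where \<alpha>: "\<And>j. uniform_limit (L j) (as pA j) (\<alpha> j) sequentially"
      "\<And>j x. x \<in> L j \<Longrightarrow> cmod (\<alpha> j x - as pA j 0 x) \<le> 2 * \<epsilon>" using lim[of pA, OF rec(3)] by metis
  obtain \<beta> where \<beta>: "\<And>j. uniform_limit (L j) (as pB j) (\<beta> j) sequentially"
      "\<And>j x. x \<in> L j \<Longrightarrow> cmod (\<beta> j x - as pB j 0 x) \<le> 2 * \<epsilon>" using lim[of pB, OF rec(4)] by metis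
  have rel1: "l (Suc j) x = l j x * w (Suc j) x"
    if l: "\<And>j. uniform_limit (L j) (as p j) (l j) sequentially" and x: "x \<in> L j" for l p j x
  proof (rule LIMSEQ_unique)
    show "(\<lambda>k. as p (Suc j) k x) \<longlonglongrightarrow> l (Suc j) x"
      by (rule tendsto_uniform_limitI[OF l]) (use x LSuc in blast)
    have "(\<lambda>k. as p j (Suc k) x) \<longlonglongrightarrow> l j x"
      using tendsto_uniform_limitI[OF l x] by (rule LIMSEQ_Suc)
    then have "(\<lambda>k. as p j (Suc k) x * w (Suc j) x) \<longlonglongrightarrow> l j x * w (Suc j) x" by (intro tendsto_intros)
    moreover have "as p j (Suc k) x * w (Suc j) x = as p (Suc j) k x" for k
      unfolding as_def v_def prod.lessThan_Suc_shift using rec(1)[OF x] by simp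
    ultimately show "(\<lambda>k. as p (Suc j) k x) \<longlonglongrightarrow> l j x * w (Suc j) x" by simp
  qed
  \<comment> \<open>Limits at different levels differ by the factor \<open>v\<close>, which is the
    same for numerator and denominator; their quotient is therefore independent of the
    level.\<close>
  have rel: "l (j + k) x = l j x * v j k x"
    if l: "\<And>j. uniform_limit (L j) (as p j) (l j) sequentially" and x: "x \<in> L j" for l p j x k
  proof (induction k)
    case (Suc k)
    then show ?case using rel1[OF l inL[OF x, of k]] by (simp add: v_def)
  qed (simp add: v_def)
  have GpL: "G j y \<in> L j" if "y \<in> pd (r j)" for j y using that VL(1)[of j] by (auto simp: V_def)
  have hol: "holo_fun X (V j) (l j)"
    if l: "uniform_limit (L j) (as p j) (l j) sequentially" and p: "\<And>n. p n \<in> poly2" for l p j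
    unfolding V_def
  proof (subst c.holo_G_image[OF pd_props(1)], rule holo_uniform_limit[OF pd_props(1)])
    have tr: "holo_Cn (pd (r j)) (\<lambda>y. q (F (j + i) (G j y)))" if "q \<in> poly2" for q i
      using holo_Cn_subset[OF c.transition_holo[OF chart[of "j + i"] Xs_mono that]] pd_props(1) by auto
    show "holo_Cn (pd (r j)) (\<lambda>y. as p j k (G j y))" for k
      unfolding as_def v_def w_def
    proof (intro holo_Cn_divide holo_Cn_prod tr p pp pd_props)
      fix y assume "y \<in> pd (r j)"
      then show "(\<Prod>i<k. pu (j + Suc i) (F (j + Suc i) (G j y))) \<noteq> 0"
        using v[OF GpL, of y j k] by (simp add: v_def w_def)
    qed
    show "uniform_limit (pd (r j)) (\<lambda>k y. as p j k (G j y)) (\<lambda>y. l j (G j y)) sequentially"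
    proof (rule uniform_limitI)
      fix e :: real assume "e > 0"
      with l have "eventually (\<lambda>n. \<forall>x\<in>L j. dist (as p j n x) (l j x) < e) sequentially" by (simp add: uniform_limit_iff)
      then show "eventually (\<lambda>n. \<forall>y\<in>pd (r j). dist (as p j n (G j y)) (l j (G j y)) < e) sequentially"
        by eventually_elim (use GpL in blast)
    qed
  qed
  have hol\<alpha>: "holo_fun X (V j) (\<alpha> j)" and hol\<beta>: "holo_fun X (V j) (\<beta> j)" for j
    by (rule hol[OF \<alpha>(1) pp(1)], rule hol[OF \<beta>(1) pp(2)])
  have K0: "\<beta> 0 x \<noteq> 0 \<and> cmod (\<alpha> 0 x / \<beta> 0 x - P (F 0 x) / Q (F 0 x)) < \<delta>" if x: "x \<in> K" for x
  proof (rule \<eta>(2))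
    have xL: "x \<in> L 0" using KV x by blast
    show "cmod (\<alpha> 0 x - P (F 0 x)) < \<eta>" "cmod (\<beta> 0 x - Q (F 0 x)) < \<eta>"
      using \<alpha>(2)[OF xL] \<beta>(2)[OF xL] \<epsilon>(2) by (auto simp: as_def v_def pP)
  qed (use x in simp)
  obtain x0 where x0: "x0 \<in> K" using K(3) by blast
  have Vmono: "V i \<subseteq> V j" if "i \<le> j" for i j
    using lift_Suc_mono_le[of V, OF _ that] VL by blast
  \<comment> \<open>The limit denominator is non-zero at a point of \<open>K\<close>, and this point
    lies in every \<open>V j\<close>; since polydiscs are convex, the identity theorem excludes zero
    germs.\<close>
  have nzG: "\<not> zero_germ (\<lambda>y. \<beta> j (G j y)) y" if y: "y \<in> pd (r j)" for j y
  proof -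
    have "x0 \<in> V j" using x0 KV(1) Vmono[of 0 j] by auto
    then obtain y0 where y0: "y0 \<in> pd (r j)" "x0 = G j y0" unfolding V_def by blast
    have "x0 \<in> L 0" using x0 KV by blast
    then have "\<beta> j x0 = \<beta> 0 x0 * v 0 j x0" "v 0 j x0 \<noteq> 0" using rel[OF \<beta>(1), of x0 0 j] v[of x0 0 j] by auto
    then have "\<beta> j (G j y0) \<noteq> 0" using K0[OF x0] y0(2) by auto
    moreover have "holo_Cn (pd (r j)) (\<lambda>y. \<beta> j (G j y))"
      using hol\<beta>[of j] unfolding V_def c.holo_G_image[OF pd_props(1)] .
    ultimately show ?thesis
      using not_zero_germ_convex[OF _ pd_props(2) y0(1) y] not_zero_germI[of "\<lambda>y. \<beta> j (G j y)" y0] by blast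
  qed
  have nz: "\<not> germ_eq X x (\<beta> j) (\<lambda>_. 0)" if xV: "x \<in> V j" for x j
  proof -
    obtain y where "y \<in> pd (r j)" "x = G j y" using xV unfolding V_def by blast
    then show ?thesis using nzG[of y j] by (simp add: c.germ_eq_iff zero_germ_def)
  qed
  have near: "holo_near X x (\<alpha> j)" "holo_near X x (\<beta> j)" if "x \<in> V j" for x j
    using hol\<alpha> hol\<beta> that by (auto simp: holo_near_def)
  have same: "germ_quotient X x (\<alpha> j) (\<beta> j) = germ_quotient X x (\<alpha> k) (\<beta> k)" if x: "x \<in> V j" and jk: "j \<le> k" for x j k
  proof -
    obtain y where y: "y \<in> pd (r j)" "x = G j y" using x unfolding V_def by blast
    have xk: "x \<in> V k" using x Vmono[OF jk] by blast
    note n = near[OF x] near[OF xk] nz[OF x] nz[OF xk]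
    show ?thesis unfolding y(2)
    proof (rule c.germ_quotient_cong)
      show "hol_at (\<lambda>x. \<alpha> j (G j x)) y" "hol_at (\<lambda>x. \<beta> j (G j x)) y" "hol_at (\<lambda>x. \<alpha> k (G j x)) y" "hol_at (\<lambda>x. \<beta> k (G j x)) y"
        using n unfolding y(2) c.holo_near_iff by auto
      show "\<not> zero_germ (\<lambda>x. \<beta> j (G j x)) y" "\<not> zero_germ (\<lambda>x. \<beta> k (G j x)) y"
        using n unfolding y(2) c.germ_eq_iff zero_germ_def by auto
      obtain d where d: "k = j + d" using jk le_Suc_ex by blast
      have "\<alpha> j (G j z) * \<beta> k (G j z) = \<alpha> k (G j z) * \<beta> j (G j z)" if "z \<in> pd (r j)" for z
        using rel[OF \<alpha>(1) GpL[OF that], of d] rel[OF \<beta>(1) GpL[OF that], of d] by (simp add: d)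
      then show "eventually (\<lambda>z. \<alpha> j (G j z) * \<beta> k (G j z) = \<alpha> k (G j z) * \<beta> j (G j z)) (nhds y)"
        unfolding eventually_nhds using pd_props(1) y(1) by blast
    qed
  qed
  define jj where "jj x = (LEAST j. x \<in> V j)" for x
  define s where "s = (\<lambda>x\<in>topspace (mtop X). germ_quotient X x (\<alpha> (jj x)) (\<beta> (jj x)))"
  have sV: "s x = germ_quotient X x (\<alpha> k) (\<beta> k)" if x: "x \<in> V k" for x k
  proof -
    have "x \<in> V (jj x)" "jj x \<le> k" unfolding jj_def using LeastI[of "\<lambda>j. x \<in> V j"] Least_le[of "\<lambda>j. x \<in> V j"] x by auto
    moreover have "x \<in> topspace (mtop X)" using openin_subset[OF Vo] x by blast
    ultimately show ?thesis using same by (simp add: s_def)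
  qed
  have sM: "s \<in> meromorphic_funs X"
    unfolding meromorphic_funs_def
  proof (intro CollectI conjI ballI)
    show "s \<in> extensional (topspace (mtop X))" unfolding s_def by simp
    fix p assume "p \<in> topspace (mtop X)"
    then obtain k where k: "p \<in> V k" using r(4) unfolding V_def by blast
    show "\<exists>W g h. p \<in> W \<and> holo_fun X W g \<and> holo_fun X W h \<and>
        (\<forall>q\<in>W. \<not> germ_eq X q h (\<lambda>_. 0) \<and> s q = germ_quotient X q g h)"
      using k hol\<alpha> hol\<beta> nz sV by (intro exI[of _ "V k"] exI[of _ "\<alpha> k"] exI[of _ "\<beta> k"]) auto
  qed
  have h0: "holo_Cn (pd (r 0)) (\<lambda>y. \<alpha> 0 (G 0 y))" "holo_Cn (pd (r 0)) (\<lambda>y. \<beta> 0 (G 0 y))"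
    using hol\<alpha>[of 0] hol\<beta>[of 0] unfolding V_def c.holo_G_image[OF pd_props(1)] by auto
  \<comment> \<open>Where the limit denominator of level 0 has no zeros, the section is the function
    \<open>\<alpha> 0 / \<beta> 0\<close>; this region contains \<open>K\<close>.\<close>
  define N where "N = pd (r 0) \<inter> (\<lambda>y. \<beta> 0 (G 0 y)) -` (- {0})"
  have N: "open N" unfolding N_def
    by (intro continuous_open_preimage holo_Cn_continuous_on h0 pd_props) auto
  define f where "f x = \<alpha> 0 x / \<beta> 0 x" for x
  have hN: "holo_Cn N (\<lambda>y. \<alpha> 0 (G 0 y))" "holo_Cn N (\<lambda>y. \<beta> 0 (G 0 y))"
    by (rule holo_Cn_subset[OF h0(1) N], simp add: N_def, rule holo_Cn_subset[OF h0(2) N], simp add: N_def)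
  have fN: "holo_Cn N (\<lambda>y. f (G 0 y))"
    unfolding f_def by (intro holo_Cn_divide hN) (simp add: N_def)
  have fW: "holo_fun X (G 0 ` N) f" using fN unfolding c.holo_G_image[OF N] .
  show ?thesis
  proof (rule that[OF sM _ fW])
    show "K \<subseteq> G 0 ` N"
    proof
      fix x assume x: "x \<in> K"
      then obtain y where y: "y \<in> pd (r 0)" "x = G 0 y" using KV(1) unfolding V_def by blast
      then have "y \<in> N" using K0[OF x] by (simp add: N_def)
      then show "x \<in> G 0 ` N" using y(2) by blast
    qed
    fix q assume "q \<in> G 0 ` N"
    then obtain y where y: "y \<in> N" "q = G 0 y" by blast
    have qV: "q \<in> V 0" using y by (auto simp: V_def N_def)
    have "germ_quotient X (G 0 y) (\<alpha> 0) (\<beta> 0) = germ_quotient X (G 0 y) f (\<lambda>_. 1)"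
    proof (rule c.germ_quotient_cong)
      show "hol_at (\<lambda>x. \<alpha> 0 (G 0 x)) y" "hol_at (\<lambda>x. \<beta> 0 (G 0 x)) y" "hol_at (\<lambda>x. f (G 0 x)) y"
        using hN fN y(1) by (auto intro: hol_atI)
      show "hol_at (\<lambda>_. 1) y" by (rule hol_at_const)
      show "\<not> zero_germ (\<lambda>x. \<beta> 0 (G 0 x)) y" by (rule not_zero_germI) (use y(1) in \<open>simp add: N_def\<close>)
      show "\<not> zero_germ (\<lambda>_. 1) y" by (rule not_zero_germI[of "\<lambda>_. 1" y]) simp
      have "\<alpha> 0 (G 0 z) * 1 = f (G 0 z) * \<beta> 0 (G 0 z)" if "z \<in> N" for z using that by (simp add: f_def N_def)
      then show "eventually (\<lambda>z. \<alpha> 0 (G 0 z) * 1 = f (G 0 z) * \<beta> 0 (G 0 z)) (nhds y)"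
        unfolding eventually_nhds using N y(1) by blast
    qed
    then show "s q = germ_quotient X q f (\<lambda>_. 1)" using sV[OF qV] y(2) by simp
  next
    fix x assume "x \<in> K"
    then show "cmod (f x - P (F 0 x) / Q (F 0 x)) < \<delta>" using K0 by (simp add: f_def)
  qed
qed

corollary section_approx:
  assumes PQ: "P \<in> poly2" "Q \<in> poly2" and K: "compactin (mtop X) K" "K \<subseteq> Xs j" "K \<noteq> {}"
    and Q0: "\<And>x. x \<in> K \<Longrightarrow> Q (F j x) \<noteq> 0" and \<delta>: "\<delta> > 0"
  obtains s W f where "s \<in> meromorphic_funs X" "K \<subseteq> W" "holo_fun X W f"
    "\<And>q. q \<in> W \<Longrightarrow> s q = germ_quotient X q f (\<lambda>_. 1)"
    "\<And>x. x \<in> K \<Longrightarrow> cmod (f x - P (F j x) / Q (F j x)) < \<delta>"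
proof -
  interpret sh: long_plane X "\<lambda>i. Xs (i + j)" "\<lambda>i. F (i + j)" "\<lambda>i. G (i + j)" by (rule shift)
  show ?thesis
    by (rule sh.section_approx0[OF PQ K(1) _ K(3) _ \<delta>]) (use K(2) Q0 that in auto)
qed

text \<open>In each step numerator and denominator are approximated at the next level with the same
  new denominator \<open>t\<close>, which cancels from their quotient.\<close>

lemma rational_approx:
  assumes P: "P \<in> poly2" and K: "compactin (mtop X) K" "K \<subseteq> Xs j" and jm: "j \<le> m" and \<delta>: "\<delta> > 0"
  shows "\<exists>A\<in>poly2. \<exists>u\<in>poly2. \<forall>x\<in>K. u (F m x) \<noteq> 0 \<and> cmod (A (F m x) / u (F m x) - P (F j x)) < \<delta>"
  using jm \<delta>
proof (induction m arbitrary: \<delta> rule: dec_induct)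
  case base
  have "(\<lambda>_. 1) \<in> poly2" unfolding poly2_def by (rule fun_alg.const)
  then show ?case using P base by (intro bexI[of _ P] bexI[of _ "\<lambda>_. 1"]) auto
next
  case (step m)
  interpret c: plane_chart X "Xs m" "F m" "G m" by (rule chart)
  have KX: "K \<subseteq> Xs m" using K(2) Xs_mono step.hyps by blast
  have \<delta>2: "\<delta> / 2 > 0" using step.prems by simp
  obtain A u where A: "A \<in> poly2" "u \<in> poly2"
      "\<And>x. x \<in> K \<Longrightarrow> u (F m x) \<noteq> 0 \<and> cmod (A (F m x) / u (F m x) - P (F j x)) < \<delta> / 2"
    using step.IH[OF \<delta>2] by blast
  have cont: "continuous_on (F m ` K) p" if "p \<in> poly2" for p
    using holo_Cn_continuous_on[OF poly2_holo[OF that]] continuous_on_subset by blast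
  have unz: "u x \<noteq> 0" if "x \<in> F m ` K" for x using A(3) that by auto
  obtain \<eta> where \<eta>: "\<eta> > 0" "\<And>x a w. x \<in> F m ` K \<Longrightarrow> cmod (a - A x) < \<eta> \<Longrightarrow> cmod (w - u x) < \<eta> \<Longrightarrow>
      w \<noteq> 0 \<and> cmod (a / w - A x / u x) < \<delta> / 2"
    using quotient_approx[OF c.compact_F_image[OF K(1) KX] cont[OF A(1)] cont[OF A(2)] unz \<delta>2] by blast
  obtain A' u' t where A': "A' \<in> poly2" "u' \<in> poly2" "t \<in> poly2"
      "\<And>x. x \<in> K \<Longrightarrow> t (F (Suc m) x) \<noteq> 0 \<and> cmod (A' (F (Suc m) x) / t (F (Suc m) x) - A (F m x)) < \<eta> \<and>
        cmod (u' (F (Suc m) x) / t (F (Suc m) x) - u (F m x)) < \<eta>"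
    using approx_step[OF chart[of m] chart[of "Suc m"] Xs_Suc Runge A(1,2) K(1) KX \<eta>(1)] by blast
  have "u' (F (Suc m) x) \<noteq> 0 \<and> cmod (A' (F (Suc m) x) / u' (F (Suc m) x) - P (F j x)) < \<delta>" if x: "x \<in> K" for x
  proof -
    define a' w' t' where "a' = A' (F (Suc m) x)" and "w' = u' (F (Suc m) x)" and "t' = t (F (Suc m) x)"
    have t: "t' \<noteq> 0" using A'(4)[OF x] by (simp add: t'_def)
    have *: "w' / t' \<noteq> 0 \<and> cmod ((a' / t') / (w' / t') - A (F m x) / u (F m x)) < \<delta> / 2"
      by (rule \<eta>(2)) (use A'(4)[OF x] x in \<open>auto simp: a'_def w'_def t'_def\<close>)
    then have "w' \<noteq> 0" "cmod (a' / w' - A (F m x) / u (F m x)) < \<delta> / 2" using t by auto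
    moreover have "cmod ((a' / w' - A (F m x) / u (F m x)) + (A (F m x) / u (F m x) - P (F j x))) < \<delta> / 2 + \<delta> / 2"
      using calculation A(3)[OF x] by (intro norm_triangle_lt add_strict_mono) auto
    ultimately show ?thesis by (simp add: a'_def w'_def)
  qed
  then show ?case using A' by blast
qed

end

section \<open>Maps close to the identity\<close>

definition pdc :: "complex^2 \<Rightarrow> real \<Rightarrow> (complex^2) set" where
  "pdc c r = rect2 (ball (c $ 1) r) (ball (c $ 2) r)"

lemma open_pdc: "open (pdc c r)"
  unfolding pdc_def by (intro open_rect2) auto

lemma pdc_iff: "x \<in> pdc c r \<longleftrightarrow> (\<forall>i. dist (c $ i) (x $ i) < r)"
  by (simp add: pdc_def forall_2)

lemma pdc_mono: "r \<le> r' \<Longrightarrow> pdc c r \<subseteq> pdc c r'"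
  by (meson pdc_iff less_le_trans subsetI)

text \<open>Cauchy's inequality on discs of radius close to 1 bounds the derivative by
  \<open>\<eta>\<close>.\<close>

lemma bounded_holomorphic_lipschitz:
  assumes f: "f holomorphic_on ball c (\<rho> + 1)" and b: "\<And>z. z \<in> ball c (\<rho> + 1) \<Longrightarrow> cmod (f z) \<le> \<eta>"
    and xy: "x \<in> ball c \<rho>" "y \<in> ball c \<rho>"
  shows "cmod (f x - f y) \<le> \<eta> * cmod (x - y)"
proof (rule field_differentiable_bound[OF convex_ball _ _ xy])
  fix z assume z: "z \<in> ball c \<rho>"
  have sub: "ball z 1 \<subseteq> ball c (\<rho> + 1)" "z \<in> ball c (\<rho> + 1)"
    using z by (auto simp: dist_norm) (smt (verit) norm_triangle_ineq4 dist_norm dist_triangle)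
  show "(f has_field_derivative deriv f z) (at z within ball c \<rho>)"
    using holomorphic_derivI[OF f open_ball sub(2)] has_field_derivative_at_within by blast
  show "cmod (deriv f z) \<le> \<eta>"
  proof (rule field_le_epsilon)
    fix e :: real assume e: "e > 0"
    show "cmod (deriv f z) \<le> \<eta> + e"
    proof -
      have \<eta>0: "\<eta> \<ge> 0" using b[OF sub(2)] norm_ge_zero order_trans by blast
      \<comment> \<open>\<open>r < 1\<close> keeps the closed disc inside the domain, and
        \<open>\<eta> / r \<le> \<eta> + e\<close>; the term \<open>e / 2\<close> makes
        \<open>r\<close> positive even if \<open>\<eta> = 0\<close>.\<close>
      define r where "r = (\<eta> + e / 2) / (\<eta> + e)"
      have r: "0 < r" "r < 1" using \<eta>0 e by (auto simp: r_def field_simps)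
      have c: "cball z r \<subseteq> ball c (\<rho> + 1)" using sub(1) r(2) by (auto simp: subset_iff)
      have "norm ((deriv ^^ 1) f z) \<le> fact 1 * \<eta> / r ^ 1"
      proof (rule Cauchy_inequality)
        show "f holomorphic_on ball z r" by (rule holomorphic_on_subset[OF f]) (use c in auto)
        show "continuous_on (cball z r) f"
          by (rule continuous_on_subset[OF holomorphic_on_imp_continuous_on[OF f] c])
        show "cmod (f x) \<le> \<eta>" if "cmod (z - x) = r" for x
          by (rule b) (use that c in \<open>auto simp: dist_norm subset_iff\<close>)
      qed (use r in simp)
      then have "cmod (deriv f z) \<le> \<eta> / r" by simp
      also have "\<eta> / r \<le> \<eta> + e"
      proof -
        have "\<eta> \<le> (\<eta> + e) * r" using \<eta>0 e by (simp add: r_def)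
        then show ?thesis using r(1) by (simp add: divide_le_eq)
      qed
      finally show ?thesis .
    qed
  qed
qed

text \<open>The inverse is the fixed point of \<open>x = y - E x\<close> with
  \<open>E x = H x - x\<close>. Of the margin 2, one unit is spent on the Lipschitz estimate for
  \<open>E\<close> by Cauchy's inequality; the other houses the iterates, whose coordinates stay
  within 1/4 of those of \<open>y\<close>. The iterates are holomorphic in \<open>y\<close> and
  converge uniformly.\<close>

lemma near_identity_inverse:
  fixes H :: "complex^2 \<Rightarrow> complex^2"
  assumes H: "\<And>i. holo_Cn (pdc c (\<rho> + 2)) (\<lambda>x. H x $ i)"
    and close: "\<And>x i. x \<in> pdc c (\<rho> + 2) \<Longrightarrow> cmod (H x $ i - x $ i) \<le> 1/4"
  obtains \<Phi> where "\<And>i. holo_Cn (pdc c \<rho>) (\<lambda>y. \<Phi> y $ i)"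
    "\<And>y. y \<in> pdc c \<rho> \<Longrightarrow> \<Phi> y \<in> pdc c (\<rho> + 1) \<and> H (\<Phi> y) = y"
    "\<And>x. x \<in> pdc c (\<rho> + 1) \<Longrightarrow> H x \<in> pdc c \<rho> \<Longrightarrow> \<Phi> (H x) = x"
proof -
  define E where "E i x = H x $ i - x $ i" for i :: 2 and x
  have E: "holo_Cn (pdc c (\<rho> + 2)) (E i)" for i
    unfolding E_def by (intro holo_Cn_diff H holo_Cn_nth open_pdc)
  \<comment> \<open>In the sum norm each of the two components of \<open>E\<close> has Lipschitz
    constant 1/4, so the iteration contracts by 1/2.\<close>
  define N where "N x = cmod (x $ 1) + cmod (x $ 2)" for x :: "complex^2"
  have lip1: "cmod (E i x - E i y) \<le> 1/4 * N (x - y)" if "x \<in> pdc c (\<rho> + 1)" "y \<in> pdc c (\<rho> + 1)" for i x y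
  proof -
    have xy: "x $ k \<in> ball (c $ k) (\<rho> + 1)" "y $ k \<in> ball (c $ k) (\<rho> + 1)" for k using that by (auto simp: pdc_iff)
    have big: "ball (c $ k) (\<rho> + 1) \<subseteq> ball (c $ k) (\<rho> + 2)" for k by auto
    have 1: "cmod (E i (pt (x $ 1) (x $ 2)) - E i (pt (y $ 1) (x $ 2))) \<le> 1/4 * cmod (x $ 1 - y $ 1)"
    proof (rule bounded_holomorphic_lipschitz[of "\<lambda>t. E i (pt t (x $ 2))"])
      show "(\<lambda>t. E i (pt t (x $ 2))) holomorphic_on ball (c $ 1) (\<rho> + 1 + 1)"
        by (rule holo_slice1[OF E]) (use xy(1)[of 2] in \<open>auto simp: pdc_def add.assoc\<close>)
      show "cmod (E i (pt z (x $ 2))) \<le> 1/4" if "z \<in> ball (c $ 1) (\<rho> + 1 + 1)" for z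
        unfolding E_def by (rule close) (use xy(1)[of 2] that in \<open>auto simp: pdc_def add.assoc\<close>)
    qed (use xy in auto)
    have 2: "cmod (E i (pt (y $ 1) (x $ 2)) - E i (pt (y $ 1) (y $ 2))) \<le> 1/4 * cmod (x $ 2 - y $ 2)"
    proof (rule bounded_holomorphic_lipschitz[of "\<lambda>t. E i (pt (y $ 1) t)"])
      show "(\<lambda>t. E i (pt (y $ 1) t)) holomorphic_on ball (c $ 2) (\<rho> + 1 + 1)"
        by (rule holo_slice2[OF E]) (use xy(2)[of 1] in \<open>auto simp: pdc_def add.assoc\<close>)
      show "cmod (E i (pt (y $ 1) z)) \<le> 1/4" if "z \<in> ball (c $ 2) (\<rho> + 1 + 1)" for z
        unfolding E_def by (rule close) (use xy(2)[of 1] that in \<open>auto simp: pdc_def add.assoc\<close>)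
    qed (use xy in auto)
    have "cmod (E i x - E i y) \<le> cmod (E i (pt (x $ 1) (x $ 2)) - E i (pt (y $ 1) (x $ 2)))
        + cmod (E i (pt (y $ 1) (x $ 2)) - E i (pt (y $ 1) (y $ 2)))"
      using norm_triangle_ineq[of "E i (pt (x $ 1) (x $ 2)) - E i (pt (y $ 1) (x $ 2))"
          "E i (pt (y $ 1) (x $ 2)) - E i (pt (y $ 1) (y $ 2))"] by simp
    with 1 2 show ?thesis by (simp add: N_def)
  qed
  define step where "step y x = pt (y $ 1 - E 1 x) (y $ 2 - E 2 x)" for y x :: "complex^2"
  define \<phi> where "\<phi> n y = ((step y) ^^ n) y" for n y
  have \<phi>0: "\<phi> 0 y = y" and \<phi>S: "\<phi> (Suc n) y = step y (\<phi> n y)" for n y by (simp_all add: \<phi>_def)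
  have stepn: "step y x $ i = y $ i - E i x" for x y i using exhaust_2[of i] by (auto simp: step_def)
  have stay: "step y x \<in> pdc c (\<rho> + 1)" if "y \<in> pdc c \<rho>" "x \<in> pdc c (\<rho> + 1)" for x y
    unfolding pdc_iff
  proof
    fix i
    have "x \<in> pdc c (\<rho> + 2)" using that(2) pdc_mono[of "\<rho> + 1" "\<rho> + 2" c] by auto
    then have "cmod (E i x) \<le> 1/4" unfolding E_def by (rule close)
    moreover have "dist (c $ i) (y $ i) < \<rho>" using that(1) by (simp add: pdc_iff)
    moreover have "dist (c $ i) (step y x $ i) \<le> dist (c $ i) (y $ i) + cmod (E i x)"
      using dist_triangle[of "c $ i" "step y x $ i" "y $ i"] by (simp add: stepn dist_norm)
    ultimately show "dist (c $ i) (step y x $ i) < \<rho> + 1" by linarith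
  qed
  have \<phi>in: "\<phi> n y \<in> pdc c (\<rho> + 1)" if "y \<in> pdc c \<rho>" for n y
  proof (induction n)
    case 0 then show ?case using that pdc_mono[of \<rho> "\<rho> + 1" c] by (auto simp: \<phi>0)
  qed (simp add: \<phi>S stay that)
  have contr: "N (step y x - step y x') \<le> 1/2 * N (x - x')"
    if "x \<in> pdc c (\<rho> + 1)" "x' \<in> pdc c (\<rho> + 1)" for x x' y
  proof -
    have "N (step y x - step y x') = cmod (E 1 x - E 1 x') + cmod (E 2 x - E 2 x')"
      unfolding N_def by (simp add: stepn norm_minus_commute)
    also have "\<dots> \<le> 1/4 * N (x - x') + 1/4 * N (x - x')" using lip1[OF that] by (intro add_mono) auto
    finally show ?thesis by simp
  qed
  have geo: "N (\<phi> (Suc n) y - \<phi> n y) \<le> (1/2) ^ n" if y: "y \<in> pdc c \<rho>" for n y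
  proof (induction n)
    case 0
    have "y \<in> pdc c (\<rho> + 2)" using y pdc_mono[of \<rho> "\<rho> + 2" c] by auto
    then have "cmod (E i y) \<le> 1/4" for i unfolding E_def by (rule close)
    from this[of 1] this[of 2] show ?case by (simp add: \<phi>S \<phi>0 N_def stepn)
  next
    case (Suc n)
    have "N (\<phi> (Suc (Suc n)) y - \<phi> (Suc n) y) \<le> 1/2 * N (\<phi> (Suc n) y - \<phi> n y)"
      unfolding \<phi>S[of "Suc n"] by (subst (2) \<phi>S) (rule contr[OF \<phi>in[OF y] \<phi>in[OF y]])
    with Suc show ?case by simp
  qed
  have "\<exists>l. uniform_limit (pdc c \<rho>) (\<lambda>n y. \<phi> n y $ i) l sequentially \<and> (\<forall>x\<in>pdc c \<rho>. cmod (l x - \<phi> 0 x $ i) \<le> 2 * 1)" for i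
  proof (rule geometric_uniform_limit)
    fix k y assume y: "y \<in> pdc c \<rho>"
    have "cmod ((\<phi> (Suc k) y - \<phi> k y) $ i) \<le> N (\<phi> (Suc k) y - \<phi> k y)"
      using exhaust_2[of i] by (auto simp: N_def)
    with geo[OF y, of k] show "cmod (\<phi> (Suc k) y $ i - \<phi> k y $ i) \<le> 1 * (1/2) ^ k" by simp
  qed simp
  then obtain l where l: "\<And>i. uniform_limit (pdc c \<rho>) (\<lambda>n y. \<phi> n y $ i) (l i) sequentially" by metis
  define \<Phi> where "\<Phi> y = pt (l 1 y) (l 2 y)" for y
  have \<Phi>n: "\<Phi> y $ i = l i y" for y i using exhaust_2[of i] by (auto simp: \<Phi>_def)
  have \<phi>hol: "holo_Cn (pdc c \<rho>) (\<lambda>y. \<phi> n y $ i)" for n i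
  proof (induction n arbitrary: i)
    case 0 then show ?case unfolding \<phi>0 by (rule holo_Cn_nth[OF open_pdc])
  next
    case (Suc n)
    have "holo_Cn (pdc c \<rho>) (\<lambda>y. E i (\<phi> n y))"
      by (rule holo_Cn_compose[OF E Suc]) (use \<phi>in pdc_mono[of "\<rho> + 1" "\<rho> + 2" c] in auto)
    then show ?case unfolding \<phi>S stepn by (intro holo_Cn_diff holo_Cn_nth open_pdc)
  qed
  have \<Phi>hol: "holo_Cn (pdc c \<rho>) (\<lambda>y. \<Phi> y $ i)" for i
    unfolding \<Phi>n by (rule holo_uniform_limit[OF open_pdc \<phi>hol l])
  have conv: "(\<lambda>n. \<phi> n y) \<longlonglongrightarrow> \<Phi> y" if "y \<in> pdc c \<rho>" for y
    by (rule vec_tendstoI) (use tendsto_uniform_limitI[OF l that] in \<open>simp add: \<Phi>n\<close>)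
  have fix\<Phi>: "\<Phi> y \<in> pdc c (\<rho> + 1) \<and> (\<forall>i. \<Phi> y $ i = y $ i - E i (\<Phi> y))" if y: "y \<in> pdc c \<rho>" for y
  proof
    have a1: "cmod (\<Phi> y $ i - y $ i) \<le> 1/4" for i
    proof (rule tendsto_upperbound)
      show "(\<lambda>n. cmod (\<phi> (Suc n) y $ i - y $ i)) \<longlonglongrightarrow> cmod (\<Phi> y $ i - y $ i)"
        by (intro tendsto_intros LIMSEQ_Suc[OF conv[OF y]])
      have "\<phi> n y \<in> pdc c (\<rho> + 2)" for n using \<phi>in[OF y] pdc_mono[of "\<rho> + 1" "\<rho> + 2" c] by auto
      then show "eventually (\<lambda>n. cmod (\<phi> (Suc n) y $ i - y $ i) \<le> 1/4) sequentially"
        using close by (auto simp: \<phi>S stepn E_def norm_minus_commute)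
    qed simp
    have a2: "dist (c $ i) (y $ i) < \<rho>" for i using y by (simp add: pdc_iff)
    have a3: "dist (c $ i) (\<Phi> y $ i) \<le> dist (c $ i) (y $ i) + cmod (\<Phi> y $ i - y $ i)" for i
      using dist_triangle[of "c $ i" "\<Phi> y $ i" "y $ i"] by (simp add: dist_norm norm_minus_commute)
    have "dist (c $ i) (\<Phi> y $ i) < \<rho> + 1" for i using a1[of i] a2[of i] a3[of i] by linarith
    then show in1: "\<Phi> y \<in> pdc c (\<rho> + 1)" by (simp add: pdc_iff)
    show "\<forall>i. \<Phi> y $ i = y $ i - E i (\<Phi> y)"
    proof
      fix i
      have "\<Phi> y \<in> pdc c (\<rho> + 2)" using in1 pdc_mono[of "\<rho> + 1" "\<rho> + 2" c] by auto
      then have "isCont (E i) (\<Phi> y)" by (rule holo_Cn_continuous_at[OF E])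
      then have "(\<lambda>n. E i (\<phi> n y)) \<longlonglongrightarrow> E i (\<Phi> y)" using conv[OF y] by (rule isCont_tendsto_compose)
      then have "(\<lambda>n. \<phi> (Suc n) y $ i) \<longlonglongrightarrow> y $ i - E i (\<Phi> y)"
        unfolding \<phi>S stepn by (intro tendsto_intros)
      moreover have "(\<lambda>n. \<phi> (Suc n) y $ i) \<longlonglongrightarrow> \<Phi> y $ i"
        by (intro tendsto_intros LIMSEQ_Suc[OF conv[OF y]])
      ultimately show "\<Phi> y $ i = y $ i - E i (\<Phi> y)" by (rule LIMSEQ_unique[rotated])
    qed
  qed
  show ?thesis
  proof (rule that[OF \<Phi>hol])
    fix y assume y: "y \<in> pdc c \<rho>"
    have "H (\<Phi> y) $ i = y $ i" for i
    proof -
      have "\<Phi> y $ i = y $ i - (H (\<Phi> y) $ i - \<Phi> y $ i)" using fix\<Phi>[OF y] by (simp add: E_def)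
      then show ?thesis by simp
    qed
    then show "\<Phi> y \<in> pdc c (\<rho> + 1) \<and> H (\<Phi> y) = y" using fix\<Phi>[OF y] by (simp add: vec_eq_iff)
  next
    fix x assume x: "x \<in> pdc c (\<rho> + 1)" "H x \<in> pdc c \<rho>"
    have "step (H x) x = x" by (simp add: vec_eq_iff stepn E_def)
    moreover have "step (H x) (\<Phi> (H x)) = \<Phi> (H x)" using fix\<Phi>[OF x(2)] by (simp add: vec_eq_iff stepn)
    moreover have "N (step (H x) (\<Phi> (H x)) - step (H x) x) \<le> 1/2 * N (\<Phi> (H x) - x)"
      using fix\<Phi>[OF x(2)] x(1) by (intro contr) auto
    ultimately have "N (\<Phi> (H x) - x) \<le> 0" by simp
    then have "cmod ((\<Phi> (H x) - x) $ 1) = 0" "cmod ((\<Phi> (H x) - x) $ 2) = 0"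
      using norm_ge_zero[of "(\<Phi> (H x) - x) $ 1"] norm_ge_zero[of "(\<Phi> (H x) - x) $ 2"] unfolding N_def by linarith+
    then show "\<Phi> (H x) = x" by (simp add: vec_eq_iff forall_2)
  qed
qed

section \<open>Coordinate systems\<close>

lemma holo_fun_cong:
  assumes X: "complex_manifold X" and f: "holo_fun X W f" and eq: "\<And>x. x \<in> W \<Longrightarrow> f x = g x"
  shows "holo_fun X W g"
  unfolding holo_fun_def
proof (intro conjI ballI, use f in \<open>simp add: holo_fun_def\<close>, clarify)
  fix U \<phi> assume U: "(U, \<phi>) \<in> atlas X"
  then have "holo_Cn (\<phi> ` (U \<inter> W)) (f \<circ> inv_into U \<phi>)" using f by (auto simp: holo_fun_def)
  then show "holo_Cn (\<phi> ` (U \<inter> W)) (g \<circ> inv_into U \<phi>)"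
  proof (rule holo_Cn_cong)
    fix z assume "z \<in> \<phi> ` (U \<inter> W)"
    then obtain x where "x \<in> U" "x \<in> W" "z = \<phi> x" by blast
    then show "(f \<circ> inv_into U \<phi>) z = (g \<circ> inv_into U \<phi>) z"
      using chart_inj(3)[OF X U] eq by (simp add: inv_into_f_f)
  qed
qed

lemma holo_fun_chart:
  assumes X: "complex_manifold X" and U: "(U, \<phi>) \<in> atlas X"
  shows "holo_fun X U (\<lambda>x. \<phi> x $ i)"
  unfolding holo_fun_def
proof (intro conjI ballI chart_inj(2)[OF X U], clarify)
  fix V \<psi> assume V: "(V, \<psi>) \<in> atlas X"
  have "compatible V \<psi> U \<phi>" using X U V unfolding complex_manifold_def by blast
  then show "holo_Cn (\<psi> ` (V \<inter> U)) ((\<lambda>x. \<phi> x $ i) \<circ> inv_into V \<psi>)"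
    unfolding compatible_def holo_Cn_map_def by (simp add: o_def)
qed

text \<open>The radius 3 is 1 plus the margin 2 needed to invert a map within 1/4 of the identity.
  \<open>U\<close> corresponds to the part of the polydisc of radius 2 that is mapped into the
  polydisc of radius 1, and the latter becomes the image of the new chart.\<close>

lemma (in plane_chart) coordinates_from_functions:
  fixes f :: "2 \<Rightarrow> 'a \<Rightarrow> complex"
  assumes f: "\<And>i. holo_fun X W (f i)" and sub: "G ` pdc c 3 \<subseteq> W"
    and close: "\<And>y i. y \<in> pdc c 3 \<Longrightarrow> cmod (f i (G y) - y $ i) \<le> 1/4"
  shows "\<exists>U. G c \<in> U \<and> U \<subseteq> W \<and> holo_coordinates X U (\<lambda>x. \<chi> i. f i x)"
proof -
  define \<psi> where "\<psi> x = (\<chi> i. f i x)" for x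
  define H where "H y = \<psi> (G y)" for y
  have Hn: "H y $ i = f i (G y)" for y i by (simp add: H_def \<psi>_def)
  have Hhol: "holo_Cn (pdc c (1 + 2)) (\<lambda>y. H y $ i)" for i
  proof -
    have "holo_fun X (G ` pdc c 3) (f i)" by (rule holo_fun_subset[OF X f open_G_image[OF open_pdc] sub])
    then show ?thesis using holo_G_image[OF open_pdc, of c 3 "f i"] by (simp add: Hn)
  qed
  have "cmod (H x $ i - x $ i) \<le> 1/4" if "x \<in> pdc c (1 + 2)" for x i
    using close[of x i] that by (simp add: Hn)
  then obtain \<Phi> where \<Phi>: "\<And>i. holo_Cn (pdc c 1) (\<lambda>y. \<Phi> y $ i)"
    "\<And>y. y \<in> pdc c 1 \<Longrightarrow> \<Phi> y \<in> pdc c (1 + 1) \<and> H (\<Phi> y) = y"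
    "\<And>x. x \<in> pdc c (1 + 1) \<Longrightarrow> H x \<in> pdc c 1 \<Longrightarrow> \<Phi> (H x) = x"
    using near_identity_inverse[of c 1 H, OF Hhol] by blast
  have contH: "continuous_on (pdc c 3) H"
    using holo_map_isCont[of "pdc c (1 + 2)" H, OF Hhol] continuous_at_imp_continuous_on[of "pdc c 3" H] by simp
  have cont\<Phi>: "continuous_on (pdc c 1) \<Phi>"
    using holo_map_isCont[of "pdc c 1" \<Phi>, OF \<Phi>(1)] continuous_at_imp_continuous_on[of "pdc c 1" \<Phi>] by simp
  define U0 where "U0 = pdc c 2 \<inter> H -` pdc c 1"
  have p23: "pdc c 2 \<subseteq> pdc c 3" by (rule pdc_mono) simp
  have U0: "open U0" unfolding U0_def
    by (intro continuous_open_preimage continuous_on_subset[OF contH p23] open_pdc)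
  have cU0: "c \<in> U0"
  proof -
    have "c \<in> pdc c 3" by (simp add: pdc_iff)
    then have "cmod (H c $ i - c $ i) \<le> 1/4" for i using close by (simp add: Hn)
    then have "dist (c $ i) (H c $ i) < 1" for i by (smt (verit) dist_norm norm_minus_commute divide_less_eq_1_pos)
    then show ?thesis by (simp add: U0_def pdc_iff)
  qed
  have \<Phi>U0: "\<Phi> y \<in> U0" "H (\<Phi> y) = y" if "y \<in> pdc c 1" for y
    using \<Phi>(2)[OF that] that by (auto simp: U0_def)
  have inv: "\<Phi> (H y) = y" if "y \<in> U0" for y using \<Phi>(3)[of y] that by (auto simp: U0_def)
  define U where "U = G ` U0"
  have U: "openin (mtop X) U" "U \<subseteq> S" unfolding U_def using open_G_image[OF U0] GS by auto
  have im: "\<psi> ` U = pdc c 1"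
  proof (intro equalityI subsetI)
    fix y assume "y \<in> \<psi> ` U" then show "y \<in> pdc c 1" by (auto simp: U_def U0_def H_def)
  next
    fix y assume y: "y \<in> pdc c 1"
    then have "y = \<psi> (G (\<Phi> y))" "G (\<Phi> y) \<in> U" using \<Phi>U0 by (auto simp: U_def H_def)
    then show "y \<in> \<psi> ` U" by (rule image_eqI)
  qed
  have inv\<psi>: "G (\<Phi> (\<psi> x)) = x" if "x \<in> U" for x using that inv by (auto simp: U_def H_def)
  have inj: "inj_on \<psi> U" by (rule inj_on_inverseI[of _ "\<lambda>y. G (\<Phi> y)"]) (rule inv\<psi>)
  have topU: "topspace (subtopology (mtop X) U) = U" using openin_subset[OF U(1)] by auto
  have "homeomorphic_maps (subtopology (mtop X) U) (top_of_set (pdc c 1)) \<psi> (\<lambda>y. G (\<Phi> y))"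
    unfolding homeomorphic_maps_def
  proof (intro conjI ballI)
    have "continuous_map (subtopology (mtop X) U) euclidean \<psi>"
      unfolding continuous_map_def
    proof (intro conjI allI impI)
      fix V :: "(complex^2) set" assume "openin euclidean V"
      then have "open (U0 \<inter> H -` V)"
        using U0 by (intro continuous_open_preimage continuous_on_subset[OF contH]) (use p23 in \<open>auto simp: U0_def\<close>)
      then have "openin (mtop X) (G ` (U0 \<inter> H -` V))" by (rule open_G_image)
      moreover have "G ` (U0 \<inter> H -` V) = {x \<in> topspace (subtopology (mtop X) U). \<psi> x \<in> V}"
        unfolding topU by (auto simp: U_def H_def)
      ultimately have "openin (mtop X) {x \<in> topspace (subtopology (mtop X) U). \<psi> x \<in> V}" by (simp only:)
      then show "openin (subtopology (mtop X) U) {x \<in> topspace (subtopology (mtop X) U). \<psi> x \<in> V}"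
        using topU by (subst openin_open_subtopology[OF U(1)]) blast
    qed simp
    then show "continuous_map (subtopology (mtop X) U) (top_of_set (pdc c 1)) \<psi>"
      using im by (auto simp: continuous_map_in_subtopology topU)
    have "continuous_map (top_of_set (pdc c 1)) (mtop X) (\<lambda>y. G (\<Phi> y))"
      using continuous_map_compose[OF _ continuous_G, of "top_of_set (pdc c 1)" \<Phi>] cont\<Phi>
      by (simp add: o_def)
    then show "continuous_map (top_of_set (pdc c 1)) (subtopology (mtop X) U) (\<lambda>y. G (\<Phi> y))"
      using \<Phi>U0(1) by (auto simp: continuous_map_in_subtopology U_def)
    fix x assume "x \<in> topspace (subtopology (mtop X) U)"
    then show "G (\<Phi> (\<psi> x)) = x" using topU inv\<psi> by auto
  next
    fix y assume "y \<in> topspace (top_of_set (pdc c 1))"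
    then have "y \<in> pdc c 1" by simp
    then show "\<psi> (G (\<Phi> y)) = y" using \<Phi>U0(2) by (simp add: H_def)
  qed
  then have "is_chart (mtop X) U \<psi>"
    unfolding is_chart_def im using U(1) open_pdc homeomorphic_map_maps by blast
  moreover have "compatible U \<psi> V \<phi>" if V: "(V, \<phi>) \<in> atlas X" for V \<phi>
    unfolding compatible_def holo_Cn_map_def
  proof (intro conjI allI)
    fix i
    have invU: "inv_into U \<psi> y = G (\<Phi> y)" if "y \<in> pdc c 1" for y
      by (rule inv_into_f_eq[OF inj]) (use \<Phi>U0[OF that] in \<open>auto simp: U_def H_def\<close>)
    have VS: "openin (mtop X) (V \<inter> S)" using chart_inj(2)[OF X V] S by auto
    have "holo_fun X (V \<inter> S) (\<lambda>x. \<phi> x $ i)" by (rule holo_fun_subset[OF X holo_fun_chart[OF X V] VS]) auto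
    then have hV: "holo_Cn (F ` (V \<inter> S)) (\<lambda>y. \<phi> (G y) $ i)" using holo_iff[OF VS] by auto
    have eq: "\<psi> ` (U \<inter> V) = pdc c 1 \<inter> \<Phi> -` (F ` (V \<inter> S))"
    proof (intro equalityI subsetI)
      fix y assume "y \<in> \<psi> ` (U \<inter> V)"
      then obtain x where x: "x \<in> U" "x \<in> V" "y = \<psi> x" by blast
      then have "\<Phi> y = F x" using inv\<psi>[OF x(1)] FG by metis
      then show "y \<in> pdc c 1 \<inter> \<Phi> -` (F ` (V \<inter> S))" using x U(2) im by auto
    next
      fix y assume y: "y \<in> pdc c 1 \<inter> \<Phi> -` (F ` (V \<inter> S))"
      then have "G (\<Phi> y) \<in> V" using image_vimage[of "V \<inter> S"] by auto
      moreover have "G (\<Phi> y) \<in> U" "\<psi> (G (\<Phi> y)) = y" using y \<Phi>U0 by (auto simp: U_def H_def)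
      ultimately show "y \<in> \<psi> ` (U \<inter> V)" by (metis IntI image_eqI)
    qed
    have op: "open (\<psi> ` (U \<inter> V))"
      unfolding eq using open_image[OF VS] by (intro continuous_open_preimage cont\<Phi> open_pdc) auto
    have "holo_Cn (\<psi> ` (U \<inter> V)) (\<lambda>y. \<phi> (G (\<Phi> y)) $ i)"
      by (rule holo_Cn_compose[OF hV]) (use holo_Cn_subset[OF \<Phi>(1) op] eq in auto)
    then show "holo_Cn (\<psi> ` (U \<inter> V)) (\<lambda>y. (\<phi> \<circ> inv_into U \<psi>) y $ i)"
      by (rule holo_Cn_cong) (use invU eq in auto)
  next
    fix i :: 2
    have "U \<subseteq> W"
      unfolding U_def using sub p23 by (auto simp: U0_def)
    then have "holo_fun X U (f i)" by (intro holo_fun_subset[OF X f U(1)])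
    then have "holo_Cn (\<phi> ` (V \<inter> U)) (f i \<circ> inv_into V \<phi>)" using V by (auto simp: holo_fun_def)
    moreover have "V \<inter> U = U \<inter> V" by blast
    ultimately show "holo_Cn (\<phi> ` (U \<inter> V)) (\<lambda>y. (\<psi> \<circ> inv_into V \<phi>) y $ i)" by (simp add: o_def \<psi>_def)
  qed
  ultimately have "holo_coordinates X U \<psi>" by (auto simp: holo_coordinates_def)
  moreover have "G c \<in> U" "U \<subseteq> W" unfolding U_def using cU0 sub p23 by (auto simp: U0_def)
  ultimately show ?thesis unfolding \<psi>_def by blast
qed

section \<open>Meromorphic hulls\<close>

lemma fun_alg_continuous:
  assumes "f \<in> fun_alg A" "\<And>a. a \<in> A \<Longrightarrow> continuous_on T a" shows "continuous_on T f"
  using assms(1) by induction (auto intro: continuous_intros assms(2))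

definition poly22 :: "((complex^2) \<times> (complex^2) \<Rightarrow> complex) set" where
  "poly22 = fun_alg (range (\<lambda>i x. fst x $ i) \<union> range (\<lambda>i x. snd x $ i))"

lemma poly22_lift:
  assumes "p \<in> poly2" shows "(\<lambda>x. p (fst x)) \<in> poly22" "(\<lambda>x. p (snd x)) \<in> poly22"
proof -
  have "(\<lambda>x. a (fst x)) \<in> poly22" "(\<lambda>x. a (snd x)) \<in> poly22"
    if "a \<in> range (\<lambda>i p. p $ i)" for a :: "complex^2 \<Rightarrow> complex"
    unfolding poly22_def by (rule fun_alg.gen, use that in blast)+
  then show "(\<lambda>x. p (fst x)) \<in> poly22" "(\<lambda>x. p (snd x)) \<in> poly22"
    using assms unfolding poly2_def poly22_def by (blast intro: fun_alg_substitute)+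
qed

text \<open>Divided differences in the two variables. They add up for sums, and products use
  \<open>f z * f' z - f w * f' w = (f z - f w) * f' w + f z * (f' z - f' w)\<close>.\<close>

lemma hefer:
  assumes "p \<in> poly2"
  shows "\<exists>N1\<in>poly22. \<exists>N2\<in>poly22. \<forall>z w. p z - p w = N1 (z, w) * (z $ 1 - w $ 1) + N2 (z, w) * (z $ 2 - w $ 2)"
  using assms unfolding poly2_def
proof induction
  case (const c)
  have "(\<lambda>_. 0) \<in> poly22" unfolding poly22_def by (rule fun_alg.const)
  then show ?case by (intro bexI[of _ "\<lambda>_. 0"]) auto
next
  case (gen f)
  then obtain i where i: "f = (\<lambda>p. p $ i)" by blast
  have c: "(\<lambda>_. b) \<in> poly22" for b unfolding poly22_def by (rule fun_alg.const)
  show ?case unfolding i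
    by (rule bexI[OF _ c[of "if i = 1 then 1 else 0"]], rule bexI[OF _ c[of "if i = 1 then 0 else 1"]])
       (use exhaust_2[of i] in auto)
next
  case (add f f')
  then obtain N1 N2 N1' N2' where N: "N1 \<in> poly22" "N2 \<in> poly22" "N1' \<in> poly22" "N2' \<in> poly22"
    "\<And>z w. f z - f w = N1 (z, w) * (z $ 1 - w $ 1) + N2 (z, w) * (z $ 2 - w $ 2)"
    "\<And>z w. f' z - f' w = N1' (z, w) * (z $ 1 - w $ 1) + N2' (z, w) * (z $ 2 - w $ 2)" by blast
  have "(\<lambda>x. N1 x + N1' x) \<in> poly22" "(\<lambda>x. N2 x + N2' x) \<in> poly22"
    using N unfolding poly22_def by (auto intro: fun_alg.add)
  moreover have "f z + f' z - (f w + f' w) = (N1 (z, w) + N1' (z, w)) * (z $ 1 - w $ 1) +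
      (N2 (z, w) + N2' (z, w)) * (z $ 2 - w $ 2)" for z w
  proof -
    have "f z + f' z - (f w + f' w) = (f z - f w) + (f' z - f' w)" by simp
    then show ?thesis unfolding N(5,6) by (simp add: algebra_simps)
  qed
  ultimately show ?case
    by (intro bexI[of _ "\<lambda>x. N1 x + N1' x"] bexI[of _ "\<lambda>x. N2 x + N2' x"]) auto
next
  case (mult f f')
  then obtain N1 N2 N1' N2' where N: "N1 \<in> poly22" "N2 \<in> poly22" "N1' \<in> poly22" "N2' \<in> poly22"
    "\<And>z w. f z - f w = N1 (z, w) * (z $ 1 - w $ 1) + N2 (z, w) * (z $ 2 - w $ 2)"
    "\<And>z w. f' z - f' w = N1' (z, w) * (z $ 1 - w $ 1) + N2' (z, w) * (z $ 2 - w $ 2)" by blast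
  have f: "(\<lambda>x. f (fst x)) \<in> poly22" "(\<lambda>x. f' (snd x)) \<in> poly22"
    using mult.hyps poly22_lift unfolding poly2_def by auto
  have "(\<lambda>x. N1 x * f' (snd x) + f (fst x) * N1' x) \<in> poly22" "(\<lambda>x. N2 x * f' (snd x) + f (fst x) * N2' x) \<in> poly22"
    using N f unfolding poly22_def by (auto intro!: fun_alg.add fun_alg.mult)
  moreover have "f z * f' z - f w * f' w = (N1 (z, w) * f' w + f z * N1' (z, w)) * (z $ 1 - w $ 1) +
      (N2 (z, w) * f' w + f z * N2' (z, w)) * (z $ 2 - w $ 2)" for z w
  proof -
    have "f z * f' z - f w * f' w = (f z - f w) * f' w + f z * (f' z - f' w)" by (simp add: algebra_simps)
    then show ?thesis unfolding N(5,6) by (simp add: algebra_simps)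
  qed
  ultimately show ?case
    by (intro bexI[of _ "\<lambda>x. N1 x * f' (snd x) + f (fst x) * N1' x"] bexI[of _ "\<lambda>x. N2 x * f' (snd x) + f (fst x) * N2' x"]) auto
qed

text \<open>Hefer's decomposition of \<open>p / q\<close> with the denominator
  \<open>q z * q w\<close> multiplied out, so that the coefficients stay polynomials.\<close>

lemma hefer_quotient:
  assumes "p \<in> poly2" "q \<in> poly2"
  obtains N1 N2 where "N1 \<in> poly22" "N2 \<in> poly22"
    "\<And>z w. p z * q w - p w * q z = N1 (z, w) * (z $ 1 - w $ 1) + N2 (z, w) * (z $ 2 - w $ 2)"
proof -
  obtain P1 P2 where P: "P1 \<in> poly22" "P2 \<in> poly22"
    "\<And>z w. p z - p w = P1 (z, w) * (z $ 1 - w $ 1) + P2 (z, w) * (z $ 2 - w $ 2)" using hefer[OF assms(1)] by blast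
  obtain Q1 Q2 where Q: "Q1 \<in> poly22" "Q2 \<in> poly22"
    "\<And>z w. q z - q w = Q1 (z, w) * (z $ 1 - w $ 1) + Q2 (z, w) * (z $ 2 - w $ 2)" using hefer[OF assms(2)] by blast
  show ?thesis
  proof (rule that[of "\<lambda>x. P1 x * q (snd x) - p (snd x) * Q1 x" "\<lambda>x. P2 x * q (snd x) - p (snd x) * Q2 x"])
    show "(\<lambda>x. P1 x * q (snd x) - p (snd x) * Q1 x) \<in> poly22" "(\<lambda>x. P2 x * q (snd x) - p (snd x) * Q2 x) \<in> poly22"
      using P Q poly22_lift(2)[OF assms(1)] poly22_lift(2)[OF assms(2)] unfolding poly22_def
      by (auto intro!: fun_alg_diff fun_alg.mult)
    fix z w
    have "p z * q w - p w * q z = (p z - p w) * q w - p w * (q z - q w)" by (simp add: algebra_simps)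
    then show "p z * q w - p w * q z =
       (P1 (z, w) * q (snd (z, w)) - p (snd (z, w)) * Q1 (z, w)) * (z $ 1 - w $ 1) +
       (P2 (z, w) * q (snd (z, w)) - p (snd (z, w)) * Q2 (z, w)) * (z $ 2 - w $ 2)"
      unfolding P(3) Q(3) by (simp add: algebra_simps)
  qed
qed

lemma kernel_2x2:
  fixes a b c d :: complex
  assumes "a * d - b * c = 0"
  obtains v1 v2 where "v1 \<noteq> 0 \<or> v2 \<noteq> 0" "a * v1 + b * v2 = 0" "c * v1 + d * v2 = 0"
proof (cases "a = 0 \<and> b = 0")
  case False
  show ?thesis by (rule that[of "-b" a]) (use False assms in \<open>auto simp: algebra_simps\<close>)
next
  case ab: True
  show ?thesis
  proof (cases "c = 0 \<and> d = 0")
    case True then show ?thesis using ab that[of 1 0] by simp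
  next
    case False
    show ?thesis by (rule that[of "-d" c]) (use False ab in \<open>auto simp: algebra_simps\<close>)
  qed
qed

lemma det_zero_2x2:
  fixes a b c d :: complex
  assumes "a * v1 + b * v2 = 0" "c * v1 + d * v2 = 0" "v1 \<noteq> 0 \<or> v2 \<noteq> 0"
  shows "a * d - b * c = 0"
proof -
  have "(a * d - b * c) * v1 = d * (a * v1 + b * v2) - b * (c * v1 + d * v2)" by (simp add: algebra_simps)
  moreover have "(a * d - b * c) * v2 = a * (c * v1 + d * v2) - c * (a * v1 + b * v2)" by (simp add: algebra_simps)
  ultimately show ?thesis using assms by auto
qed

lemma rational_fun_alg:
  assumes "f \<in> fun_alg (range (\<lambda>i w. w $ i) \<union> range (\<lambda>i w. p i w / q w))"
    and p: "\<And>i::2. p i \<in> poly2" and q: "q \<in> poly2" "\<And>w. w \<in> T \<Longrightarrow> q w \<noteq> 0"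
  shows "\<exists>a\<in>poly2. \<exists>b\<in>poly2. \<forall>w\<in>T. b w \<noteq> 0 \<and> f w = a w / b w"
  using assms(1)
proof induction
  have one: "(\<lambda>_. c) \<in> poly2" for c unfolding poly2_def by (rule fun_alg.const)
  {
    case (const c)
    then show ?case by (intro bexI[OF _ one[of c]] bexI[OF _ one[of 1]]) auto
  next
    case (gen f)
    then consider i where "f = (\<lambda>w. w $ i)" | i where "f = (\<lambda>w. p i w / q w)" by blast
    then show ?case
    proof cases
      case 1
      then show ?thesis by (intro bexI[OF _ poly2_nth[of i]] bexI[OF _ one[of 1]]) auto
    next
      case (2 i)
      then show ?thesis by (intro bexI[OF _ p[of i]] bexI[OF _ q(1)]) (use q(2) in auto)
    qed
  next
    case (add f f')
    then obtain a b a' b' where ab: "a \<in> poly2" "b \<in> poly2" "\<forall>w\<in>T. b w \<noteq> 0 \<and> f w = a w / b w"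
      "a' \<in> poly2" "b' \<in> poly2" "\<forall>w\<in>T. b' w \<noteq> 0 \<and> f' w = a' w / b' w" by blast
    have "(\<lambda>w. a w * b' w + a' w * b w) \<in> poly2" "(\<lambda>w. b w * b' w) \<in> poly2"
      using ab unfolding poly2_def by (auto intro!: fun_alg.add fun_alg.mult)
    then show ?case
      by (intro bexI[of _ "\<lambda>w. a w * b' w + a' w * b w"] bexI[of _ "\<lambda>w. b w * b' w"])
         (use ab in \<open>auto simp: add_frac_eq\<close>)
  next
    case (mult f f')
    then obtain a b a' b' where ab: "a \<in> poly2" "b \<in> poly2" "\<forall>w\<in>T. b w \<noteq> 0 \<and> f w = a w / b w"
      "a' \<in> poly2" "b' \<in> poly2" "\<forall>w\<in>T. b' w \<noteq> 0 \<and> f' w = a' w / b' w" by blast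
    have "(\<lambda>w. a w * a' w) \<in> poly2" "(\<lambda>w. b w * b' w) \<in> poly2"
      using ab unfolding poly2_def by (auto intro!: fun_alg.mult)
    then show ?case
      by (intro bexI[of _ "\<lambda>w. a w * a' w"] bexI[of _ "\<lambda>w. b w * b' w"]) (use ab in auto)
  }
qed

text \<open>On the diagonal the Hefer matrix of \<open>(p 1 / q, p 2 / q)\<close> is, up to scaling, its Jacobian.\<close>

lemma hefer_det_nonzero:
  fixes p :: "2 \<Rightarrow> complex^2 \<Rightarrow> complex"
  assumes N: "\<And>i. N1 i \<in> poly22" "\<And>i. N2 i \<in> poly22"
      "\<And>i z w. p i z * q w - p i w * q z = N1 i (z, w) * (z $ 1 - w $ 1) + N2 i (z, w) * (z $ 2 - w $ 2)"
    and q: "q \<in> poly2" "q w \<noteq> 0"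
    and \<Theta>: "\<And>i. holo_Cn M (\<lambda>y. \<Theta> y $ i)" "(\<chi> i. p i w / q w) \<in> M"
    and inv: "eventually (\<lambda>z. \<Theta> (\<chi> i. p i z / q z) = z) (nhds w)"
  shows "N1 1 (w, w) * N2 2 (w, w) - N2 1 (w, w) * N1 2 (w, w) \<noteq> 0"
proof
  assume "N1 1 (w, w) * N2 2 (w, w) - N2 1 (w, w) * N1 2 (w, w) = 0"
  from kernel_2x2[OF this] obtain v1 v2 where v: "v1 \<noteq> 0 \<or> v2 \<noteq> 0"
    "N1 1 (w, w) * v1 + N2 1 (w, w) * v2 = 0" "N1 2 (w, w) * v1 + N2 2 (w, w) * v2 = 0" by blast
  define v where "v = pt v1 v2"
  \<comment> \<open>A line through \<open>w\<close> in a direction \<open>v\<close> from the kernel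
    of the singular matrix. The derivative of \<open>t\<close> along it vanishes at
    \<open>w\<close>, and so does that of \<open>\<Theta> \<circ> t\<close>; but this map is the
    identity near \<open>w\<close>, which forces \<open>v = 0\<close>.\<close>
  define \<zeta> where "\<zeta> s = w + s *s v" for s :: complex
  define t where "t z = (\<chi> i. p i z / q z)" for z
  have \<zeta>0: "\<zeta> 0 = w" by (simp add: \<zeta>_def)
  have cont\<zeta>: "continuous_on UNIV \<zeta>" unfolding \<zeta>_def by (rule continuous_on_line)
  have isc: "isCont \<zeta> 0" using cont\<zeta> by (simp add: continuous_on_eq_continuous_at)
  have contN: "continuous_on UNIV n" if "n \<in> poly22" for n
    using that unfolding poly22_def by (rule fun_alg_continuous) (auto intro!: continuous_intros)
  have contq: "continuous_on UNIV q" using holo_Cn_continuous_on[OF poly2_holo[OF q(1)]] .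
  have qnz: "eventually (\<lambda>s. q (\<zeta> s) \<noteq> 0) (nhds 0)"
  proof (rule eventually_nhds_compose[OF _ isc])
    have "isCont q w" using contq by (simp add: continuous_on_eq_continuous_at)
    then have "(q \<longlongrightarrow> q w) (nhds w)" using tendsto_at_iff_tendsto_nhds[of q w] by (simp add: isCont_def)
    then show "eventually (\<lambda>z. q z \<noteq> 0) (nhds (\<zeta> 0))" unfolding \<zeta>0 using q(2) by (rule tendsto_imp_eventually_ne)
  qed
  have dt: "((\<lambda>s. t (\<zeta> s) $ i) has_field_derivative 0) (at 0)" for i
  proof -
    define g where "g s = (N1 i (\<zeta> s, w) * v1 + N2 i (\<zeta> s, w) * v2) / (q (\<zeta> s) * q w)" for s
    have "continuous_on UNIV (\<lambda>s. n (\<zeta> s, w))" if "n \<in> poly22" for n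
      by (rule continuous_on_compose2[OF contN[OF that]]) (auto intro!: continuous_intros cont\<zeta>)
    then have "isCont (\<lambda>s. n (\<zeta> s, w)) 0" if "n \<in> poly22" for n
      using that by (simp add: continuous_on_eq_continuous_at)
    moreover have "continuous_on UNIV (\<lambda>s. q (\<zeta> s))"
      by (rule continuous_on_compose2[OF contq cont\<zeta>]) auto
    then have "isCont (\<lambda>s. q (\<zeta> s)) 0" by (simp add: continuous_on_eq_continuous_at)
    ultimately have gc: "isCont g 0"
      unfolding g_def using N(1,2) q(2) \<zeta>0 by (intro continuous_intros) auto
    have g0: "g 0 = 0" using v(2,3) exhaust_2[of i] by (auto simp: g_def \<zeta>0)
    have "((\<lambda>s. t w $ i + s * g s) has_field_derivative 0) (at 0)"
      unfolding CARAT_DERIV by (rule exI[of _ g]) (use gc g0 in simp)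
    moreover have "eventually (\<lambda>s. t w $ i + s * g s = t (\<zeta> s) $ i) (nhds 0)"
      using qnz
    proof eventually_elim
      case (elim s)
      have "\<zeta> s $ 1 - w $ 1 = s * v1" "\<zeta> s $ 2 - w $ 2 = s * v2" by (simp_all add: \<zeta>_def v_def)
      then have "p i (\<zeta> s) * q w - p i w * q (\<zeta> s) = s * (N1 i (\<zeta> s, w) * v1 + N2 i (\<zeta> s, w) * v2)"
        using N(3)[of i "\<zeta> s" w] by (simp add: algebra_simps)
      then have "p i (\<zeta> s) / q (\<zeta> s) - p i w / q w = s * g s"
        using elim q(2) by (simp add: g_def divide_simps)
      then show ?case by (simp add: t_def algebra_simps)
    qed
    ultimately show ?thesis
      using DERIV_cong_ev[of 0 0 "\<lambda>s. t w $ i + s * g s" "\<lambda>s. t (\<zeta> s) $ i" 0 0] by simp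
  qed
  have dtv: "((\<lambda>s. t (\<zeta> s)) has_derivative (\<lambda>h. 0)) (at 0)"
    unfolding has_derivative_componentwise_within[of "\<lambda>s. t (\<zeta> s)"]
  proof
    fix b :: "complex^2" assume "b \<in> Basis"
    then obtain i b' where b: "b = axis i b'" "b' \<in> Basis" by (auto simp: Basis_vec_def)
    have "((\<lambda>s. t (\<zeta> s) $ i \<bullet> b') has_derivative (\<lambda>h. (h * 0) \<bullet> b')) (at 0)"
      using dt[of i, unfolded has_field_derivative_def] by (auto intro!: derivative_eq_intros)
    then show "((\<lambda>s. t (\<zeta> s) \<bullet> b) has_derivative (\<lambda>h. 0 \<bullet> b)) (at 0)" by (simp add: b inner_axis)
  qed
  have "v $ k = 0" for k
  proof -
    have "t (\<zeta> 0) \<in> M" using \<Theta>(2) by (simp add: t_def \<zeta>0)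
    then obtain E where E: "((\<lambda>y. \<Theta> y $ k) has_derivative E) (at (t (\<zeta> 0)))"
      using \<Theta>(1)[of k] unfolding holo_Cn_def by blast
    have "((\<lambda>s. \<Theta> (t (\<zeta> s)) $ k) has_derivative (\<lambda>h. E 0)) (at 0)"
      by (rule has_derivative_compose[OF dtv E])
    moreover have "E 0 = 0" using E has_derivative_bounded_linear linear_0 bounded_linear.linear by blast
    ultimately have "((\<lambda>s. \<Theta> (t (\<zeta> s)) $ k) has_derivative (\<lambda>h. 0 * h)) (at 0)" by simp
    then have "((\<lambda>s. \<Theta> (t (\<zeta> s)) $ k) has_field_derivative 0) (at 0)"
      unfolding has_field_derivative_def .
    moreover have "eventually (\<lambda>z. \<Theta> (t z) = z) (nhds (\<zeta> 0))" using inv by (simp add: t_def \<zeta>0)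
    then have "eventually (\<lambda>s. \<Theta> (t (\<zeta> s)) = \<zeta> s) (nhds 0)" by (rule eventually_nhds_compose[OF _ isc])
    then have "eventually (\<lambda>s. \<Theta> (t (\<zeta> s)) $ k = \<zeta> s $ k) (nhds 0)" by eventually_elim simp
    ultimately have "((\<lambda>s. \<zeta> s $ k) has_field_derivative 0) (at 0)"
      using DERIV_cong_ev[of 0 0 "\<lambda>s. \<Theta> (t (\<zeta> s)) $ k" "\<lambda>s. \<zeta> s $ k" 0 0] by simp
    moreover have "((\<lambda>s. w $ k + s * v $ k) has_field_derivative v $ k) (at 0)"
      by (auto intro!: derivative_eq_intros)
    then have "((\<lambda>s. \<zeta> s $ k) has_field_derivative v $ k) (at 0)" by (simp add: \<zeta>_def)
    ultimately show ?thesis by (rule DERIV_unique[symmetric])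
  qed
  from this[of 1] this[of 2] v(1) show False by (simp add: v_def)
qed

lemma compact_nonzero_bound:
  fixes f :: "'b::topological_space \<Rightarrow> complex"
  assumes C: "compact C" "continuous_on C f" and nz: "\<And>x. x \<in> C \<Longrightarrow> f x \<noteq> 0"
  obtains m where "m > 0" "\<And>x. x \<in> C \<Longrightarrow> m \<le> cmod (f x)"
proof (cases "C = {}")
  case True
  then show ?thesis using that[of 1] by simp
next
  case False
  have "continuous_on C (\<lambda>x. cmod (f x))" by (intro continuous_intros C)
  from continuous_attains_inf[OF C(1) False this]
  obtain x0 where x0: "x0 \<in> C" "\<And>x. x \<in> C \<Longrightarrow> cmod (f x0) \<le> cmod (f x)" by blast
  show ?thesis by (rule that[of "cmod (f x0)"]) (use x0 nz in auto)
qed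

text \<open>The pole is put at distance \<open>m / 8\<close> from \<open>e0\<close>, where the
  reciprocal then has modulus \<open>8 / m\<close>. Where \<open>cmod e \<ge> 7 * m / 8\<close>, the
  distance from the pole is at least \<open>7 * m / 8 - 2 * m / 8\<close>, so there the reciprocal
  is smaller by the factor 5.\<close>

lemma reciprocal_separates:
  fixes e e0 :: complex
  assumes m: "m > 0" and e0: "cmod e0 \<le> m / 8" and e: "m - m / 8 \<le> cmod e"
  shows "e - (e0 - of_real (m / 8)) \<noteq> 0" "cmod (1 / (e - (e0 - of_real (m / 8)))) \<le> 8 / (5 * m)"
proof -
  have "cmod e - cmod (e0 - of_real (m / 8)) \<le> cmod (e - (e0 - of_real (m / 8)))"
    by (rule norm_triangle_ineq2)
  moreover have "cmod (e0 - of_real (m / 8)) \<le> cmod e0 + cmod (of_real (m / 8))"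
    by (rule norm_triangle_ineq4)
  moreover have "cmod (of_real (m / 8)) = m / 8" using m by (simp only: norm_of_real)
  ultimately have *: "5 * m / 8 \<le> cmod (e - (e0 - of_real (m / 8)))" using e0 e by linarith
  moreover have "5 * m / 8 > 0" using m by simp
  ultimately show "e - (e0 - of_real (m / 8)) \<noteq> 0" by (metis norm_zero not_le)
  have "1 / cmod (e - (e0 - of_real (m / 8))) \<le> 1 / (5 * m / 8)"
    by (rule frac_le) (use * m in auto)
  then show "cmod (1 / (e - (e0 - of_real (m / 8)))) \<le> 8 / (5 * m)" by (simp only: norm_divide norm_one) simp
qed

lemma pdc_0: "pdc 0 r = pd r"
  by (simp add: pdc_def pd_def)

lemma cpd_subset_pd: "r < r' \<Longrightarrow> cpd r \<subseteq> pd r'"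
  unfolding cpd_def pd_def by (intro rect2_mono) auto

text \<open>Here \<open>t = (p 1 / q, p 2 / q)\<close> has the local left inverse \<open>\<Theta>\<close> on \<open>S\<close>, but \<open>\<Theta> \<circ> t\<close> moves
  \<open>w0\<close> to another point of the same fibre.  Hence the Hefer determinant of \<open>t\<close> at the pair
  \<open>(\<Theta> (t w), w)\<close>, as a function of \<open>w\<close>, vanishes at \<open>w0\<close> but not on \<open>S\<close>; the reciprocal of a
  rational approximation of it separates \<open>w0\<close> from \<open>S\<close>.\<close>

lemma rational_separation:
  fixes p :: "2 \<Rightarrow> complex^2 \<Rightarrow> complex" and q :: "complex^2 \<Rightarrow> complex" and S :: "(complex^2) set"
  defines "t \<equiv> \<lambda>w. \<chi> i. p i w / q w"
  assumes p: "\<And>i. p i \<in> poly2" and q: "q \<in> poly2" "\<And>w. w \<in> insert w0 S \<Longrightarrow> q w \<noteq> 0"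
    and S: "compact S" and R: "0 < R" "R < \<rho>" and tR: "\<And>w. w \<in> insert w0 S \<Longrightarrow> t w \<in> cpd R"
    and \<Theta>: "\<And>k. holo_Cn (pd \<rho>) (\<lambda>y. \<Theta> y $ k)"
    and inv: "\<And>w. w \<in> S \<Longrightarrow> eventually (\<lambda>z. \<Theta> (t z) = z) (nhds w)"
    and \<zeta>: "\<Theta> (t w0) \<noteq> w0" "q (\<Theta> (t w0)) \<noteq> 0" "t (\<Theta> (t w0)) = t w0"
  obtains A B M where "A \<in> poly2" "B \<in> poly2" "\<And>w. w \<in> insert w0 S \<Longrightarrow> B w \<noteq> 0"
    "\<And>w. w \<in> S \<Longrightarrow> cmod (A w / B w) \<le> M" "0 \<le> M" "M < cmod (A w0 / B w0)"
proof -
  let ?T = "insert w0 S"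
  have "\<exists>N1 N2. N1 \<in> poly22 \<and> N2 \<in> poly22 \<and>
      (\<forall>z w. p i z * q w - p i w * q z = N1 (z, w) * (z $ 1 - w $ 1) + N2 (z, w) * (z $ 2 - w $ 2))" for i
    by (rule hefer_quotient[OF p[of i] q(1)]) blast
  then obtain N1 N2 where N: "\<And>i. N1 i \<in> poly22" "\<And>i. N2 i \<in> poly22"
    "\<And>i z w. p i z * q w - p i w * q z = N1 i (z, w) * (z $ 1 - w $ 1) + N2 i (z, w) * (z $ 2 - w $ 2)"
    by metis
  define D where "D x = N1 1 x * N2 2 x - N2 1 x * N1 2 x" for x
  have D: "D \<in> poly22"
    unfolding D_def[abs_def] using N(1,2) unfolding poly22_def by (intro fun_alg_diff fun_alg.mult)
  have tpd: "t w \<in> pd \<rho>" if "w \<in> ?T" for w using tR[OF that] cpd_subset_pd[OF R(2)] by blast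
  have \<Theta>t: "\<Theta> (t w) = w" if "w \<in> S" for w using inv[OF that] by (rule eventually_nhds_x_imp_x)
  have D_nz: "D (w, w) \<noteq> 0" if w: "w \<in> S" for w
    unfolding D_def
    by (rule hefer_det_nonzero[OF N q(1) _ \<Theta>]) (use q(2) tpd inv w in \<open>auto simp: t_def\<close>)
  \<comment> \<open>As \<open>t\<close> takes the same value at \<open>\<Theta> (t w0)\<close> and
    at \<open>w0\<close>, their difference is a non-zero vector in the kernel of the Hefer
    matrix.\<close>
  have D_0: "D (\<Theta> (t w0), w0) = 0"
    unfolding D_def
  proof (rule det_zero_2x2)
    define \<zeta>0 where "\<zeta>0 = \<Theta> (t w0)"
    have "p i \<zeta>0 / q \<zeta>0 = p i w0 / q w0" for i
      using arg_cong[OF \<zeta>(3), of "\<lambda>v. v $ i"] by (simp add: t_def \<zeta>0_def)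
    then have "p i \<zeta>0 * q w0 - p i w0 * q \<zeta>0 = 0" for i
      using \<zeta>(2) q(2)[of w0] by (simp add: \<zeta>0_def frac_eq_eq)
    then have z: "N1 i (\<zeta>0, w0) * (\<zeta>0 $ 1 - w0 $ 1) + N2 i (\<zeta>0, w0) * (\<zeta>0 $ 2 - w0 $ 2) = 0" for i
      using N(3)[of i \<zeta>0 w0] by simp
    show "N1 1 (\<Theta> (t w0), w0) * (\<Theta> (t w0) $ 1 - w0 $ 1) + N2 1 (\<Theta> (t w0), w0) * (\<Theta> (t w0) $ 2 - w0 $ 2) = 0"
      "N1 2 (\<Theta> (t w0), w0) * (\<Theta> (t w0) $ 1 - w0 $ 1) + N2 2 (\<Theta> (t w0), w0) * (\<Theta> (t w0) $ 2 - w0 $ 2) = 0"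
      using z[of 1] z[of 2] by (simp_all add: \<zeta>0_def)
    show "\<Theta> (t w0) $ 1 - w0 $ 1 \<noteq> 0 \<or> \<Theta> (t w0) $ 2 - w0 $ 2 \<noteq> 0"
      using \<zeta>(1) by (auto simp: vec_eq_iff forall_2)
  qed
  have "continuous_on UNIV D"
    using D unfolding poly22_def by (rule fun_alg_continuous) (auto intro!: continuous_intros)
  then have cS: "continuous_on S (\<lambda>w. D (w, w))"
    by (rule continuous_on_compose2) (auto intro!: continuous_intros)
  obtain m where m: "m > 0" "\<And>w. w \<in> S \<Longrightarrow> m \<le> cmod (D (w, w))"
    using compact_nonzero_bound[where f = "\<lambda>w. D (w, w)", OF S cS D_nz] by blast
  \<comment> \<open>\<open>E\<close> need not be rational because of \<open>\<Theta>\<close>. It is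
    a polynomial in the components of \<open>\<Theta> \<circ> t\<close> and the coordinates, the
    generators \<open>GA\<close>; replacing \<open>\<Theta>\<close> by polynomials on
    \<open>cpd R\<close> leads to the rational generators \<open>GB\<close>.\<close>
  define E where "E w = D (\<Theta> (t w), w)" for w
  define GA where "GA = range (\<lambda>k w. \<Theta> (t w) $ k) \<union> range (\<lambda>k (w::complex^2). w $ k)"
  define GB where "GB = range (\<lambda>i (w::complex^2). w $ i) \<union> range (\<lambda>i w. p i w / q w)"
  have E: "E \<in> fun_alg GA"
    unfolding E_def[abs_def] using D unfolding poly22_def
  proof (rule fun_alg_substitute)
    fix a :: "(complex^2) \<times> (complex^2) \<Rightarrow> complex"
    assume "a \<in> range (\<lambda>i x. fst x $ i) \<union> range (\<lambda>i x. snd x $ i)"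
    then show "(\<lambda>x. a (\<Theta> (t x), x)) \<in> fun_alg GA" by (auto intro!: fun_alg.gen simp: GA_def)
  qed
  have cT: "compact ?T" using S by simp
  have "(\<exists>M. \<forall>w\<in>?T. cmod (E w) \<le> M) \<and> approximable ?T (fun_alg GB) E"
  proof (rule fun_alg_approx[OF E])
    fix a assume "a \<in> GA"
    then consider k where "a = (\<lambda>w. \<Theta> (t w) $ k)" | k where "a = (\<lambda>w. w $ k)" unfolding GA_def by blast
    then show "\<exists>M. \<forall>w\<in>?T. cmod (a w) \<le> M"
    proof cases
      case (1 k)
      have "continuous_on (cpd R) (\<lambda>y. \<Theta> y $ k)"
        using holo_Cn_continuous_on[OF \<Theta>] cpd_subset_pd[OF R(2)] continuous_on_subset by blast
      from compact_imp_bounded[OF compact_continuous_image[OF this pd_props(3)]]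
      obtain M where "\<And>y. y \<in> cpd R \<Longrightarrow> cmod (\<Theta> y $ k) \<le> M" unfolding bounded_iff by blast
      then show ?thesis using tR unfolding 1 by blast
    next
      case (2 k)
      have "continuous_on ?T (\<lambda>w. w $ k)" by (intro continuous_intros)
      from compact_imp_bounded[OF compact_continuous_image[OF this cT]]
      show ?thesis unfolding bounded_iff 2 by blast
    qed
  next
    fix a assume "a \<in> GA"
    then consider k where "a = (\<lambda>w. \<Theta> (t w) $ k)" | k where "a = (\<lambda>w. w $ k)" unfolding GA_def by blast
    then show "approximable ?T (fun_alg GB) a"
    proof cases
      case (1 k)
      have dense: "approximable (cpd R) poly2 (\<lambda>y. \<Theta> y $ k)"
        unfolding cpd_def by (rule poly2_dense[OF \<Theta>[unfolded pd_def] R])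
      show ?thesis unfolding approximable_def
      proof (intro allI impI)
        fix \<epsilon> :: real assume "\<epsilon> > 0"
        then obtain P where P: "P \<in> poly2" "\<forall>y\<in>cpd R. cmod (\<Theta> y $ k - P y) < \<epsilon>"
          using dense unfolding approximable_def by blast
        have "(\<lambda>w. P (t w)) \<in> fun_alg GB"
          using P(1) unfolding poly2_def
        proof (rule fun_alg_substitute)
          fix b :: "complex^2 \<Rightarrow> complex" assume "b \<in> range (\<lambda>i p. p $ i)"
          then show "(\<lambda>x. b (t x)) \<in> fun_alg GB" by (auto intro!: fun_alg.gen simp: GB_def t_def)
        qed
        moreover have "\<forall>w\<in>?T. cmod (a w - P (t w)) < \<epsilon>" using P(2) tR unfolding 1 by blast
        ultimately show "\<exists>f'\<in>fun_alg GB. \<forall>w\<in>?T. cmod (a w - f' w) < \<epsilon>"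
          by (intro bexI[of _ "\<lambda>w. P (t w)"])
      qed
    next
      case (2 k)
      have "a \<in> fun_alg GB" unfolding 2 GB_def by (rule fun_alg.gen) blast
      then show ?thesis unfolding approximable_def by (intro allI impI bexI[of _ a]) auto
    qed
  qed
  then have "approximable ?T (fun_alg GB) E" by blast
  moreover have "m / 8 > 0" using m(1) by simp
  ultimately obtain e where e: "e \<in> fun_alg GB" "\<And>w. w \<in> ?T \<Longrightarrow> cmod (E w - e w) < m / 8"
    unfolding approximable_def by blast
  obtain a b where ab: "a \<in> poly2" "b \<in> poly2" "\<And>w. w \<in> ?T \<Longrightarrow> b w \<noteq> 0 \<and> e w = a w / b w"
    using rational_fun_alg[OF e(1)[unfolded GB_def] p q] by blast
  \<comment> \<open>A value close to \<open>e w0\<close> but different from it: the reciprocal of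
    \<open>e - \<kappa>\<close> is large at \<open>w0\<close> and moderate on
    \<open>S\<close>.\<close>
  define \<kappa> where "\<kappa> = e w0 - of_real (m / 8)"
  define B where "B w = a w - \<kappa> * b w" for w
  have "(\<lambda>_. \<kappa>) \<in> poly2" unfolding poly2_def by (rule fun_alg.const)
  then have B: "B \<in> poly2"
    unfolding B_def[abs_def] using ab(1,2) unfolding poly2_def by (intro fun_alg_diff fun_alg.mult)
  have Be: "B w = b w * (e w - \<kappa>)" "b w / B w = 1 / (e w - \<kappa>)" if "w \<in> ?T" for w
  proof -
    show "B w = b w * (e w - \<kappa>)" using ab(3)[OF that] by (simp add: B_def field_simps)
    then show "b w / B w = 1 / (e w - \<kappa>)" using ab(3)[OF that] by simp
  qed
  have "E w0 = 0" using D_0 by (simp add: E_def)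
  then have e0: "cmod (e w0) \<le> m / 8" using e(2)[of w0] by simp
  have eS: "m - m / 8 \<le> cmod (e w)" if "w \<in> S" for w
  proof -
    have "m \<le> cmod (E w)" using m(2)[OF that] \<Theta>t[OF that] by (simp add: E_def)
    moreover have "cmod (E w) - cmod (E w - e w) \<le> cmod (e w)"
      using norm_triangle_ineq2[of "E w" "E w - e w"] by simp
    moreover have "cmod (E w - e w) < m / 8" by (rule e(2)) (use that in simp)
    ultimately show ?thesis by linarith
  qed
  have w0: "e w0 - \<kappa> = of_real (m / 8)" by (simp add: \<kappa>_def)
  show ?thesis
  proof (rule that[OF ab(2) B, of "8 / (5 * m)"])
    show "B w \<noteq> 0" if w: "w \<in> ?T" for w
    proof (cases "w = w0")
      case True
      have "e w0 - \<kappa> \<noteq> 0" unfolding w0 using m(1) by simp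
      then show ?thesis using Be(1)[OF w] ab(3)[OF w] True by (metis mult_eq_0_iff)
    next
      case False
      then have "e w - \<kappa> \<noteq> 0" unfolding \<kappa>_def using reciprocal_separates(1)[OF m(1) e0 eS] w by blast
      then show ?thesis using Be(1)[OF w] ab(3)[OF w] by simp
    qed
    show "cmod (b w / B w) \<le> 8 / (5 * m)" if w: "w \<in> S" for w
      using reciprocal_separates(2)[OF m(1) e0 eS[OF w]] Be(2)[of w] w by (simp add: \<kappa>_def)
    have "b w0 / B w0 = 1 / of_real (m / 8)" using Be(2)[of w0] w0 by simp
    then have "cmod (b w0 / B w0) = 8 / m" using m(1) by (simp add: norm_divide)
    then show "8 / (5 * m) < cmod (b w0 / B w0)" using m(1) by (simp add: divide_strict_left_mono)
  qed (use m(1) in simp)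
qed

context long_plane
begin

text \<open>The separating rational function is approximated on \<open>insert z K\<close> by a
  global section. The error \<open>\<delta>\<close> is a third of the gap, so that losing it once at
  \<open>z\<close> and once on \<open>K\<close> leaves a strict inequality.\<close>

lemma hull_exclude:
  assumes AB: "A \<in> poly2" "B \<in> poly2" and z: "z \<in> Xs m" and K: "compactin (mtop X) K" "K \<subseteq> Xs m"
    and nz: "\<And>x. x \<in> insert z K \<Longrightarrow> B (F m x) \<noteq> 0"
    and M: "\<And>x. x \<in> K \<Longrightarrow> cmod (A (F m x) / B (F m x)) \<le> M" "0 \<le> M" "M < cmod (A (F m z) / B (F m z))"
  shows "z \<notin> mero_hull X K"
proof
  assume zh: "z \<in> mero_hull X K"
  define R where "R x = A (F m x) / B (F m x)" for x
  define \<delta> where "\<delta> = (cmod (R z) - M) / 3"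
  have \<delta>: "\<delta> > 0" using M(3) by (simp add: \<delta>_def R_def)
  have "compactin (mtop X) ({z} \<union> K)"
    by (rule compactin_Un[OF _ K(1)]) (use z cover in auto)
  then have K': "compactin (mtop X) (insert z K)" by simp
  have sub: "insert z K \<subseteq> Xs m" using z K(2) by blast
  obtain s W f where s: "s \<in> meromorphic_funs X" "insert z K \<subseteq> W" "holo_fun X W f"
    "\<And>q. q \<in> W \<Longrightarrow> s q = germ_quotient X q f (\<lambda>_. 1)"
    "\<And>x. x \<in> insert z K \<Longrightarrow> cmod (f x - A (F m x) / B (F m x)) < \<delta>"
  proof (rule section_approx[OF AB K' sub insert_not_empty nz \<delta>], goal_cases)
    case 1
    show ?case by (rule 1(2))
  next
    case (2 s W f)
    show ?case by (rule that[OF 2(2-6)])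
  qed
  have close: "cmod (f x - R x) < \<delta>" if "x \<in> insert z K" for x using s(5)[OF that] by (simp add: R_def)
  have val: "mero_val X s x = f x" if "x \<in> insert z K" for x
    by (rule mero_val_at[OF X s(3)]) (use that s(2,4) in blast)+
  have "mero_holo_on X (insert z K) s" unfolding mero_holo_on_def using s(2,3,4) by blast
  then have "cmod (mero_val X s z) \<le> sup_norm K (mero_val X s)"
    using zh s(1) unfolding mero_hull_def by blast
  also have "\<dots> \<le> M + \<delta>"
  proof (rule sup_norm_least)
    fix x assume x: "x \<in> K"
    have "cmod (f x) \<le> cmod (R x) + cmod (f x - R x)" using norm_triangle_ineq[of "R x" "f x - R x"] by simp
    then show "cmod (mero_val X s x) \<le> M + \<delta>" using close[of x] M(1)[OF x] val[of x] x by (simp add: R_def)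
  qed (use M(2) \<delta> in simp)
  finally have "cmod (f z) \<le> M + \<delta>" using val[of z] by simp
  moreover have "cmod (R z) \<le> cmod (f z) + cmod (f z - R z)"
    using norm_triangle_ineq4[of "f z" "f z - R z"] by simp
  moreover have "cmod (f z - R z) < \<delta>" by (rule close) simp
  ultimately have "cmod (R z) < M + 2 * \<delta>" by linarith
  then show False using \<delta> by (simp add: \<delta>_def field_simps)
qed

text \<open>The denominator is moved by a small constant so that it does not vanish at the extra point.\<close>

lemma coordinate_approx:
  assumes L: "compactin (mtop X) L" "L \<subseteq> Xs j" and jm: "j \<le> m" and z: "z \<in> Xs m"
  obtains p :: "2 \<Rightarrow> complex^2 \<Rightarrow> complex" and q where "\<And>i. p i \<in> poly2" "q \<in> poly2" "q (F m z) \<noteq> 0"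
    "\<And>x. x \<in> L \<Longrightarrow> q (F m x) \<noteq> 0" "\<And>x i. x \<in> L \<Longrightarrow> cmod (p i (F m x) / q (F m x) - F j x $ i) \<le> 1/4"
proof -
  interpret c: plane_chart X "Xs m" "F m" "G m" by (rule chart)
  have LX: "L \<subseteq> Xs m" using L(2) Xs_mono[OF jm] by blast
  have "\<exists>A u. A \<in> poly2 \<and> u \<in> poly2 \<and> u (F m z) \<noteq> 0 \<and>
      (\<forall>x\<in>L. u (F m x) \<noteq> 0 \<and> cmod (A (F m x) / u (F m x) - F j x $ i) < 1/4)" for i :: 2
  proof -
    have e8: "(1/8 :: real) > 0" by simp
    obtain A u where A: "A \<in> poly2" "u \<in> poly2"
        "\<And>x. x \<in> L \<Longrightarrow> u (F m x) \<noteq> 0 \<and> cmod (A (F m x) / u (F m x) - F j x $ i) < 1/8"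
      using rational_approx[OF poly2_nth[of i] L jm e8] by blast
    have cont: "continuous_on (F m ` L) p" if "p \<in> poly2" for p
      using holo_Cn_continuous_on[OF poly2_holo[OF that]] continuous_on_subset by blast
    have unz: "u x \<noteq> 0" if "x \<in> F m ` L" for x using A(3) that by auto
    obtain \<eta> where \<eta>: "\<eta> > 0" "\<And>x a w. x \<in> F m ` L \<Longrightarrow> cmod (a - A x) < \<eta> \<Longrightarrow> cmod (w - u x) < \<eta> \<Longrightarrow>
        w \<noteq> 0 \<and> cmod (a / w - A x / u x) < 1/8"
      using quotient_approx[OF c.compact_F_image[OF L(1) LX] cont[OF A(1)] cont[OF A(2)] unz e8] by blast
    define \<epsilon> where "\<epsilon> = (if u (F m z) = 0 then complex_of_real (\<eta> / 2) else 0)"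
    have \<epsilon>: "cmod \<epsilon> < \<eta>" "u (F m z) - \<epsilon> \<noteq> 0" using \<eta>(1) by (auto simp: \<epsilon>_def norm_divide)
    have "(\<lambda>_. \<epsilon>) \<in> poly2" unfolding poly2_def by (rule fun_alg.const)
    then have "(\<lambda>w. u w - \<epsilon>) \<in> poly2" using A(2) unfolding poly2_def by (rule fun_alg_diff[rotated])
    moreover have "u (F m x) - \<epsilon> \<noteq> 0 \<and> cmod (A (F m x) / (u (F m x) - \<epsilon>) - F j x $ i) < 1/4" if x: "x \<in> L" for x
    proof -
      have *: "u (F m x) - \<epsilon> \<noteq> 0 \<and> cmod (A (F m x) / (u (F m x) - \<epsilon>) - A (F m x) / u (F m x)) < 1/8"
        by (rule \<eta>(2)) (use x \<eta>(1) \<epsilon>(1) in auto)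
      have "cmod ((A (F m x) / (u (F m x) - \<epsilon>) - A (F m x) / u (F m x)) + (A (F m x) / u (F m x) - F j x $ i)) < 1/8 + 1/8"
        using * A(3)[OF x] by (intro norm_triangle_lt add_strict_mono) auto
      with * show ?thesis by simp
    qed
    ultimately show ?thesis using A(1) \<epsilon>(2) by blast
  qed
  then obtain A u where A: "\<And>i. A i \<in> poly2" "\<And>i. u i \<in> poly2" "\<And>i. u i (F m z) \<noteq> 0"
      "\<And>i x. x \<in> L \<Longrightarrow> u i (F m x) \<noteq> 0 \<and> cmod (A i (F m x) / u i (F m x) - F j x $ i) < 1/4"
    by metis
  \<comment> \<open>The two quotients are brought to a common denominator, as the Hefer
    decomposition of the map expects a single \<open>q\<close>.\<close>
  define p where "p i w = A i w * u (if i = 1 then 2 else 1) w" for i w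
  define q where "q w = u 1 w * u 2 w" for w
  show ?thesis
  proof (rule that)
    show "p i \<in> poly2" for i unfolding p_def[abs_def] using A(1,2) unfolding poly2_def by (intro fun_alg.mult) auto
    show "q \<in> poly2" unfolding q_def[abs_def] using A(2) unfolding poly2_def by (intro fun_alg.mult) auto
    show "q (F m z) \<noteq> 0" using A(3) by (simp add: q_def)
    fix x i assume x: "x \<in> L"
    show q: "q (F m x) \<noteq> 0" using A(4)[OF x] by (simp add: q_def)
    have "p i (F m x) / q (F m x) = A i (F m x) / u i (F m x)"
      using A(4)[OF x] exhaust_2[of i] by (auto simp: p_def q_def)
    then show "cmod (p i (F m x) / q (F m x) - F j x $ i) \<le> 1/4" using A(4)[OF x, of i] by simp
  qed
qed

lemma hull_in_compact:
  assumes K: "compactin (mtop X) K"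
  obtains L where "compactin (mtop X) L" "mero_hull X K \<subseteq> L"
proof -
  interpret c: plane_chart X "Xs j" "F j" "G j" for j by (rule chart)
  obtain j where j: "K \<subseteq> Xs j" using compact_in_level[OF K] .
  obtain r where r: "r > 0" "F j ` K \<subseteq> pd r" using compact_in_pd[OF c.compact_F_image[OF K j]] .
  \<comment> \<open>\<open>r\<close> bounds the coordinates on \<open>K\<close>,
    \<open>\<rho>\<close> leaves room for the error 1/4 of the approximating map, and radius
    \<open>\<rho> + 2\<close> adds the margin of the inversion lemma. \<open>L\<close> is fixed
    before the point \<open>z\<close> and its level come into play.\<close>
  define \<rho> where "\<rho> = r + 1"
  define L where "L = G j ` cpd (\<rho> + 2)"
  have L: "compactin (mtop X) L" "L \<subseteq> Xs j"
    unfolding L_def using c.compact_G_image[OF pd_props(3)] c.GS by auto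
  have Fr: "cmod (F j x $ i) < r" if "x \<in> K" for x i
  proof -
    have "F j x \<in> pdc 0 r" using r(2) that unfolding pdc_0 by blast
    then show ?thesis by (simp add: pdc_iff)
  qed
  have FrP: "F j x \<in> pdc 0 (\<rho> + d)" if "x \<in> K" "0 \<le> d" for x d
  proof -
    have "cmod (F j x $ i) < \<rho> + d" for i using Fr[OF that(1), of i] that(2) unfolding \<rho>_def by linarith
    then show ?thesis by (simp add: pdc_iff)
  qed
  have pdcL: "G j y \<in> L" if "y \<in> pdc 0 (\<rho> + 2)" for y
    using that pd_props(4) unfolding L_def pdc_0 by blast
  have KL: "K \<subseteq> L"
  proof
    fix x assume x: "x \<in> K"
    have "F j x \<in> pdc 0 (\<rho> + 2)" by (rule FrP[OF x]) simp
    then have "G j (F j x) \<in> L" by (rule pdcL)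
    then show "x \<in> L" using c.GF[of x j] x j by auto
  qed
  have "z \<in> L" if zh: "z \<in> mero_hull X K" for z
  proof (rule ccontr)
    assume zL: "z \<notin> L"
    have "z \<in> topspace (mtop X)" using zh by (simp add: mero_hull_def)
    then obtain k where k: "z \<in> Xs k" using cover by blast
    define m where "m = max j k"
    have jm: "j \<le> m" by (simp add: m_def)
    have zm: "z \<in> Xs m" using k Xs_mono[of k m] by (auto simp: m_def)
    have Xjm: "Xs j \<subseteq> Xs m" by (rule Xs_mono[OF jm])
    have Km: "K \<subseteq> Xs m" using j Xjm by blast
    obtain p q where p: "\<And>i::2. p i \<in> poly2" and q: "q \<in> poly2" "q (F m z) \<noteq> 0" "\<And>x. x \<in> L \<Longrightarrow> q (F m x) \<noteq> 0"
      and close: "\<And>x i. x \<in> L \<Longrightarrow> cmod (p i (F m x) / q (F m x) - F j x $ i) \<le> 1/4"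
      by (rule coordinate_approx[OF L jm zm]) blast
    define t where "t w = (\<chi> i. p i w / q w)" for w
    have tK: "cmod (t (F m x) $ i) \<le> r + 1/4" if x: "x \<in> K" for x i
    proof -
      have "cmod (t (F m x) $ i) \<le> cmod (F j x $ i) + cmod (t (F m x) $ i - F j x $ i)"
        using norm_triangle_ineq[of "F j x $ i" "t (F m x) $ i - F j x $ i"] by simp
      then show ?thesis using Fr[OF x, of i] close[of x i] KL x by (force simp: t_def)
    qed
    have qT: "q (F m x) \<noteq> 0" if "x \<in> insert z K" for x using q(2,3) KL that by blast
    \<comment> \<open>Otherwise some component of \<open>t\<close> has modulus at least
      \<open>r + 1\<close> at \<open>z\<close> but at most \<open>r + 1/4\<close> on
      \<open>K\<close>, and it excludes \<open>z\<close> from the hull.\<close>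
    have tz: "cmod (t (F m z) $ i) < \<rho>" for i
    proof (rule ccontr)
      assume "\<not> cmod (t (F m z) $ i) < \<rho>"
      then have "r + 1/4 < cmod (p i (F m z) / q (F m z))" by (simp add: t_def \<rho>_def)
      then have "z \<notin> mero_hull X K"
        using hull_exclude[OF p[of i] q(1) zm K Km qT, of "r + 1/4"] tK[of _ i] r(1) by (simp add: t_def)
      then show False using zh by blast
    qed
    define H where "H y = t (F m (G j y))" for y
    have trans: "holo_Cn UNIV (\<lambda>y. P (F m (G j y)))" if "P \<in> poly2" for P
      by (rule c.transition_holo[OF chart Xjm that])
    have H: "holo_Cn (pdc 0 (\<rho> + 2)) (\<lambda>y. H y $ i)" for i
    proof -
      have "holo_Cn (pdc 0 (\<rho> + 2)) (\<lambda>y. p i (F m (G j y)) / q (F m (G j y)))"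
        by (intro holo_Cn_divide holo_Cn_subset[OF trans[OF p[of i]] open_pdc] holo_Cn_subset[OF trans[OF q(1)] open_pdc])
           (use q(3) pdcL in auto)
      then show ?thesis by (simp add: H_def t_def)
    qed
    have Hclose: "cmod (H y $ i - y $ i) \<le> 1/4" if "y \<in> pdc 0 (\<rho> + 2)" for y i
      using close[OF pdcL[OF that], of i] by (simp add: H_def t_def c.FG)
    obtain \<Phi> where \<Phi>: "\<And>i. holo_Cn (pdc 0 \<rho>) (\<lambda>y. \<Phi> y $ i)"
      "\<And>y. y \<in> pdc 0 \<rho> \<Longrightarrow> \<Phi> y \<in> pdc 0 (\<rho> + 1) \<and> H (\<Phi> y) = y"
      "\<And>x. x \<in> pdc 0 (\<rho> + 1) \<Longrightarrow> H x \<in> pdc 0 \<rho> \<Longrightarrow> \<Phi> (H x) = x"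
    proof (rule near_identity_inverse[OF H Hclose], goal_cases)
      case 1
      show ?case by (rule 1(2))
    next
      case (2 \<Phi>)
      show ?case by (rule that[OF 2(2-4)])
    qed
    define \<Theta> where "\<Theta> y = F m (G j (\<Phi> y))" for y
    have \<Theta>: "holo_Cn (pd \<rho>) (\<lambda>y. \<Theta> y $ k)" for k
      unfolding \<Theta>_def pdc_0[symmetric]
      by (rule holo_Cn_compose[OF trans[OF poly2_nth[of k]] \<Phi>(1)]) simp
    have p12: "pdc 0 (\<rho> + 1) \<subseteq> pdc 0 (\<rho> + 2)" by (rule pdc_mono) simp
    define Y where "Y = pdc 0 (\<rho> + 1) \<inter> H -` pdc 0 \<rho>"
    have Yo: "open Y"
    proof -
      have "continuous_on (pdc 0 (\<rho> + 1)) (\<lambda>y. \<chi> i. H y $ i)"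
        using holo_Cn_continuous_on[OF H] p12 continuous_on_subset by (intro continuous_on_vec_lambda) blast
      then have "continuous_on (pdc 0 (\<rho> + 1)) H" by simp
      then show ?thesis unfolding Y_def by (rule continuous_open_preimage[OF _ open_pdc open_pdc])
    qed
    \<comment> \<open>The identity is needed near each point and not only at it, because the Hefer
      determinant on the diagonal is handled through derivatives.\<close>
    have inv: "eventually (\<lambda>w'. \<Theta> (t w') = w') (nhds w)" if wK: "w \<in> F m ` K" for w
    proof -
      obtain x where x: "x \<in> K" "w = F m x" using wK by blast
      have Gx: "G j (F j x) = x" using c.GF[of x j] x(1) j by auto
      have "F j x \<in> pdc 0 (\<rho> + 1)" by (rule FrP[OF x(1)]) simp
      moreover have "cmod (t (F m x) $ i) < \<rho>" for i using tK[OF x(1), of i] by (simp add: \<rho>_def)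
      then have "H (F j x) \<in> pdc 0 \<rho>" by (simp add: pdc_iff H_def Gx)
      ultimately have "F j x \<in> Y" by (simp add: Y_def)
      then have "G j (F j x) \<in> G j ` Y" by (rule imageI)
      then have wV: "w \<in> F m ` G j ` Y" unfolding Gx x(2) by (rule imageI)
      have "G j ` Y \<subseteq> Xs m" using c.GS[of j] Xjm by blast
      then have Vo: "open (F m ` G j ` Y)" by (intro c.open_image c.open_G_image Yo)
      have "\<Theta> (t w') = w'" if w': "w' \<in> F m ` G j ` Y" for w'
      proof -
        obtain y where y: "y \<in> Y" "w' = F m (G j y)" using w' by blast
        then have "\<Phi> (H y) = y" using \<Phi>(3)[of y] by (simp add: Y_def)
        then show ?thesis by (simp add: \<Theta>_def y(2) H_def)
      qed
      then show ?thesis unfolding eventually_nhds using Vo wV by blast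
    qed
    \<comment> \<open>A radius below \<open>\<rho>\<close> whose closed polydisc contains all values
      of \<open>t\<close> in question; there \<open>\<Theta>\<close> can be approximated by
      polynomials.\<close>
    define R where "R = max (r + 1/4) (max (cmod (t (F m z) $ 1)) (cmod (t (F m z) $ 2)))"
    have R: "0 < R" "R < \<rho>" using r(1) tz[of 1] tz[of 2] by (auto simp: R_def \<rho>_def)
    have tR: "t w \<in> cpd R" if w: "w \<in> insert (F m z) (F m ` K)" for w
    proof -
      have "cmod (t w $ i) \<le> R" for i
      proof (cases "w = F m z")
        case True then show ?thesis using exhaust_2[of i] by (auto simp: R_def)
      next
        case False
        then obtain x where "x \<in> K" "w = F m x" using w by blast
        then show ?thesis using tK[of x i] by (simp add: R_def)
      qed
      then show ?thesis by (simp add: cpd_def)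
    qed
    have "t (F m z) \<in> pdc 0 \<rho>" using tz by (simp add: pdc_iff)
    then have \<Phi>z: "\<Phi> (t (F m z)) \<in> pdc 0 (\<rho> + 1)" "H (\<Phi> (t (F m z))) = t (F m z)" using \<Phi>(2) by auto
    have inL: "G j (\<Phi> (t (F m z))) \<in> L" using \<Phi>z(1) p12 pdcL by blast
    \<comment> \<open>The point of \<open>X\<close> with coordinates
      \<open>\<Theta> (t (F m z))\<close> lies in \<open>L\<close> and has the same value of
      \<open>t\<close> as \<open>z\<close>; it differs from \<open>z\<close> because
      \<open>z \<notin> L\<close>.\<close>
    have \<zeta>: "\<Theta> (t (F m z)) \<noteq> F m z" "q (\<Theta> (t (F m z))) \<noteq> 0" "t (\<Theta> (t (F m z))) = t (F m z)"
    proof -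
      show "\<Theta> (t (F m z)) \<noteq> F m z"
      proof
        assume "\<Theta> (t (F m z)) = F m z"
        then have "G m (F m (G j (\<Phi> (t (F m z))))) = G m (F m z)" by (simp add: \<Theta>_def)
        moreover have "G j (\<Phi> (t (F m z))) \<in> Xs m" using c.GS Xjm by blast
        ultimately have "G j (\<Phi> (t (F m z))) = z" using c.GF zm by simp
        then show False using inL zL by simp
      qed
      show "q (\<Theta> (t (F m z))) \<noteq> 0" unfolding \<Theta>_def by (rule q(3)[OF inL])
      show "t (\<Theta> (t (F m z))) = t (F m z)" using \<Phi>z(2) by (simp add: \<Theta>_def H_def)
    qed
    have qT': "q w \<noteq> 0" if "w \<in> insert (F m z) (F m ` K)" for w using that qT by blast
    obtain A B M where A: "A \<in> poly2" "B \<in> poly2" "\<And>w. w \<in> insert (F m z) (F m ` K) \<Longrightarrow> B w \<noteq> 0"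
      "\<And>w. w \<in> F m ` K \<Longrightarrow> cmod (A w / B w) \<le> M" "0 \<le> M" "M < cmod (A (F m z) / B (F m z))"
    proof (rule rational_separation[OF p q(1) qT' c.compact_F_image[OF K Km] R
            tR[unfolded t_def] \<Theta> inv[unfolded t_def] \<zeta>[unfolded t_def]], goal_cases)
      case (4 A B M)
      show ?case by (rule that[OF 4(2-7)])
    qed assumption+
    have "z \<notin> mero_hull X K"
      by (rule hull_exclude[OF A(1,2) zm K Km _ _ A(5,6)]) (use A(3,4) in auto)
    then show False using zh by blast
  qed
  then show ?thesis using that[OF L(1)] by blast
qed

text \<open>A section that excludes \<open>z\<close> is holomorphic on an open set containing
  \<open>z\<close> and \<open>K\<close>, so by continuity it excludes the points near
  \<open>z\<close> as well. A closed hull inside a compact set is compact.\<close>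

lemma closedin_mero_hull:
  shows "closedin (mtop X) (mero_hull X K)"
  unfolding closedin_def
proof (intro conjI)
  interpret c: plane_chart X "Xs j" "F j" "G j" for j by (rule chart)
  show "mero_hull X K \<subseteq> topspace (mtop X)" by (auto simp: mero_hull_def)
  have "\<exists>T. openin (mtop X) T \<and> z \<in> T \<and> T \<subseteq> topspace (mtop X) - mero_hull X K"
    if z: "z \<in> topspace (mtop X) - mero_hull X K" for z
  proof -
    obtain s where s: "s \<in> meromorphic_funs X" "mero_holo_on X (insert z K) s"
        "\<not> cmod (mero_val X s z) \<le> sup_norm K (mero_val X s)"
      using z unfolding mero_hull_def by blast
    obtain W f where W: "insert z K \<subseteq> W" "holo_fun X W f" "\<And>q. q \<in> W \<Longrightarrow> s q = germ_quotient X q f (\<lambda>_. 1)"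
      using s(2) unfolding mero_holo_on_def by blast
    obtain j where j: "z \<in> Xs j" using z cover by blast
    have Wo: "openin (mtop X) (W \<inter> Xs j)" using W(2) c.S[of j] by (auto simp: holo_fun_def)
    have "holo_fun X (W \<inter> Xs j) f" by (rule holo_fun_subset[OF X W(2) Wo]) simp
    then have h: "holo_Cn (F j ` (W \<inter> Xs j)) (\<lambda>y. f (G j y))" using c.holo_iff[OF Wo] by auto
    define V where "V = F j ` (W \<inter> Xs j) \<inter> (\<lambda>y. cmod (f (G j y))) -` {sup_norm K (mero_val X s)<..}"
    have Vo: "open V"
      unfolding V_def
      by (intro continuous_open_preimage continuous_intros holo_Cn_continuous_on[OF h] holo_Cn_open[OF h])
    have val: "mero_val X s x = f x" if "x \<in> W" for x
      by (rule mero_val_at[OF X W(2) that]) (rule W(3)[OF that])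
    show ?thesis
    proof (intro exI conjI)
      show "openin (mtop X) (G j ` V)" by (rule c.open_G_image[OF Vo])
      have "F j z \<in> V" using W(1) j s(3) val[of z] c.GF[OF j] by (simp add: V_def)
      then have "G j (F j z) \<in> G j ` V" by (rule imageI)
      then show "z \<in> G j ` V" using c.GF[OF j] by simp
      show "G j ` V \<subseteq> topspace (mtop X) - mero_hull X K"
      proof
        fix x assume "x \<in> G j ` V"
        then obtain y where y: "y \<in> V" "x = G j y" by blast
        then obtain x' where x': "x' \<in> W" "x' \<in> Xs j" "y = F j x'" unfolding V_def by blast
        have xx: "x = x'" using y(2) x'(2,3) c.GF by simp
        have "sup_norm K (mero_val X s) < cmod (f x)" using y by (simp add: V_def)
        then have "sup_norm K (mero_val X s) < cmod (mero_val X s x)" using val[OF x'(1)] by (simp add: xx)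
        moreover have "mero_holo_on X (insert x K) s"
          unfolding mero_holo_on_def using W x'(1) xx by (intro exI[of _ W] exI[of _ f]) auto
        ultimately have "x \<notin> mero_hull X K" using s(1) unfolding mero_hull_def by force
        moreover have "x \<in> topspace (mtop X)" using x'(2) cover unfolding xx by blast
        ultimately show "x \<in> topspace (mtop X) - mero_hull X K" by blast
      qed
    qed
  qed
  then show "openin (mtop X) (topspace (mtop X) - mero_hull X K)"
    by (subst openin_subopen) blast
qed

lemma separates_points:
  assumes "x \<in> topspace (mtop X)" "y \<in> topspace (mtop X)" "x \<noteq> y"
  shows "\<exists>s\<in>meromorphic_funs X. mero_holo_on X {x, y} s \<and> mero_val X s x \<noteq> mero_val X s y"
proof -
  have "compactin (mtop X) ({x} \<union> {y})" by (rule compactin_Un) (use assms in simp_all)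
  then have K: "compactin (mtop X) {x, y}" by (simp add: insert_commute)
  obtain j where j: "{x, y} \<subseteq> Xs j" using compact_in_level[OF K] .
  interpret c: plane_chart X "Xs j" "F j" "G j" by (rule chart)
  have "F j x \<noteq> F j y" using c.GF[of x] c.GF[of y] j assms(3) by auto
  then obtain i where i: "F j x $ i \<noteq> F j y $ i" by (auto simp: vec_eq_iff)
  \<comment> \<open>Two errors below half the distance of the coordinate values cannot make the
    values equal.\<close>
  define \<delta> where "\<delta> = cmod (F j x $ i - F j y $ i) / 2"
  have \<delta>: "\<delta> > 0" using i by (simp add: \<delta>_def)
  have one: "(\<lambda>_. 1) \<in> poly2" unfolding poly2_def by (rule fun_alg.const)
  obtain s W f where s: "s \<in> meromorphic_funs X" "{x, y} \<subseteq> W" "holo_fun X W f"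
    "\<And>q. q \<in> W \<Longrightarrow> s q = germ_quotient X q f (\<lambda>_. 1)"
    "\<And>x'. x' \<in> {x, y} \<Longrightarrow> cmod (f x' - F j x' $ i / 1) < \<delta>"
  proof (rule section_approx[OF poly2_nth[of i] one K j insert_not_empty one_neq_zero \<delta>], goal_cases)
    case (1 s W f)
    show ?case by (rule that[OF 1(2-6)])
  qed
  have "f x \<noteq> f y"
  proof
    assume "f x = f y"
    then have "cmod (F j x $ i - F j y $ i) \<le> cmod (f y - F j y $ i) + cmod (f x - F j x $ i)"
      using norm_triangle_ineq4[of "f y - F j y $ i" "f x - F j x $ i"] by simp
    then show False using s(5)[of x] s(5)[of y] by (simp add: \<delta>_def)
  qed
  moreover have "mero_val X s x = f x" "mero_val X s y = f y"
    by (rule mero_val_at[OF X s(3)]; use s(2,4) in blast)+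
  ultimately show ?thesis using s unfolding mero_holo_on_def by (intro bexI[OF _ s(1)]) auto
qed

text \<open>Sections that approximate both coordinates within 1/4 on a closed polydisc of radius 3
  form a chart by the inversion of maps close to the identity.\<close>

lemma local_coordinates:
  assumes "x \<in> topspace (mtop X)"
  shows "\<exists>U s. x \<in> U \<and> (\<forall>i. s i \<in> meromorphic_funs X \<and> mero_holo_on X U (s i)) \<and>
    holo_coordinates X U (\<lambda>z. \<chi> i. mero_val X (s i) z)"
proof -
  obtain j where j: "x \<in> Xs j" using assms cover by blast
  interpret c: plane_chart X "Xs j" "F j" "G j" by (rule chart)
  define b where "b = F j x"
  define C where "C = rect2 (cball (b $ 1) 3) (cball (b $ 2) 3)"
  define K where "K = G j ` C"
  have "compact C" unfolding C_def by (intro compact_rect2) auto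
  then have K: "compactin (mtop X) K" unfolding K_def by (rule c.compact_G_image)
  have KX: "K \<subseteq> Xs j" unfolding K_def using c.GS by blast
  have "b \<in> C" by (simp add: C_def)
  then have K0: "K \<noteq> {}" unfolding K_def by blast
  have pdcK: "G j y \<in> K" if "y \<in> pdc b 3" for y using that by (auto simp: K_def C_def pdc_def)
  have one: "(\<lambda>_. 1) \<in> poly2" unfolding poly2_def by (rule fun_alg.const)
  have q4: "(1/4::real) > 0" by simp
  have "\<exists>s W f. s \<in> meromorphic_funs X \<and> K \<subseteq> W \<and> holo_fun X W f \<and>
      (\<forall>q\<in>W. s q = germ_quotient X q f (\<lambda>_. 1)) \<and> (\<forall>x\<in>K. cmod (f x - F j x $ i / 1) < 1/4)" for i
    by (rule section_approx[OF poly2_nth[of i] one K KX K0 one_neq_zero q4]) blast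
  then obtain s W f where s: "\<And>i::2. s i \<in> meromorphic_funs X" "\<And>i. K \<subseteq> W i" "\<And>i. holo_fun X (W i) (f i)"
      "\<And>i q. q \<in> W i \<Longrightarrow> s i q = germ_quotient X q (f i) (\<lambda>_. 1)"
      "\<And>i x. x \<in> K \<Longrightarrow> cmod (f i x - F j x $ i / 1) < 1/4" by metis
  define V where "V = W 1 \<inter> W 2"
  have VW: "V \<subseteq> W i" for i using exhaust_2[of i] by (auto simp: V_def)
  have Vo: "openin (mtop X) V" unfolding V_def using s(3) by (intro openin_Int) (auto simp: holo_fun_def)
  have val: "mero_val X (s i) y = f i y" if "y \<in> V" for i y
    by (rule mero_val_at[OF X s(3)]) (use that VW s(4) in blast)+
  have hV: "holo_fun X V (mero_val X (s i))" for i
    by (rule holo_fun_cong[OF X holo_fun_subset[OF X s(3)[of i] Vo VW]]) (simp add: val)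
  have KV: "K \<subseteq> V" using s(2) by (auto simp: V_def)
  obtain U where U: "G j b \<in> U" "U \<subseteq> V" "holo_coordinates X U (\<lambda>x. \<chi> i. mero_val X (s i) x)"
  proof -
    have "\<exists>U. G j b \<in> U \<and> U \<subseteq> V \<and> holo_coordinates X U (\<lambda>x. \<chi> i. mero_val X (s i) x)"
    proof (rule c.coordinates_from_functions[OF hV])
      show "G j ` pdc b 3 \<subseteq> V" using pdcK KV by blast
      show "cmod (mero_val X (s i) (G j y) - y $ i) \<le> 1/4" if "y \<in> pdc b 3" for y i
        using s(5)[OF pdcK[OF that], of i] val[OF subsetD[OF KV pdcK[OF that]], of i] by (simp add: c.FG)
    qed
    then show ?thesis using that by blast
  qed
  have "mero_holo_on X U (s i)" for i
    unfolding mero_holo_on_def using U(2) VW[of i] s(3,4) by (intro exI[of _ "W i"] exI[of _ "f i"]) auto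
  moreover have "x \<in> U" using U(1) c.GF[OF j] by (simp add: b_def)
  ultimately show ?thesis using U(3) s(1) by blast
qed

theorem M_manifold: "M_manifold X"
  unfolding M_manifold_def
proof (intro conjI allI impI ballI X separates_points local_coordinates)
  fix K assume "compactin (mtop X) K"
  then obtain L where "compactin (mtop X) L" "mero_hull X K \<subseteq> L" by (rule hull_in_compact)
  then show "compactin (mtop X) (mero_hull X K)" by (rule closed_compactin[OF _ _ closedin_mero_hull])
qed

end

theorem theorem18:
  fixes X :: "('a, 2) cmfd" and Xs :: "nat \<Rightarrow> 'a set"
  assumes "complex_manifold X"
    and "\<And>j. openin (mtop X) (Xs j)"
    and "\<And>j. Xs j \<subseteq> Xs (Suc j)"
    and "\<And>j. biholomorphic (open_submfd X (Xs j)) (complex_space :: (complex^2, 2) cmfd)"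
    and "(\<Union>j. Xs j) = topspace (mtop X)"
    and "\<And>j. mero_Runge_pair (Xs j) (open_submfd X (Xs (Suc j)))"
  shows "M_manifold X"
proof -
  have "\<exists>F G. plane_chart X (Xs j) F G" for j
    by (rule plane_chart_exists[OF assms(1) assms(2)[of j] assms(4)[of j]]) blast
  then obtain F G where "\<And>j. plane_chart X (Xs j) (F j) (G j)" by metis
  then have "long_plane X Xs F G" by (intro long_plane.intro assms)
  then show ?thesis by (rule long_plane.M_manifold)
qed

end
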